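(* Let $1\le p<\infty$, let $f_0\in\mathbb{F}(\gamma,p,M)$, and let $l\in\mathcal{L}$. For $f\in\mathbb{F}(\gamma,p,M)$ let $X_1,X_2,\ldots$ be i.i.d. with density $f$ and let $f_n$ be the estimator defined in the context. Then $$\lim_{\mathcal{V}\searrow f_0}\ \limsup_{n\to\infty}\ \sup_{f\in\mathcal{V}}\ \mathbb{E}_f\, l\big(\psi_p^{-1}(n)\,\|f_n-f\|_p\big)\le l(1),$$ where $\mathcal{V}$ ranges over neighborhoods of $f_0$ in the topology $\mathbb{T}(\gamma,p,M)$; i.e. for every $\varepsilon>0$ there is a neighborhood $\mathcal{V}$ of $f_0$ with $\limsup_{n\to\infty}\sup_{f\in\mathcal{V}}\mathbb{E}_f\, l(\psi_p^{-1}(n)\|f_n-f\|_p)\le l(1)+\varepsilon$.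
   Context: Fix $\gamma>0$, $M>0$, $1\le p<\infty$. For $q>0$ and a function $h$ on $\mathbb{R}$, $\|h\|_q=(\int_{\mathbb{R}}|h(t)|^q\,dt)^{1/q}$. Let $G(z)=\frac{1}{2\gamma\cosh(\pi z/(2\gamma))}$. Let $\mathcal{F}(\gamma,p,M)$ be the class of real functions $f$ on $\mathbb{R}$ of the form $f(x)=\int_{\mathbb{R}}G(x-s)u(s)\,ds$ for some real $u\in L_p(\mathbb{R})$ with $\|u\|_p\le M$; write $u_f$ for this $u$ (it equals a.e. the boundary value $\lim_{y\to\pm\gamma}\mathrm{Re} f(x+iy)$ of the analytic continuation of $f$ to the strip $|\mathrm{Im} z|<\gamma$). If $2\le p<\infty$, $\mathbb{F}(\gamma,p,M)$ is the set of probability densities $f\in\mathcal{F}(\gamma,p,M)$ with $\int f^{p/2}<\infty$; if $1\le p<2$, fix $\lambda$ with $(2-p)/p<\lambda\le 2$ and let $\mathbb{F}(\gamma,p,M)$ be the set of probability densities $f\in\mathcal{F}(\gamma,p,M)$ with $\int|x|^\lambda f(x)\,dx<\infty$. The topology $\mathbb{T}(\gamma,p,M)$ on $\mathbb{F}(\gamma,p,M)$ is induced by the distance $\rho_p(f,g)=\|u_f-u_g\|_p+\int_{\mathbb{R}}|x|^\lambda|f(x)-g(x)|\,dx$ if $1\le p<2$, and $\rho_p(f,g)=\|u_f-u_g\|_p+\|f-g\|_{p/2}$ if $2\le p<\infty$. Estimator: let $N=\frac{\log n}{2\gamma}$, $\theta_n=1-\frac1N$, $h_n=\theta_n/N$,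 $k_n(x)=\frac{\cos(\theta_n x)-\cos x}{\pi(1-\theta_n)x^2}$, $k_{h_n}(x)=h_n^{-1}k_n(x/h_n)$, and $f_n(x)=\frac1n\sum_{i=1}^n k_{h_n}(x-X_i)$, $x\in\mathbb{R}$. Rate: $M_p=(\mathbb{E}|Z|^p)^{1/p}$ for $Z\sim\mathcal{N}(0,1)$, $\beta_p=\pi^{-1/2}\|f\|_{p/2}^{1/2}M_p$ (computed for the true density $f$), and $\psi_p(n)=(nh_n)^{-1/2}\beta_p$. Loss class: $\mathcal{L}=\mathcal{L}(A,B)$ is the class of non-decreasing functions $l:[0,\infty)\to\mathbb{R}$ with $l(0)=0$, $l$ continuous at $x=1$, and $l(x)\le Ae^{B|x|}$ for all $x\ge0$, for some constants $A,B>0$. *)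

theory Defs
  imports "HOL-Probability.Probability"
begin

definition G_ker :: "real \<Rightarrow> real \<Rightarrow> real" where
  "G_ker \<gamma> z = 1 / (2 * \<gamma> * cosh (pi * z / (2 * \<gamma>)))"

definition Lq_norm :: "real \<Rightarrow> (real \<Rightarrow> real) \<Rightarrow> real" where
  "Lq_norm q h = (LINT t|lborel. \<bar>h t\<bar> powr q) powr (1 / q)"

definition represents :: "real \<Rightarrow> real \<Rightarrow> real \<Rightarrow> (real \<Rightarrow> real) \<Rightarrow> (real \<Rightarrow> real) \<Rightarrow> bool" where
  "represents \<gamma> p M f u \<longleftrightarrow>
     u \<in> borel_measurable lborel \<and>
     integrable lborel (\<lambda>t. \<bar>u t\<bar> powr p) \<and>
     Lq_norm p u \<le> M \<and>
     (\<forall>x. f x = (LINT s|lborel. G_ker \<gamma> (x - s) * u s))"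

definition calF :: "real \<Rightarrow> real \<Rightarrow> real \<Rightarrow> (real \<Rightarrow> real) set" where
  "calF \<gamma> p M = {f. \<exists>u. represents \<gamma> p M f u}"

text \<open>u_f (unique a.e.; any choice gives the same L_p distances).\<close>
definition u_of :: "real \<Rightarrow> real \<Rightarrow> real \<Rightarrow> (real \<Rightarrow> real) \<Rightarrow> (real \<Rightarrow> real)" where
  "u_of \<gamma> p M f = (SOME u. represents \<gamma> p M f u)"

definition is_prob_density :: "(real \<Rightarrow> real) \<Rightarrow> bool" where
  "is_prob_density f \<longleftrightarrow> f \<in> borel_measurable lborel \<and> (\<forall>x. 0 \<le> f x) \<and>
     integrable lborel f \<and> (LINT x|lborel. f x) = 1"

definition bbF :: "real \<Rightarrow> real \<Rightarrow> real \<Rightarrow> real \<Rightarrow> (real \<Rightarrow> real) set" where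
  "bbF \<gamma> p M lam = {f \<in> calF \<gamma> p M. is_prob_density f \<and>
     (if 2 \<le> p then integrable lborel (\<lambda>x. f x powr (p / 2))
      else integrable lborel (\<lambda>x. \<bar>x\<bar> powr lam * f x))}"

text \<open>The distance rho_p inducing the topology bbT(gamma,p,M).\<close>
definition rho :: "real \<Rightarrow> real \<Rightarrow> real \<Rightarrow> real \<Rightarrow> (real \<Rightarrow> real) \<Rightarrow> (real \<Rightarrow> real) \<Rightarrow> real" where
  "rho \<gamma> p M lam f g =
     Lq_norm p (\<lambda>t. u_of \<gamma> p M f t - u_of \<gamma> p M g t) +
     (if p < 2 then (LINT x|lborel. \<bar>x\<bar> powr lam * \<bar>f x - g x\<bar>)
      else Lq_norm (p / 2) (\<lambda>x. f x - g x))"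

definition N_par :: "real \<Rightarrow> nat \<Rightarrow> real" where
  "N_par \<gamma> n = ln (real n) / (2 * \<gamma>)"
definition theta_par :: "real \<Rightarrow> nat \<Rightarrow> real" where
  "theta_par \<gamma> n = 1 - 1 / N_par \<gamma> n"
definition h_par :: "real \<Rightarrow> nat \<Rightarrow> real" where
  "h_par \<gamma> n = theta_par \<gamma> n / N_par \<gamma> n"
definition k_ker :: "real \<Rightarrow> nat \<Rightarrow> real \<Rightarrow> real" where
  "k_ker \<gamma> n x = (cos (theta_par \<gamma> n * x) - cos x) / (pi * (1 - theta_par \<gamma> n) * x\<^sup>2)"
definition kh_ker :: "real \<Rightarrow> nat \<Rightarrow> real \<Rightarrow> real" where
  "kh_ker \<gamma> n x = k_ker \<gamma> n (x / h_par \<gamma> n) / h_par \<gamma> n"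

definition estimator :: "real \<Rightarrow> nat \<Rightarrow> (nat \<Rightarrow> real) \<Rightarrow> real \<Rightarrow> real" where
  "estimator \<gamma> n X x = (\<Sum>i<n. kh_ker \<gamma> n (x - X i)) / real n"

definition M_const :: "real \<Rightarrow> real" where
  "M_const p = (LINT z|lborel. \<bar>z\<bar> powr p * std_normal_density z) powr (1 / p)"

definition beta_const :: "real \<Rightarrow> (real \<Rightarrow> real) \<Rightarrow> real" where
  "beta_const p f = (1 / sqrt pi) * sqrt (Lq_norm (p / 2) f) * M_const p"

definition psi_rate :: "real \<Rightarrow> real \<Rightarrow> (real \<Rightarrow> real) \<Rightarrow> nat \<Rightarrow> real" where
  "psi_rate \<gamma> p f n = beta_const p f / sqrt (real n * h_par \<gamma> n)"

definition loss_class :: "real \<Rightarrow> real \<Rightarrow> (real \<Rightarrow> real) set" where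
  "loss_class A B = {l. mono_on {0..} l \<and> l 0 = 0 \<and> isCont l 1 \<and>
                        (\<forall>x\<ge>0. l x \<le> A * exp (B * \<bar>x\<bar>))}"

text \<open>E_f l(psi^{-1}(n) ||f_n - f||_p), X_1..X_n iid with density f
  (product of n copies of the law with density f); l >= 0 on [0,inf).\<close>
definition risk :: "real \<Rightarrow> real \<Rightarrow> (real \<Rightarrow> real) \<Rightarrow> (real \<Rightarrow> real) \<Rightarrow> nat \<Rightarrow> ennreal" where
  "risk \<gamma> p l f n =
     (\<integral>\<^sup>+ X. ennreal (l (Lq_norm p (\<lambda>x. estimator \<gamma> n X x - f x) / psi_rate \<gamma> p f n))
        \<partial>(PiM {..<n} (\<lambda>_. density lborel (\<lambda>x. ennreal (f x)))))"

end

theory Submission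
  imports Defs "HOL-Complex_Analysis.Complex_Analysis" "HOL-Real_Asymp.Real_Asymp"
begin

text \<open>
  Write \<open>Y = (n h)\<^sup>1\<^sup>/\<^sup>2 (f\<^sub>n - E f\<^sub>n)\<close>. The kernel has a trapezoidal Fourier transform equal to 1 on
  \<open>[-N, N]\<close> with \<open>exp (- \<gamma> N) = n\<^sup>-\<^sup>1\<^sup>/\<^sup>2\<close>, and \<open>G\<close> has transform \<open>1 / cosh (\<gamma> t)\<close>; hence the bias has norm
  \<open>O(n\<^sup>-\<^sup>1\<^sup>/\<^sup>2)\<close>, which is negligible against the rate. By the Lindeberg argument \<open>Y(x)\<close> is asymptotically
  normal with variance \<open>f(x) / \<pi>\<close>, so the functional \<open>\<integral> min (|Y|, K) powr p\<close> has expectation at most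
  \<open>\<beta>\<^sub>p powr p + o(1)\<close>. The squares of its differences in the single observations sum to \<open>O(h \<parallel>k\<^sub>n\<parallel>\<^sub>1 powr 2)\<close>, which tends
  to 0, so the bounded difference inequality concentrates it, and the part removed by clipping is
  small by a moment bound; hence \<open>\<parallel>Y\<parallel>\<^sub>p \<le> (1 + \<epsilon>) \<beta>\<^sub>p\<close> with probability tending to one.

  To pass to the loss one needs bounded exponential moments of \<open>\<parallel>Y\<parallel>\<^sub>p\<close>. For \<open>p \<le> 2\<close> they follow
  from bounded differences alone. For \<open>p > 2\<close> the bounded difference inequality only gives
  \<open>exp (O((log n) powr (1 - 2/p))) = n powr o(1)\<close>; this suffices on the set where the variance of \<open>Y(x)\<close> is tiny, because
  there \<open>E \<integral> |Y| powr p\<close> is polynomially small in \<open>n\<close>. On the complement \<open>Y(x)\<close> is subgaussian at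
  the relevant scale, and Jensen's inequality in \<open>x\<close> applies.

  Uniformity over neighbourhoods is handled by contradiction, along a sequence of densities
  converging to \<open>f0\<close>, so that all limits are limits of sequences.
\<close>

subsection \<open>Bounded differences\<close>

text \<open>The sinc kernel, whose transform is an indicator, is not integrable, while changing one
  observation moves the clipped functional by an amount governed by the L_1 norm of the kernel.
  Hence the trapezoid: its sloping part has length \<open>N / \<theta> - N = 1 / \<theta>\<close>,
  which keeps the bias constant bounded and lets the L_1 norm grow at most like
  \<open>N powr (1/4)\<close>, slower than \<open>h powr (- 1/2)\<close>. Clipping makes
  \<open>|y| powr p\<close> bounded and Lipschitz, so that both weak convergence and concentration
  apply.

  The difficulty for \<open>p > 2\<close> is that \<open>h\<close> times the squared L_p norm of the
  kernel is bounded only by a multiple of \<open>h powr (2 / p - 1)\<close>, which diverges. For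
  \<open>p < 2\<close> the difficulty lies at infinity: the limit variance enters through
  \<open>f powr (p / 2)\<close>, which has heavier tails than \<open>f\<close>, and the moment of
  order \<open>lam\<close> supplies a majorant.

  The clipped functional converges to a quantity built from \<open>f0\<close>, while the rate
  contains the constant of the varying density. That constant stands in a denominator, so Fatou's
  lemma gives the comparison of the two.\<close>

lemma bounded_differences_bounded:
  assumes "finite I"
    and diff: "\<And>X i a. i \<in> I \<Longrightarrow> X \<in> space (Pi\<^sub>M I (\<lambda>_. D)) \<Longrightarrow> a \<in> space D \<Longrightarrow>
                 \<bar>F (X(i := a)) - F X\<bar> \<le> (c::real)"
    and "prob_space D"
  shows "\<exists>b. \<forall>X \<in> space (Pi\<^sub>M I (\<lambda>_. D)). \<bar>F X\<bar> \<le> b"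
  using assms(1,2)
proof (induction I arbitrary: F rule: finite_induct)
  case empty
  then show ?case by (auto simp: space_PiM)
next
  case (insert i J)
  obtain a0 where a0: "a0 \<in> space D"
    using prob_space.not_empty[OF assms(3)] by auto
  \<comment> \<open>Freezing coordinate \<open>i\<close> at \<open>a0\<close> leaves a function of
    the other coordinates with the same constant \<open>c\<close>; unfreezing it costs one further
    \<open>c\<close>.\<close>
  have "\<exists>b. \<forall>X \<in> space (Pi\<^sub>M J (\<lambda>_. D)). \<bar>F (X(i := a0))\<bar> \<le> b"
  proof (rule insert.IH)
    fix X j a assume j: "j \<in> J" and X: "X \<in> space (Pi\<^sub>M J (\<lambda>_. D))" and a: "a \<in> space D"
    have "X(i := a0) \<in> space (Pi\<^sub>M (insert i J) (\<lambda>_. D))"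
      using X a0 by (auto simp: space_PiM PiE_def extensional_def)
    from insert.prems[of j, OF _ this a] j
    have "\<bar>F ((X(i := a0))(j := a)) - F (X(i := a0))\<bar> \<le> c" by blast
    moreover have "(X(j := a))(i := a0) = (X(i := a0))(j := a)"
      using j insert.hyps by (intro fun_upd_twist) auto
    ultimately show "\<bar>F ((X(j := a))(i := a0)) - F (X(i := a0))\<bar> \<le> c" by simp
  qed
  then obtain b where b: "\<And>X. X \<in> space (Pi\<^sub>M J (\<lambda>_. D)) \<Longrightarrow> \<bar>F (X(i := a0))\<bar> \<le> b" by auto
  show ?case
  proof (intro exI ballI)
    fix X assume X: "X \<in> space (Pi\<^sub>M (insert i J) (\<lambda>_. D))"
    define Y where "Y = restrict X J"
    have Y: "Y \<in> space (Pi\<^sub>M J (\<lambda>_. D))" using X by (auto simp: Y_def space_PiM PiE_def)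
    have "Y(i := a0) = X(i := a0)"
      using X insert.hyps by (auto simp: Y_def space_PiM PiE_def extensional_def fun_eq_iff)
    then have "\<bar>F (X(i := a0))\<bar> \<le> b" using b[OF Y] by simp
    moreover have "\<bar>F (X(i := a0)) - F X\<bar> \<le> c" by (rule insert.prems) (use X a0 in auto)
    ultimately show "\<bar>F X\<bar> \<le> b + c" by linarith
  qed
qed

text \<open>McDiarmid's inequality in exponential form: the coordinates are integrated out one at a
  time. With the others fixed, \<open>F\<close> stays in an interval of length \<open>2 * c\<close>,
  so Hoeffding's lemma costs \<open>exp (t\<^sup>2 * (2 * c)\<^sup>2 / 8)\<close> per coordinate,
  and the averaged function inherits the difference constant.\<close>

theorem bounded_differences_mgf:
  assumes "finite I" and D: "prob_space D"
    and meas: "F \<in> borel_measurable (Pi\<^sub>M I (\<lambda>_. D))"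
    and diff: "\<And>X i a. i \<in> I \<Longrightarrow> X \<in> space (Pi\<^sub>M I (\<lambda>_. D)) \<Longrightarrow> a \<in> space D \<Longrightarrow>
                 \<bar>F (X(i := a)) - F X\<bar> \<le> (c::real)"
    and t: "t > 0"
  shows "(\<integral>\<^sup>+X. ennreal (exp (t * F X)) \<partial>Pi\<^sub>M I (\<lambda>_. D)) \<le>
           ennreal (exp (t * (LINT X|Pi\<^sub>M I (\<lambda>_. D). F X) + t\<^sup>2 * real (card I) * c\<^sup>2 / 2))"
  using assms(1) meas diff
proof (induction I arbitrary: F rule: finite_induct)
  case empty
  interpret prob_space "Pi\<^sub>M {} (\<lambda>_::'a. D)" by (intro prob_space_PiM D)
  show ?case by (simp add: PiM_empty nn_integral_count_space_finite lebesgue_integral_count_space_finite)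
next
  case (insert i J)
  interpret D: prob_space D by fact
  interpret product_prob_space "\<lambda>_. D" by unfold_locales
  have ps: "prob_space (Pi\<^sub>M J (\<lambda>_. D))" "prob_space (Pi\<^sub>M (insert i J) (\<lambda>_. D))"
    by (auto intro: prob_space_PiM D)
  interpret PJ: prob_space "Pi\<^sub>M J (\<lambda>_. D)" by fact
  interpret PI: prob_space "Pi\<^sub>M (insert i J) (\<lambda>_. D)" by fact
  note [measurable] = insert.prems(1)
  have upd: "X(i := a) \<in> space (Pi\<^sub>M (insert i J) (\<lambda>_. D))"
    if "X \<in> space (Pi\<^sub>M J (\<lambda>_. D))" "a \<in> space D" for X a
    using that by (auto simp: space_PiM PiE_def extensional_def)
  have "\<exists>b. \<forall>X \<in> space (Pi\<^sub>M (insert i J) (\<lambda>_. D)). \<bar>F X\<bar> \<le> b"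
    by (rule bounded_differences_bounded[OF _ insert.prems(2) D]) (simp add: insert.hyps)
  then obtain b where b: "\<And>X. X \<in> space (Pi\<^sub>M (insert i J) (\<lambda>_. D)) \<Longrightarrow> \<bar>F X\<bar> \<le> b"
    by metis
  have intF: "integrable (Pi\<^sub>M (insert i J) (\<lambda>_. D)) F"
    by (rule PI.integrable_const_bound[where B = b]) (rule AE_I2, unfold real_norm_def, rule b, assumption, fact)
  have m2 [measurable]: "(\<lambda>(X, a). F (X(i := a))) \<in> borel_measurable (Pi\<^sub>M J (\<lambda>_. D) \<Otimes>\<^sub>M D)"
    using insert.hyps by measurable
  have m1 [measurable]: "(\<lambda>a. F (X(i := a))) \<in> borel_measurable D" if "X \<in> space (Pi\<^sub>M J (\<lambda>_. D))" for X
    using measurable_Pair2[OF m2 that] by simp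
  have intD: "integrable D (\<lambda>a. F (X(i := a)))" if X: "X \<in> space (Pi\<^sub>M J (\<lambda>_. D))" for X
    by (rule D.integrable_const_bound[where B = b]) (rule AE_I2, unfold real_norm_def, rule b, rule upd[OF that], assumption, rule m1[OF that])
  define F' where "F' X = (LINT a|D. F (X(i := a)))" for X
  have F'_meas [measurable]: "F' \<in> borel_measurable (Pi\<^sub>M J (\<lambda>_. D))"
    unfolding F'_def by measurable
  have eqF: "(LINT X|Pi\<^sub>M (insert i J) (\<lambda>_. D). F X) = (LINT X|Pi\<^sub>M J (\<lambda>_. D). F' X)"
    unfolding F'_def by (rule product_integral_insert) (use insert intF in auto)
  have "(\<integral>\<^sup>+X. ennreal (exp (t * F X)) \<partial>Pi\<^sub>M (insert i J) (\<lambda>_. D)) =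
        (\<integral>\<^sup>+X. \<integral>\<^sup>+a. ennreal (exp (t * F (X(i := a)))) \<partial>D \<partial>Pi\<^sub>M J (\<lambda>_. D))"
    by (rule product_nn_integral_insert) (use insert in auto)
  also have "\<dots> \<le> (\<integral>\<^sup>+X. ennreal (exp (t * F' X)) * ennreal (exp (t\<^sup>2 * c\<^sup>2 / 2)) \<partial>Pi\<^sub>M J (\<lambda>_. D))"
  proof (rule nn_integral_mono)
    fix X assume X: "X \<in> space (Pi\<^sub>M J (\<lambda>_. D))"
    obtain a0 where a0: "a0 \<in> space D" using D.not_empty by auto
    have rng: "F (X(i := a)) \<in> {F (X(i := a0)) - c .. F (X(i := a0)) + c}" if "a \<in> space D" for a
    proof -
      have "\<bar>F ((X(i := a0))(i := a)) - F (X(i := a0))\<bar> \<le> c"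
        by (rule insert.prems(2)[OF _ upd[OF X a0] that]) simp
      then show ?thesis unfolding fun_upd_upd by (auto simp: abs_le_iff)
    qed
    interpret H: interval_bounded_random_variable D "\<lambda>a. F (X(i := a))"
      "F (X(i := a0)) - c" "F (X(i := a0)) + c"
      by unfold_locales (use X rng in auto)
    have "(\<integral>\<^sup>+a. ennreal (exp (t * F (X(i := a)))) \<partial>D) =
          (\<integral>\<^sup>+a. ennreal (exp (t * F' X)) * ennreal (exp (t * (F (X(i := a)) - F' X))) \<partial>D)"
      by (intro nn_integral_cong) (simp add: algebra_simps flip: ennreal_mult exp_add)
    also have "\<dots> = ennreal (exp (t * F' X)) * (\<integral>\<^sup>+a. ennreal (exp (t * (F (X(i := a)) - F' X))) \<partial>D)"
      using X by (intro nn_integral_cmult) auto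
    also have "\<dots> \<le> ennreal (exp (t * F' X)) * ennreal (exp (t\<^sup>2 * c\<^sup>2 / 2))"
      using H.Hoeffdings_lemma_nn_integral[OF t]
      by (intro mult_left_mono) (auto simp: F'_def power2_eq_square algebra_simps)
    finally show "(\<integral>\<^sup>+a. ennreal (exp (t * F (X(i := a)))) \<partial>D) \<le>
       ennreal (exp (t * F' X)) * ennreal (exp (t\<^sup>2 * c\<^sup>2 / 2))" .
  qed
  also have "\<dots> = (\<integral>\<^sup>+X. ennreal (exp (t * F' X)) \<partial>Pi\<^sub>M J (\<lambda>_. D)) * ennreal (exp (t\<^sup>2 * c\<^sup>2 / 2))"
    by (intro nn_integral_multc) auto
  also have "\<dots> \<le> ennreal (exp (t * (LINT X|Pi\<^sub>M J (\<lambda>_. D). F' X) + t\<^sup>2 * real (card J) * c\<^sup>2 / 2)) *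
                   ennreal (exp (t\<^sup>2 * c\<^sup>2 / 2))"
  proof (intro mult_right_mono insert.IH F'_meas)
    fix X j a assume j: "j \<in> J" and X: "X \<in> space (Pi\<^sub>M J (\<lambda>_. D))" and a: "a \<in> space D"
    have X': "X(j := a) \<in> space (Pi\<^sub>M J (\<lambda>_. D))"
      using X a j by (auto simp: space_PiM PiE_def extensional_def)
    have "\<bar>F' (X(j := a)) - F' X\<bar> = \<bar>LINT b|D. F ((X(j := a))(i := b)) - F (X(i := b))\<bar>"
      unfolding F'_def by (subst Bochner_Integration.integral_diff) (auto intro: intD X X')
    also have "\<dots> \<le> (LINT b|D. \<bar>F ((X(j := a))(i := b)) - F (X(i := b))\<bar>)"
      by (rule integral_abs_bound)
    also have "\<dots> \<le> (LINT b|D. c)"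
    proof (rule integral_mono)
      show "integrable D (\<lambda>b. \<bar>F ((X(j := a))(i := b)) - F (X(i := b))\<bar>)"
        by (intro integrable_abs Bochner_Integration.integrable_diff intD X X')
      fix b assume "b \<in> space D"
      from insert.prems(2)[OF _ upd[OF X this] a, of j] j
      have "\<bar>F ((X(i := b))(j := a)) - F (X(i := b))\<bar> \<le> c" by blast
      moreover have "(X(j := a))(i := b) = (X(i := b))(j := a)"
        using j insert.hyps by (intro fun_upd_twist) auto
      ultimately show "\<bar>F ((X(j := a))(i := b)) - F (X(i := b))\<bar> \<le> c" by simp
    qed auto
    finally show "\<bar>F' (X(j := a)) - F' X\<bar> \<le> c" by (simp add: D.prob_space)
  qed auto
  also have "\<dots> = ennreal (exp (t * (LINT X|Pi\<^sub>M (insert i J) (\<lambda>_. D). F X) +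
                     t\<^sup>2 * real (card (insert i J)) * c\<^sup>2 / 2))"
    using insert.hyps by (simp add: eqF field_simps flip: ennreal_mult exp_add)
  finally show ?case .
qed

subsection \<open>Norms of order p\<close>

text \<open>Tangent line of a convex function. The point \<open>x = 0\<close> is treated by hand
  because convexity of \<open>powr\<close> is taken on the open half-line.\<close>

lemma powr_tangent:
  fixes p x y :: real
  assumes p: "1 \<le> p" and x: "0 \<le> x" and y: "0 < y"
  shows "y powr p + p * y powr (p - 1) * (x - y) \<le> x powr p"
proof (cases "x = 0")
  case True
  have "y powr p = y powr (p - 1) * y"
    using y by (simp add: powr_diff)
  then have "y powr p + p * y powr (p - 1) * (x - y) = (1 - p) * (y powr (p - 1) * y)"
    using True by (simp add: algebra_simps)
  also have "\<dots> \<le> 0" using p y by (intro mult_nonpos_nonneg) auto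
  finally show ?thesis using True by simp
next
  case False
  have "((\<lambda>x. x powr p) has_real_derivative (p * y powr (p - 1))) (at y within {0<..})"
    using y by (intro DERIV_subset[OF has_real_derivative_powr]) auto
  from convex_on_imp_above_tangent[OF powr_convex[OF p] _ _ _ this, of x] False x y
  show ?thesis by (auto simp: interior_open is_interval_connected)
qed

text \<open>The two tangent inequalities at the combined point \<open>z\<close> are averaged; their
  linear terms cancel.\<close>

lemma powr_convex_comb:
  fixes p x y w :: real
  assumes p: "1 \<le> p" and "0 \<le> x" "0 \<le> y" "0 \<le> w" "w \<le> 1"
  shows "(w * x + (1 - w) * y) powr p \<le> w * x powr p + (1 - w) * y powr p"
proof (cases "w * x + (1 - w) * y = 0")
  case True
  with assms show ?thesis by simp
next
  case False
  define z where "z = w * x + (1 - w) * y"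
  have z: "z > 0" using False assms by (auto simp: z_def less_le intro!: add_nonneg_nonneg mult_nonneg_nonneg)
  have "w * (z powr p + p * z powr (p - 1) * (x - z)) + (1 - w) * (z powr p + p * z powr (p - 1) * (y - z))
      \<le> w * x powr p + (1 - w) * y powr p"
    using assms by (intro add_mono mult_left_mono powr_tangent z) auto
  moreover have "w * (z powr p + p * z powr (p - 1) * (x - z)) + (1 - w) * (z powr p + p * z powr (p - 1) * (y - z))
     = z powr p + p * z powr (p - 1) * (w * x + (1 - w) * y - z)" by (simp add: algebra_simps)
  ultimately show ?thesis by (simp add: z_def)
qed

lemma powr_add_le:
  fixes p x y :: real
  assumes "1 \<le> p" "0 \<le> x" "0 \<le> y"
  shows "(x + y) powr p \<le> 2 powr p * (x powr p + y powr p)"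
proof -
  have "(x + y) powr p = 2 powr p * (((1/2) * x + (1 - 1/2) * y) powr p)"
  proof -
    have "x + y = 2 * ((1/2) * x + (1 - 1/2) * y)" by simp
    then show ?thesis using powr_mult[of 2 "(1/2) * x + (1 - 1/2) * y" p] by metis
  qed
  also have "\<dots> \<le> 2 powr p * ((1/2) * x powr p + (1 - 1/2) * y powr p)"
    using assms by (intro mult_left_mono powr_convex_comb) auto
  also have "\<dots> \<le> 2 powr p * (x powr p + y powr p)"
    by (intro mult_left_mono add_mono) auto
  finally show ?thesis .
qed

definition Lp :: "real \<Rightarrow> (real \<Rightarrow> real) set" where
  "Lp p = {g. g \<in> borel_measurable lborel \<and> integrable lborel (\<lambda>x. \<bar>g x\<bar> powr p)}"

lemma Lp_meas: "g \<in> Lp p \<Longrightarrow> g \<in> borel_measurable lborel"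
  by (simp add: Lp_def)

lemma Lp_int: "g \<in> Lp p \<Longrightarrow> integrable lborel (\<lambda>x. \<bar>g x\<bar> powr p)"
  by (simp add: Lp_def)

lemma Lp_bound:
  assumes "h \<in> Lp p" "g \<in> borel_measurable lborel" "\<And>x. \<bar>g x\<bar> \<le> \<bar>h x\<bar>" "0 \<le> p"
  shows "g \<in> Lp p"
proof -
  have [measurable]: "g \<in> borel_measurable borel" using assms(2) by simp
  have "integrable lborel (\<lambda>x. \<bar>g x\<bar> powr p)"
    by (rule Bochner_Integration.integrable_bound[OF Lp_int[OF assms(1)]])
       (auto intro!: AE_I2 powr_mono2 assms)
  then show ?thesis using assms(2) by (simp add: Lp_def)
qed

lemma Lp_add:
  assumes p: "1 \<le> p" and f: "f \<in> Lp p" and g: "g \<in> Lp p"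
  shows "(\<lambda>x. f x + g x) \<in> Lp p"
proof -
  note [measurable] = Lp_meas[OF f] Lp_meas[OF g]
  have "integrable lborel (\<lambda>x. \<bar>f x + g x\<bar> powr p)"
  proof (rule Bochner_Integration.integrable_bound)
    show "integrable lborel (\<lambda>x. 2 powr p * (\<bar>f x\<bar> powr p + \<bar>g x\<bar> powr p))"
      using Lp_int[OF f] Lp_int[OF g] by auto
    have "\<bar>f x + g x\<bar> powr p \<le> 2 powr p * (\<bar>f x\<bar> powr p + \<bar>g x\<bar> powr p)" for x
      using p by (intro order_trans[OF powr_mono2 powr_add_le[OF p]]) auto
    then show "AE x in lborel. norm (\<bar>f x + g x\<bar> powr p) \<le> norm (2 powr p * (\<bar>f x\<bar> powr p + \<bar>g x\<bar> powr p))"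
      by (auto intro!: AE_I2 order_trans[OF _ abs_ge_self])
  qed measurable
  then show ?thesis by (simp add: Lp_def)
qed

lemma Lp_cmult:
  assumes "g \<in> Lp p" shows "(\<lambda>x. c * g x) \<in> Lp p"
proof -
  note [measurable] = Lp_meas[OF assms]
  have "integrable lborel (\<lambda>x. \<bar>c\<bar> powr p * \<bar>g x\<bar> powr p)"
    using Lp_int[OF assms] by auto
  then show ?thesis by (simp add: Lp_def abs_mult powr_mult)
qed

lemma Lp_diff:
  assumes p: "1 \<le> p" and f: "f \<in> Lp p" and g: "g \<in> Lp p"
  shows "(\<lambda>x. f x - g x) \<in> Lp p"
  using Lp_add[OF p f Lp_cmult[OF g, of "-1"]] by simp

lemma Lp_sum:
  assumes p: "1 \<le> p" and "finite I" "\<And>i. i \<in> I \<Longrightarrow> g i \<in> Lp p"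
  shows "(\<lambda>x. \<Sum>i\<in>I. g i x) \<in> Lp p"
  using assms(2,3)
proof (induction I rule: finite_induct)
  case empty then show ?case by (simp add: Lp_def)
next
  case (insert i I) then show ?case by (auto intro!: Lp_add p)
qed

lemma Lp_shift:
  assumes g: "g \<in> Lp p" shows "(\<lambda>x. g (x - c)) \<in> Lp p"
proof -
  note [measurable] = Lp_meas[OF g]
  show ?thesis
    using lborel_integrable_real_affine[OF Lp_int[OF g], of 1 "-c"] by (simp add: Lp_def)
qed

lemma Lq_norm_nonneg [simp]: "0 \<le> Lq_norm p g"
  by (simp add: Lq_norm_def)

lemma Lq_norm_powr:
  assumes "p > 0" shows "Lq_norm p g powr p = (LINT x|lborel. \<bar>g x\<bar> powr p)"
  using assms by (simp add: Lq_norm_def powr_powr)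

lemma Lq_norm_le:
  assumes "p > 0" "c \<ge> 0" "(LINT x|lborel. \<bar>g x\<bar> powr p) \<le> c powr p"
  shows "Lq_norm p g \<le> c"
proof -
  have "Lq_norm p g \<le> (c powr p) powr (1 / p)"
    unfolding Lq_norm_def using assms by (intro powr_mono2) auto
  then show ?thesis using assms by (simp add: powr_powr)
qed

lemma Lq_norm_mono:
  assumes "p > 0" "h \<in> Lp p" "g \<in> borel_measurable lborel" "\<And>x. \<bar>g x\<bar> \<le> \<bar>h x\<bar>"
  shows "Lq_norm p g \<le> Lq_norm p h"
  unfolding Lq_norm_def
  using assms Lp_int[OF assms(2)] Lp_int[OF Lp_bound[OF assms(2-4)]]
  by (intro powr_mono2 integral_mono) auto

lemma Lq_norm_cmult:
  assumes "p > 0"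
  shows "Lq_norm p (\<lambda>x. c * g x) = \<bar>c\<bar> * Lq_norm p g"
  using assms by (simp add: Lq_norm_def abs_mult powr_mult powr_powr)

lemma Lq_norm_shift: "Lq_norm p (\<lambda>x. g (x - c)) = Lq_norm p g"
  using lborel_integral_real_affine[of 1 "\<lambda>x. \<bar>g x\<bar> powr p" "-c"] by (simp add: Lq_norm_def)

text \<open>Normalise both functions and use convexity with weights \<open>A / (A + B)\<close> and
  \<open>B / (A + B)\<close>. The summand \<open>e / 2\<close> in \<open>A\<close> and
  \<open>B\<close> keeps them positive, so null functions need no case of their own.\<close>

lemma minkowski:
  assumes p: "1 \<le> p" and f: "f \<in> Lp p" and g: "g \<in> Lp p"
  shows "Lq_norm p (\<lambda>x. f x + g x) \<le> Lq_norm p f + Lq_norm p g"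
proof (rule field_le_epsilon)
  fix e :: real assume e: "e > 0"
  define A where "A = Lq_norm p f + e / 2"
  define B where "B = Lq_norm p g + e / 2"
  have AB: "A > 0" "B > 0" using e by (auto simp: A_def B_def add_nonneg_pos)
  note [measurable] = Lp_meas[OF f] Lp_meas[OF g]
  note int = Lp_int[OF f] Lp_int[OF g] Lp_int[OF Lp_add[OF p f g]]
  have "(LINT x|lborel. \<bar>f x\<bar> powr p) \<le> A powr p" "(LINT x|lborel. \<bar>g x\<bar> powr p) \<le> B powr p"
    using p e by (auto simp: A_def B_def simp flip: Lq_norm_powr intro!: powr_mono2)
  then have le1: "(LINT x|lborel. \<bar>f x\<bar> powr p) / A powr p \<le> 1" "(LINT x|lborel. \<bar>g x\<bar> powr p) / B powr p \<le> 1"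
    using AB by auto
  define w where "w = A / (A + B)"
  have w: "0 \<le> w" "w \<le> 1" "1 - w = B / (A + B)" using AB by (auto simp: w_def field_simps)
  have pt: "\<bar>f x + g x\<bar> powr p \<le>
      (A + B) powr p * (w * (\<bar>f x\<bar> powr p / A powr p) + (1 - w) * (\<bar>g x\<bar> powr p / B powr p))" for x
  proof -
    have "\<bar>f x + g x\<bar> powr p \<le> (\<bar>f x\<bar> + \<bar>g x\<bar>) powr p" using p by (intro powr_mono2) auto
    also have "\<bar>f x\<bar> + \<bar>g x\<bar> = (A + B) * (w * (\<bar>f x\<bar> / A) + (1 - w) * (\<bar>g x\<bar> / B))"
      using AB w by (simp add: w_def w(3) distrib_left)
    also have "\<dots> powr p = (A + B) powr p * (w * (\<bar>f x\<bar> / A) + (1 - w) * (\<bar>g x\<bar> / B)) powr p"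
      using AB w by (intro powr_mult) 
    also have "\<dots> \<le> (A + B) powr p * (w * (\<bar>f x\<bar> / A) powr p + (1 - w) * (\<bar>g x\<bar> / B) powr p)"
      using AB w p by (intro mult_left_mono powr_convex_comb) auto
    finally show ?thesis using AB by (simp add: powr_divide)
  qed
  have "(LINT x|lborel. \<bar>f x + g x\<bar> powr p) \<le> (LINT x|lborel. 
      (A + B) powr p * (w * (\<bar>f x\<bar> powr p / A powr p) + (1 - w) * (\<bar>g x\<bar> powr p / B powr p)))"
    using int pt by (intro integral_mono) auto
  also have "\<dots> = (A + B) powr p * (w * ((LINT x|lborel. \<bar>f x\<bar> powr p) / A powr p) + 
      (1 - w) * ((LINT x|lborel. \<bar>g x\<bar> powr p) / B powr p))"
    using int by simp
  also have "\<dots> \<le> (A + B) powr p * (w * 1 + (1 - w) * 1)"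
    using w le1 by (intro mult_left_mono add_mono) auto
  finally have "(LINT x|lborel. \<bar>f x + g x\<bar> powr p) \<le> (A + B) powr p" by simp
  then have "Lq_norm p (\<lambda>x. f x + g x) \<le> A + B" using AB p by (intro Lq_norm_le) auto
  then show "Lq_norm p (\<lambda>x. f x + g x) \<le> Lq_norm p f + Lq_norm p g + e" by (simp add: A_def B_def)
qed

lemma Lq_norm_minus_commute: "Lq_norm p (\<lambda>x. f x - g x) = Lq_norm p (\<lambda>x. g x - f x)"
  by (simp add: Lq_norm_def abs_minus_commute)

lemma Lq_norm_diff_le:
  assumes p: "1 \<le> p" and f: "f \<in> Lp p" and g: "g \<in> Lp p"
  shows "Lq_norm p f - Lq_norm p g \<le> Lq_norm p (\<lambda>x. f x - g x)"
  using minkowski[OF p Lp_diff[OF p f g] g] by simp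

lemma Lq_norm_abs_diff_le:
  assumes p: "1 \<le> p" and f: "f \<in> Lp p" and g: "g \<in> Lp p"
  shows "\<bar>Lq_norm p f - Lq_norm p g\<bar> \<le> Lq_norm p (\<lambda>x. f x - g x)"
  using Lq_norm_diff_le[OF p f g] Lq_norm_diff_le[OF p g f] Lq_norm_minus_commute[of p f g] by linarith

section \<open>Jensen's inequality and scalar inequalities for powers and exponentials\<close>

lemma (in prob_space) jensen_powr:
  fixes X :: "'a \<Rightarrow> real"
  assumes p: "1 \<le> p" and X: "integrable M X" "\<And>x. 0 \<le> X x" and Xp: "integrable M (\<lambda>x. X x powr p)"
  shows "(expectation X) powr p \<le> expectation (\<lambda>x. X x powr p)"
proof (cases "expectation X = 0")
  case True
  then show ?thesis using p by simp
next
  case False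
  define y where "y = expectation X"
  have y: "y > 0" using False X by (auto simp: y_def less_le)
  have "expectation (\<lambda>x. y powr p + p * y powr (p - 1) * (X x - y)) \<le> expectation (\<lambda>x. X x powr p)"
    using X Xp by (intro integral_mono powr_tangent p y) auto
  also have "expectation (\<lambda>x. y powr p + p * y powr (p - 1) * (X x - y)) =
     y powr p + p * y powr (p - 1) * (y - y)"
    using X by (simp add: prob_space y_def)
  finally show ?thesis by (simp add: y_def)
qed

text \<open>On \<open>[0, K]\<close> the slope of the power is at most
  \<open>p * K powr (p - 1)\<close>, and clipping is a contraction. Through this bound a change of
  the deviation is measured in L_1, whatever \<open>p\<close> is.\<close>

lemma clipped_powr_lipschitz:
  fixes p K x y :: real
  assumes p: "1 \<le> p" and K: "0 < K"
  shows "\<bar>min \<bar>x\<bar> K powr p - min \<bar>y\<bar> K powr p\<bar> \<le> p * K powr (p - 1) * \<bar>x - y\<bar>"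
proof -
  have *: "b powr p - a powr p \<le> p * K powr (p - 1) * (b - a)" if "0 \<le> a" "a \<le> b" "b \<le> K" for a b
  proof (cases "b = 0")
    case False
    then have b: "b > 0" using that by simp
    have "b powr p - a powr p \<le> p * b powr (p - 1) * (b - a)"
      using powr_tangent[OF p that(1) b] by (simp add: algebra_simps)
    also have "\<dots> \<le> p * K powr (p - 1) * (b - a)"
      using that p b by (intro mult_right_mono mult_left_mono powr_mono2) auto
    finally show ?thesis .
  qed (use that in auto)
  define a where "a = min \<bar>x\<bar> K"
  define b where "b = min \<bar>y\<bar> K"
  have ab: "\<bar>a - b\<bar> \<le> \<bar>x - y\<bar>" unfolding a_def b_def
    using abs_triangle_ineq3[of x y] by (cases "\<bar>x\<bar> \<le> K"; cases "\<bar>y\<bar> \<le> K"; simp add: min_def)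
  have nn: "0 \<le> a" "0 \<le> b" "a \<le> K" "b \<le> K"
    unfolding a_def b_def using K by (auto intro: min.boundedI)
  have "\<bar>a powr p - b powr p\<bar> \<le> p * K powr (p - 1) * \<bar>a - b\<bar>"
  proof (cases "a \<le> b")
    case True
    then have "a powr p \<le> b powr p" using nn p by (intro powr_mono2) auto
    with *[OF nn(1) True nn(4)] True show ?thesis by (simp add: abs_of_nonpos)
  next
    case False
    then have "b powr p \<le> a powr p" using nn p by (intro powr_mono2) auto
    with *[OF nn(2) _ nn(3)] False show ?thesis by (simp add: abs_of_nonneg)
  qed
  also have "\<dots> \<le> p * K powr (p - 1) * \<bar>x - y\<bar>" using ab p by (intro mult_left_mono) auto
  finally show ?thesis unfolding a_def b_def .
qed

text \<open>A minorant of \<open>exp y\<close> that is linear in \<open>(y / \<tau>) powr p\<close>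
  and touches at \<open>y = \<tau>\<close>. Integrated against a weight of mass at most one, it
  bounds the exponential of an L_p norm by an integral of exponentials, a form of Jensen's
  inequality valid once \<open>\<tau>\<close> is at least \<open>p\<close>.\<close>

lemma exp_powr_tangent:
  fixes p y \<tau> :: real
  assumes p: "1 \<le> p" "p \<le> \<tau>" and y: "0 \<le> y"
  shows "exp \<tau> * (1 - \<tau> / p + \<tau> / p * (y / \<tau>) powr p) \<le> exp y"
proof -
  have \<tau>: "\<tau> > 0" using p by simp
  have "(y / \<tau>) powr p \<le> exp (p * (y / \<tau> - 1))"
  proof (cases "y = 0")
    case False
    have "ln (y / \<tau>) \<le> y / \<tau> - 1" using ln_le_minus_one[of "y / \<tau>"] y \<tau> False by simp
    then show ?thesis using False y \<tau> p by (simp add: powr_def)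
  qed simp
  define z where "z = exp (p * (y / \<tau> - 1))"
  have z: "z > 0" by (simp add: z_def)
  have "1 - \<tau> / p + \<tau> / p * (y / \<tau>) powr p \<le> 1 - \<tau> / p + \<tau> / p * z"
    unfolding z_def using p \<tau> \<open>(y / \<tau>) powr p \<le> _\<close> by (intro add_left_mono mult_left_mono) auto
  \<comment> \<open>Bernoulli's inequality with exponent \<open>\<tau> / p\<close>; this is where
    \<open>p \<le> \<tau>\<close> enters.\<close>
  also have "\<dots> \<le> z powr (\<tau> / p)"
  proof -
    have "1 + \<tau> / p * (z - 1) \<le> z powr (\<tau> / p)"
      using powr_tangent[of "\<tau> / p" z 1] p \<tau> z by simp
    then show ?thesis by (simp add: right_diff_distrib)
  qed
  also have "\<dots> = exp (y - \<tau>)" using p \<tau> by (simp add: z_def powr_def field_simps)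
  finally have "exp \<tau> * (1 - \<tau> / p + \<tau> / p * (y / \<tau>) powr p) \<le> exp \<tau> * exp (y - \<tau>)"
    by (intro mult_left_mono) auto
  then show ?thesis by (simp flip: exp_add)
qed

lemma exp_le_quadratic:
  fixes y :: real assumes "\<bar>y\<bar> \<le> 1" shows "exp y \<le> 1 + y + y\<^sup>2"
proof (cases "y \<ge> 0")
  case True then show ?thesis using exp_bound[of y] assms by simp
next
  case False
  have q: "1 - y + y\<^sup>2 / 2 \<le> exp (- y)"
    using exp_lower_Taylor_quadratic[of "- y"] False by simp
  have "1 \<le> (1 - y + y\<^sup>2 / 2) * (1 + y + y\<^sup>2)"
  proof -
    have eq: "(1 - y + y\<^sup>2 / 2) * (1 + y + y\<^sup>2) = 1 + y\<^sup>2 / 2 + y\<^sup>2 * (- y) / 2 + y^4 / 2"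
      by (simp add: power2_eq_square power4_eq_xxxx field_simps)
    moreover have "y\<^sup>2 * (- y) \<ge> 0" using False by (intro mult_nonneg_nonneg) auto
    moreover have "y^4 \<ge> 0" "y\<^sup>2 \<ge> 0" by (simp_all add: zero_le_even_power)
    ultimately show ?thesis unfolding eq by linarith
  qed
  also have "\<dots> \<le> exp (- y) * (1 + y + y\<^sup>2)"
  proof (rule mult_right_mono[OF q])
    have "0 \<le> (y + 1/2)\<^sup>2 + 3/4" by simp
    also have "\<dots> = 1 + y + y\<^sup>2" by (simp add: power2_eq_square field_simps)
    finally show "0 \<le> 1 + y + y\<^sup>2" .
  qed
  finally show ?thesis by (simp add: exp_minus field_simps)
qed

lemma cosh_minus_one_ge:
  fixes y :: real assumes "k \<ge> 1" shows "y ^ (2 * k) / fact (2 * k) \<le> cosh y - 1"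
proof -
  have s: "(\<lambda>n. if even n then y ^ n / fact n else 0) sums cosh y"
    using cosh_converges[of y] by (simp add: scaleR_conv_of_real field_simps cong: if_cong)
  have "(\<Sum>n\<in>{0, 2 * k}. if even n then y ^ n / fact n else 0) \<le> cosh y"
    using sums_summable[OF s] unfolding sums_unique[OF s]
    by (intro sum_le_suminf) (auto simp: zero_le_even_power)
  then show ?thesis using assms by simp
qed

text \<open>The majorant vanishes quadratically at 0. Moments of \<open>Y\<close> bounded through it
  are therefore linear in the variance when this is small, hence integrable in \<open>x\<close>. The
  exponent \<open>r\<close> lies between 2 and the even number \<open>2 * k\<close>, and both powers
  occur in the series of \<open>cosh\<close>.\<close>

lemma powr_le_cosh:
  fixes r :: real assumes "2 \<le> r"
  obtains C where "C > 0" "\<And>y. \<bar>y\<bar> powr r \<le> C * (cosh y - 1)"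
proof -
  define k where "k = nat \<lceil>r\<rceil>"
  have k: "r \<le> real (2 * k)" "k \<ge> 1" using assms by (auto simp: k_def) linarith+
  have "\<bar>y\<bar> powr r \<le> (2 + fact (2 * k)) * (cosh y - 1)" for y
  proof -
    have "\<bar>y\<bar> powr r \<le> y ^ 2 + y ^ (2 * k)"
    proof (cases "\<bar>y\<bar> \<le> 1")
      case True
      have "\<bar>y\<bar> powr r \<le> \<bar>y\<bar> powr 2" using True assms by (intro powr_mono') auto
      then show ?thesis by (auto simp: powr_numeral zero_le_even_power intro: add_increasing2)
    next
      case False
      have "\<bar>y\<bar> powr r \<le> \<bar>y\<bar> powr real (2 * k)" using False k by (intro powr_mono) auto
      also have "\<dots> = y ^ (2 * k)" using False by (subst powr_realpow) (auto simp: power_even_abs)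
      finally show ?thesis using zero_le_power2[of y] by linarith
    qed
    moreover have "y ^ 2 \<le> 2 * (cosh y - 1)" using cosh_minus_one_ge[of 1 y] by (simp add: numeral_2_eq_2)
    moreover have "y ^ (2 * k) \<le> fact (2 * k) * (cosh y - 1)"
      using cosh_minus_one_ge[OF k(2), of y] by (simp add: field_simps)
    ultimately show ?thesis by (simp add: algebra_simps)
  qed
  then show ?thesis by (intro that[of "2 + fact (2 * k)"]) (auto simp: add_pos_nonneg)
qed

subsection \<open>The normalised deviation of a kernel estimator\<close>

text \<open>One density, one kernel and one sample size. The kernel is assumed only integrable and
  bounded by \<open>1 / h\<close>, which separates the probabilistic estimates from the Fourier
  analysis.\<close>

locale kde =
  fixes f k :: "real \<Rightarrow> real" and h :: real and n :: nat
  assumes dens: "is_prob_density f"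
    and k_meas [measurable]: "k \<in> borel_measurable borel"
    and k_bound: "\<And>z. \<bar>k z\<bar> \<le> 1 / h"
    and k_int: "integrable lborel k"
    and h_pos: "h > 0" and n_pos: "n > 0"
begin

definition D where "D = density lborel (\<lambda>x. ennreal (f x))"
definition P where "P = Pi\<^sub>M {..<n} (\<lambda>_. D)"
definition m where "m x = (LINT y|D. k (x - y))"
text \<open>An uncentred second moment: it dominates the variance of \<open>Y\<close>, and its
  integral over \<open>x\<close> can be computed exactly.\<close>

definition s2 where "s2 x = h * (LINT y|D. (k (x - y))\<^sup>2)"
text \<open>The number \<open>sqrt (h / n) * (2 / h)\<close>, a uniform bound for one centred and
  normalised kernel value. Exponents up to \<open>1 / a\<close> are those for which \<open>Y\<close>
  is controlled as a subgaussian variable.\<close>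

definition a where "a = 2 / sqrt (real n * h)"
definition \<xi> where "\<xi> x y = sqrt (h / real n) * (k (x - y) - m x)"
definition Y where "Y X x = (\<Sum>i<n. \<xi> x (X i))"

lemma f_meas [measurable]: "f \<in> borel_measurable borel"
  and f_nonneg: "0 \<le> f x" and f_int: "integrable lborel f" and f_int1: "(LINT x|lborel. f x) = 1"
  using dens by (auto simp: is_prob_density_def)

lemma sets_D [measurable_cong, simp]: "sets D = sets borel"
  by (simp add: D_def)

lemma space_D [simp]: "space D = UNIV"
  by (simp add: D_def)

lemma prob_space_D: "prob_space D"
proof (rule prob_spaceI)
  have "emeasure D (space D) = (\<integral>\<^sup>+x. ennreal (f x) \<partial>lborel)"
    by (simp add: D_def emeasure_density)
  also have "\<dots> = ennreal 1"
    using f_int f_int1 f_nonneg by (simp add: nn_integral_eq_integral)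
  finally show "emeasure D (space D) = 1" by simp
qed

sublocale D: prob_space D by (rule prob_space_D)

lemma prob_space_P: "prob_space P"
  unfolding P_def by (intro prob_space_PiM prob_space_D)

lemma sets_P [measurable_cong]: "sets P = sets (Pi\<^sub>M {..<n} (\<lambda>_. borel :: real measure))"
  unfolding P_def by (intro sets_PiM_cong) auto

sublocale P: prob_space P by (rule prob_space_P)

lemma integral_D: "g \<in> borel_measurable borel \<Longrightarrow> (LINT y|D. g y) = (LINT y|lborel. f y * g y)"
  for g :: "real \<Rightarrow> real"
  unfolding D_def by (subst integral_density) (auto simp: f_nonneg)

lemma integrable_bounded_D:
  fixes g :: "real \<Rightarrow> real"
  shows "g \<in> borel_measurable borel \<Longrightarrow> (\<And>y. \<bar>g y\<bar> \<le> B) \<Longrightarrow> integrable D g"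
  by (rule D.integrable_const_bound[where B = B]) auto

lemma integrable_bounded_P:
  fixes F :: "_ \<Rightarrow> real"
  shows "F \<in> borel_measurable P \<Longrightarrow> (\<And>X. \<bar>F X\<bar> \<le> B) \<Longrightarrow> integrable P F"
  by (rule P.integrable_const_bound[where B = B]) auto

lemma int_k: "integrable D (\<lambda>y. k (x - y))"
  by (rule integrable_bounded_D[where B = "1 / h"]) (auto intro: k_bound)

lemma k2_bound: "(k z)\<^sup>2 \<le> (1 / h)\<^sup>2"
  by (rule power2_le_iff_abs_le[THEN iffD2]) (use h_pos k_bound in auto)

lemma int_k2: "integrable D (\<lambda>y. (k (x - y))\<^sup>2)"
  by (rule integrable_bounded_D[where B = "(1 / h)\<^sup>2"]) (auto intro: k2_bound)

lemma m_meas [measurable]: "m \<in> borel_measurable borel"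
  unfolding m_def by measurable

lemma s2_meas [measurable]: "s2 \<in> borel_measurable borel"
  unfolding s2_def by measurable

lemma s2_nonneg: "0 \<le> s2 x"
  unfolding s2_def using h_pos by (intro mult_nonneg_nonneg) auto

lemma m_bound: "\<bar>m x\<bar> \<le> 1 / h"
proof -
  have "\<bar>m x\<bar> \<le> (LINT y|D. \<bar>k (x - y)\<bar>)" unfolding m_def by (rule integral_abs_bound)
  also have "\<dots> \<le> (LINT y|D. 1 / h)" by (intro integral_mono integrable_abs int_k k_bound) auto
  finally show ?thesis by (simp add: D.prob_space[simplified])
qed

lemma a_pos: "a > 0" using h_pos n_pos by (simp add: a_def)

lemma \<xi>_meas [measurable]: "(\<lambda>(x, y). \<xi> x y) \<in> borel_measurable (borel \<Otimes>\<^sub>M borel)"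
  unfolding \<xi>_def by measurable

lemma \<xi>_bound: "\<bar>\<xi> x y\<bar> \<le> a"
proof -
  have "\<bar>\<xi> x y\<bar> \<le> sqrt (h / n) * (2 / h)"
    unfolding \<xi>_def abs_mult using m_bound[of x] k_bound[of "x - y"] h_pos
    by (intro mult_mono) (auto intro: order_trans[OF abs_triangle_ineq4])
  also have "\<dots> = a" using h_pos n_pos
    by (simp add: a_def real_sqrt_divide real_sqrt_mult field_simps)
  finally show ?thesis .
qed

lemma int_\<xi>: "integrable D (\<xi> x)"
  by (rule integrable_bounded_D[where B = a]) (auto intro: \<xi>_bound)

lemma int_\<xi>2: "integrable D (\<lambda>y. (\<xi> x y)\<^sup>2)"
  by (rule integrable_bounded_D[where B = "a\<^sup>2"])
     (use a_pos \<xi>_bound in \<open>auto intro!: power2_le_iff_abs_le[THEN iffD2]\<close>)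

lemma mean_\<xi>: "(LINT y|D. \<xi> x y) = 0"
  unfolding \<xi>_def using int_k[of x] by (simp add: D.prob_space[simplified] m_def)

lemma var_\<xi>: "real n * (LINT y|D. (\<xi> x y)\<^sup>2) = s2 x - h * (m x)\<^sup>2"
proof -
  have "(LINT y|D. (\<xi> x y)\<^sup>2) = (LINT y|D. h / n * ((k (x - y))\<^sup>2 - 2 * m x * k (x - y) + (m x)\<^sup>2))"
    unfolding \<xi>_def using h_pos by (intro Bochner_Integration.integral_cong refl)
      (simp add: power_mult_distrib power2_diff)
  also have "\<dots> = h / n * ((LINT y|D. (k (x - y))\<^sup>2) - 2 * m x * m x + (m x)\<^sup>2)"
    using int_k[of x] int_k2[of x] by (simp add: D.prob_space[simplified] m_def)
  finally show ?thesis using n_pos by (simp add: s2_def field_simps power2_eq_square)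
qed

lemma var_\<xi>_le: "real n * (LINT y|D. (\<xi> x y)\<^sup>2) \<le> s2 x"
  unfolding var_\<xi> using h_pos by simp

lemma Y_meas [measurable]: "(\<lambda>(X, x). Y X x) \<in> borel_measurable (P \<Otimes>\<^sub>M borel)"
  unfolding Y_def split_beta'
proof (intro borel_measurable_sum)
  fix i assume "i \<in> {..<n}"
  then have [measurable]: "(\<lambda>z. fst z i) \<in> P \<Otimes>\<^sub>M (borel :: real measure) \<rightarrow>\<^sub>M borel"
    by measurable
  show "(\<lambda>z. \<xi> (snd z) (fst z i)) \<in> borel_measurable (P \<Otimes>\<^sub>M borel)"
    using measurable_compose[OF measurable_Pair[OF measurable_snd \<open>(\<lambda>z. fst z i) \<in> _\<close>] \<xi>_meas]
    by simp
qed

lemma Y_meas1 [measurable]: "(\<lambda>X. Y X x) \<in> borel_measurable P"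
  using measurable_compose[OF measurable_Pair[OF measurable_ident measurable_const[of x]] Y_meas] by simp

lemma Y_meas2: "Y X \<in> borel_measurable borel"
  unfolding Y_def by measurable

lemma Y_bound: "\<bar>Y X x\<bar> \<le> real n * a"
proof -
  have "\<bar>Y X x\<bar> \<le> (\<Sum>i<n. \<bar>\<xi> x (X i)\<bar>)" unfolding Y_def by (rule sum_abs)
  also have "\<dots> \<le> (\<Sum>i<n. a)" by (intro sum_mono \<xi>_bound)
  finally show ?thesis by simp
qed

lemma Y_exp_int: "integrable P (\<lambda>X. exp (t * Y X x))"
proof (rule integrable_bounded_P)
  show "\<bar>exp (t * Y X x)\<bar> \<le> exp (\<bar>t\<bar> * (real n * a))" for X
    using mult_mono[OF order_refl Y_bound[of X x], of "\<bar>t\<bar>"] by (simp flip: abs_mult)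
qed measurable

text \<open>As long as \<open>|t| * a\<close> is at most 1,
  \<open>exp y \<le> 1 + y + y\<^sup>2\<close> applies to every summand. The linear term has mean
  zero, each factor is at most \<open>1 + t\<^sup>2 * s2 x / n\<close>, and independence multiplies
  the factors.\<close>

lemma Y_mgf:
  assumes t: "\<bar>t\<bar> * a \<le> 1"
  shows "(LINT X|P. exp (t * Y X x)) \<le> exp (t\<^sup>2 * s2 x)"
proof -
  interpret prod: product_sigma_finite "\<lambda>_::nat. D" by unfold_locales
  have int: "integrable D (\<lambda>y. exp (t * \<xi> x y))"
  proof (rule integrable_bounded_D)
    show "\<bar>exp (t * \<xi> x y)\<bar> \<le> exp 1" for y
      using order_trans[OF mult_left_mono[OF \<xi>_bound[of x y] abs_ge_zero[of t]] t] by (simp flip: abs_mult)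
  qed measurable
  have "(LINT X|P. exp (t * Y X x)) = (LINT X|P. (\<Prod>i<n. exp (t * \<xi> x (X i))))"
    by (simp add: Y_def sum_distrib_left exp_sum)
  also have "\<dots> = (\<Prod>i<n. (LINT y|D. exp (t * \<xi> x y)))"
    unfolding P_def using int by (intro prod.product_integral_prod) auto
  also have "\<dots> \<le> (\<Prod>i<n. exp (t\<^sup>2 * s2 x / n))"
  proof (intro prod_mono conjI)
    have "(LINT y|D. exp (t * \<xi> x y)) \<le> (LINT y|D. 1 + t * \<xi> x y + t\<^sup>2 * (\<xi> x y)\<^sup>2)"
    proof (intro integral_mono int)
      fix y
      have "\<bar>t * \<xi> x y\<bar> \<le> 1" unfolding abs_mult
        using order_trans[OF mult_left_mono[OF \<xi>_bound[of x y] abs_ge_zero[of t]] t] .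
      from exp_le_quadratic[OF this]
      show "exp (t * \<xi> x y) \<le> 1 + t * \<xi> x y + t\<^sup>2 * (\<xi> x y)\<^sup>2" by (simp add: power_mult_distrib)
    qed (use int_\<xi>[of x] int_\<xi>2[of x] in auto)
    also have "\<dots> = 1 + t\<^sup>2 * (LINT y|D. (\<xi> x y)\<^sup>2)"
      using int_\<xi>[of x] int_\<xi>2[of x] by (simp add: D.prob_space[simplified] mean_\<xi>)
    also have "\<dots> \<le> 1 + t\<^sup>2 * (s2 x / n)"
      using var_\<xi>_le[of x] n_pos by (intro add_left_mono mult_left_mono) (auto simp: field_simps)
    also have "\<dots> \<le> exp (t\<^sup>2 * s2 x / n)" using exp_ge_add_one_self[of "t\<^sup>2 * s2 x / n"] by simp
    finally show "(LINT y|D. exp (t * \<xi> x y)) \<le> exp (t\<^sup>2 * s2 x / n)" .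
  qed auto
  also have "\<dots> = exp (t\<^sup>2 * s2 x)" using n_pos by (simp flip: exp_of_nat_mult)
  finally show ?thesis .
qed

lemma Y_exp_abs:
  assumes t: "0 \<le> t" "t * a \<le> 1"
  shows "(LINT X|P. exp (t * \<bar>Y X x\<bar>)) \<le> 2 * exp (t\<^sup>2 * s2 x)"
proof -
  have "(LINT X|P. exp (t * \<bar>Y X x\<bar>)) \<le> (LINT X|P. exp (t * Y X x) + exp (- t * Y X x))"
  proof (intro integral_mono)
    show "integrable P (\<lambda>X. exp (t * \<bar>Y X x\<bar>))"
      by (rule integrable_bounded_P[where B = "exp (t * (real n * a))"])
         (use t in \<open>auto intro!: mult_left_mono Y_bound\<close>)
  next
    show "integrable P (\<lambda>X. exp (t * Y X x) + exp (- t * Y X x))"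
      by (intro Bochner_Integration.integrable_add Y_exp_int)
  qed (auto simp: abs_if)
  also have "\<dots> = (LINT X|P. exp (t * Y X x)) + (LINT X|P. exp (- t * Y X x))"
    by (intro Bochner_Integration.integral_add Y_exp_int)
  also have "\<dots> \<le> exp (t\<^sup>2 * s2 x) + exp ((- t)\<^sup>2 * s2 x)"
    using t by (intro add_mono Y_mgf) auto
  finally show ?thesis by simp
qed

lemma Y_powr_int: "0 \<le> r \<Longrightarrow> integrable P (\<lambda>X. \<bar>Y X x\<bar> powr r)"
  by (rule integrable_bounded_P[where B = "(real n * a) powr r"]) (auto intro!: powr_mono2 Y_bound)

text \<open>Averaging \<open>cosh (t * Y) - 1\<close> retains the subtracted 1, so the bound
  vanishes with \<open>s2 x\<close>. The exponent \<open>t\<close> is left free: it is taken as 1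
  for general moments, as \<open>1 / a\<close> where the variance is tiny, and as
  \<open>1 / (a + sqrt (s2 x))\<close> for the second moment.\<close>

lemma Y_moment:
  assumes C: "\<And>y. \<bar>y\<bar> powr r \<le> C * (cosh y - 1)" "C > 0" and r: "0 \<le> r"
    and t: "0 < t" "t * a \<le> 1"
  shows "(LINT X|P. \<bar>Y X x\<bar> powr r) \<le> C * t powr (- r) * (exp (t\<^sup>2 * s2 x) - 1)"
proof -
  have cosh: "integrable P (\<lambda>X. cosh (t * Y X x))"
    unfolding cosh_def using Y_exp_int[of t x] Y_exp_int[of "-t" x] by simp
  have "(LINT X|P. \<bar>Y X x\<bar> powr r) \<le> (LINT X|P. C * t powr (- r) * (cosh (t * Y X x) - 1))"
  proof (intro integral_mono Y_powr_int r)
    show "\<bar>Y X x\<bar> powr r \<le> C * t powr (- r) * (cosh (t * Y X x) - 1)" for X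
      using C(1)[of "t * Y X x"] t by (simp add: abs_mult powr_mult powr_minus field_simps)
  qed (use cosh in auto)
  also have "\<dots> = C * t powr (- r) * ((LINT X|P. cosh (t * Y X x)) - 1)"
    using cosh by (simp add: P.prob_space)
  also have "(LINT X|P. cosh (t * Y X x)) = ((LINT X|P. exp (t * Y X x)) + (LINT X|P. exp (- t * Y X x))) / 2"
    unfolding cosh_def using Y_exp_int[of t x] Y_exp_int[of "-t" x] by simp
  also have "C * t powr (- r) * (\<dots> - 1) \<le> C * t powr (- r) * ((exp (t\<^sup>2 * s2 x) + exp ((- t)\<^sup>2 * s2 x)) / 2 - 1)"
    using t C(2) by (intro mult_left_mono diff_mono divide_right_mono add_mono Y_mgf) auto
  finally show ?thesis by simp
qed

lemma Y_second_moment: "(LINT X|P. \<bar>Y X x\<bar> powr 2) \<le> 4 * s2 x"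
proof -
  \<comment> \<open>This choice satisfies \<open>t * a \<le> 1\<close> and
    \<open>t\<^sup>2 * s2 x \<le> 1\<close> at once, also when \<open>s2 x\<close> is zero.\<close>
  define t where "t = 1 / (a + sqrt (s2 x))"
  have pos: "a + sqrt (s2 x) > 0" using a_pos s2_nonneg[of x] by (intro add_pos_nonneg) auto
  have t: "t > 0" "t * a \<le> 1" using pos s2_nonneg[of x] by (auto simp: t_def)
  have "t * sqrt (s2 x) \<le> 1" using pos a_pos by (auto simp: t_def)
  then have "(t * sqrt (s2 x))\<^sup>2 \<le> 1" using t s2_nonneg[of x] by (intro power_le_one) auto
  then have ts: "t\<^sup>2 * s2 x \<le> 1" using s2_nonneg by (simp add: power_mult_distrib)
  have "(LINT X|P. \<bar>Y X x\<bar> powr 2) \<le> 2 * t powr (- 2) * (exp (t\<^sup>2 * s2 x) - 1)"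
  proof (rule Y_moment[OF _ _ _ t])
    show "\<bar>y\<bar> powr 2 \<le> 2 * (cosh y - 1)" for y :: real
      using cosh_minus_one_ge[of 1 y] by (simp add: powr_numeral power2_eq_square numeral_2_eq_2)
  qed auto
  also have "\<dots> \<le> 2 * t powr (- 2) * (2 * (t\<^sup>2 * s2 x))"
  proof (intro mult_left_mono)
    have "exp (t\<^sup>2 * s2 x) \<le> 1 + t\<^sup>2 * s2 x + (t\<^sup>2 * s2 x)\<^sup>2"
      using ts s2_nonneg[of x] by (intro exp_le_quadratic) auto
    also have "(t\<^sup>2 * s2 x)\<^sup>2 \<le> t\<^sup>2 * s2 x"
      using mult_left_mono[OF ts, of "t\<^sup>2 * s2 x"] s2_nonneg[of x] by (simp add: power2_eq_square)
    finally show "exp (t\<^sup>2 * s2 x) - 1 \<le> 2 * (t\<^sup>2 * s2 x)" by simp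
  qed (use t in auto)
  also have "\<dots> = 4 * s2 x" using t by (simp add: powr_minus powr_numeral field_simps)
  finally show ?thesis .
qed

text \<open>After Tonelli, the integral over \<open>x\<close> is independent of the observation by
  translation invariance, and averaging over a probability law leaves it unchanged.\<close>

lemma nn_s2: "(\<integral>\<^sup>+x. ennreal (s2 x) \<partial>lborel) = ennreal (h * (LINT z|lborel. (k z)\<^sup>2))"
proof -
  interpret pair_sigma_finite lborel D by unfold_locales
  have ki: "integrable lborel (\<lambda>z. (k z)\<^sup>2)"
  proof (rule Bochner_Integration.integrable_bound)
    show "integrable lborel (\<lambda>z. 1 / h * \<bar>k z\<bar>)" using k_int by auto
    have "(k z)\<^sup>2 \<le> 1 / h * \<bar>k z\<bar>" for z
      using mult_right_mono[OF k_bound[of z] abs_ge_zero[of "k z"]] by (simp add: power2_eq_square)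
    then show "AE z in lborel. norm ((k z)\<^sup>2) \<le> norm (1 / h * \<bar>k z\<bar>)"
      using h_pos by simp
  qed measurable
  have "(\<integral>\<^sup>+x. ennreal (s2 x) \<partial>lborel) = (\<integral>\<^sup>+x. ennreal h * (\<integral>\<^sup>+y. ennreal ((k (x - y))\<^sup>2) \<partial>D) \<partial>lborel)"
    unfolding s2_def using h_pos int_k2
    by (intro nn_integral_cong) (simp add: nn_integral_eq_integral ennreal_mult)
  also have "\<dots> = ennreal h * (\<integral>\<^sup>+x. (\<integral>\<^sup>+y. ennreal ((k (x - y))\<^sup>2) \<partial>D) \<partial>lborel)"
    by (intro nn_integral_cmult) measurable
  also have "(\<integral>\<^sup>+x. (\<integral>\<^sup>+y. ennreal ((k (x - y))\<^sup>2) \<partial>D) \<partial>lborel) = 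
      (\<integral>\<^sup>+y. (\<integral>\<^sup>+x. ennreal ((k (x - y))\<^sup>2) \<partial>lborel) \<partial>D)"
    by (rule Fubini'[symmetric]) measurable
  also have "\<dots> = (\<integral>\<^sup>+y. ennreal (LINT z|lborel. (k z)\<^sup>2) \<partial>D)"
  proof (rule nn_integral_cong)
    fix y
    have "(\<integral>\<^sup>+x. ennreal ((k (x - y))\<^sup>2) \<partial>lborel) = (\<integral>\<^sup>+z. ennreal ((k z)\<^sup>2) \<partial>lborel)"
      using nn_integral_real_affine[of "\<lambda>z. ennreal ((k z)\<^sup>2)" 1 "-y"] by simp
    also have "\<dots> = ennreal (LINT z|lborel. (k z)\<^sup>2)" using ki by (intro nn_integral_eq_integral) auto
    finally show "(\<integral>\<^sup>+x. ennreal ((k (x - y))\<^sup>2) \<partial>lborel) = ennreal (LINT z|lborel. (k z)\<^sup>2)" .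
  qed
  finally show ?thesis using h_pos by (simp add: D.emeasure_space_1[simplified] ennreal_mult)
qed

lemma k_Lp:
  assumes p: "1 \<le> p" shows "k \<in> Lp p"
proof -
  have "integrable lborel (\<lambda>z. \<bar>k z\<bar> powr p)"
  proof (rule Bochner_Integration.integrable_bound)
    show "integrable lborel (\<lambda>z. (1 / h) powr (p - 1) * \<bar>k z\<bar>)" using k_int by auto
    have "\<bar>k z\<bar> powr p \<le> (1 / h) powr (p - 1) * \<bar>k z\<bar>" for z
    proof (cases "k z = 0")
      case False
      have "\<bar>k z\<bar> powr p = \<bar>k z\<bar> powr (p - 1) * \<bar>k z\<bar>" using False by (simp add: powr_diff)
      also have "\<dots> \<le> (1 / h) powr (p - 1) * \<bar>k z\<bar>" 
        using p by (intro mult_right_mono powr_mono2 k_bound) auto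
      finally show ?thesis .
    qed simp
    then show "AE z in lborel. norm (\<bar>k z\<bar> powr p) \<le> norm ((1 / h) powr (p - 1) * \<bar>k z\<bar>)"
      by (auto intro!: AE_I2 order_trans[OF _ abs_ge_self])
  qed measurable
  then show ?thesis by (simp add: Lp_def)
qed

text \<open>Jensen's inequality for the law of one observation, then Tonelli and translation
  invariance.\<close>

lemma m_Lp:
  assumes p: "1 \<le> p" shows "m \<in> Lp p"
proof -
  interpret pair_sigma_finite lborel D by unfold_locales
  note kp = Lp_int[OF k_Lp[OF p]]
  have ikp: "integrable D (\<lambda>y. \<bar>k (x - y)\<bar> powr p)" for x
    by (rule integrable_bounded_D[where B = "(1 / h) powr p"]) (use p in \<open>auto intro!: powr_mono2 k_bound\<close>)
  have "\<bar>m x\<bar> powr p \<le> (LINT y|D. \<bar>k (x - y)\<bar> powr p)" for x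
  proof -
    have "\<bar>m x\<bar> powr p \<le> (LINT y|D. \<bar>k (x - y)\<bar>) powr p"
      unfolding m_def using p by (intro powr_mono2 integral_abs_bound) auto
    also have "\<dots> \<le> (LINT y|D. \<bar>k (x - y)\<bar> powr p)"
      by (intro D.jensen_powr p integrable_abs int_k ikp) auto
    finally show ?thesis .
  qed
  then have "(\<integral>\<^sup>+x. ennreal (\<bar>m x\<bar> powr p) \<partial>lborel) \<le> (\<integral>\<^sup>+x. (\<integral>\<^sup>+y. ennreal (\<bar>k (x - y)\<bar> powr p) \<partial>D) \<partial>lborel)"
    using ikp by (intro nn_integral_mono) (simp add: nn_integral_eq_integral)
  also have "\<dots> = (\<integral>\<^sup>+y. (\<integral>\<^sup>+x. ennreal (\<bar>k (x - y)\<bar> powr p) \<partial>lborel) \<partial>D)"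
    by (rule Fubini'[symmetric]) measurable
  also have "\<dots> = (\<integral>\<^sup>+y. ennreal (LINT z|lborel. \<bar>k z\<bar> powr p) \<partial>D)"
  proof (rule nn_integral_cong)
    fix y
    have "(\<integral>\<^sup>+x. ennreal (\<bar>k (x - y)\<bar> powr p) \<partial>lborel) = (\<integral>\<^sup>+z. ennreal (\<bar>k z\<bar> powr p) \<partial>lborel)"
      using nn_integral_real_affine[of "\<lambda>z. ennreal (\<bar>k z\<bar> powr p)" 1 "-y"] by simp
    also have "\<dots> = ennreal (LINT z|lborel. \<bar>k z\<bar> powr p)" using kp by (intro nn_integral_eq_integral) auto
    finally show "(\<integral>\<^sup>+x. ennreal (\<bar>k (x - y)\<bar> powr p) \<partial>lborel) = ennreal (LINT z|lborel. \<bar>k z\<bar> powr p)" .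
  qed
  also have "\<dots> < \<infinity>" by (simp add: D.emeasure_space_1[simplified])
  finally have "integrable lborel (\<lambda>x. \<bar>m x\<bar> powr p)" by (intro integrableI_bounded) auto
  then show ?thesis by (simp add: Lp_def)
qed

lemma Y_Lp:
  assumes p: "1 \<le> p" shows "Y X \<in> Lp p"
  unfolding Y_def \<xi>_def by (intro Lp_sum Lp_cmult Lp_diff Lp_shift k_Lp m_Lp p) auto

lemma Y_ind_Lp:
  assumes p: "1 \<le> p" and [measurable]: "S \<in> sets borel"
  shows "(\<lambda>x. indicator S x * Y X x) \<in> Lp p"
proof (rule Lp_bound[OF Y_Lp[OF p]])
  note [measurable] = Y_meas2
  show "(\<lambda>x. indicator S x * Y X x) \<in> borel_measurable lborel" by measurable
qed (use p in \<open>auto simp: indicator_def\<close>)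

text \<open>The set parameter serves the splitting of the line by the size of the variance.
  \<open>VK\<close> below carries no root, so that its expectation is an integral over
  \<open>x\<close> of clipped moments.\<close>

definition T where "T p S X = Lq_norm p (\<lambda>x. indicator S x * Y X x)"
definition VK where "VK p K X = (LINT x|lborel. min \<bar>Y X x\<bar> K powr p)"

lemma T_meas [measurable]:
  assumes [measurable]: "S \<in> sets borel"
  shows "T p S \<in> borel_measurable P"
  unfolding T_def Lq_norm_def by measurable

lemma VK_meas [measurable]: "VK p K \<in> borel_measurable P"
  unfolding VK_def by measurable

text \<open>The centring cancels, leaving two translates of the kernel; all difference bounds thus
  reduce to norms of \<open>k\<close>.\<close>

lemma Y_upd:
  assumes "i < n"
  shows "Y (X(i := b)) x - Y X x = sqrt (h / n) * (k (x - b) - k (x - X i))"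
proof -
  have "Y (X(i := b)) x - Y X x = (\<Sum>j<n. \<xi> x ((X(i := b)) j) - \<xi> x (X j))"
    by (simp add: Y_def sum_subtractf)
  also have "\<dots> = (\<Sum>j<n. if j = i then \<xi> x b - \<xi> x (X i) else 0)"
    by (intro sum.cong) auto
  also have "\<dots> = \<xi> x b - \<xi> x (X i)" using assms by simp
  finally show ?thesis by (simp add: \<xi>_def algebra_simps)
qed

lemma Y_upd_norm:
  assumes p: "1 \<le> p" and i: "i < n"
  shows "Lq_norm p (\<lambda>x. Y (X(i := b)) x - Y X x) \<le> 2 * sqrt (h / n) * Lq_norm p k"
proof -
  have "Lq_norm p (\<lambda>x. Y (X(i := b)) x - Y X x) = sqrt (h / n) * Lq_norm p (\<lambda>x. k (x - b) + (- 1) * k (x - X i))"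
    unfolding Y_upd[OF i] using p h_pos by (subst Lq_norm_cmult) auto
  also have "\<dots> \<le> sqrt (h / n) * (Lq_norm p (\<lambda>x. k (x - b)) + Lq_norm p (\<lambda>x. (- 1) * k (x - X i)))"
    using h_pos by (intro mult_left_mono minkowski p Lp_shift k_Lp Lp_cmult) auto
  also have "\<dots> = 2 * sqrt (h / n) * Lq_norm p k"
    using p Lq_norm_cmult[of p "-1"] by (simp add: Lq_norm_shift[of p k])
  finally show ?thesis .
qed

lemma T_diff:
  assumes p: "1 \<le> p" and S [measurable]: "S \<in> sets borel" and i: "i < n"
  shows "\<bar>T p S (X(i := b)) - T p S X\<bar> \<le> 2 * sqrt (h / n) * Lq_norm p k"
proof -
  have "\<bar>T p S (X(i := b)) - T p S X\<bar> \<le> Lq_norm p (\<lambda>x. indicator S x * Y (X(i := b)) x - indicator S x * Y X x)"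
    unfolding T_def by (intro Lq_norm_abs_diff_le p Y_ind_Lp S)
  also have "\<dots> \<le> Lq_norm p (\<lambda>x. Y (X(i := b)) x - Y X x)"
    using Lp_meas[OF Lp_diff[OF p Y_ind_Lp[OF p S] Y_ind_Lp[OF p S]]] p
    by (intro Lq_norm_mono Lp_diff Y_Lp) (auto simp: indicator_def)
  also have "\<dots> \<le> 2 * sqrt (h / n) * Lq_norm p k" by (rule Y_upd_norm[OF p i])
  finally show ?thesis .
qed

lemma VK_int:
  assumes p: "1 \<le> p" and K: "K > 0"
  shows "integrable lborel (\<lambda>x. min \<bar>Y X x\<bar> K powr p)"
proof (rule Bochner_Integration.integrable_bound[OF Lp_int[OF Y_Lp[OF p, of X]]])
  note [measurable] = Y_meas2
  show "(\<lambda>x. min \<bar>Y X x\<bar> K powr p) \<in> borel_measurable lborel" by measurable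
  have "min \<bar>Y X x\<bar> K powr p \<le> \<bar>Y X x\<bar> powr p" for x using p K by (intro powr_mono2) (auto intro: min.boundedI)
  then show "AE x in lborel. norm (min \<bar>Y X x\<bar> K powr p) \<le> norm (\<bar>Y X x\<bar> powr p)" by simp
qed

text \<open>The Lipschitz bound passes to the L_1 norm of the kernel for every \<open>p\<close>.
  This matters because \<open>h\<close> times the square of that norm tends to zero along the
  sequences considered later.\<close>

lemma VK_diff:
  assumes p: "1 \<le> p" and K: "K > 0" and i: "i < n"
  shows "\<bar>VK p K (X(i := b)) - VK p K X\<bar> \<le> p * K powr (p - 1) * (2 * sqrt (h / n) * Lq_norm 1 k)"
proof -
  note L1 = Lp_int[OF Lp_diff[OF _ Y_Lp[of 1, of "X(i := b)"] Y_Lp[of 1, of X]]]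
  have "\<bar>VK p K (X(i := b)) - VK p K X\<bar> = \<bar>LINT x|lborel. min \<bar>Y (X(i := b)) x\<bar> K powr p - min \<bar>Y X x\<bar> K powr p\<bar>"
    unfolding VK_def by (subst Bochner_Integration.integral_diff) (auto intro!: VK_int p K)
  also have "\<dots> \<le> (LINT x|lborel. \<bar>min \<bar>Y (X(i := b)) x\<bar> K powr p - min \<bar>Y X x\<bar> K powr p\<bar>)"
    by (rule integral_abs_bound)
  also have "\<dots> \<le> (LINT x|lborel. p * K powr (p - 1) * \<bar>Y (X(i := b)) x - Y X x\<bar>)"
  proof (rule integral_mono)
    show "integrable lborel (\<lambda>x. \<bar>min \<bar>Y (X(i := b)) x\<bar> K powr p - min \<bar>Y X x\<bar> K powr p\<bar>)"
      by (intro integrable_abs Bochner_Integration.integrable_diff VK_int p K)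
    show "integrable lborel (\<lambda>x. p * K powr (p - 1) * \<bar>Y (X(i := b)) x - Y X x\<bar>)" using L1 by simp
  qed (rule clipped_powr_lipschitz[OF p K])
  also have "\<dots> = p * K powr (p - 1) * Lq_norm 1 (\<lambda>x. Y (X(i := b)) x - Y X x)"
    by (simp add: Lq_norm_def)
  also have "\<dots> \<le> p * K powr (p - 1) * (2 * sqrt (h / n) * Lq_norm 1 k)"
    using p i by (intro mult_left_mono Y_upd_norm) auto
  finally show ?thesis .
qed

lemma mgf_bounded_diff:
  assumes [measurable]: "F \<in> borel_measurable P"
    and diff: "\<And>X i b. i < n \<Longrightarrow> \<bar>F (X(i := b)) - F X\<bar> \<le> (c::real)" and t: "t > 0"
  shows "(\<integral>\<^sup>+X. ennreal (exp (t * F X)) \<partial>P) \<le> ennreal (exp (t * (LINT X|P. F X) + t\<^sup>2 * real n * c\<^sup>2 / 2))"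
  unfolding P_def using bounded_differences_mgf[OF _ prob_space_D assms(1)[unfolded P_def], of c t] diff t
  by (simp add: mult.assoc)

lemma integrable_bounded_diff:
  assumes [measurable]: "F \<in> borel_measurable P"
    and diff: "\<And>X i b. i < n \<Longrightarrow> \<bar>F (X(i := b)) - F X\<bar> \<le> (c::real)"
  shows "integrable P F"
proof -
  have "\<exists>b. \<forall>X \<in> space (Pi\<^sub>M {..<n} (\<lambda>_. D)). \<bar>F X\<bar> \<le> b"
    by (rule bounded_differences_bounded[OF _ _ prob_space_D]) (auto intro: diff)
  then obtain b where "\<And>X. X \<in> space P \<Longrightarrow> \<bar>F X\<bar> \<le> b" unfolding P_def by metis
  then show ?thesis by (intro P.integrable_const_bound[where B = b] AE_I2) auto
qed

lemma nn_integral_Y_swap: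
  fixes g :: "real \<Rightarrow> real \<Rightarrow> real"
  assumes [measurable]: "(\<lambda>(x, y). g x y) \<in> borel_measurable (borel \<Otimes>\<^sub>M borel)"
    and nn: "\<And>x y. 0 \<le> g x y" and int: "\<And>X. integrable lborel (\<lambda>x. g x (Y X x))"
  shows "(\<integral>\<^sup>+X. ennreal (LINT x|lborel. g x (Y X x)) \<partial>P) = (\<integral>\<^sup>+x. (\<integral>\<^sup>+X. ennreal (g x (Y X x)) \<partial>P) \<partial>lborel)"
proof -
  interpret pair_sigma_finite P lborel by unfold_locales
  have m: "(\<lambda>z. g (snd z) (Y (fst z) (snd z))) \<in> borel_measurable (P \<Otimes>\<^sub>M borel)"
    using measurable_compose[OF measurable_Pair[OF measurable_snd Y_meas[unfolded split_beta']] assms(1)] by simp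
  have "(\<integral>\<^sup>+X. ennreal (LINT x|lborel. g x (Y X x)) \<partial>P) = (\<integral>\<^sup>+X. (\<integral>\<^sup>+x. ennreal (g x (Y X x)) \<partial>lborel) \<partial>P)"
    using nn int by (intro nn_integral_cong) (simp add: nn_integral_eq_integral)
  also have "\<dots> = (\<integral>\<^sup>+x. (\<integral>\<^sup>+X. ennreal (g x (Y X x)) \<partial>P) \<partial>lborel)"
    using m by (intro Fubini'[symmetric]) (simp add: split_beta')
  finally show ?thesis .
qed

lemma nn_T_powr:
  assumes p: "1 \<le> p" and [measurable]: "S \<in> sets borel"
  shows "(\<integral>\<^sup>+X. ennreal (T p S X powr p) \<partial>P) = 
    (\<integral>\<^sup>+x. ennreal (LINT X|P. \<bar>Y X x\<bar> powr p) * indicator S x \<partial>lborel)"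
proof -
  have "(\<integral>\<^sup>+X. ennreal (T p S X powr p) \<partial>P) = (\<integral>\<^sup>+X. ennreal (LINT x|lborel. \<bar>indicator S x * Y X x\<bar> powr p) \<partial>P)"
    using p by (simp add: T_def Lq_norm_powr)
  also have "\<dots> = (\<integral>\<^sup>+x. (\<integral>\<^sup>+X. ennreal (\<bar>indicator S x * Y X x\<bar> powr p) \<partial>P) \<partial>lborel)"
    by (rule nn_integral_Y_swap) (use Lp_int[OF Y_ind_Lp[OF p, of S]] in auto)
  also have "\<dots> = (\<integral>\<^sup>+x. ennreal (LINT X|P. \<bar>Y X x\<bar> powr p) * indicator S x \<partial>lborel)"
    using Y_powr_int p by (intro nn_integral_cong) (auto simp: indicator_def nn_integral_eq_integral)
  finally show ?thesis .
qed

lemma nn_VK: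
  assumes p: "1 \<le> p" and K: "K > 0"
  shows "(\<integral>\<^sup>+X. ennreal (VK p K X) \<partial>P) = (\<integral>\<^sup>+x. ennreal (LINT X|P. min \<bar>Y X x\<bar> K powr p) \<partial>lborel)"
proof -
  have "(\<integral>\<^sup>+X. ennreal (VK p K X) \<partial>P) = (\<integral>\<^sup>+x. (\<integral>\<^sup>+X. ennreal (min \<bar>Y X x\<bar> K powr p) \<partial>P) \<partial>lborel)"
    unfolding VK_def by (rule nn_integral_Y_swap) (use VK_int[OF p K] in auto)
  also have "\<dots> = (\<integral>\<^sup>+x. ennreal (LINT X|P. min \<bar>Y X x\<bar> K powr p) \<partial>lborel)"
  proof (intro nn_integral_cong nn_integral_eq_integral)
    show "integrable P (\<lambda>X. min \<bar>Y X x\<bar> K powr p)" for x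
      by (rule integrable_bounded_P[where B = "K powr p"]) (use p K in \<open>auto intro!: powr_mono2 min.boundedI\<close>)
  qed auto
  finally show ?thesis .
qed

end

section \<open>Exponential moments and tails of the norm of the deviation\<close>

lemma exp_minus_one_le: "0 \<le> z \<Longrightarrow> z \<le> c \<Longrightarrow> exp z - 1 \<le> exp c * z" for z c :: real
proof -
  assume z: "0 \<le> z" "z \<le> c"
  have "1 - z \<le> exp (- z)" using exp_ge_add_one_self[of "- z"] by simp
  then have "exp z * (1 - z) \<le> exp z * exp (- z)" by (intro mult_left_mono) auto
  then have "exp z - 1 \<le> exp z * z" by (simp add: exp_minus algebra_simps)
  also have "\<dots> \<le> exp c * z" using z by (intro mult_right_mono) auto
  finally show ?thesis .
qed

context kde
begin

definition S2 where "S2 = h * (LINT z|lborel. (k z)\<^sup>2)"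

lemma S2_nonneg: "0 \<le> S2" unfolding S2_def using h_pos by simp

lemma nn_s2_eq: "(\<integral>\<^sup>+x. ennreal (s2 x) \<partial>lborel) = ennreal S2"
  by (simp add: nn_s2 S2_def)

lemma int_s2: "integrable lborel s2"
  using nn_s2_eq s2_nonneg by (intro integrableI_bounded) auto

lemma LINT_s2: "(LINT x|lborel. s2 x) = S2"
  using nn_s2_eq s2_nonneg S2_nonneg int_s2 by (simp add: nn_integral_eq_integral)

lemma T_nonneg: "0 \<le> T p S X" by (simp add: T_def)

text \<open>For \<open>p \<ge> 1\<close> one has \<open>T \<le> 1 + T powr p\<close> pointwise, so
  the integrated p-th moment controls the mean.\<close>

lemma T_mean:
  assumes p: "1 \<le> p" and S: "S \<in> sets borel" and v: "0 \<le> v"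
    and le: "(\<integral>\<^sup>+X. ennreal (T p S X powr p) \<partial>P) \<le> ennreal v"
  shows "(LINT X|P. T p S X) \<le> 1 + v"
proof -
  note [measurable] = S
  have "ennreal (LINT X|P. T p S X) = (\<integral>\<^sup>+X. ennreal (T p S X) \<partial>P)"
    using T_diff[OF p S] by (intro nn_integral_eq_integral[symmetric] integrable_bounded_diff) (auto simp: T_nonneg)
  also have "\<dots> \<le> (\<integral>\<^sup>+X. 1 + ennreal (T p S X powr p) \<partial>P)"
  proof (rule nn_integral_mono)
    fix X
    have "T p S X \<le> 1 + T p S X powr p"
    proof (cases "T p S X \<le> 1")
      case False
      then have "T p S X powr 1 \<le> T p S X powr p" using p by (intro powr_mono) auto
      then show ?thesis using False by simp
    qed (simp add: add_increasing2)
    then show "ennreal (T p S X) \<le> 1 + ennreal (T p S X powr p)"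
      by (metis ennreal_1 ennreal_leI ennreal_plus powr_ge_zero zero_le_one)
  qed
  also have "\<dots> \<le> 1 + ennreal v"
    using le by (subst nn_integral_add) (auto simp: P.emeasure_space_1)
  also have "\<dots> = ennreal (1 + v)" using v by (simp flip: ennreal_1 ennreal_plus)
  finally show ?thesis using v by (subst (asm) ennreal_le_iff) auto
qed

text \<open>Bounded differences with \<open>c = 2 * sqrt (h / n) * Lq_norm p k\<close>, for which
  \<open>n * c\<^sup>2 / 2\<close> is twice \<open>h\<close> times the squared norm.\<close>

lemma T_exp:
  assumes p: "1 \<le> p" and S: "S \<in> sets borel" and v: "0 \<le> v" and t: "t > 0"
    and le: "(\<integral>\<^sup>+X. ennreal (T p S X powr p) \<partial>P) \<le> ennreal v"
  shows "(\<integral>\<^sup>+X. ennreal (exp (t * T p S X)) \<partial>P) \<le> 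
    ennreal (exp (t * (1 + v) + 2 * t\<^sup>2 * (h * (Lq_norm p k)\<^sup>2)))"
proof -
  note [measurable] = S
  define c where "c = 2 * sqrt (h / n) * Lq_norm p k"
  have c: "real n * c\<^sup>2 = 4 * (h * (Lq_norm p k)\<^sup>2)"
    using n_pos h_pos by (simp add: c_def power_mult_distrib)
  have "(\<integral>\<^sup>+X. ennreal (exp (t * T p S X)) \<partial>P) \<le> 
      ennreal (exp (t * (LINT X|P. T p S X) + t\<^sup>2 * real n * c\<^sup>2 / 2))"
    unfolding c_def by (intro mgf_bounded_diff t T_diff p S) measurable
  also have "t\<^sup>2 * real n * c\<^sup>2 / 2 = 2 * t\<^sup>2 * (h * (Lq_norm p k)\<^sup>2)"
    using c by (simp add: mult.assoc)
  also have "ennreal (exp (t * (LINT X|P. T p S X) + 2 * t\<^sup>2 * (h * (Lq_norm p k)\<^sup>2))) \<le>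
      ennreal (exp (t * (1 + v) + 2 * t\<^sup>2 * (h * (Lq_norm p k)\<^sup>2)))"
    using T_mean[OF p S v le] t by (intro ennreal_leI) simp
  finally show ?thesis .
qed

text \<open>The threshold is equivalent to \<open>B * (S2 / s2 x) powr (1 / p) * a \<le> 1\<close>,
  which says that the tilt used on this set stays in the range where \<open>Y_mgf\<close>
  holds.\<close>

definition G where "G p B = {x. S2 * (B * a) powr p \<le> s2 x}"

lemma G_meas [measurable]: "G p B \<in> sets borel" unfolding G_def by measurable

text \<open>Jensen's inequality in \<open>x\<close> with the weight \<open>w = s2 / S2\<close> on
  \<open>G\<close>, of mass at most one. The tilt \<open>lm\<close> solves
  \<open>w * lm powr p = B powr p\<close>, so the weighted integral of
  \<open>(lm * |Y|) powr p\<close> is exactly \<open>(B * T) powr p\<close>. The exponent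
  \<open>lm\<^sup>2 * s2\<close> that remains is a constant times
  \<open>s2 powr (1 - 2 / p)\<close>, bounded because \<open>p \<ge> 2\<close>.\<close>

lemma T_exp_good:
  assumes p: "2 \<le> p" and B: "B > 0" and S2_pos: "S2 > 0" and C0: "\<And>x. s2 x \<le> C0"
  shows "(\<integral>\<^sup>+X. ennreal (exp (B * T p (G p B) X)) \<partial>P) \<le> 
     ennreal (exp p + 2 * exp (B\<^sup>2 * S2 powr (2 / p) * C0 powr (1 - 2 / p)))"
proof -
  define w where "w x = indicator (G p B) x * (s2 x / S2)" for x
  define lm where "lm x = B * (S2 / s2 x) powr (1 / p)" for x
  define Q where "Q = B\<^sup>2 * S2 powr (2 / p) * C0 powr (1 - 2 / p)"
  have [measurable]: "w \<in> borel_measurable borel" "lm \<in> borel_measurable borel"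
    unfolding w_def lm_def by measurable
  have thr: "S2 * (B * a) powr p > 0" using S2_pos B a_pos by simp
  have G_pos: "s2 x > 0" if "x \<in> G p B" for x using that thr by (simp add: G_def)
  have w_nonneg: "0 \<le> w x" for x using s2_nonneg S2_pos by (simp add: w_def)
  have w_int: "integrable lborel w"
    by (rule Bochner_Integration.integrable_bound[of _ "\<lambda>x. s2 x / S2"])
       (use int_s2 s2_nonneg S2_pos in \<open>auto simp: w_def indicator_def\<close>)
  have w_le: "(LINT x|lborel. w x) \<le> 1"
  proof -
    have "(LINT x|lborel. w x) \<le> (LINT x|lborel. s2 x / S2)"
    proof (rule integral_mono[OF w_int])
      show "w x \<le> s2 x / S2" for x using s2_nonneg S2_pos by (simp add: w_def indicator_def)
    qed (use int_s2 in simp)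
    also have "\<dots> = 1" using S2_pos by (simp add: LINT_s2)
    finally show ?thesis .
  qed
  have lm_nonneg: "0 \<le> lm x" for x using B by (simp add: lm_def)
  have lma: "lm x * a \<le> 1" if x: "x \<in> G p B" for x
  proof -
    have "S2 / s2 x \<le> (1 / (B * a)) powr p"
      using x G_pos[OF x] B a_pos by (simp add: G_def powr_divide field_simps)
    then have "(S2 / s2 x) powr (1 / p) \<le> ((1 / (B * a)) powr p) powr (1 / p)"
      using p S2_pos s2_nonneg[of x] by (intro powr_mono2) auto
    also have "\<dots> = 1 / (B * a)" using p B a_pos by (simp add: powr_powr)
    finally show ?thesis using B a_pos by (simp add: lm_def field_simps)
  qed
  have lms: "(lm x)\<^sup>2 * s2 x \<le> Q" if x: "x \<in> G p B" for x
  proof -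
    have "(lm x)\<^sup>2 = B\<^sup>2 * (S2 / s2 x) powr (2 / p)"
      unfolding lm_def power_mult_distrib power2_eq_square[of "_ powr _"] by (simp flip: powr_add)
    then have "(lm x)\<^sup>2 * s2 x = B\<^sup>2 * S2 powr (2 / p) * (s2 x powr 1 / s2 x powr (2 / p))"
      using G_pos[OF x] by (simp add: powr_divide)
    also have "s2 x powr 1 / s2 x powr (2 / p) = s2 x powr (1 - 2 / p)"
      by (rule powr_diff[symmetric])
    also have "B\<^sup>2 * S2 powr (2 / p) * s2 x powr (1 - 2 / p) \<le> Q"
      unfolding Q_def using p B C0 G_pos[OF x]
      by (intro mult_left_mono powr_mono2) auto
    finally show ?thesis .
  qed
  have wlm: "w x * (lm x * \<bar>y\<bar>) powr p = B powr p * \<bar>indicator (G p B) x * y\<bar> powr p" for x y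
  proof (cases "x \<in> G p B")
    case True
    then show ?thesis using p G_pos[OF True] S2_pos
      by (simp add: w_def lm_def powr_mult powr_powr)
  qed (simp add: w_def)
  define g where "g x y = w x * exp (lm x * \<bar>y\<bar>)" for x y
  have g_nonneg: "0 \<le> g x y" for x y by (simp add: g_def w_nonneg)
  have g_meas [measurable]: "(\<lambda>(x, y). g x y) \<in> borel_measurable (borel \<Otimes>\<^sub>M borel)"
    unfolding g_def by measurable
  have g_int: "integrable lborel (\<lambda>x. g x (Y X x))" for X
  proof (rule Bochner_Integration.integrable_bound)
    note [measurable] = Y_meas2
    show "integrable lborel (\<lambda>x. exp (real n) * w x)" using w_int by simp
    show "(\<lambda>x. g x (Y X x)) \<in> borel_measurable lborel" unfolding g_def by measurable
    have "g x (Y X x) \<le> exp (real n) * w x" for x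
    proof (cases "x \<in> G p B")
      case True
      have "lm x * \<bar>Y X x\<bar> \<le> lm x * (real n * a)" by (intro mult_left_mono Y_bound lm_nonneg)
      also have "\<dots> = real n * (lm x * a)" by simp
      also have "\<dots> \<le> real n * 1" by (intro mult_left_mono lma True) auto
      finally show ?thesis using w_nonneg by (simp add: g_def mult.commute mult_left_mono)
    qed (simp add: g_def w_def)
    then show "AE x in lborel. norm (g x (Y X x)) \<le> norm (exp (real n) * w x)"
      using g_nonneg w_nonneg by simp
  qed
  \<comment> \<open>\<open>exp_powr_tangent\<close> requires \<open>p \<le> \<tau>\<close>; smaller
    values are absorbed by the summand \<open>exp p\<close>.\<close>
  have key: "exp (B * T p (G p B) X) \<le> exp p + (LINT x|lborel. g x (Y X x))" for X
  proof (cases "B * T p (G p B) X \<le> p")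
    case True
    then have "exp (B * T p (G p B) X) \<le> exp p" by simp
    moreover have "0 \<le> (LINT x|lborel. g x (Y X x))" by (simp add: g_nonneg)
    ultimately show ?thesis by linarith
  next
    case False
    define \<tau> where "\<tau> = B * T p (G p B) X"
    have \<tau>: "p \<le> \<tau>" "\<tau> > 0" using False p by (auto simp: \<tau>_def)
    have ind: "integrable lborel (\<lambda>x. \<bar>indicator (G p B) x * Y X x\<bar> powr p)"
      using Lp_int[OF Y_ind_Lp[of p "G p B" X]] p by auto
    have "exp \<tau> = exp \<tau> * ((1 - \<tau> / p) * 1 + \<tau> / p)" by simp
    \<comment> \<open>The coefficient \<open>1 - \<tau> / p\<close> is nonpositive, so replacing 1
      by a mass that is at most 1 goes in the right direction.\<close>
    also have "\<dots> \<le> exp \<tau> * ((1 - \<tau> / p) * (LINT x|lborel. w x) + \<tau> / p)"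
      using w_le \<tau> p by (intro mult_left_mono add_right_mono mult_left_mono_neg) auto
    also have "\<dots> = exp \<tau> * ((1 - \<tau> / p) * (LINT x|lborel. w x) + \<tau> / p * \<tau> powr (- p) * (LINT x|lborel. B powr p * \<bar>indicator (G p B) x * Y X x\<bar> powr p))"
    proof -
      have eq: "\<tau> powr p = (LINT x|lborel. B powr p * \<bar>indicator (G p B) x * Y X x\<bar> powr p)"
        using p by (simp add: \<tau>_def T_def powr_mult flip: Lq_norm_powr)
      then have "\<tau> powr (- p) * (LINT x|lborel. B powr p * \<bar>indicator (G p B) x * Y X x\<bar> powr p) = 1"
        unfolding eq[symmetric] using \<tau> by (simp add: powr_minus)
      then show ?thesis by (simp only: mult.assoc mult_1_right)
    qed
    also have "\<dots> =
      (LINT x|lborel. exp \<tau> * ((1 - \<tau> / p) * w x + \<tau> / p * \<tau> powr (- p) * (B powr p * \<bar>indicator (G p B) x * Y X x\<bar> powr p)))"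
      using w_int ind by simp
    also have "\<dots> \<le> (LINT x|lborel. g x (Y X x))"
    proof (intro integral_mono g_int)
      fix x
      have "exp \<tau> * ((1 - \<tau> / p) * w x + \<tau> / p * \<tau> powr (- p) * (B powr p * \<bar>indicator (G p B) x * Y X x\<bar> powr p))
        = w x * (exp \<tau> * (1 - \<tau> / p + \<tau> / p * (lm x * \<bar>Y X x\<bar> / \<tau>) powr p))"
      proof -
        have "(lm x * \<bar>Y X x\<bar> / \<tau>) powr p = \<tau> powr (- p) * (lm x * \<bar>Y X x\<bar>) powr p"
          unfolding powr_divide powr_minus by (simp add: divide_inverse)
        then show ?thesis unfolding wlm[symmetric] by (simp only:) (simp add: algebra_simps)
      qed
      also have "\<dots> \<le> g x (Y X x)" unfolding g_def
        using p \<tau> lm_nonneg w_nonneg by (intro mult_left_mono exp_powr_tangent) auto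
      finally show "exp \<tau> * ((1 - \<tau> / p) * w x + \<tau> / p * \<tau> powr (- p) * (B powr p * \<bar>indicator (G p B) x * Y X x\<bar> powr p))
        \<le> g x (Y X x)" .
    qed (use w_int ind in simp)
    finally show ?thesis using exp_gt_zero[of p] unfolding \<tau>_def by linarith
  qed
  have "(\<integral>\<^sup>+X. ennreal (exp (B * T p (G p B) X)) \<partial>P) \<le> (\<integral>\<^sup>+X. ennreal (exp p) + ennreal (LINT x|lborel. g x (Y X x)) \<partial>P)"
    using key g_nonneg by (intro nn_integral_mono) (simp flip: ennreal_plus add: ennreal_leI)
  also have "\<dots> = ennreal (exp p) + (\<integral>\<^sup>+X. ennreal (LINT x|lborel. g x (Y X x)) \<partial>P)"
  proof (subst nn_integral_add)
    show "(\<lambda>X. ennreal (LINT x|lborel. g x (Y X x))) \<in> borel_measurable P"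
    proof -
      have "(\<lambda>z. g (snd z) (Y (fst z) (snd z))) \<in> borel_measurable (P \<Otimes>\<^sub>M borel)"
        using measurable_compose[OF measurable_Pair[OF measurable_snd Y_meas[unfolded split_beta']] g_meas] by simp
      then have [measurable]: "(\<lambda>(X, x). g x (Y X x)) \<in> borel_measurable (P \<Otimes>\<^sub>M lborel)" by (simp add: split_beta')
      show ?thesis by measurable
    qed
  qed (auto simp: P.emeasure_space_1)
  also have "(\<integral>\<^sup>+X. ennreal (LINT x|lborel. g x (Y X x)) \<partial>P) = (\<integral>\<^sup>+x. (\<integral>\<^sup>+X. ennreal (g x (Y X x)) \<partial>P) \<partial>lborel)"
    by (rule nn_integral_Y_swap[OF g_meas g_nonneg g_int])
  also have "\<dots> \<le> (\<integral>\<^sup>+x. ennreal (2 * exp Q) * ennreal (w x) \<partial>lborel)"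
  proof (rule nn_integral_mono)
    fix x
    show "(\<integral>\<^sup>+X. ennreal (g x (Y X x)) \<partial>P) \<le> ennreal (2 * exp Q) * ennreal (w x)"
    proof (cases "x \<in> G p B")
      case True
      have i: "integrable P (\<lambda>X. exp (lm x * \<bar>Y X x\<bar>))"
        by (rule integrable_bounded_P[where B = "exp (lm x * (real n * a))"])
           (use lm_nonneg in \<open>auto intro!: mult_left_mono Y_bound\<close>)
      have "(\<integral>\<^sup>+X. ennreal (g x (Y X x)) \<partial>P) = ennreal (w x * (LINT X|P. exp (lm x * \<bar>Y X x\<bar>)))"
        unfolding g_def using i w_nonneg by (subst nn_integral_eq_integral) auto
      also have "\<dots> \<le> ennreal (w x * (2 * exp Q))"
        using Y_exp_abs[OF lm_nonneg lma[OF True]] lms[OF True]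
        by (intro ennreal_leI mult_left_mono w_nonneg order_trans[OF Y_exp_abs[OF lm_nonneg lma[OF True]]]) auto
      finally show ?thesis using w_nonneg by (simp add: mult.commute flip: ennreal_mult)
    qed (simp add: g_def w_def)
  qed
  also have "\<dots> = ennreal (2 * exp Q) * ennreal (LINT x|lborel. w x)"
    using w_int w_nonneg by (subst nn_integral_cmult) (auto simp: nn_integral_eq_integral)
  also have "\<dots> \<le> ennreal (2 * exp Q) * 1"
    using w_le by (intro mult_left_mono) (auto simp: ennreal_le_1)
  finally have "(\<integral>\<^sup>+X. ennreal (exp (B * T p (G p B) X)) \<partial>P) \<le> ennreal (exp p) + ennreal (2 * exp Q) * 1"
    by (simp add: add_left_mono)
  also have "\<dots> = ennreal (exp p + 2 * exp Q)" by (simp flip: ennreal_plus)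
  finally show ?thesis by (simp add: Q_def)
qed

lemma T_powr_le:
  assumes p: "1 \<le> p" and S [measurable]: "S \<in> sets borel" and c: "0 \<le> c"
    and le: "\<And>x. x \<in> S \<Longrightarrow> (LINT X|P. \<bar>Y X x\<bar> powr p) \<le> c * s2 x"
  shows "(\<integral>\<^sup>+X. ennreal (T p S X powr p) \<partial>P) \<le> ennreal (c * S2)"
proof -
  have "(\<integral>\<^sup>+X. ennreal (T p S X powr p) \<partial>P) \<le> (\<integral>\<^sup>+x. ennreal c * ennreal (s2 x) \<partial>lborel)"
    unfolding nn_T_powr[OF p S] using c le s2_nonneg
    by (intro nn_integral_mono) (auto simp: indicator_def ennreal_leI simp flip: ennreal_mult)
  also have "\<dots> = ennreal (c * S2)"
    using c by (subst nn_integral_cmult) (auto simp: nn_s2_eq ennreal_mult S2_nonneg)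
  finally show ?thesis .
qed

text \<open>Exponent 1, admissible once \<open>a \<le> 1\<close>; on \<open>[0, C0]\<close> the
  function \<open>exp z - 1\<close> is at most \<open>exp C0 * z\<close>.\<close>

lemma Y_moment_s2:
  assumes C: "\<And>y. \<bar>y\<bar> powr r \<le> C * (cosh y - 1)" "C > 0" and r: "0 \<le> r" and a: "a \<le> 1"
    and C0: "s2 x \<le> C0"
  shows "(LINT X|P. \<bar>Y X x\<bar> powr r) \<le> C * exp C0 * s2 x"
proof -
  have "(LINT X|P. \<bar>Y X x\<bar> powr r) \<le> C * 1 powr (- r) * (exp (1\<^sup>2 * s2 x) - 1)"
    by (rule Y_moment[OF C r]) (use a in auto)
  also have "\<dots> \<le> C * 1 powr (- r) * (exp C0 * s2 x)"
    using C(2) exp_minus_one_le[OF s2_nonneg C0] by (intro mult_left_mono) auto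
  finally show ?thesis by (simp add: mult.assoc)
qed

text \<open>Off \<open>G\<close>, the smallness hypothesis gives
  \<open>s2 x \<le> a\<^sup>2\<close>, so the extreme exponent \<open>1 / a\<close> can be used with
  bounded loss. The gain is the factor \<open>a powr (p - 2)\<close>, a negative power of
  \<open>n * h\<close> when \<open>p > 2\<close>.\<close>

lemma Y_moment_bad:
  assumes p: "2 \<le> p" and B: "B > 0" and C: "\<And>y. \<bar>y\<bar> powr p \<le> C * (cosh y - 1)" "C > 0" 
    and small: "S2 * B powr p * a powr (p - 2) \<le> 1" and x: "x \<in> - G p B"
  shows "(LINT X|P. \<bar>Y X x\<bar> powr p) \<le> 3 * C * a powr (p - 2) * s2 x"
proof -
  have e: "exp (1::real) \<le> 3" by (rule exp_le)
  have "s2 x / a\<^sup>2 \<le> S2 * (B * a) powr p / a\<^sup>2"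
    using x a_pos by (intro divide_right_mono) (auto simp: G_def)
  also have "\<dots> = S2 * B powr p * a powr (p - 2)"
    using a_pos B by (simp add: powr_mult powr_diff powr_numeral)
  finally have z: "(1 / a)\<^sup>2 * s2 x \<le> 1" using small by (simp add: power_divide)
  have "(LINT X|P. \<bar>Y X x\<bar> powr p) \<le> C * (1 / a) powr (- p) * (exp ((1 / a)\<^sup>2 * s2 x) - 1)"
    by (rule Y_moment[OF C]) (use p a_pos in auto)
  also have "\<dots> \<le> C * (1 / a) powr (- p) * (3 * ((1 / a)\<^sup>2 * s2 x))"
  proof (intro mult_left_mono)
    have "exp ((1 / a)\<^sup>2 * s2 x) - 1 \<le> exp 1 * ((1 / a)\<^sup>2 * s2 x)"
      by (rule exp_minus_one_le[OF _ z]) (simp add: s2_nonneg)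
    also have "\<dots> \<le> 3 * ((1 / a)\<^sup>2 * s2 x)" by (intro mult_right_mono e) (simp add: s2_nonneg)
    finally show "exp ((1 / a)\<^sup>2 * s2 x) - 1 \<le> 3 * ((1 / a)\<^sup>2 * s2 x)" .
  qed (use C(2) in auto)
  also have "\<dots> = 3 * C * a powr (p - 2) * s2 x"
    using a_pos by (simp add: powr_divide powr_minus powr_diff powr_numeral field_simps)
  finally show ?thesis .
qed

text \<open>Jensen's inequality from the second moment. The result is not linear in
  \<open>s2\<close>, so its integral over \<open>x\<close> is not controlled by \<open>S2\<close>;
  this is the source of the weighted estimates for \<open>p < 2\<close>.\<close>

lemma Y_moment_le2:
  assumes p: "1 \<le> p" "p \<le> 2"
  shows "(LINT X|P. \<bar>Y X x\<bar> powr p) \<le> (4 * s2 x) powr (p / 2)"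
proof -
  define E where "E = (LINT X|P. \<bar>Y X x\<bar> powr p)"
  have E: "0 \<le> E" by (simp add: E_def)
  have "E powr (2 / p) \<le> (LINT X|P. (\<bar>Y X x\<bar> powr p) powr (2 / p))"
    unfolding E_def using p Y_powr_int[of 2 x] by (intro P.jensen_powr Y_powr_int) (auto simp: powr_powr)
  also have "\<dots> = (LINT X|P. \<bar>Y X x\<bar> powr 2)" using p by (simp add: powr_powr)
  also have "\<dots> \<le> 4 * s2 x" by (rule Y_second_moment)
  finally have "(E powr (2 / p)) powr (p / 2) \<le> (4 * s2 x) powr (p / 2)" using p by (intro powr_mono2) auto
  then show ?thesis using p E by (simp add: powr_powr E_def)
qed

lemma clip_int: "0 \<le> p \<Longrightarrow> 0 < K \<Longrightarrow> integrable P (\<lambda>X. min \<bar>Y X x\<bar> K powr p)"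
  by (rule integrable_bounded_P[where B = "K powr p"]) (auto intro!: powr_mono2 min.boundedI)

lemma clip_moment_le2:
  assumes p: "1 \<le> p" "p \<le> 2" and K: "0 < K"
  shows "(LINT X|P. min \<bar>Y X x\<bar> K powr p) \<le> (4 * s2 x) powr (p / 2)"
proof -
  have "(LINT X|P. min \<bar>Y X x\<bar> K powr p) \<le> (LINT X|P. \<bar>Y X x\<bar> powr p)"
    using p K by (intro integral_mono clip_int Y_powr_int powr_mono2) (auto intro: min.boundedI)
  also note Y_moment_le2[OF p]
  finally show ?thesis .
qed

text \<open>Clipping pays for all powers beyond the second. The majorant is proportional to
  \<open>s2\<close>, and the integrals of \<open>s2\<close> converge along the sequences considered
  later.\<close>

lemma clip_moment_ge2:
  assumes p: "2 \<le> p" and K: "0 < K"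
  shows "(LINT X|P. min \<bar>Y X x\<bar> K powr p) \<le> 4 * K powr (p - 2) * s2 x"
proof -
  have "(LINT X|P. min \<bar>Y X x\<bar> K powr p) \<le> (LINT X|P. K powr (p - 2) * \<bar>Y X x\<bar> powr 2)"
  proof (intro integral_mono clip_int)
    fix X
    have "min \<bar>Y X x\<bar> K powr p = min \<bar>Y X x\<bar> K powr (p - 2) * min \<bar>Y X x\<bar> K powr 2"
      by (simp flip: powr_add)
    also have "\<dots> \<le> K powr (p - 2) * \<bar>Y X x\<bar> powr 2"
      using p K by (intro mult_mono powr_mono2) (auto intro: min.boundedI)
    finally show "min \<bar>Y X x\<bar> K powr p \<le> K powr (p - 2) * \<bar>Y X x\<bar> powr 2" .
  qed (use p K Y_powr_int[of 2 x] in auto)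
  also have "\<dots> = K powr (p - 2) * (LINT X|P. \<bar>Y X x\<bar> powr 2)" by simp
  also have "\<dots> \<le> K powr (p - 2) * (4 * s2 x)" by (intro mult_left_mono Y_second_moment) auto
  finally show ?thesis by (simp add: algebra_simps)
qed

text \<open>Where \<open>|Y|\<close> exceeds \<open>K\<close>, two additional powers of
  \<open>|Y|\<close> dominate the factor \<open>K\<^sup>2\<close>.\<close>

lemma T_powr_le_clip:
  assumes p: "1 \<le> p" and K: "K > 0"
  shows "T p UNIV X powr p \<le> VK p K X + T (p + 2) UNIV X powr (p + 2) / K\<^sup>2"
proof -
  have "T p UNIV X powr p = (LINT x|lborel. \<bar>Y X x\<bar> powr p)"
    using p by (simp add: T_def Lq_norm_powr)
  also have "\<dots> \<le> (LINT x|lborel. min \<bar>Y X x\<bar> K powr p + \<bar>Y X x\<bar> powr (p + 2) / K\<^sup>2)"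
  proof (intro integral_mono)
    fix x
    show "\<bar>Y X x\<bar> powr p \<le> min \<bar>Y X x\<bar> K powr p + \<bar>Y X x\<bar> powr (p + 2) / K\<^sup>2"
    proof (cases "\<bar>Y X x\<bar> \<le> K")
      case False
      have "K\<^sup>2 \<le> \<bar>Y X x\<bar>\<^sup>2" using False K by (intro power_mono) auto
      then have "\<bar>Y X x\<bar> powr p * K\<^sup>2 \<le> \<bar>Y X x\<bar> powr p * \<bar>Y X x\<bar>\<^sup>2" by (intro mult_left_mono) auto
      also have "\<dots> = \<bar>Y X x\<bar> powr (p + 2)" using False K by (simp add: powr_add powr_numeral)
      finally have "\<bar>Y X x\<bar> powr p \<le> \<bar>Y X x\<bar> powr (p + 2) / K\<^sup>2" using K by (simp add: field_simps)
      then show ?thesis by (simp add: add_increasing)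
    qed (simp add: min_absorb1)
  qed (use p K Lp_int[OF Y_Lp] VK_int in auto)
  also have "\<dots> = VK p K X + T (p + 2) UNIV X powr (p + 2) / K\<^sup>2"
    using p K Lp_int[OF Y_Lp[of "p + 2" X]] VK_int[OF p K, of X] by (simp add: VK_def T_def Lq_norm_powr)
  finally show ?thesis .
qed

text \<open>One of two things must happen: the clipped functional exceeds \<open>v\<close> by
  \<open>\<eta>\<close>, handled by Chernoff's bound and bounded differences, or the part above
  \<open>K\<close> exceeds \<open>\<eta>\<close>, handled by Markov's inequality. \<open>K\<close>
  and \<open>t\<close> remain free so that they can be fixed before the bandwidth tends to
  zero.\<close>

lemma T_tail:
  assumes p: "1 \<le> p" and K: "K > 0" and \<eta>: "\<eta> > 0" and t: "t > 0" and w: "0 \<le> w" and v: "0 \<le> v"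
    and V: "(\<integral>\<^sup>+X. ennreal (VK p K X) \<partial>P) \<le> ennreal v"
    and W: "(\<integral>\<^sup>+X. ennreal (T (p + 2) UNIV X powr (p + 2)) \<partial>P) \<le> ennreal w"
  shows "emeasure P {X \<in> space P. v + 2 * \<eta> \<le> T p UNIV X powr p} \<le>
    ennreal (exp (- t * \<eta> + 2 * t\<^sup>2 * (p * K powr (p - 1))\<^sup>2 * (h * (Lq_norm 1 k)\<^sup>2)) + w / (K\<^sup>2 * \<eta>))"
proof -
  define c where "c = p * K powr (p - 1) * (2 * sqrt (h / n) * Lq_norm 1 k)"
  have VKn: "0 \<le> VK p K X" for X by (simp add: VK_def)
  have VKi: "integrable P (VK p K)"
    using VK_diff[OF p K] by (intro integrable_bounded_diff) auto
  have EV: "(LINT X|P. VK p K X) \<le> v"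
    using V v nn_integral_eq_integral[OF VKi] VKn by (simp add: ennreal_le_iff)
  have c2: "real n * c\<^sup>2 / 2 = 2 * (p * K powr (p - 1))\<^sup>2 * (h * (Lq_norm 1 k)\<^sup>2)"
    using n_pos h_pos by (simp add: c_def power_mult_distrib)
  let ?A = "{X \<in> space P. 1 \<le> ennreal (exp (- t * (v + \<eta>))) * ennreal (exp (t * VK p K X))}"
  let ?B = "{X \<in> space P. 1 \<le> ennreal (1 / (K\<^sup>2 * \<eta>)) * ennreal (T (p + 2) UNIV X powr (p + 2))}"
  have sub: "{X \<in> space P. v + 2 * \<eta> \<le> T p UNIV X powr p} \<subseteq> ?A \<union> ?B"
  proof
    fix X assume "X \<in> {X \<in> space P. v + 2 * \<eta> \<le> T p UNIV X powr p}"
    then have X: "X \<in> space P" "v + 2 * \<eta> \<le> VK p K X + T (p + 2) UNIV X powr (p + 2) / K\<^sup>2"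
      using T_powr_le_clip[OF p K, of X] by auto
    show "X \<in> ?A \<union> ?B"
    proof (cases "v + \<eta> \<le> VK p K X")
      case True
      then have "1 \<le> exp (- t * (v + \<eta>)) * exp (t * VK p K X)"
        using t by (simp flip: exp_add add: mult_left_mono distrib_left[symmetric])
      then have "ennreal 1 \<le> ennreal (exp (- t * (v + \<eta>)) * exp (t * VK p K X))" by (rule ennreal_leI)
      then have "X \<in> ?A" using X by (simp add: ennreal_mult)
      then show ?thesis by blast
    next
      case False
      then have "\<eta> \<le> T (p + 2) UNIV X powr (p + 2) / K\<^sup>2" using X by linarith
      then have "1 \<le> 1 / (K\<^sup>2 * \<eta>) * T (p + 2) UNIV X powr (p + 2)" using K \<eta> by (simp add: field_simps)
      then have "ennreal 1 \<le> ennreal (1 / (K\<^sup>2 * \<eta>) * T (p + 2) UNIV X powr (p + 2))" by (rule ennreal_leI)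
      then have "1 \<le> ennreal (1 / (K\<^sup>2 * \<eta>)) * ennreal (T (p + 2) UNIV X powr (p + 2))"
        unfolding ennreal_1 by (subst (asm) ennreal_mult) (use \<eta> in auto)
      then show ?thesis using X(1) by blast
    qed
  qed
  have "emeasure P ?A \<le> ennreal (exp (- t * (v + \<eta>))) * (\<integral>\<^sup>+X. ennreal (exp (t * VK p K X)) * indicator (space P) X \<partial>P)"
    by (rule order_trans[OF _ nn_integral_Markov_inequality]) (auto intro!: emeasure_mono)
  also have "(\<integral>\<^sup>+X. ennreal (exp (t * VK p K X)) * indicator (space P) X \<partial>P) = (\<integral>\<^sup>+X. ennreal (exp (t * VK p K X)) \<partial>P)"
    by (intro nn_integral_cong) auto
  also have "\<dots> \<le> ennreal (exp (t * (LINT X|P. VK p K X) + t\<^sup>2 * real n * c\<^sup>2 / 2))"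
    unfolding c_def by (intro mgf_bounded_diff t VK_diff p K) measurable
  also have "\<dots> \<le> ennreal (exp (t * v + t\<^sup>2 * real n * c\<^sup>2 / 2))"
    using EV t by (intro ennreal_leI) simp
  also have "ennreal (exp (- t * (v + \<eta>))) * ennreal (exp (t * v + t\<^sup>2 * real n * c\<^sup>2 / 2)) = 
      ennreal (exp (- t * \<eta> + t\<^sup>2 * (real n * c\<^sup>2 / 2)))"
    by (simp flip: ennreal_mult exp_add add: algebra_simps)
  finally have A: "emeasure P ?A \<le> ennreal (exp (- t * \<eta> + t\<^sup>2 * (real n * c\<^sup>2 / 2)))"
    by (simp add: mult_left_mono)
  have "emeasure P ?B \<le> ennreal (1 / (K\<^sup>2 * \<eta>)) * (\<integral>\<^sup>+X. ennreal (T (p + 2) UNIV X powr (p + 2)) * indicator (space P) X \<partial>P)"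
    by (rule order_trans[OF _ nn_integral_Markov_inequality]) (auto intro!: emeasure_mono)
  also have "(\<integral>\<^sup>+X. ennreal (T (p + 2) UNIV X powr (p + 2)) * indicator (space P) X \<partial>P) = (\<integral>\<^sup>+X. ennreal (T (p + 2) UNIV X powr (p + 2)) \<partial>P)"
    by (intro nn_integral_cong) auto
  also note W
  also have "ennreal (1 / (K\<^sup>2 * \<eta>)) * ennreal w = ennreal (w / (K\<^sup>2 * \<eta>))"
    using w \<eta> by (simp flip: ennreal_mult)
  finally have B: "emeasure P ?B \<le> ennreal (w / (K\<^sup>2 * \<eta>))" by (simp add: mult_left_mono)
  have "emeasure P {X \<in> space P. v + 2 * \<eta> \<le> T p UNIV X powr p} \<le> emeasure P (?A \<union> ?B)"
    using sub by (intro emeasure_mono) auto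
  also have "\<dots> \<le> emeasure P ?A + emeasure P ?B" by (intro emeasure_subadditive) auto
  also have "\<dots> \<le> ennreal (exp (- t * \<eta> + t\<^sup>2 * (real n * c\<^sup>2 / 2))) + ennreal (w / (K\<^sup>2 * \<eta>))"
    by (intro add_mono A B)
  finally show ?thesis using w \<eta> by (simp add: c2 algebra_simps flip: ennreal_plus)
qed

end

subsection \<open>Central limit theorem for the deviation\<close>

context kde begin

lemma real_distribution_Y: "real_distribution (distr P borel (\<lambda>X. Y X x))"
  by (rule P.real_distribution_distr) (rule Y_meas1)

lemma \<xi>_meas1 [measurable]: "\<xi> x \<in> borel_measurable borel"
  unfolding \<xi>_def by measurable

lemma char_Y: "char (distr P borel (\<lambda>X. Y X x)) t = (char (distr D borel (\<xi> x)) t) ^ n"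
proof -
  interpret prod: product_sigma_finite "\<lambda>_::nat. D" by unfold_locales
  have "char (distr P borel (\<lambda>X. Y X x)) t = (LINT X|P. iexp (t * Y X x))"
    unfolding char_def by (subst integral_distr) auto
  also have "\<dots> = (LINT X|P. (\<Prod>i<n. iexp (t * \<xi> x (X i))))"
    by (simp add: Y_def sum_distrib_left exp_sum)
  also have "\<dots> = (\<Prod>i<n. (LINT y|D. iexp (t * \<xi> x y)))"
    unfolding P_def by (intro prod.product_integral_prod) (auto intro!: D.integrable_iexp)
  also have "\<dots> = (LINT y|D. iexp (t * \<xi> x y)) ^ n" by simp
  also have "(LINT y|D. iexp (t * \<xi> x y)) = char (distr D borel (\<xi> x)) t"
    unfolding char_def by (subst integral_distr) auto
  finally show ?thesis .
qed

text \<open>The uniform bound \<open>|\<xi>| \<le> a\<close> turns the third moment in the Taylor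
  remainder into \<open>a\<close> times the variance, which replaces a Lindeberg condition.\<close>

lemma char_\<xi>_approx:
  "cmod (char (distr D borel (\<xi> x)) t - (1 - t\<^sup>2 * (LINT y|D. (\<xi> x y)\<^sup>2) / 2)) \<le> \<bar>t\<bar> ^ 3 * a * (LINT y|D. (\<xi> x y)\<^sup>2) / 6"
proof -
  have "cmod (char (distr D borel (\<xi> x)) t - (1 - t\<^sup>2 * (LINT y|D. (\<xi> x y)\<^sup>2) / 2)) \<le> 
     (t\<^sup>2 / 6) * (LINT y|D. min (6 * (\<xi> x y)\<^sup>2) (\<bar>t\<bar> * \<bar>\<xi> x y\<bar> ^ 3))"
    by (intro D.char_approx3' int_\<xi>2 int_\<xi> mean_\<xi> refl) (simp_all add: mean_\<xi>[of x])
  also have "\<dots> \<le> (t\<^sup>2 / 6) * (LINT y|D. \<bar>t\<bar> * a * (\<xi> x y)\<^sup>2)"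
  proof (intro mult_left_mono integral_mono)
    show "integrable D (\<lambda>y. \<bar>t\<bar> * a * (\<xi> x y)\<^sup>2)" using int_\<xi>2 by simp
    show le: "min (6 * (\<xi> x y)\<^sup>2) (\<bar>t\<bar> * \<bar>\<xi> x y\<bar> ^ 3) \<le> \<bar>t\<bar> * a * (\<xi> x y)\<^sup>2" for y
    proof -
      have "\<bar>\<xi> x y\<bar> ^ 3 = \<bar>\<xi> x y\<bar> * (\<xi> x y)\<^sup>2" by (simp add: power3_eq_cube power2_eq_square abs_mult)
      also have "\<dots> \<le> a * (\<xi> x y)\<^sup>2" by (intro mult_right_mono \<xi>_bound) auto
      finally have "\<bar>t\<bar> * \<bar>\<xi> x y\<bar> ^ 3 \<le> \<bar>t\<bar> * (a * (\<xi> x y)\<^sup>2)" by (rule mult_left_mono) simp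
      then show ?thesis by (simp add: min.coboundedI2 mult.assoc)
    qed
    show "integrable D (\<lambda>y. min (6 * (\<xi> x y)\<^sup>2) (\<bar>t\<bar> * \<bar>\<xi> x y\<bar> ^ 3))"
    proof (rule Bochner_Integration.integrable_bound[OF \<open>integrable D (\<lambda>y. \<bar>t\<bar> * a * (\<xi> x y)\<^sup>2)\<close>])
      show "AE y in D. norm (min (6 * (\<xi> x y)\<^sup>2) (\<bar>t\<bar> * \<bar>\<xi> x y\<bar> ^ 3)) \<le> norm (\<bar>t\<bar> * a * (\<xi> x y)\<^sup>2)"
      proof (rule AE_I2)
        fix y
        have "0 \<le> min (6 * (\<xi> x y)\<^sup>2) (\<bar>t\<bar> * \<bar>\<xi> x y\<bar> ^ 3)" by (intro min.boundedI) auto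
        then show "norm (min (6 * (\<xi> x y)\<^sup>2) (\<bar>t\<bar> * \<bar>\<xi> x y\<bar> ^ 3)) \<le> norm (\<bar>t\<bar> * a * (\<xi> x y)\<^sup>2)"
          using le[of y] unfolding real_norm_def
          by (metis abs_of_nonneg abs_ge_self order_trans)
      qed
    qed measurable
  qed auto
  also have "\<dots> = \<bar>t\<bar> ^ 3 * a * (LINT y|D. (\<xi> x y)\<^sup>2) / 6"
  proof -
    have "t\<^sup>2 * \<bar>t\<bar> = \<bar>t\<bar> ^ 3" by (simp add: power3_eq_cube power2_eq_square)
    then show ?thesis by (simp add: ac_simps)
  qed
  finally show ?thesis .
qed

text \<open>The characteristic function of one summand, \<open>1 - c / n\<close> and
  \<open>exp (- c / n)\<close> all lie in the unit disc, so passing to n-th powers multiplies their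
  distances by at most \<open>n\<close>. The hypothesis ensures
  \<open>0 \<le> 1 - c / n\<close>.\<close>

lemma char_Y_approx:
  assumes small: "t\<^sup>2 * (s2 x - h * (m x)\<^sup>2) / 2 \<le> real n"
  defines "c \<equiv> t\<^sup>2 * (s2 x - h * (m x)\<^sup>2) / 2"
  shows "cmod (char (distr P borel (\<lambda>X. Y X x)) t - exp (- c)) \<le> \<bar>t\<bar> * a * c / 3 + c\<^sup>2 / n"
proof -
  define v where "v = (LINT y|D. (\<xi> x y)\<^sup>2)"
  have v: "v \<ge> 0" by (simp add: v_def)
  have nv: "real n * v = s2 x - h * (m x)\<^sup>2" unfolding v_def by (rule var_\<xi>)
  have c: "t\<^sup>2 * v / 2 = c / n" "0 \<le> c" using n_pos v nv[symmetric] by (auto simp: c_def field_simps)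
  have c1: "c / n \<le> 1" using small n_pos by (simp add: c_def)
  interpret \<xi>d: real_distribution "distr D borel (\<xi> x)" by (rule D.real_distribution_distr) simp
  define z where "z = char (distr D borel (\<xi> x)) t"
  define w :: complex where "w = of_real (1 - c / n)"
  define e :: complex where "e = of_real (exp (- (c / n)))"
  have nz: "cmod z \<le> 1" unfolding z_def by (rule \<xi>d.cmod_char_le_1)
  have nw: "cmod w \<le> 1" unfolding w_def norm_of_real using c c1 n_pos by (auto simp: abs_le_iff)
  have ne: "cmod e \<le> 1" unfolding e_def norm_of_real using c n_pos by auto
  have en: "e ^ n = exp (- c)"
    unfolding e_def using n_pos by (simp flip: of_real_power exp_of_nat_mult)
  have zw: "cmod (z - w) \<le> \<bar>t\<bar> ^ 3 * a * v / 6"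
    using char_\<xi>_approx[of x t] c(1) unfolding z_def w_def v_def[symmetric] by simp
  have we: "cmod (w - e) \<le> (c / n)\<^sup>2"
  proof -
    have "exp (- (c / n)) \<le> 1 + (- (c / n)) + (- (c / n))\<^sup>2"
      using c c1 n_pos by (intro exp_le_quadratic) auto
    moreover have "1 + (- (c / n)) \<le> exp (- (c / n))" by (rule exp_ge_add_one_self)
    ultimately show ?thesis unfolding w_def e_def of_real_diff[symmetric] norm_of_real by (simp add: abs_le_iff)
  qed
  have "cmod (z ^ n - e ^ n) \<le> cmod (z ^ n - w ^ n) + cmod (w ^ n - e ^ n)"
    using norm_triangle_ineq[of "z ^ n - w ^ n" "w ^ n - e ^ n"] by simp
  also have "\<dots> \<le> n * cmod (z - w) + n * cmod (w - e)"
    by (intro add_mono norm_power_diff nz nw ne)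
  also have "\<dots> \<le> n * (\<bar>t\<bar> ^ 3 * a * v / 6) + n * (c / n)\<^sup>2"
    using zw we by (intro add_mono mult_left_mono) auto
  also have "n * (\<bar>t\<bar> ^ 3 * a * v / 6) = \<bar>t\<bar> * a * c / 3"
    unfolding c_def nv[symmetric] by (simp add: power3_eq_cube power2_eq_square)
  also have "n * (c / n)\<^sup>2 = c\<^sup>2 / n" using n_pos by (simp add: power2_eq_square)
  finally show ?thesis unfolding char_Y z_def[symmetric] en .
qed

end

text \<open>A triangular array: density, kernel, bandwidth and sample size all vary with
  \<open>j\<close>.\<close>

locale kde_seq =
  fixes f k :: "nat \<Rightarrow> real \<Rightarrow> real" and h :: "nat \<Rightarrow> real" and n :: "nat \<Rightarrow> nat"
  assumes kde: "\<And>j. kde (f j) (k j) (h j) (n j)"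
    and n_lim: "filterlim (\<lambda>j. real (n j)) at_top sequentially"
    and nh_lim: "filterlim (\<lambda>j. real (n j) * h j) at_top sequentially"
begin

abbreviation "PP j \<equiv> kde.P (f j) (n j)"
abbreviation "YY j \<equiv> kde.Y (f j) (k j) (h j) (n j)"
abbreviation "mm j \<equiv> kde.m (f j) (k j)"
abbreviation "ss j \<equiv> kde.s2 (f j) (k j) (h j)"
abbreviation "aa j \<equiv> kde.a (h j) (n j)"

lemma aa_lim: "aa \<longlonglongrightarrow> 0"
proof -
  have "(\<lambda>j. 2 / sqrt (real (n j) * h j)) \<longlonglongrightarrow> 0"
    by (rule tendsto_divide_0[OF tendsto_const filterlim_at_top_imp_at_infinity])
       (rule filterlim_compose[OF sqrt_at_top nh_lim])
  then show ?thesis by (simp add: kde.a_def[OF kde])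
qed

text \<open>Levy's continuity theorem. The limit is written as the law of
  \<open>\<sigma> * z\<close>, so a point at which the variance tends to zero is covered by
  \<open>\<sigma> = 0\<close>.\<close>

theorem clt:
  fixes \<phi> :: "real \<Rightarrow> real"
  assumes s: "(\<lambda>j. ss j x) \<longlonglongrightarrow> \<sigma>\<^sup>2" and m: "(\<lambda>j. h j * (mm j x)\<^sup>2) \<longlonglongrightarrow> 0"
    and \<phi>: "\<And>y. isCont \<phi> y" "\<And>y. \<bar>\<phi> y\<bar> \<le> B"
  shows "(\<lambda>j. LINT X|PP j. \<phi> (YY j X x)) \<longlonglongrightarrow> (LINT z|std_normal_distribution. \<phi> (\<sigma> * z))"
proof -
  interpret N: real_distribution std_normal_distribution by (rule real_dist_normal_dist)
  have [measurable]: "\<phi> \<in> borel_measurable borel"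
    by (intro borel_measurable_continuous_onI continuous_at_imp_continuous_on) (use \<phi> in auto)
  have char': "char (distr std_normal_distribution borel (\<lambda>z. \<sigma> * z)) t = exp (- (t\<^sup>2 * \<sigma>\<^sup>2 / 2))" for t
  proof -
    have "char (distr std_normal_distribution borel (\<lambda>z. \<sigma> * z)) t = char std_normal_distribution (t * \<sigma>)"
      unfolding char_def by (subst integral_distr) (auto simp: mult.assoc)
    then show ?thesis by (simp add: char_std_normal_distribution power_mult_distrib flip: exp_of_real)
  qed
  have conv: "(\<lambda>j. char (distr (PP j) borel (\<lambda>X. YY j X x)) t) \<longlonglongrightarrow> char (distr std_normal_distribution borel (\<lambda>z. \<sigma> * z)) t" for t
  proof -
    define c where "c j = t\<^sup>2 * (ss j x - h j * (mm j x)\<^sup>2) / 2" for j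
    have cl: "c \<longlonglongrightarrow> t\<^sup>2 * \<sigma>\<^sup>2 / 2"
      unfolding c_def by (rule tendsto_eq_intros s m refl | simp)+
    have inv: "(\<lambda>j. 1 / real (n j)) \<longlonglongrightarrow> 0"
      by (rule tendsto_divide_0[OF tendsto_const filterlim_at_top_imp_at_infinity[OF n_lim]])
    have "(\<lambda>j. c j * (1 / real (n j))) \<longlonglongrightarrow> (t\<^sup>2 * \<sigma>\<^sup>2 / 2) * 0" by (intro tendsto_mult cl inv)
    then have "eventually (\<lambda>j. c j * (1 / real (n j)) < 1) sequentially" 
      by (intro order_tendstoD(2)) auto
    then have ev: "eventually (\<lambda>j. c j \<le> real (n j)) sequentially"
    proof eventually_elim
      case (elim j)
      then show ?case using kde.n_pos[OF kde[of j]] by (simp add: field_simps)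
    qed
    have "(\<lambda>j. \<bar>t\<bar> * aa j * c j / 3 + (c j)\<^sup>2 * (1 / n j)) \<longlonglongrightarrow> \<bar>t\<bar> * 0 * (t\<^sup>2 * \<sigma>\<^sup>2 / 2) / 3 + (t\<^sup>2 * \<sigma>\<^sup>2 / 2)\<^sup>2 * 0"
      by (intro tendsto_add tendsto_mult tendsto_divide tendsto_power tendsto_const cl inv aa_lim) auto
    then have z: "(\<lambda>j. \<bar>t\<bar> * aa j * c j / 3 + (c j)\<^sup>2 * (1 / n j)) \<longlonglongrightarrow> 0" by simp
    have "(\<lambda>j. char (distr (PP j) borel (\<lambda>X. YY j X x)) t - exp (- c j)) \<longlonglongrightarrow> 0"
    proof (rule Lim_null_comparison[OF _ z])
      show "\<forall>\<^sub>F j in sequentially. norm (char (distr (PP j) borel (\<lambda>X. YY j X x)) t - exp (- c j)) \<le> \<bar>t\<bar> * aa j * c j / 3 + (c j)\<^sup>2 * (1 / n j)"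
        using ev
      proof eventually_elim
        case (elim j)
        from kde.char_Y_approx[OF kde[of j], of t x] elim show ?case by (simp add: c_def)
      qed
    qed
    moreover have "(\<lambda>j. complex_of_real (exp (- c j))) \<longlonglongrightarrow> complex_of_real (exp (- (t\<^sup>2 * \<sigma>\<^sup>2 / 2)))"
      by (intro tendsto_of_real tendsto_exp tendsto_minus cl)
    ultimately have "(\<lambda>j. (char (distr (PP j) borel (\<lambda>X. YY j X x)) t - exp (- c j)) + complex_of_real (exp (- c j)))
       \<longlonglongrightarrow> 0 + complex_of_real (exp (- (t\<^sup>2 * \<sigma>\<^sup>2 / 2)))" by (rule tendsto_add)
    then show ?thesis unfolding char' by simp
  qed
  have rd: "real_distribution (distr (PP j) borel (\<lambda>X. YY j X x))" for j
    by (rule kde.real_distribution_Y[OF kde])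
  have rd': "real_distribution (distr std_normal_distribution borel (\<lambda>z. \<sigma> * z))"
    by (rule N.real_distribution_distr) simp
  have "weak_conv_m (\<lambda>j. distr (PP j) borel (\<lambda>X. YY j X x)) (distr std_normal_distribution borel (\<lambda>z. \<sigma> * z))"
    by (rule levy_continuity[OF rd rd' conv])
  then have "(\<lambda>j. integral\<^sup>L (distr (PP j) borel (\<lambda>X. YY j X x)) \<phi>) \<longlonglongrightarrow> integral\<^sup>L (distr std_normal_distribution borel (\<lambda>z. \<sigma> * z)) \<phi>"
    using \<phi> by (intro weak_conv_imp_integral_bdd_continuous_conv[where B = B] rd rd') auto
  then show ?thesis
    using kde.Y_meas1[OF kde] by (simp add: integral_distr)
qed

end

subsection \<open>The Fourier transform of the hyperbolic secant\<close>

lemma integrable_cauchy: "integrable lborel (\<lambda>x::real. inverse (1 + x\<^sup>2))"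
  and integral_cauchy: "(LINT x|lborel. inverse (1 + x\<^sup>2)) = (pi::real)"
  using integrable_inverse_1_plus_square LBINT_inverse_1_plus_square
  by (simp_all add: set_integrable_def interval_lebesgue_integral_def set_lebesgue_integral_def)

lemma sech_le: "1 / cosh x \<le> 2 * inverse (1 + x\<^sup>2)" for x :: real
proof -
  have "(1 + x\<^sup>2) / 2 \<le> cosh x"
    using cosh_minus_one_ge[of 1 x] by (simp add: numeral_2_eq_2 field_simps power2_eq_square)
  then have "1 / cosh x \<le> 1 / ((1 + x\<^sup>2) / 2)" by (intro divide_left_mono) (auto simp: add_pos_nonneg)
  then show ?thesis by (simp add: field_simps)
qed

lemma integrable_sech: "integrable lborel (\<lambda>x::real. 1 / cosh x)"
proof (rule Bochner_Integration.integrable_bound)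
  show "integrable lborel (\<lambda>x::real. 2 * inverse (1 + x\<^sup>2))" using integrable_cauchy by simp
  have "(\<lambda>x::real. 1 / cosh x) \<in> borel_measurable borel"
    by (intro borel_measurable_continuous_onI) (auto intro!: continuous_intros)
  then show "(\<lambda>x::real. 1 / cosh x) \<in> borel_measurable lborel" by simp
  show "AE x::real in lborel. norm (1 / cosh x) \<le> norm (2 * inverse (1 + x\<^sup>2))"
    using sech_le by (auto intro!: AE_I2 order_trans[OF _ abs_ge_self])
qed

lemma holomorphic_cosh: "(cosh :: complex \<Rightarrow> complex) holomorphic_on X"
  unfolding cosh_field_def[abs_def] by (intro holomorphic_intros) auto

lemma norm_cosh_squared: "(cmod (cosh z))\<^sup>2 = (cos (Im z))\<^sup>2 + (sinh (Re z))\<^sup>2"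
  unfolding cosh_conv_cos norm_cos_squared
  by (simp add: sinh_field_def exp_minus power_divide)

lemma cosh_zero_strip:
  assumes z: "cosh z = 0" and "-1 < Im z" "Im z < 4"
  shows "z = \<i> * (pi / 2)"
proof -
  have "(cos (Im z))\<^sup>2 + (sinh (Re z))\<^sup>2 = 0" using norm_cosh_squared[of z] z by simp
  then have c: "cos (Im z) = 0" and s: "Re z = 0" by (auto simp: add_nonneg_eq_0_iff)
  have "Im z = pi / 2"
  proof (rule ccontr)
    assume "Im z \<noteq> pi / 2"
    then consider "Im z < pi / 2" | "Im z > pi / 2" by linarith
    then show False
    proof cases
      case 1
      then show False using cos_gt_zero_pi[of "Im z"] c assms pi_gt3 by auto
    next
      case 2
      then have "cos (Im z - pi) > 0" using assms pi_gt3 by (intro cos_gt_zero_pi) auto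
      then show False using c by simp
    qed
  qed
  with s show ?thesis by (simp add: complex_eq_iff)
qed

lemma contour_integral_linepath_translate:
  "contour_integral (linepath (a + c) (b + c)) g = contour_integral (linepath a b) (\<lambda>z. g (z + c))"
proof -
  have "linepath (a + c) (b + c) x = linepath a b x + c" for x
    by (simp add: linepath_def algebra_simps)
  then show ?thesis by (simp add: contour_integral_integral)
qed

text \<open>Residue theorem on a rectangle of height pi. A shift by \<open>\<i> * pi\<close> changes
  the sign of \<open>cosh\<close> and multiplies the exponential by \<open>exp (- pi * t)\<close>,
  so the two long sides combine to \<open>1 + exp (- pi * t)\<close> times the integral, up to
  vanishing short sides.\<close>

lemma fourier_sech: "(LINT x|lborel. cos (t * x) / cosh x) = pi / cosh (pi * t / 2)"
proof -
  define g :: "complex \<Rightarrow> complex" where "g z = exp (\<i> * t * z) / cosh z" for z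
  \<comment> \<open>An open strip containing the closed rectangle, since \<open>pi < 4\<close>, and
    no zero of \<open>cosh\<close> other than \<open>\<i> * (pi / 2)\<close>: the neighbouring ones
    have imaginary parts \<open>- pi / 2 < -1\<close> and \<open>3 * pi / 2 > 4\<close>.\<close>
  define S where "S = {z. -1 < Im z \<and> Im z < 4}"
  define p0 :: complex where "p0 = \<i> * (pi / 2)"
  have S: "open S" "connected S" "convex S"
  proof -
    have e: "S = {z. -1 < Im z} \<inter> {z. Im z < 4}" by (auto simp: S_def)
    show "open S" unfolding e by (intro open_Int open_halfspace_Im_gt open_halfspace_Im_lt)
    show "convex S" unfolding e by (intro convex_Int convex_halfspace_Im_gt convex_halfspace_Im_lt)
    then show "connected S" by (rule convex_connected)
  qed
  have nz: "cosh z \<noteq> 0" if "z \<in> S - {p0}" for z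
    using that cosh_zero_strip[of z] by (auto simp: S_def p0_def)
  have holo: "g holomorphic_on S - {p0}"
    unfolding g_def using nz by (intro holomorphic_intros holomorphic_cosh) auto
  have p0S: "p0 \<in> S" using pi_gt3 pi_less_4 by (auto simp: S_def p0_def)
  have res: "residue g p0 = exp (- pi * t / 2) / \<i>"
  proof -
    have c0: "cosh p0 = 0" unfolding p0_def cosh_conv_cos by simp
    have s0: "sinh p0 = \<i>" unfolding p0_def sinh_conv_sin by simp
    have "residue (\<lambda>w. exp (\<i> * t * w) / cosh w) p0 = exp (\<i> * t * p0) / \<i>"
    proof (rule residue_simple_pole_deriv[OF _ _ S(1,2) p0S])
      show "(cosh has_field_derivative \<i>) (at p0)"
        using s0 by (auto intro!: derivative_eq_intros)
    qed (auto intro!: holomorphic_intros holomorphic_cosh simp: c0)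
    also have "\<i> * t * p0 = of_real (- pi * t / 2)" by (simp add: p0_def complex_eq_iff)
    finally show ?thesis unfolding g_def exp_of_real by simp
  qed
  define I where "I R = contour_integral (linepath (of_real (- R)) (of_real R)) g" for R
  have rect: "cmod ((1 + exp (- pi * t)) * I R - 2 * pi * exp (- pi * t / 2)) \<le> 2 * pi * (exp (\<bar>t\<bar> * pi) / sinh R)"
    if R: "R > 0" for R
  proof -
    define a1 where "a1 = complex_of_real (- R)"
    define a2 where "a2 = complex_of_real R"
    define a3 where "a3 = complex_of_real R + \<i> * pi"
    define a4 where "a4 = complex_of_real (- R) + \<i> * pi"
    have rp: "rectpath a1 a3 = linepath a1 a2 +++ linepath a2 a3 +++ linepath a3 a4 +++ linepath a4 a1"
      unfolding rectpath_def Let_def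
      by (simp add: a1_def a2_def a3_def a4_def complex_eq_iff)
         (intro arg_cong2[where f = joinpaths] arg_cong2[where f = linepath] refl; simp add: complex_eq_iff)?
    have pts: "a1 \<in> S" "a2 \<in> S" "a3 \<in> S" "a4 \<in> S"
      using pi_gt3 pi_less_4 by (auto simp: S_def a1_def a2_def a3_def a4_def)
    have img: "path_image (rectpath a1 a3) \<subseteq> S - {p0}"
    proof -
      have "path_image (rectpath a1 a3) \<subseteq> cbox a1 a3"
        using R by (intro path_image_rectpath_subset_cbox) (auto simp: a1_def a3_def)
      moreover have "cbox a1 a3 \<subseteq> S" using pi_gt3 pi_less_4 by (auto simp: S_def a1_def a3_def in_cbox_complex_iff)
      moreover have "path_image (rectpath a1 a3) \<inter> box a1 a3 = {}"
        using R by (intro path_image_rectpath_inter_box) (auto simp: a1_def a3_def)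
      moreover have "p0 \<in> box a1 a3" using R pi_gt_zero by (auto simp: a1_def a3_def p0_def in_box_complex_iff)
      ultimately show ?thesis by blast
    qed
    have wn: "winding_number (rectpath a1 a3) p0 = 1"
      using R by (intro winding_number_rectpath) (auto simp: a1_def a3_def p0_def in_box_complex_iff)
    have outside: "winding_number (rectpath a1 a3) z = 0" if "z \<notin> S" for z
    proof (rule winding_number_rectpath_outside)
      show "z \<notin> cbox a1 a3"
        using that pi_less_4 by (auto simp: S_def a1_def a3_def in_cbox_complex_iff)
    qed (use R in \<open>auto simp: a1_def a3_def\<close>)
    have "contour_integral (rectpath a1 a3) g = 2 * pi * \<i> * (\<Sum>p\<in>{p0}. winding_number (rectpath a1 a3) p * residue g p)"
      by (rule Residue_theorem[OF S(1,2) _ holo]) (use img outside in auto)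
    also have "(\<Sum>p\<in>{p0}. winding_number (rectpath a1 a3) p * residue g p) = residue g p0" by (simp add: wn)
    also have "2 * pi * \<i> * residue g p0 = 2 * pi * exp (- pi * t / 2)"
    proof -
      have "c * \<i> * (e / \<i>) = c * e" for c e :: complex by (simp only: mult.assoc) simp
      then show ?thesis unfolding res of_real_mult .
    qed
    finally have total: "contour_integral (rectpath a1 a3) g = 2 * pi * exp (- pi * t / 2)" .
    have pim: "path_image (linepath a1 a2) \<union> path_image (linepath a2 a3) \<union> path_image (linepath a3 a4) \<union> path_image (linepath a4 a1) \<subseteq> S - {p0}"
      using img unfolding rp by (simp add: path_image_join Un_assoc)
    have cont: "continuous_on (S - {p0}) g" by (rule holomorphic_on_imp_continuous_on[OF holo])
    have ci: "g contour_integrable_on linepath a1 a2" "g contour_integrable_on linepath a2 a3"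
      "g contour_integrable_on linepath a3 a4" "g contour_integrable_on linepath a4 a1"
    proof -
      have *: "g contour_integrable_on linepath a b" if "path_image (linepath a b) \<subseteq> S - {p0}" for a b
        using that by (intro contour_integrable_continuous_linepath continuous_on_subset[OF cont]) simp
      show "g contour_integrable_on linepath a1 a2" "g contour_integrable_on linepath a2 a3"
        "g contour_integrable_on linepath a3 a4" "g contour_integrable_on linepath a4 a1"
        by (rule *; use pim in blast)+
    qed
    have split: "contour_integral (rectpath a1 a3) g = contour_integral (linepath a1 a2) g + 
      (contour_integral (linepath a2 a3) g + (contour_integral (linepath a3 a4) g + contour_integral (linepath a4 a1) g))"
      unfolding rp by (subst contour_integral_join; simp add: ci contour_integrable_join)+
    have top: "contour_integral (linepath a3 a4) g = exp (- pi * t) * I R"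
    proof -
      have "contour_integral (linepath a3 a4) g = - contour_integral (linepath a4 a3) g"
        using contour_integral_reverse_linepath[of a4 a3 g] pim 
          continuous_on_subset[OF cont, of "closed_segment a3 a4"] 
        by (simp add: closed_segment_commute)
      also have "contour_integral (linepath a4 a3) g = contour_integral (linepath a1 a2) (\<lambda>z. g (z + \<i> * pi))"
        unfolding a1_def a2_def a3_def a4_def by (rule contour_integral_linepath_translate)
      also have "(\<lambda>z. g (z + \<i> * pi)) = (\<lambda>z. - exp (- pi * t) * g z)"
      proof
        fix z
        have "cosh (z + \<i> * pi) = - cosh z"
          by (simp add: cosh_add) (simp add: cosh_conv_cos sinh_conv_sin)
        moreover have "exp (\<i> * t * (z + \<i> * pi)) = exp (\<i> * t * z) * exp (- pi * t)"
        proof -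
          have "\<i> * t * (z + \<i> * pi) = \<i> * t * z + of_real (- pi * t)" by (simp add: complex_eq_iff algebra_simps)
          then show ?thesis by (simp only: exp_add exp_of_real)
        qed
        ultimately show "g (z + \<i> * pi) = - exp (- pi * t) * g z" by (simp add: g_def)
      qed
      also have "contour_integral (linepath a1 a2) (\<lambda>z. - exp (- pi * t) * g z) = - exp (- pi * t) * I R"
        unfolding I_def a1_def[symmetric] a2_def[symmetric] by (rule contour_integral_lmul[OF ci(1)])
      finally show ?thesis by simp
    qed
    \<comment> \<open>On the short sides \<open>|cosh z|\<close> is at least \<open>sinh R\<close>,
      because its square is a sum of the squares of \<open>cos (Im z)\<close> and
      \<open>sinh (Re z)\<close>.\<close>
    have gb: "cmod (g z) \<le> exp (\<bar>t\<bar> * pi) / sinh R" if z: "\<bar>Re z\<bar> = R" "0 \<le> Im z" "Im z \<le> pi" for z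
    proof -
      have sR: "sinh R > 0" using R by simp
      have "(sinh R)\<^sup>2 = (sinh (Re z))\<^sup>2" using z(1) by (auto simp: abs_if split: if_splits)
      then have "(sinh R)\<^sup>2 \<le> (cmod (cosh z))\<^sup>2" by (simp add: norm_cosh_squared)
      then have c: "sinh R \<le> cmod (cosh z)" by (rule power2_le_imp_le) simp
      have "- (t * Im z) \<le> \<bar>t\<bar> * pi"
        using mult_left_mono[of "Im z" pi "\<bar>t\<bar>"] mult_right_mono[OF abs_ge_minus_self[of t], of "Im z"] z by auto
      then have "cmod (exp (\<i> * t * z)) \<le> exp (\<bar>t\<bar> * pi)" by simp
      then show ?thesis unfolding g_def norm_divide using c sR by (intro frac_le) auto
    qed
    have side: "cmod (contour_integral (linepath a2 a3) g) \<le> exp (\<bar>t\<bar> * pi) / sinh R * cmod (a3 - a2)"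
      "cmod (contour_integral (linepath a4 a1) g) \<le> exp (\<bar>t\<bar> * pi) / sinh R * cmod (a1 - a4)"
    proof -
      have seg: "Re z = R \<and> 0 \<le> Im z \<and> Im z \<le> pi" if "z \<in> closed_segment a2 a3" for z
        using that pi_gt_zero by (auto simp: closed_segment_def a2_def a3_def algebra_simps mult_left_le_one_le)
      have seg': "Re z = - R \<and> 0 \<le> Im z \<and> Im z \<le> pi" if "z \<in> closed_segment a4 a1" for z
      proof -
        from that obtain u where u: "0 \<le> u" "u \<le> 1" "z = (1 - u) *\<^sub>R a4 + u *\<^sub>R a1"
          by (auto simp: closed_segment_def)
        have "Re z = (1 - u) * (- R) + u * (- R)" "Im z = (1 - u) * pi"
          unfolding u(3) by (auto simp: a4_def a1_def)
        moreover have "0 \<le> (1 - u) * pi" using u by (intro mult_nonneg_nonneg) auto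
        moreover have "(1 - u) * pi \<le> 1 * pi" using u by (intro mult_right_mono) auto
        moreover have "(1 - u) * (- R) + u * (- R) = - R" by algebra
        ultimately show ?thesis by simp
      qed
      show "cmod (contour_integral (linepath a2 a3) g) \<le> exp (\<bar>t\<bar> * pi) / sinh R * cmod (a3 - a2)"
        by (rule contour_integral_bound_linepath[OF ci(2)]) (use seg gb R in auto)
      show "cmod (contour_integral (linepath a4 a1) g) \<le> exp (\<bar>t\<bar> * pi) / sinh R * cmod (a1 - a4)"
        by (rule contour_integral_bound_linepath[OF ci(4)]) (use seg' gb R in auto)
    qed
    have len: "cmod (a3 - a2) = pi" "cmod (a1 - a4) = pi" by (auto simp: a1_def a2_def a3_def a4_def norm_mult)
    have "(1 + exp (- pi * t)) * I R - 2 * pi * exp (- pi * t / 2) = 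
       - (contour_integral (linepath a2 a3) g + contour_integral (linepath a4 a1) g)"
      using split top total by (simp add: I_def a1_def a2_def algebra_simps)
    also have "cmod \<dots> \<le> exp (\<bar>t\<bar> * pi) / sinh R * pi + exp (\<bar>t\<bar> * pi) / sinh R * pi"
      unfolding norm_minus_cancel using side len by (intro order_trans[OF norm_triangle_ineq] add_mono) auto
    finally show ?thesis by (simp add: algebra_simps)
  qed
  have sinh_lim: "filterlim (\<lambda>n. sinh (real n + 1)) at_top sequentially"
    by (rule filterlim_compose[OF sinh_real_at_top])
       (rule filterlim_at_top_mono[OF filterlim_real_sequentially], simp)
  define J where "J n = (LINT x|lborel. indicator {- (real n + 1)..real n + 1} x * (cos (t * x) / cosh x))" for n
  have meas: "(\<lambda>x. cos (t * x) / cosh x) \<in> borel_measurable borel"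
    by (intro borel_measurable_continuous_onI) (auto intro!: continuous_intros)
  note [measurable] = meas
  have bound: "\<bar>cos (t * x) / cosh x\<bar> \<le> 1 / cosh x" for x
    by (simp add: abs_divide divide_right_mono)
  have ReI: "Re (I (real n + 1)) = J n" for n
  proof -
    define R where "R = real n + 1"
    have R: "R > 0" by (simp add: R_def)
    have ci: "continuous_on {-R..R} (\<lambda>x. g (of_real x))"
    proof -
      have "cosh (complex_of_real x) \<noteq> 0" for x
      proof -
        have "(cmod (cosh (complex_of_real x)))\<^sup>2 = 1 + (sinh x)\<^sup>2" by (simp add: norm_cosh_squared)
        moreover have "1 + (sinh x)\<^sup>2 > 0" by (simp add: add_pos_nonneg)
        ultimately show ?thesis by auto
      qed
      then show ?thesis unfolding g_def by (intro continuous_intros) auto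
    qed
    have "I R = integral {-R..R} (\<lambda>x. g (of_real x))"
      unfolding I_def using R by (subst contour_integral_linepath_Reals_eq) auto
    then have "Re (I R) = integral {-R..R} (\<lambda>x. Re (g (of_real x)))"
      using integral_linear[OF integrable_continuous_real[OF ci] bounded_linear_Re] by (simp add: o_def)
    also have "(\<lambda>x. Re (g (of_real x))) = (\<lambda>x. cos (t * x) / cosh x)"
    proof
      fix x :: real
      have "cosh (complex_of_real x) = of_real (cosh x)" by (simp add: cosh_field_def exp_of_real flip: of_real_minus)
      then show "Re (g (of_real x)) = cos (t * x) / cosh x"
        by (simp add: g_def exp_Euler Re_divide_of_real flip: of_real_mult) (simp add: Re_exp)?
    qed
    also have "integral {-R..R} (\<lambda>x. cos (t * x) / cosh x) = (LINT x:{-R..R}|lborel. cos (t * x) / cosh x)"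
    proof (rule set_borel_integral_eq_integral(2)[symmetric])
      show "set_integrable lborel {-R..R} (\<lambda>x. cos (t * x) / cosh x)"
        by (rule borel_integrable_atLeastAtMost') (auto intro!: continuous_intros)
    qed
    finally show ?thesis by (simp add: J_def set_lebesgue_integral_def R_def)
  qed
  have J_lim: "J \<longlonglongrightarrow> (LINT x|lborel. cos (t * x) / cosh x)"
    unfolding J_def
  proof (rule integral_dominated_convergence[where w = "\<lambda>x. 1 / cosh x"])
    show "integrable lborel (\<lambda>x::real. 1 / cosh x)" by (rule integrable_sech)
    show "AE x in lborel. (\<lambda>n. indicator {- (real n + 1)..real n + 1} x * (cos (t * x) / cosh x)) \<longlonglongrightarrow> cos (t * x) / cosh x"
    proof (rule AE_I2, rule tendsto_eventually)
      fix x :: real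
      obtain n0 where n0: "\<bar>x\<bar> \<le> real n0" using real_arch_simple by blast
      show "\<forall>\<^sub>F n in sequentially. indicator {- (real n + 1)..real n + 1} x * (cos (t * x) / cosh x) = cos (t * x) / cosh x"
        using eventually_ge_at_top[of n0] by eventually_elim (use n0 in \<open>auto simp: indicator_def abs_le_iff\<close>)
    qed
    show "AE x in lborel. norm (indicator {- (real n + 1)..real n + 1} x * (cos (t * x) / cosh x)) \<le> 1 / cosh x" for n
      using bound by (auto intro!: AE_I2 simp: indicator_def)
  qed measurable
  have lim: "(\<lambda>n. (1 + exp (- pi * t)) * J n - 2 * pi * exp (- pi * t / 2)) \<longlonglongrightarrow> 0"
  proof (rule Lim_null_comparison)
    show "\<forall>\<^sub>F n in sequentially. norm ((1 + exp (- pi * t)) * J n - 2 * pi * exp (- pi * t / 2)) \<le> 2 * pi * (exp (\<bar>t\<bar> * pi) / sinh (real n + 1))"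
    proof (intro always_eventually allI)
      fix n
      have "(1 + exp (- pi * t)) * J n - 2 * pi * exp (- pi * t / 2) =
        Re (complex_of_real (1 + exp (- pi * t)) * I (real n + 1) - complex_of_real (2 * pi * exp (- pi * t / 2)))"
        by (simp add: ReI[symmetric])
      also have "\<bar>\<dots>\<bar> \<le> cmod (complex_of_real (1 + exp (- pi * t)) * I (real n + 1) - complex_of_real (2 * pi * exp (- pi * t / 2)))"
        by (rule abs_Re_le_cmod)
      also have "\<dots> \<le> 2 * pi * (exp (\<bar>t\<bar> * pi) / sinh (real n + 1))"
        using rect[of "real n + 1"] by simp
      finally show "norm ((1 + exp (- pi * t)) * J n - 2 * pi * exp (- pi * t / 2)) \<le> 2 * pi * (exp (\<bar>t\<bar> * pi) / sinh (real n + 1))"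
        by simp
    qed
    have "(\<lambda>n. exp (\<bar>t\<bar> * pi) / sinh (real n + 1)) \<longlonglongrightarrow> 0"
      by (rule tendsto_divide_0[OF tendsto_const filterlim_at_top_imp_at_infinity[OF sinh_lim]])
    then show "(\<lambda>n. 2 * pi * (exp (\<bar>t\<bar> * pi) / sinh (real n + 1))) \<longlonglongrightarrow> 0"
      using tendsto_mult_right_zero by blast
  qed
  have "(\<lambda>n. (1 + exp (- pi * t)) * J n - 2 * pi * exp (- pi * t / 2)) \<longlonglongrightarrow> 
      (1 + exp (- pi * t)) * (LINT x|lborel. cos (t * x) / cosh x) - 2 * pi * exp (- pi * t / 2)"
    by (intro tendsto_intros J_lim)
  from LIMSEQ_unique[OF this lim]
  have A: "(1 + exp (- pi * t)) * (LINT x|lborel. cos (t * x) / cosh x) = 2 * pi * exp (- pi * t / 2)" by simp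
  have B: "1 + exp (- pi * t) = 2 * exp (- pi * t / 2) * cosh (pi * t / 2)"
  proof -
    define E F where "E = exp (- pi * t / 2)" and "F = exp (pi * t / 2)"
    have 1: "E * F = 1" and 2: "E * E = exp (- pi * t)" by (simp_all add: E_def F_def flip: exp_add)
    have 3: "cosh (pi * t / 2) = (F + E) / 2" by (simp add: cosh_field_def E_def F_def)
    have "1 + exp (- pi * t) = E * F + E * E" unfolding 1 2 ..
    also have "\<dots> = 2 * E * ((F + E) / 2)" by (simp add: algebra_simps)
    finally show ?thesis unfolding E_def[symmetric] 3 .
  qed
  have "2 * exp (- pi * t / 2) * (cosh (pi * t / 2) * (LINT x|lborel. cos (t * x) / cosh x)) = 2 * exp (- pi * t / 2) * pi"
    using A unfolding B by (simp only: ac_simps)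
  then have "cosh (pi * t / 2) * (LINT x|lborel. cos (t * x) / cosh x) = pi" by simp
  then show ?thesis by (simp add: field_simps)
qed

subsection \<open>Bias of the trapezoidal kernel\<close>

lemma power_le_fact_exp:
  fixes x :: real assumes "0 \<le> x" shows "x ^ k \<le> fact k * exp x"
proof -
  have s: "(\<lambda>n. x ^ n /\<^sub>R fact n) sums exp x" by (rule exp_converges)
  have "(\<Sum>n\<in>{k}. x ^ n /\<^sub>R fact n) \<le> exp x"
    unfolding sums_unique[OF s] using assms sums_summable[OF s] by (intro sum_le_suminf) auto
  then show ?thesis by (simp add: field_simps)
qed

lemma integrable_cauchy_shift: "integrable lborel (\<lambda>x::real. inverse (1 + (x - c)\<^sup>2))"
  and integral_cauchy_shift: "(LINT x|lborel. inverse (1 + (x - c)\<^sup>2)) = (pi::real)"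
  using lborel_integrable_real_affine[OF integrable_cauchy, of 1 "- c"]
    lborel_integral_real_affine[of 1 "\<lambda>x. inverse (1 + x\<^sup>2)" "- c"] integral_cauchy
  by (simp_all add: algebra_simps)

lemma cauchy_pos [simp]: "0 < inverse (1 + x\<^sup>2)" for x :: real
  by (simp add: add_pos_nonneg)

lemma cauchy_nonneg [simp]: "0 \<le> inverse (1 + x\<^sup>2)" for x :: real
  by (simp add: add_nonneg_nonneg)

lemma LINT_cauchy_bound:
  fixes g :: "real \<Rightarrow> real"
  assumes m: "g \<in> borel_measurable borel" and b: "\<And>t. \<bar>g t\<bar> \<le> K * inverse (1 + (t - c)\<^sup>2)"
  shows "integrable lborel g" "\<bar>LINT t|lborel. g t\<bar> \<le> K * pi"
proof -
  show i: "integrable lborel g"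
    by (rule Bochner_Integration.integrable_bound[of _ "\<lambda>t. K * inverse (1 + (t - c)\<^sup>2)"])
       (use m b integrable_cauchy_shift in \<open>auto intro!: AE_I2 order_trans[OF b abs_ge_self]\<close>)
  have "\<bar>LINT t|lborel. g t\<bar> \<le> (LINT t|lborel. \<bar>g t\<bar>)" by (rule integral_abs_bound)
  also have "\<dots> \<le> (LINT t|lborel. K * inverse (1 + (t - c)\<^sup>2))"
    using i b integrable_cauchy_shift by (intro integral_mono) auto
  finally show "\<bar>LINT t|lborel. g t\<bar> \<le> K * pi" by (simp add: integral_cauchy_shift)
qed

section \<open>Exponential decay of the hyperbolic secant and of its tail transforms\<close>

definition sech :: "real \<Rightarrow> real \<Rightarrow> real" where "sech \<gamma> t = 1 / cosh (\<gamma> * t)"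

lemma sech_pos: "0 < sech \<gamma> t" by (simp add: sech_def)

lemma sech_cont [continuous_intros]: "continuous_on A (sech \<gamma>)"
  unfolding sech_def by (intro continuous_intros) auto

lemma sech_meas [measurable]: "sech \<gamma> \<in> borel_measurable borel"
  by (intro borel_measurable_continuous_onI continuous_intros)

lemma sech_even: "sech \<gamma> (- t) = sech \<gamma> t" by (simp add: sech_def)

text \<open>The sum of the bounds \<open>fact k / \<gamma> ^ k\<close> of
  \<open>s ^ k * exp (- \<gamma> * s)\<close> for \<open>k\<close> from 0 to 3, doubled because
  \<open>1 / cosh y\<close> is at most \<open>2 * exp (- y)\<close>.\<close>

definition sechC :: "real \<Rightarrow> real" where "sechC \<gamma> = 2 * (1 + 1 / \<gamma> + 2 / \<gamma>\<^sup>2 + 6 / \<gamma> ^ 3)"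

lemma sechC_pos: "\<gamma> > 0 \<Longrightarrow> sechC \<gamma> > 0"
  unfolding sechC_def by (intro mult_pos_pos add_pos_pos) auto

text \<open>Part of the exponential decay is kept as the factor \<open>exp (- \<gamma> * c)\<close>,
  which becomes the rate of the bias; the rest is traded for a Cauchy profile centred at
  \<open>c\<close>, whose integral is pi for every \<open>c\<close>.\<close>

lemma sech_bounds:
  assumes \<gamma>: "\<gamma> > 0" and t: "c \<le> t"
  shows "sech \<gamma> t \<le> sechC \<gamma> * exp (- \<gamma> * c) * inverse (1 + (t - c)\<^sup>2)"
    and "(t - c) * sech \<gamma> t \<le> sechC \<gamma> * exp (- \<gamma> * c) * inverse (1 + (t - c)\<^sup>2)"
proof -
  define s where "s = t - c"
  have s: "0 \<le> s" using t by (simp add: s_def)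
  have pw: "s ^ k * exp (- \<gamma> * s) \<le> fact k / \<gamma> ^ k" for k
    using power_le_fact_exp[of "\<gamma> * s" k] \<gamma> s by (simp add: field_simps exp_minus)
  have pw': "exp (- \<gamma> * s) \<le> 1" "s * exp (- \<gamma> * s) \<le> 1 / \<gamma>" "s\<^sup>2 * exp (- \<gamma> * s) \<le> 2 / \<gamma>\<^sup>2" "s ^ 3 * exp (- \<gamma> * s) \<le> 6 / \<gamma> ^ 3"
    using pw[of 0] pw[of 1] pw[of 2] pw[of 3] by (simp_all add: fact_numeral)
  have nn: "0 \<le> 1 / \<gamma>" "0 \<le> 2 / \<gamma>\<^sup>2" "0 \<le> 6 / \<gamma> ^ 3" using \<gamma> by auto
  have v: "sech \<gamma> t \<le> 2 * exp (- \<gamma> * c) * exp (- \<gamma> * s)"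
  proof -
    have "exp (\<gamma> * t) / 2 \<le> cosh (\<gamma> * t)" by (simp add: cosh_field_def)
    then have "sech \<gamma> t \<le> 1 / (exp (\<gamma> * t) / 2)" unfolding sech_def by (intro divide_left_mono) auto
    also have "\<dots> = 2 * exp (- \<gamma> * c) * exp (- \<gamma> * s)"
      by (simp add: s_def exp_minus field_simps flip: exp_add)
    finally show ?thesis .
  qed
  have half: "sechC \<gamma> / 2 = 1 + 1 / \<gamma> + 2 / \<gamma>\<^sup>2 + 6 / \<gamma> ^ 3" by (simp add: sechC_def)
  have k: "exp (- \<gamma> * s) * (1 + s\<^sup>2) \<le> sechC \<gamma> / 2" "s * exp (- \<gamma> * s) * (1 + s\<^sup>2) \<le> sechC \<gamma> / 2"
  proof -
    have "exp (- \<gamma> * s) * (1 + s\<^sup>2) = exp (- \<gamma> * s) + s\<^sup>2 * exp (- \<gamma> * s)" by (simp add: algebra_simps)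
    then show "exp (- \<gamma> * s) * (1 + s\<^sup>2) \<le> sechC \<gamma> / 2" using pw' nn unfolding half by linarith
    have "s * exp (- \<gamma> * s) * (1 + s\<^sup>2) = s * exp (- \<gamma> * s) + s ^ 3 * exp (- \<gamma> * s)"
      by (simp add: algebra_simps power2_eq_square power3_eq_cube)
    then show "s * exp (- \<gamma> * s) * (1 + s\<^sup>2) \<le> sechC \<gamma> / 2" using pw' nn unfolding half by linarith
  qed
  have p: "0 < 1 + s\<^sup>2" by (simp add: add_pos_nonneg)
  have k': "exp (- \<gamma> * s) \<le> sechC \<gamma> / 2 * inverse (1 + s\<^sup>2)" "s * exp (- \<gamma> * s) \<le> sechC \<gamma> / 2 * inverse (1 + s\<^sup>2)"
    unfolding divide_inverse[symmetric, of "sechC \<gamma> / 2"] pos_le_divide_eq[OF p] by (fact k)+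
  note v
  also have "2 * exp (- \<gamma> * c) * exp (- \<gamma> * s) \<le> 2 * exp (- \<gamma> * c) * (sechC \<gamma> / 2 * inverse (1 + s\<^sup>2))"
    by (intro mult_left_mono k') auto
  also have "\<dots> = sechC \<gamma> * exp (- \<gamma> * c) * inverse (1 + s\<^sup>2)" by simp
  finally show "sech \<gamma> t \<le> sechC \<gamma> * exp (- \<gamma> * c) * inverse (1 + (t - c)\<^sup>2)"
    unfolding s_def .
  have "s * sech \<gamma> t \<le> s * (2 * exp (- \<gamma> * c) * exp (- \<gamma> * s))" by (intro mult_left_mono v s)
  also have "\<dots> = 2 * exp (- \<gamma> * c) * (s * exp (- \<gamma> * s))" by simp
  also have "\<dots> \<le> 2 * exp (- \<gamma> * c) * (sechC \<gamma> / 2 * inverse (1 + s\<^sup>2))"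
    by (intro mult_left_mono k') auto
  also have "\<dots> = sechC \<gamma> * exp (- \<gamma> * c) * inverse (1 + s\<^sup>2)" by simp
  finally show "(t - c) * sech \<gamma> t \<le> sechC \<gamma> * exp (- \<gamma> * c) * inverse (1 + (t - c)\<^sup>2)"
    unfolding s_def .
qed

text \<open>Cosine transform of the ramp \<open>max 0 (t - c)\<close> times the transform of
  \<open>G_ker\<close>. The deviation of a trapezoidal window from 1 is a scaled difference of two
  such ramps, so the bias is a difference of two values of \<open>W\<close>.\<close>

definition W :: "real \<Rightarrow> real \<Rightarrow> real \<Rightarrow> real" where
  "W \<gamma> c x = (LINT t|lborel. (t - c) * sech \<gamma> t * cos (t * x) * indicator {c..} t)"

lemma W_integrable:
  assumes \<gamma>: "\<gamma> > 0"
  shows "integrable lborel (\<lambda>t. (t - c) * sech \<gamma> t * cos (t * x) * indicator {c..} t)"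
    and "\<bar>W \<gamma> c x\<bar> \<le> sechC \<gamma> * exp (- \<gamma> * c) * pi"
proof -
  have b: "\<bar>(t - c) * sech \<gamma> t * cos (t * x) * indicator {c..} t\<bar> \<le> sechC \<gamma> * exp (- \<gamma> * c) * inverse (1 + (t - c)\<^sup>2)" for t
  proof (cases "c \<le> t")
    case True
    have "\<bar>(t - c) * sech \<gamma> t * cos (t * x)\<bar> \<le> \<bar>(t - c) * sech \<gamma> t\<bar> * 1"
      unfolding abs_mult[of "(t - c) * sech \<gamma> t"] by (intro mult_left_mono) auto
    then show ?thesis using True sech_bounds(2)[OF \<gamma> True] sech_pos[of \<gamma> t] by simp
  next
    case False
    then show ?thesis using sechC_pos[OF \<gamma>] by simp
  qed
  show "integrable lborel (\<lambda>t. (t - c) * sech \<gamma> t * cos (t * x) * indicator {c..} t)"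
    by (rule LINT_cauchy_bound(1)[OF _ b]) measurable
  show "\<bar>W \<gamma> c x\<bar> \<le> sechC \<gamma> * exp (- \<gamma> * c) * pi"
    unfolding W_def by (rule LINT_cauchy_bound(2)[OF _ b]) measurable
qed

lemma LINT_Icc_lim:
  fixes g :: "real \<Rightarrow> real"
  assumes m [measurable]: "g \<in> borel_measurable borel"
    and b: "\<And>t. c \<le> t \<Longrightarrow> \<bar>g t\<bar> \<le> K * inverse (1 + (t - c)\<^sup>2)"
  shows "(\<lambda>n. LINT t|lborel. g t * indicator {c..c + real n} t) \<longlonglongrightarrow> (LINT t|lborel. g t * indicator {c..} t)"
proof -
  have K: "0 \<le> K" using b[of c] by (auto dest: order_trans[OF abs_ge_zero])
  show ?thesis
  proof (rule integral_dominated_convergence[where w = "\<lambda>t. K * inverse (1 + (t - c)\<^sup>2)"])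
    show "integrable lborel (\<lambda>t. K * inverse (1 + (t - c)\<^sup>2))" using integrable_cauchy_shift by simp
    show "AE t in lborel. (\<lambda>n. g t * indicator {c..c + real n} t) \<longlonglongrightarrow> g t * indicator {c..} t"
    proof (rule AE_I2, rule tendsto_eventually)
      fix t :: real
      obtain n0 where n0: "t - c \<le> real n0" using real_arch_simple by blast
      show "\<forall>\<^sub>F n in sequentially. g t * indicator {c..c + real n} t = g t * indicator {c..} t"
        using eventually_ge_at_top[of n0] by eventually_elim (use n0 in \<open>auto simp: indicator_def\<close>)
    qed
    show "AE t in lborel. norm (g t * indicator {c..c + real n} t) \<le> K * inverse (1 + (t - c)\<^sup>2)" for n
      using b K by (intro AE_I2) (auto simp: indicator_def)
  qed measurable
qed

text \<open>Two integrations by parts. The ramp vanishes at \<open>c\<close>, so the only boundary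
  term is \<open>sech \<gamma> c * cos (c * x)\<close>, and it carries the factor
  \<open>exp (- \<gamma> * c)\<close>, as do the first two derivatives. The resulting decay of order
  \<open>1 / x\<^sup>2\<close> makes the bias kernel integrable.\<close>

lemma W_decay:
  assumes \<gamma>: "\<gamma> > 0" and c: "0 \<le> c"
  shows "\<bar>x\<^sup>2 * W \<gamma> c x\<bar> \<le> sechC \<gamma> * exp (- \<gamma> * c) * (1 + (2 * \<gamma> + \<gamma>\<^sup>2) * pi)"
proof -
  define v where "v = sech \<gamma>"
  define th where "th t = tanh (\<gamma> * t)" for t
  define v1 where "v1 t = - \<gamma> * (v t * th t)" for t
  define v2 where "v2 t = \<gamma>\<^sup>2 * (v t * (2 * (th t)\<^sup>2 - 1))" for t
  define q where "q t = (t - c) * v t" for t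
  define q1 where "q1 t = v t + (t - c) * v1 t" for t
  define q2 where "q2 t = 2 * v1 t + (t - c) * v2 t" for t
  define E where "E = sechC \<gamma> * exp (- \<gamma> * c)"
  have E: "E > 0" using sechC_pos[OF \<gamma>] by (simp add: E_def)
  have v_pos: "v t > 0" for t by (simp add: v_def sech_pos)
  have dth: "(th has_real_derivative (1 - (th t)\<^sup>2) * \<gamma>) (at t)" for t
    unfolding th_def by (auto intro!: derivative_eq_intros simp: tanh_def field_simps power2_eq_square)
  have dv: "(v has_real_derivative v1 t) (at t)" for t
    unfolding v_def sech_def[abs_def] v1_def th_def
    by (auto intro!: derivative_eq_intros simp: tanh_def sech_def field_simps power2_eq_square)
  have dv1: "(v1 has_real_derivative v2 t) (at t)" for t
    unfolding v1_def v2_def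
    by (rule derivative_eq_intros dv dth refl)+ (simp add: v1_def power2_eq_square algebra_simps)
  have dq: "(q has_real_derivative q1 t) (at t)" for t
    unfolding q_def q1_def by (auto intro!: derivative_eq_intros dv)
  have dq1: "(q1 has_real_derivative q2 t) (at t)" for t
    unfolding q1_def q2_def by (auto intro!: derivative_eq_intros dv dv1)
  \<comment> \<open>A single antiderivative that performs both integrations by parts; its value at
    \<open>c\<close> is the boundary term.\<close>
  define F where "F t = x * q t * sin (t * x) + q1 t * cos (t * x)" for t
  have dF: "(F has_real_derivative (x\<^sup>2 * q t * cos (t * x) + q2 t * cos (t * x))) (at t)" for t
    unfolding F_def by (auto intro!: derivative_eq_intros dq dq1 simp: power2_eq_square algebra_simps)
  have th1: "\<bar>th t\<bar> \<le> 1" for t using tanh_real_bounds[of "\<gamma> * t"] by (auto simp: th_def)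
  have cont: "isCont q t" "isCont q1 t" "isCont v t" "isCont v1 t" "isCont th t" for t
    using dq dq1 dv dv1 dth by (blast intro: DERIV_isCont)+
  have cont2: "isCont q2 t" for t
    unfolding q2_def v2_def by (intro continuous_intros cont)
  have [measurable]: "q \<in> borel_measurable borel" "q2 \<in> borel_measurable borel"
    by (intro borel_measurable_continuous_onI continuous_at_imp_continuous_on ballI cont cont2)+
  have b1: "\<bar>v1 t\<bar> \<le> \<gamma> * v t" for t
  proof -
    have "\<bar>v1 t\<bar> = \<gamma> * v t * \<bar>th t\<bar>" using \<gamma> v_pos[of t] by (simp add: v1_def abs_mult)
    also have "\<dots> \<le> \<gamma> * v t * 1" using \<gamma> v_pos[of t] th1 by (intro mult_left_mono) auto
    finally show ?thesis by simp
  qed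
  have b2: "\<bar>v2 t\<bar> \<le> \<gamma>\<^sup>2 * v t" for t
  proof -
    have "(th t)\<^sup>2 \<le> 1" using th1[of t] by (simp add: abs_square_le_1)
    moreover have "0 \<le> (th t)\<^sup>2" by simp
    ultimately have "\<bar>2 * (th t)\<^sup>2 - 1\<bar> \<le> 1" by (simp only: abs_le_iff) linarith
    then have "\<gamma>\<^sup>2 * v t * \<bar>2 * (th t)\<^sup>2 - 1\<bar> \<le> \<gamma>\<^sup>2 * v t * 1"
      using v_pos[of t] by (intro mult_left_mono) auto
    then show ?thesis using v_pos[of t] by (simp add: v2_def abs_mult)
  qed
  have vb: "v t \<le> E * inverse (1 + (t - c)\<^sup>2)" "q t \<le> E * inverse (1 + (t - c)\<^sup>2)" "0 \<le> q t" if "c \<le> t" for t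
    using sech_bounds[OF \<gamma> that] that v_pos[of t] by (simp_all add: v_def q_def E_def)
  have q1b: "\<bar>q1 t\<bar> \<le> (1 + \<gamma>) * (E * inverse (1 + (t - c)\<^sup>2))" if t: "c \<le> t" for t
  proof -
    have "\<bar>q1 t\<bar> \<le> v t + (t - c) * (\<gamma> * v t)"
      unfolding q1_def using v_pos[of t] t mult_left_mono[OF b1[of t], of "t - c"]
      by (intro order_trans[OF abs_triangle_ineq]) (auto simp: abs_mult)
    also have "\<dots> = v t + \<gamma> * q t" by (simp add: q_def)
    also have "\<dots> \<le> E * inverse (1 + (t - c)\<^sup>2) + \<gamma> * (E * inverse (1 + (t - c)\<^sup>2))"
      using \<gamma> vb[OF t] by (intro add_mono mult_left_mono) auto
    finally show ?thesis by (simp add: algebra_simps)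
  qed
  have q2b: "\<bar>q2 t\<bar> \<le> (2 * \<gamma> + \<gamma>\<^sup>2) * E * inverse (1 + (t - c)\<^sup>2)" if t: "c \<le> t" for t
  proof -
    have "\<bar>q2 t\<bar> \<le> 2 * (\<gamma> * v t) + (t - c) * (\<gamma>\<^sup>2 * v t)"
      unfolding q2_def using b1[of t] t mult_left_mono[OF b2[of t], of "t - c"]
      by (intro order_trans[OF abs_triangle_ineq]) (auto simp: abs_mult)
    also have "\<dots> = 2 * \<gamma> * v t + \<gamma>\<^sup>2 * q t" by (simp add: q_def)
    also have "\<dots> \<le> 2 * \<gamma> * (E * inverse (1 + (t - c)\<^sup>2)) + \<gamma>\<^sup>2 * (E * inverse (1 + (t - c)\<^sup>2))"
      using \<gamma> vb[OF t] by (intro add_mono mult_left_mono) auto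
    finally show ?thesis by (simp add: algebra_simps)
  qed
  have cosb: "\<bar>y * cos z\<bar> \<le> \<bar>y\<bar>" for y z :: real
    unfolding abs_mult using mult_left_mono[of "\<bar>cos z\<bar>" 1 "\<bar>y\<bar>"] by simp
  have sinb: "\<bar>y * sin z\<bar> \<le> \<bar>y\<bar>" for y z :: real
    unfolding abs_mult using mult_left_mono[of "\<bar>sin z\<bar>" 1 "\<bar>y\<bar>"] by simp
  have l1: "(\<lambda>n. LINT t|lborel. (x\<^sup>2 * q t * cos (t * x)) * indicator {c..c + real n} t) \<longlonglongrightarrow>
     (LINT t|lborel. (x\<^sup>2 * q t * cos (t * x)) * indicator {c..} t)"
  proof (rule LINT_Icc_lim[where K = "x\<^sup>2 * E"])
    fix t assume t: "c \<le> t"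
    have "\<bar>x\<^sup>2 * q t * cos (t * x)\<bar> \<le> x\<^sup>2 * q t" using cosb[of "x\<^sup>2 * q t" "t * x"] vb(3)[OF t] by simp
    also have "\<dots> \<le> x\<^sup>2 * (E * inverse (1 + (t - c)\<^sup>2))" by (intro mult_left_mono vb t) auto
    finally show "\<bar>x\<^sup>2 * q t * cos (t * x)\<bar> \<le> x\<^sup>2 * E * inverse (1 + (t - c)\<^sup>2)" by simp
  qed measurable
  have l2: "(\<lambda>n. LINT t|lborel. (q2 t * cos (t * x)) * indicator {c..c + real n} t) \<longlonglongrightarrow>
     (LINT t|lborel. (q2 t * cos (t * x)) * indicator {c..} t)"
    by (rule LINT_Icc_lim[where K = "(2 * \<gamma> + \<gamma>\<^sup>2) * E"]) (measurable, rule order_trans[OF cosb q2b])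
  have F_lim: "(\<lambda>n. F (c + real n)) \<longlonglongrightarrow> 0"
  proof (rule Lim_null_comparison)
    show "\<forall>\<^sub>F n in sequentially. norm (F (c + real n)) \<le> (\<bar>x\<bar> + 1 + \<gamma>) * E * inverse (1 + (real n)\<^sup>2)"
    proof (intro always_eventually allI)
      fix n
      define t where "t = c + real n"
      have t: "c \<le> t" "t - c = real n" by (auto simp: t_def)
      have "\<bar>F t\<bar> \<le> \<bar>x * q t\<bar> + \<bar>q1 t\<bar>" unfolding F_def
        using sinb[of "x * q t" "t * x"] cosb[of "q1 t" "t * x"] by (intro order_trans[OF abs_triangle_ineq]) auto
      also have "\<dots> \<le> \<bar>x\<bar> * (E * inverse (1 + (t - c)\<^sup>2)) + (1 + \<gamma>) * (E * inverse (1 + (t - c)\<^sup>2))"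
        unfolding abs_mult using vb[OF t(1)] by (intro add_mono mult_left_mono q1b t) auto
      also have "\<dots> = (\<bar>x\<bar> + 1 + \<gamma>) * E * inverse (1 + (t - c)\<^sup>2)" by (simp add: algebra_simps)
      finally show "norm (F (c + real n)) \<le> (\<bar>x\<bar> + 1 + \<gamma>) * E * inverse (1 + (real n)\<^sup>2)"
        using t by (simp add: t_def)
    qed
    have nsq: "real n \<le> 1 + (real n)\<^sup>2" for n
      using zero_le_power2[of "real n - 1"] by (simp add: power2_diff)
    have "filterlim (\<lambda>n. 1 + (real n)\<^sup>2) at_top sequentially"
      by (rule filterlim_at_top_mono[OF filterlim_real_sequentially])
         (rule always_eventually, rule allI, rule nsq)
    then have "(\<lambda>n. inverse (1 + (real n)\<^sup>2)) \<longlonglongrightarrow> 0"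
      by (rule tendsto_inverse_0_at_top)
    then show "(\<lambda>n. (\<bar>x\<bar> + 1 + \<gamma>) * E * inverse (1 + (real n)\<^sup>2)) \<longlonglongrightarrow> 0"
      using tendsto_mult_right_zero by blast
  qed
  have eqn: "(LINT t|lborel. (x\<^sup>2 * q t * cos (t * x)) * indicator {c..c + real n} t) +
      (LINT t|lborel. (q2 t * cos (t * x)) * indicator {c..c + real n} t) = F (c + real n) - v c * cos (c * x)" for n
  proof -
    have ii: "integrable lborel (\<lambda>t. g t * indicator {c..c + real n} t)" if "\<And>t. isCont g t" for g :: "real \<Rightarrow> real"
    proof -
      have "set_integrable lborel {c..c + real n} g"
        by (intro borel_integrable_atLeastAtMost' continuous_at_imp_continuous_on ballI that)
      then show ?thesis by (simp add: set_integrable_def mult.commute)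
    qed
    have "(LINT t|lborel. (x\<^sup>2 * q t * cos (t * x)) * indicator {c..c + real n} t) +
      (LINT t|lborel. (q2 t * cos (t * x)) * indicator {c..c + real n} t) =
      (LINT t|lborel. (x\<^sup>2 * q t * cos (t * x) + q2 t * cos (t * x)) * indicator {c..c + real n} t)"
      by (subst Bochner_Integration.integral_add[symmetric])
         (auto intro!: ii continuous_intros cont cont2 simp: distrib_right)
    also have "\<dots> = F (c + real n) - F c"
      by (rule integral_FTC_Icc_real) (auto intro!: dF continuous_intros cont cont2)
    also have "F c = v c * cos (c * x)" by (simp add: F_def q_def q1_def)
    finally show ?thesis .
  qed
  have "(\<lambda>n. F (c + real n) - v c * cos (c * x)) \<longlonglongrightarrow> (LINT t|lborel. (x\<^sup>2 * q t * cos (t * x)) * indicator {c..} t) +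
      (LINT t|lborel. (q2 t * cos (t * x)) * indicator {c..} t)"
    using tendsto_add[OF l1 l2] unfolding eqn .
  moreover have "(\<lambda>n. F (c + real n) - v c * cos (c * x)) \<longlonglongrightarrow> 0 - v c * cos (c * x)"
    by (intro tendsto_intros F_lim)
  ultimately have "(LINT t|lborel. (x\<^sup>2 * q t * cos (t * x)) * indicator {c..} t) +
      (LINT t|lborel. (q2 t * cos (t * x)) * indicator {c..} t) = 0 - v c * cos (c * x)"
    by (rule LIMSEQ_unique)
  moreover have "(LINT t|lborel. (x\<^sup>2 * q t * cos (t * x)) * indicator {c..} t) = x\<^sup>2 * W \<gamma> c x"
    unfolding W_def q_def v_def by (subst integral_mult_right_zero[symmetric]) (simp add: mult.assoc)
  ultimately have "x\<^sup>2 * W \<gamma> c x = - (v c * cos (c * x)) - (LINT t|lborel. (q2 t * cos (t * x)) * indicator {c..} t)" by simp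
  also have "\<bar>\<dots>\<bar> \<le> \<bar>v c * cos (c * x)\<bar> + \<bar>LINT t|lborel. (q2 t * cos (t * x)) * indicator {c..} t\<bar>" by linarith
  also have "\<dots> \<le> E + (2 * \<gamma> + \<gamma>\<^sup>2) * E * pi"
  proof (rule add_mono)
    show "\<bar>v c * cos (c * x)\<bar> \<le> E" using cosb[of "v c" "c * x"] vb(1)[of c] v_pos[of c] by simp
    show "\<bar>LINT t|lborel. (q2 t * cos (t * x)) * indicator {c..} t\<bar> \<le> (2 * \<gamma> + \<gamma>\<^sup>2) * E * pi"
    proof (rule LINT_cauchy_bound(2)[where c = c])
      show "\<bar>q2 t * cos (t * x) * indicator {c..} t\<bar> \<le> (2 * \<gamma> + \<gamma>\<^sup>2) * E * inverse (1 + (t - c)\<^sup>2)" for t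
        using order_trans[OF cosb q2b[of t]] \<gamma> E by (auto simp: indicator_def)
    qed measurable
  qed
  finally show ?thesis by (simp add: E_def algebra_simps)
qed

lemma norm_mono_nonneg: "0 \<le> a \<Longrightarrow> a \<le> b \<Longrightarrow> norm a \<le> norm b" for a b :: real
  by simp

lemma fubini_lborel:
  fixes F :: "real \<Rightarrow> real \<Rightarrow> real"
  assumes m [measurable]: "(\<lambda>(x, y). F x y) \<in> borel_measurable (borel \<Otimes>\<^sub>M borel)"
    and i: "\<And>x. integrable lborel (F x)" and b: "\<And>x. (LINT y|lborel. \<bar>F x y\<bar>) \<le> a x" and a: "integrable lborel a"
  shows "(LINT x|lborel. LINT y|lborel. F x y) = (LINT y|lborel. LINT x|lborel. F x y)"
proof -
  have m' [measurable]: "(\<lambda>(x, y). F x y) \<in> borel_measurable (lborel \<Otimes>\<^sub>M lborel)" by simp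
  have "integrable (lborel \<Otimes>\<^sub>M lborel) (\<lambda>(x, y). F x y)"
  proof (rule lborel_pair.Fubini_integrable)
    show "integrable lborel (\<lambda>x. LINT y|lborel. norm (case (x, y) of (x, y) \<Rightarrow> F x y))"
    proof (rule Bochner_Integration.integrable_bound[OF a])
      show "AE x in lborel. norm (LINT y|lborel. norm (case (x, y) of (x, y) \<Rightarrow> F x y)) \<le> norm (a x)"
        using b by (auto intro!: AE_I2 order_trans[OF b abs_ge_self])
    qed simp
  qed (use i in auto)
  from lborel_pair.Fubini_integral[OF this] show ?thesis by simp
qed

lemma integral_even_half:
  fixes g :: "real \<Rightarrow> real"
  assumes i: "integrable lborel g" and e: "\<And>t. g (- t) = g t"
  shows "(LINT t|lborel. g t * indicator {0..} t) = (LINT t|lborel. g t) / 2"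
proof -
  note [measurable] = borel_measurable_integrable[OF i]
  have ii: "integrable lborel (\<lambda>t. g t * indicator S t)" if "S \<in> sets borel" for S
    using integrable_mult_indicator[OF _ i, of S] that by (simp add: mult.commute)
  have "(LINT t|lborel. g t) = (LINT t|lborel. g t * indicator {0..} t + g t * indicator {..<0} t)"
    by (intro Bochner_Integration.integral_cong refl) (auto simp: indicator_def)
  also have "\<dots> = (LINT t|lborel. g t * indicator {0..} t) + (LINT t|lborel. g t * indicator {..<0} t)"
    by (intro Bochner_Integration.integral_add ii) auto
  also have "(LINT t|lborel. g t * indicator {..<0} t) = (LINT t|lborel. g t * indicator {0<..} t)"
    by (subst lborel_integral_real_affine[of "-1" _ 0])
       (auto simp: e indicator_def intro!: Bochner_Integration.integral_cong)
  also have "\<dots> = (LINT t|lborel. g t * indicator {0..} t)"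
    by (intro integral_cong_AE) (use AE_lborel_singleton[of "0::real"] in \<open>auto simp: indicator_def elim!: eventually_mono\<close>)
  finally show ?thesis by simp
qed

section \<open>The kernel \<open>G_ker\<close> and its cosine transform\<close>

lemma G_ker_eq: "G_ker \<gamma> y = sech (pi / (2 * \<gamma>)) y / (2 * \<gamma>)"
  by (simp add: G_ker_def sech_def field_simps)

lemma G_ker_even: "G_ker \<gamma> (- y) = G_ker \<gamma> y"
  by (simp add: G_ker_eq sech_even)

lemma G_ker_meas [measurable]: "G_ker \<gamma> \<in> borel_measurable borel"
  unfolding G_ker_eq[abs_def] by measurable

lemma G_ker_pos: "\<gamma> > 0 \<Longrightarrow> 0 < G_ker \<gamma> y"
  by (simp add: G_ker_def)

lemma G_ker_le: "\<gamma> > 0 \<Longrightarrow> G_ker \<gamma> y \<le> 1 / (2 * \<gamma>)"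
  unfolding G_ker_def using cosh_real_ge_1[of "pi * y / (2 * \<gamma>)"] by (intro divide_left_mono) auto

lemma integrable_sech': "c > 0 \<Longrightarrow> integrable lborel (sech c)"
  using lborel_integrable_real_affine[OF integrable_sech, of c 0] by (simp add: sech_def[abs_def])

lemma fourier_sech': "c > 0 \<Longrightarrow> (LINT y|lborel. cos (t * y) * sech c y) = pi / (c * cosh (pi * t / (2 * c)))"
proof -
  assume c: "c > 0"
  have "pi / cosh (pi * (t / c) / 2) = (LINT x|lborel. cos (t / c * x) / cosh x)" by (rule fourier_sech[symmetric])
  also have "\<dots> = c * (LINT x|lborel. cos (t / c * (0 + c * x)) / cosh (0 + c * x))"
    using c by (subst lborel_integral_real_affine[of c _ 0]) auto
  also have "(\<lambda>x. cos (t / c * (0 + c * x)) / cosh (0 + c * x)) = (\<lambda>x. cos (t * x) * sech c x)"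
    using c by (simp add: sech_def)
  finally show ?thesis using c by (simp add: field_simps)
qed

lemma G_ker_integrable: "\<gamma> > 0 \<Longrightarrow> integrable lborel (G_ker \<gamma>)"
  unfolding G_ker_eq[abs_def] using integrable_sech'[of "pi / (2 * \<gamma>)"] by simp

lemma cos_G_integrable: "\<gamma> > 0 \<Longrightarrow> integrable lborel (\<lambda>y. cos (g y) * G_ker \<gamma> y)"
  if [measurable]: "g \<in> borel_measurable borel" for g
  by (rule Bochner_Integration.integrable_bound[OF G_ker_integrable])
     (auto simp: abs_mult mult_left_le_one_le)

lemma G_ker_fourier:
  assumes \<gamma>: "\<gamma> > 0" shows "(LINT y|lborel. cos (t * y) * G_ker \<gamma> y) = sech \<gamma> t"
proof -
  have "(LINT y|lborel. cos (t * y) * G_ker \<gamma> y) = (LINT y|lborel. cos (t * y) * sech (pi / (2 * \<gamma>)) y / (2 * \<gamma>))"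
    by (simp add: G_ker_eq)
  also have "\<dots> = (LINT y|lborel. cos (t * y) * sech (pi / (2 * \<gamma>)) y) / (2 * \<gamma>)" by simp
  also have "\<dots> = sech \<gamma> t"
    using \<gamma> by (subst fourier_sech') (auto simp: sech_def field_simps)
  finally show ?thesis .
qed

lemma G_ker_integral: "\<gamma> > 0 \<Longrightarrow> (LINT y|lborel. G_ker \<gamma> y) = 1"
  using G_ker_fourier[of \<gamma> 0] by (simp add: sech_def)

lemma G_ker_conv_cos:
  assumes \<gamma>: "\<gamma> > 0" shows "(LINT y|lborel. cos (t * (x - y)) * G_ker \<gamma> y) = cos (t * x) * sech \<gamma> t"
proof -
  have isn: "integrable lborel (\<lambda>y. sin (t * y) * G_ker \<gamma> y)"
    by (rule Bochner_Integration.integrable_bound[OF G_ker_integrable[OF \<gamma>]])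
       (auto simp: abs_mult mult_left_le_one_le)
  have "(LINT y|lborel. sin (t * y) * G_ker \<gamma> y) = - (LINT y|lborel. sin (t * y) * G_ker \<gamma> y)"
    by (subst lborel_integral_real_affine[of "-1" _ 0]) (auto simp: G_ker_even)
  then have s0: "(LINT y|lborel. sin (t * y) * G_ker \<gamma> y) = 0" by simp
  have "(LINT y|lborel. cos (t * (x - y)) * G_ker \<gamma> y) =
    (LINT y|lborel. cos (t * x) * (cos (t * y) * G_ker \<gamma> y) + sin (t * x) * (sin (t * y) * G_ker \<gamma> y))"
    by (intro Bochner_Integration.integral_cong refl) (simp add: right_diff_distrib cos_diff algebra_simps)
  also have "\<dots> = cos (t * x) * (LINT y|lborel. cos (t * y) * G_ker \<gamma> y) + sin (t * x) * (LINT y|lborel. sin (t * y) * G_ker \<gamma> y)"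
    using isn cos_G_integrable[OF _ \<gamma>, of "\<lambda>y. t * y"] by simp
  finally show ?thesis by (simp add: s0 G_ker_fourier[OF \<gamma>])
qed

text \<open>Up to scaling the hyperbolic secant is its own transform, so inversion is the same
  integral with the roles of \<open>x\<close> and \<open>t\<close> exchanged; restricting to the
  half-line halves it.\<close>

lemma G_ker_inverse_fourier:
  assumes \<gamma>: "\<gamma> > 0"
  shows "integrable lborel (\<lambda>t. sech \<gamma> t * cos (t * x) * indicator {0..} t)"
    and "(LINT t|lborel. sech \<gamma> t * cos (t * x) * indicator {0..} t) = pi * G_ker \<gamma> x"
proof -
  have i: "integrable lborel (\<lambda>t. sech \<gamma> t * cos (t * x))"
    by (rule Bochner_Integration.integrable_bound[OF integrable_sech'[OF \<gamma>]])
       (use sech_pos[of \<gamma>] in \<open>auto simp: abs_mult mult_right_le_one_le\<close>)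
  show "integrable lborel (\<lambda>t. sech \<gamma> t * cos (t * x) * indicator {0..} t)"
    using integrable_mult_indicator[OF _ i, of "{0..}"] by (simp add: mult.commute)
  have "(LINT t|lborel. sech \<gamma> t * cos (t * x) * indicator {0..} t) = (LINT t|lborel. sech \<gamma> t * cos (t * x)) / 2"
    by (rule integral_even_half[OF i]) (simp add: sech_even)
  also have "(LINT t|lborel. sech \<gamma> t * cos (t * x)) = (LINT t|lborel. cos (x * t) * sech \<gamma> t)"
    by (simp add: mult.commute)
  also have "\<dots> / 2 = pi * G_ker \<gamma> x" using \<gamma> by (simp add: fourier_sech' G_ker_def)
  finally show "(LINT t|lborel. sech \<gamma> t * cos (t * x) * indicator {0..} t) = pi * G_ker \<gamma> x" .
qed

section \<open>Fejer and de la Vallee Poussin kernels and their convolution with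
  \<open>G_ker\<close>\<close>

definition fejer :: "real \<Rightarrow> real \<Rightarrow> real" where "fejer c z = (1 - cos (c * z)) / z\<^sup>2"

lemma fejer_meas [measurable]: "fejer c \<in> borel_measurable borel"
  unfolding fejer_def[abs_def] by measurable

lemma fejer_bounds: "0 \<le> fejer c z" "fejer c z \<le> c\<^sup>2 / 2" "fejer c z * z\<^sup>2 \<le> 2"
proof -
  show "0 \<le> fejer c z" by (simp add: fejer_def)
  have "1 - cos (c * z) = 2 * (sin (c * z / 2))\<^sup>2" using cos_double_sin[of "c * z / 2"] by simp
  also have "\<dots> \<le> 2 * (c * z / 2)\<^sup>2"
    by (intro mult_left_mono abs_le_square_iff[THEN iffD1] abs_sin_x_le_abs_x) auto
  finally have "1 - cos (c * z) \<le> c\<^sup>2 / 2 * z\<^sup>2" by (simp add: power_mult_distrib power_divide)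
  then show "fejer c z \<le> c\<^sup>2 / 2" by (cases "z = 0") (auto simp: fejer_def pos_divide_le_eq)
  show "fejer c z * z\<^sup>2 \<le> 2" using cos_ge_minus_one[of "c * z"] by (auto simp: fejer_def)
qed

lemma fejer_le: "fejer c z \<le> (c\<^sup>2 / 2 + 2) * inverse (1 + z\<^sup>2)"
proof -
  have p: "0 < 1 + z\<^sup>2" by (simp add: add_pos_nonneg)
  have "fejer c z * (1 + z\<^sup>2) \<le> c\<^sup>2 / 2 + 2" using fejer_bounds[of c z] by (simp add: distrib_left)
  then show ?thesis unfolding divide_inverse[symmetric] pos_le_divide_eq[OF p] .
qed

lemma fejer_integrable: "integrable lborel (fejer c)"
  by (rule LINT_cauchy_bound(1)[where c = 0 and K = "c\<^sup>2 / 2 + 2"])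
     (use fejer_le fejer_bounds in auto)

lemma fejer_fourier:
  assumes c: "0 \<le> c" and z: "z \<noteq> 0"
  shows "(LINT t|lborel. (c - t) * cos (t * z) * indicator {0..c} t) = fejer c z"
proof -
  have "(LINT t|lborel. (c - t) * cos (t * z) * indicator {0..c} t) =
     ((c - c) * sin (c * z) / z - cos (c * z) / z\<^sup>2) - ((c - 0) * sin (0 * z) / z - cos (0 * z) / z\<^sup>2)"
  proof (rule integral_FTC_Icc_real[OF c])
    show "((\<lambda>t. (c - t) * sin (t * z) / z - cos (t * z) / z\<^sup>2) has_real_derivative (c - t) * cos (t * z)) (at t)" for t
      using z by (auto intro!: derivative_eq_intros simp: power2_eq_square field_simps)
  qed (auto intro!: continuous_intros)
  then show ?thesis by (simp add: fejer_def diff_divide_distrib)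
qed

text \<open>The Fejer kernel is the cosine integral of a triangle; exchanging the integrals
  multiplies the triangle by the transform of \<open>G_ker\<close>. The term
  \<open>W \<gamma> 0 x\<close> does not depend on \<open>c\<close> and cancels when two such
  formulas are subtracted.\<close>

lemma fejer_conv_G:
  assumes \<gamma>: "\<gamma> > 0" and c: "0 \<le> c"
  shows "integrable lborel (\<lambda>y. fejer c (x - y) * G_ker \<gamma> y)"
    and "(LINT y|lborel. fejer c (x - y) * G_ker \<gamma> y) = c * (pi * G_ker \<gamma> x) - W \<gamma> 0 x + W \<gamma> c x"
proof -
  show "integrable lborel (\<lambda>y. fejer c (x - y) * G_ker \<gamma> y)"
  proof (rule Bochner_Integration.integrable_bound)
    show "integrable lborel (\<lambda>y. c\<^sup>2 / 2 * G_ker \<gamma> y)" using G_ker_integrable[OF \<gamma>] by simp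
    show "AE y in lborel. norm (fejer c (x - y) * G_ker \<gamma> y) \<le> norm (c\<^sup>2 / 2 * G_ker \<gamma> y)"
      by (intro AE_I2 norm_mono_nonneg mult_nonneg_nonneg mult_right_mono fejer_bounds less_imp_le[OF G_ker_pos[OF \<gamma>]])
  qed measurable
  define F where "F y t = (c - t) * cos (t * (x - y)) * indicator {0..c} t * G_ker \<gamma> y" for y t
  have Fb: "\<bar>F y t\<bar> \<le> c * indicator {0..c} t * G_ker \<gamma> y" for y t
    using G_ker_pos[OF \<gamma>, of y] mult_mono[of "c - t" c "\<bar>cos (t * (x - y))\<bar>" 1] c
    by (auto simp: F_def indicator_def abs_mult intro!: mult_right_mono)
  have Fi: "integrable lborel (F y)" "(LINT t|lborel. \<bar>F y t\<bar>) \<le> c\<^sup>2 * G_ker \<gamma> y" for y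
  proof -
    have "integrable lborel (indicator {0..c} :: real \<Rightarrow> real)"
      by (rule integrable_real_indicator) (use c in \<open>auto simp: emeasure_lborel_Icc\<close>)
    then have i: "integrable lborel (\<lambda>t. c * indicator {0..c} t * G_ker \<gamma> y)" by simp
    show ii: "integrable lborel (F y)"
      by (rule Bochner_Integration.integrable_bound[OF i])
         (auto simp: F_def[abs_def] intro!: AE_I2 order_trans[OF Fb[unfolded F_def] abs_ge_self])
    have "(LINT t|lborel. \<bar>F y t\<bar>) \<le> (LINT t|lborel. c * indicator {0..c} t * G_ker \<gamma> y)"
      by (intro integral_mono integrable_abs ii i Fb)
    also have "\<dots> = c\<^sup>2 * G_ker \<gamma> y" using c by (simp add: power2_eq_square)
    finally show "(LINT t|lborel. \<bar>F y t\<bar>) \<le> c\<^sup>2 * G_ker \<gamma> y" .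
  qed
  have "(LINT y|lborel. fejer c (x - y) * G_ker \<gamma> y) = (LINT y|lborel. LINT t|lborel. F y t)"
  proof (rule integral_cong_AE)
    \<comment> \<open>At \<open>y = x\<close> division by zero gives \<open>fejer\<close> the value
      0 in place of the limit \<open>c\<^sup>2 / 2\<close>, so the identity holds only off a null
      set.\<close>
    have "AE y in lborel. y \<noteq> x" by (rule AE_lborel_singleton)
    then show "AE y in lborel. fejer c (x - y) * G_ker \<gamma> y = (LINT t|lborel. F y t)"
    proof eventually_elim
      case (elim y)
      then show ?case unfolding F_def by (simp add: fejer_fourier[OF c, of "x - y"])
    qed
  qed (auto simp: F_def)
  also have "\<dots> = (LINT t|lborel. LINT y|lborel. F y t)"
    by (rule fubini_lborel[OF _ Fi]) (use G_ker_integrable[OF \<gamma>] in \<open>auto simp: F_def[abs_def]\<close>)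
  also have "\<dots> = (LINT t|lborel. (c - t) * indicator {0..c} t * (cos (t * x) * sech \<gamma> t))"
  proof (rule Bochner_Integration.integral_cong[OF refl])
    fix t
    have "(LINT y|lborel. F y t) = (LINT y|lborel. (c - t) * indicator {0..c} t * (cos (t * (x - y)) * G_ker \<gamma> y))"
      unfolding F_def by (intro Bochner_Integration.integral_cong) auto
    then show "(LINT y|lborel. F y t) = (c - t) * indicator {0..c} t * (cos (t * x) * sech \<gamma> t)"
      using G_ker_conv_cos[OF \<gamma>] by simp
  qed
  \<comment> \<open>On the half-line the triangle \<open>max 0 (c - t)\<close> equals
    \<open>c - t\<close> plus the ramp \<open>max 0 (t - c)\<close>.\<close>
  also have "\<dots> = (LINT t|lborel. c * (sech \<gamma> t * cos (t * x) * indicator {0..} t) - 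
      (t - 0) * sech \<gamma> t * cos (t * x) * indicator {0..} t + (t - c) * sech \<gamma> t * cos (t * x) * indicator {c..} t)"
    using c by (intro Bochner_Integration.integral_cong refl) (auto simp: indicator_def algebra_simps)
  also have "\<dots> = c * (pi * G_ker \<gamma> x) - W \<gamma> 0 x + W \<gamma> c x"
    using G_ker_inverse_fourier[OF \<gamma>, of x] W_integrable(1)[OF \<gamma>, of 0 x] W_integrable(1)[OF \<gamma>, of c x]
    unfolding W_def by simp
  finally show "(LINT y|lborel. fejer c (x - y) * G_ker \<gamma> y) = c * (pi * G_ker \<gamma> x) - W \<gamma> 0 x + W \<gamma> c x" .
qed

text \<open>The de la Vallee Poussin kernel: its transform is 1 up to frequency \<open>N\<close>, 0
  beyond \<open>N'\<close> and linear in between.\<close>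

definition vp :: "real \<Rightarrow> real \<Rightarrow> real \<Rightarrow> real" where
  "vp N N' z = (fejer N' z - fejer N z) / (pi * (N' - N))"

lemma vp_meas [measurable]: "vp N N' \<in> borel_measurable borel"
  unfolding vp_def[abs_def] by measurable

lemma vp_integrable: "integrable lborel (vp N N')"
  unfolding vp_def[abs_def] using fejer_integrable by simp

text \<open>The constants of \<open>W_integrable\<close> and \<open>W_decay\<close> added, then
  doubled for the two cut-offs.\<close>

definition biasC :: "real \<Rightarrow> real" where "biasC \<gamma> = 2 * sechC \<gamma> * (1 + (1 + 2 * \<gamma> + \<gamma>\<^sup>2) * pi)"

lemma biasC_pos: "\<gamma> > 0 \<Longrightarrow> biasC \<gamma> > 0"
  unfolding biasC_def using sechC_pos[of \<gamma>] by (intro mult_pos_pos add_pos_nonneg) auto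

text \<open>In the difference of the two Fejer convolutions only the ramps beyond \<open>N\<close>
  survive. A slope of length at least 1 keeps the division by \<open>N' - N\<close> from enlarging
  them, and adding the bounds of \<open>W\<close> and \<open>x\<^sup>2 * W\<close> yields a Cauchy
  profile in \<open>x\<close>.\<close>

theorem vp_conv_G:
  assumes \<gamma>: "\<gamma> > 0" and N: "0 \<le> N" "N + 1 \<le> N'"
  shows "\<bar>(LINT y|lborel. vp N N' (x - y) * G_ker \<gamma> y) - G_ker \<gamma> x\<bar> \<le> biasC \<gamma> * exp (- \<gamma> * N) * inverse (1 + x\<^sup>2)"
proof -
  have d: "N' - N > 0" "0 \<le> N'" "1 \<le> N' - N" using N by auto
  have "(LINT y|lborel. vp N N' (x - y) * G_ker \<gamma> y) = 
    (LINT y|lborel. fejer N' (x - y) * G_ker \<gamma> y - fejer N (x - y) * G_ker \<gamma> y) / (pi * (N' - N))"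
    unfolding vp_def by (subst integral_divide_zero[symmetric]) (simp add: left_diff_distrib diff_divide_distrib)
  also have "\<dots> = ((N' - N) * (pi * G_ker \<gamma> x) + W \<gamma> N' x - W \<gamma> N x) / (pi * (N' - N))"
    using fejer_conv_G[OF \<gamma> N(1), of x] fejer_conv_G[OF \<gamma> d(2), of x] by (simp add: algebra_simps)
  also have "\<dots> = G_ker \<gamma> x + (W \<gamma> N' x - W \<gamma> N x) / (pi * (N' - N))"
    using d by (simp add: field_simps)
  finally have eq: "(LINT y|lborel. vp N N' (x - y) * G_ker \<gamma> y) - G_ker \<gamma> x = (W \<gamma> N' x - W \<gamma> N x) / (pi * (N' - N))" by simp
  define K where "K = sechC \<gamma> * exp (- \<gamma> * N) * (1 + (1 + 2 * \<gamma> + \<gamma>\<^sup>2) * pi)"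
  have K0: "K \<ge> 0" unfolding K_def using sechC_pos[OF \<gamma>] \<gamma> by (intro mult_nonneg_nonneg add_nonneg_nonneg) auto
  have Wb: "\<bar>W \<gamma> c x\<bar> * (1 + x\<^sup>2) \<le> K" if c: "N \<le> c" for c
  proof -
    have c0: "0 \<le> c" using c N by simp
    have "\<bar>W \<gamma> c x\<bar> * (1 + x\<^sup>2) = \<bar>W \<gamma> c x\<bar> + \<bar>x\<^sup>2 * W \<gamma> c x\<bar>" by (simp add: abs_mult algebra_simps)
    also have "\<dots> \<le> sechC \<gamma> * exp (- \<gamma> * c) * pi + sechC \<gamma> * exp (- \<gamma> * c) * (1 + (2 * \<gamma> + \<gamma>\<^sup>2) * pi)"
      by (intro add_mono W_integrable(2) W_decay \<gamma> c0)
    also have "\<dots> = sechC \<gamma> * exp (- \<gamma> * c) * (1 + (1 + 2 * \<gamma> + \<gamma>\<^sup>2) * pi)" by (simp add: algebra_simps)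
    also have "\<dots> \<le> K" unfolding K_def using sechC_pos[OF \<gamma>] \<gamma> c 
      by (intro mult_right_mono mult_left_mono add_nonneg_nonneg) auto
    finally show ?thesis .
  qed
  have "1 \<le> pi * (N' - N)" using mult_mono[of 1 pi 1 "N' - N"] d pi_gt3 by auto
  then have "\<bar>(W \<gamma> N' x - W \<gamma> N x) / (pi * (N' - N))\<bar> \<le> \<bar>W \<gamma> N' x - W \<gamma> N x\<bar>"
    using d by (simp add: abs_divide divide_le_eq mult_le_cancel_left1 abs_mult) (smt (verit) mult_left_le mult.commute mult_le_cancel_left1)?
  also have "\<dots> \<le> \<bar>W \<gamma> N' x\<bar> + \<bar>W \<gamma> N x\<bar>" by (rule abs_triangle_ineq4)
  finally have "\<bar>(W \<gamma> N' x - W \<gamma> N x) / (pi * (N' - N))\<bar> * (1 + x\<^sup>2) \<le> (\<bar>W \<gamma> N' x\<bar> + \<bar>W \<gamma> N x\<bar>) * (1 + x\<^sup>2)"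
    by (intro mult_right_mono) auto
  also have "\<dots> \<le> 2 * K" using Wb[of N'] Wb[of N] N by (simp add: distrib_right)
  finally have fin: "\<bar>(W \<gamma> N' x - W \<gamma> N x) / (pi * (N' - N))\<bar> * (1 + x\<^sup>2) \<le> 2 * K" .
  have p: "0 < 1 + x\<^sup>2" by (simp add: add_pos_nonneg)
  have "\<bar>(W \<gamma> N' x - W \<gamma> N x) / (pi * (N' - N))\<bar> \<le> 2 * K / (1 + x\<^sup>2)"
    using fin by (simp only: pos_le_divide_eq[OF p])
  also have "2 * K / (1 + x\<^sup>2) = biasC \<gamma> * exp (- \<gamma> * N) * inverse (1 + x\<^sup>2)"
    by (simp add: K_def biasC_def divide_inverse)
  finally show ?thesis unfolding eq .
qed

section \<open>Convolution of L_p functions with \<open>G_ker\<close> and the bias bound\<close>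

lemma abs_le_add_powr:
  fixes u p \<eta> :: real
  assumes p: "1 \<le> p" and \<eta>: "\<eta> > 0"
  shows "\<bar>u\<bar> \<le> \<eta> + \<eta> powr (1 - p) * \<bar>u\<bar> powr p"
proof (cases "\<bar>u\<bar> \<le> \<eta>")
  case True
  then show ?thesis by (simp add: add_increasing2)
next
  case False
  then have u: "\<bar>u\<bar> > 0" using \<eta> by linarith
  have "\<bar>u\<bar> = \<bar>u\<bar> powr (1 - p) * \<bar>u\<bar> powr p" using u by (simp flip: powr_add)
  also have "\<dots> \<le> \<eta> powr (1 - p) * \<bar>u\<bar> powr p"
    using False \<eta> p by (intro mult_right_mono powr_mono2') auto
  finally show ?thesis using \<eta> by linarith
qed

lemma G_shift:
  assumes \<gamma>: "\<gamma> > 0"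
  shows "integrable lborel (\<lambda>s. G_ker \<gamma> (x - s))" "(LINT s|lborel. G_ker \<gamma> (x - s)) = 1"
  using lborel_integrable_real_affine[OF G_ker_integrable[OF \<gamma>], of "-1" x]
    lborel_integral_real_affine[of "-1" "G_ker \<gamma>" x] G_ker_integral[OF \<gamma>] by simp_all

text \<open>The function is split at height \<open>\<eta>\<close>: the bounded part meets the mass 1
  of the kernel, the rest its supremum \<open>1 / (2 * \<gamma>)\<close>. Height 1 later gives
  boundedness of the densities, and a small height gives uniform convergence.\<close>

lemma G_conv:
  assumes \<gamma>: "\<gamma> > 0" and p: "1 \<le> p" and u: "u \<in> Lp p" and \<eta>: "\<eta> > 0"
  shows "integrable lborel (\<lambda>s. G_ker \<gamma> (x - s) * u s)"
    and "(LINT s|lborel. \<bar>G_ker \<gamma> (x - s) * u s\<bar>) \<le> \<eta> + \<eta> powr (1 - p) * (Lq_norm p u powr p) / (2 * \<gamma>)"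
proof -
  note [measurable] = Lp_meas[OF u]
  note up = Lp_int[OF u]
  define B where "B s = \<eta> * G_ker \<gamma> (x - s) + \<eta> powr (1 - p) / (2 * \<gamma>) * \<bar>u s\<bar> powr p" for s
  have B: "integrable lborel B" unfolding B_def using G_shift[OF \<gamma>, of x] up by simp
  have le: "\<bar>G_ker \<gamma> (x - s) * u s\<bar> \<le> B s" for s
  proof -
    have "\<bar>G_ker \<gamma> (x - s) * u s\<bar> = G_ker \<gamma> (x - s) * \<bar>u s\<bar>" using G_ker_pos[OF \<gamma>, of "x - s"] by (simp add: abs_mult)
    also have "\<dots> \<le> G_ker \<gamma> (x - s) * (\<eta> + \<eta> powr (1 - p) * \<bar>u s\<bar> powr p)"
      using G_ker_pos[OF \<gamma>, of "x - s"] by (intro mult_left_mono abs_le_add_powr p \<eta>) auto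
    also have "\<dots> = \<eta> * G_ker \<gamma> (x - s) + G_ker \<gamma> (x - s) * (\<eta> powr (1 - p) * \<bar>u s\<bar> powr p)"
      by (simp add: algebra_simps)
    also have "\<dots> \<le> \<eta> * G_ker \<gamma> (x - s) + 1 / (2 * \<gamma>) * (\<eta> powr (1 - p) * \<bar>u s\<bar> powr p)"
      by (intro add_left_mono mult_right_mono G_ker_le \<gamma>) auto
    finally show ?thesis by (simp add: B_def)
  qed
  show i: "integrable lborel (\<lambda>s. G_ker \<gamma> (x - s) * u s)"
    by (rule Bochner_Integration.integrable_bound[OF B]) (auto intro!: AE_I2 order_trans[OF le abs_ge_self])
  have "(LINT s|lborel. \<bar>G_ker \<gamma> (x - s) * u s\<bar>) \<le> (LINT s|lborel. B s)"
    by (intro integral_mono integrable_abs i B le)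
  also have "\<dots> = \<eta> + \<eta> powr (1 - p) * (Lq_norm p u powr p) / (2 * \<gamma>)"
    unfolding B_def using G_shift[OF \<gamma>, of x] up p by (simp add: Lq_norm_powr)
  finally show "(LINT s|lborel. \<bar>G_ker \<gamma> (x - s) * u s\<bar>) \<le> \<eta> + \<eta> powr (1 - p) * (Lq_norm p u powr p) / (2 * \<gamma>)" .
qed

lemma cosh_ratio: "cosh a \<le> exp \<bar>a - b\<bar> * cosh b" for a b :: real
proof -
  have "exp a \<le> exp (\<bar>a - b\<bar> + b)" "exp (- a) \<le> exp (\<bar>a - b\<bar> - b)" by simp_all
  then have "exp a + exp (- a) \<le> exp \<bar>a - b\<bar> * exp b + exp \<bar>a - b\<bar> * exp (- b)"
    by (simp add: exp_add exp_diff exp_minus divide_inverse)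
  then show ?thesis by (simp add: cosh_field_def distrib_left)
qed

text \<open>A Harnack inequality: a shift of the argument changes \<open>cosh\<close> by at most the
  exponential of the shift. The bound is relative to the kernel itself, so it can be integrated
  against \<open>|u|\<close>.\<close>

lemma G_ker_harnack:
  assumes \<gamma>: "\<gamma> > 0"
  shows "\<bar>G_ker \<gamma> z - G_ker \<gamma> z'\<bar> \<le> (exp (pi / (2 * \<gamma>) * \<bar>z - z'\<bar>) - 1) * G_ker \<gamma> z"
proof -
  define e where "e = exp (pi / (2 * \<gamma>) * \<bar>z - z'\<bar>)"
  have e: "e \<ge> 1" using \<gamma> by (simp add: e_def)
  have r: "G_ker \<gamma> a \<le> exp (pi / (2 * \<gamma>) * \<bar>a - b\<bar>) * G_ker \<gamma> b" for a b
  proof -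
    have "cosh (pi * b / (2 * \<gamma>)) \<le> exp (\<bar>pi * b / (2 * \<gamma>) - pi * a / (2 * \<gamma>)\<bar>) * cosh (pi * a / (2 * \<gamma>))" by (rule cosh_ratio)
    also have "\<bar>pi * b / (2 * \<gamma>) - pi * a / (2 * \<gamma>)\<bar> = pi / (2 * \<gamma>) * \<bar>a - b\<bar>"
    proof -
      have "pi * b / (2 * \<gamma>) - pi * a / (2 * \<gamma>) = pi / (2 * \<gamma>) * (b - a)" by (simp add: right_diff_distrib)
      then show ?thesis using \<gamma> by (simp add: abs_mult abs_minus_commute)
    qed
    finally show ?thesis using \<gamma> by (simp add: G_ker_def field_simps)
  qed
  have 1: "G_ker \<gamma> z' \<le> e * G_ker \<gamma> z" using r[of z' z] by (simp add: e_def abs_minus_commute)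
  have 0: "G_ker \<gamma> z \<le> e * G_ker \<gamma> z'" using r[of z z'] by (simp add: e_def)
  \<comment> \<open>Since \<open>2 - e \<le> 1 / e\<close>, the lower Harnack bound takes a linear
    form with the same constant \<open>e - 1\<close> as the upper one.\<close>
  have 2: "(2 - e) * G_ker \<gamma> z \<le> G_ker \<gamma> z'"
  proof -
    have "e * (2 - e) \<le> 1" using zero_le_power2[of "e - 1"] by (simp add: power2_eq_square algebra_simps)
    have "e * ((2 - e) * G_ker \<gamma> z) \<le> 1 * G_ker \<gamma> z"
      using \<open>e * (2 - e) \<le> 1\<close> G_ker_pos[OF \<gamma>, of z] unfolding mult.assoc[symmetric] by (intro mult_right_mono) auto
    also have "\<dots> \<le> e * G_ker \<gamma> z'" using 0 by simp
    finally show ?thesis using e by simp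
  qed
  show ?thesis unfolding e_def[symmetric] using 1 2 by (simp add: abs_le_iff algebra_simps)
qed

lemma G_conv_lip:
  assumes \<gamma>: "\<gamma> > 0" and p: "1 \<le> p" and u: "u \<in> Lp p"
  shows "\<bar>(LINT s|lborel. G_ker \<gamma> (x - s) * u s) - (LINT s|lborel. G_ker \<gamma> (x' - s) * u s)\<bar> \<le>
     (exp (pi / (2 * \<gamma>) * \<bar>x - x'\<bar>) - 1) * (LINT s|lborel. \<bar>G_ker \<gamma> (x - s) * u s\<bar>)"
proof -
  note i = G_conv(1)[OF \<gamma> p u zero_less_one]
  have "\<bar>(LINT s|lborel. G_ker \<gamma> (x - s) * u s) - (LINT s|lborel. G_ker \<gamma> (x' - s) * u s)\<bar> =
    \<bar>LINT s|lborel. G_ker \<gamma> (x - s) * u s - G_ker \<gamma> (x' - s) * u s\<bar>"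
    by (subst Bochner_Integration.integral_diff[OF i i]) simp
  also have "\<dots> \<le> (LINT s|lborel. \<bar>G_ker \<gamma> (x - s) * u s - G_ker \<gamma> (x' - s) * u s\<bar>)" by (rule integral_abs_bound)
  also have "\<dots> \<le> (LINT s|lborel. (exp (pi / (2 * \<gamma>) * \<bar>x - x'\<bar>) - 1) * \<bar>G_ker \<gamma> (x - s) * u s\<bar>)"
  proof (intro integral_mono)
    show "integrable lborel (\<lambda>s. \<bar>G_ker \<gamma> (x - s) * u s - G_ker \<gamma> (x' - s) * u s\<bar>)" using i by auto
    show "integrable lborel (\<lambda>s. (exp (pi / (2 * \<gamma>) * \<bar>x - x'\<bar>) - 1) * \<bar>G_ker \<gamma> (x - s) * u s\<bar>)"
      using i[of x] by auto
    fix s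
    have "\<bar>G_ker \<gamma> (x - s) * u s - G_ker \<gamma> (x' - s) * u s\<bar> = \<bar>G_ker \<gamma> (x - s) - G_ker \<gamma> (x' - s)\<bar> * \<bar>u s\<bar>"
      by (simp add: left_diff_distrib[symmetric] abs_mult)
    also have "\<dots> \<le> ((exp (pi / (2 * \<gamma>) * \<bar>(x - s) - (x' - s)\<bar>) - 1) * G_ker \<gamma> (x - s)) * \<bar>u s\<bar>"
      by (intro mult_right_mono G_ker_harnack \<gamma>) auto
    also have "\<dots> = (exp (pi / (2 * \<gamma>) * \<bar>x - x'\<bar>) - 1) * \<bar>G_ker \<gamma> (x - s) * u s\<bar>"
      using G_ker_pos[OF \<gamma>, of "x - s"] by (simp add: abs_mult)
    finally show "\<bar>G_ker \<gamma> (x - s) * u s - G_ker \<gamma> (x' - s) * u s\<bar> \<le> (exp (pi / (2 * \<gamma>) * \<bar>x - x'\<bar>) - 1) * \<bar>G_ker \<gamma> (x - s) * u s\<bar>" .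
  qed
  finally show ?thesis by simp
qed

text \<open>Young's inequality by Jensen and Tonelli: divided by pi, the Cauchy profile is a
  probability density in either variable.\<close>

lemma young_cauchy:
  assumes p: "1 \<le> p" and u: "u \<in> Lp p" and E: "0 \<le> E" and g [measurable]: "g \<in> borel_measurable borel"
    and le: "\<And>x. \<bar>g x\<bar> \<le> E * (LINT s|lborel. inverse (1 + (x - s)\<^sup>2) * \<bar>u s\<bar>)"
  shows "g \<in> Lp p" "Lq_norm p g \<le> E * pi * Lq_norm p u"
proof -
  note um [measurable] = Lp_meas[OF u]
  note up = Lp_int[OF u]
  define \<kappa> where "\<kappa> x s = inverse (1 + (x - s)\<^sup>2) / pi" for x s :: real
  have \<kappa>_nonneg: "0 \<le> \<kappa> x s" for x s by (simp add: \<kappa>_def)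
  have \<kappa>_le: "\<kappa> x s \<le> 1" for x s
  proof -
    have "inverse (1 + (x - s)\<^sup>2) \<le> 1" by (simp add: inverse_le_1_iff)
    then show ?thesis using pi_gt3 by (simp add: \<kappa>_def)
  qed
  have [measurable]: "(\<lambda>(x, s). \<kappa> x s) \<in> borel_measurable (borel \<Otimes>\<^sub>M borel)" unfolding \<kappa>_def by measurable
  have \<kappa>i: "integrable lborel (\<kappa> x)" "(LINT s|lborel. \<kappa> x s) = 1" for x
    using integrable_cauchy_shift[of x] integral_cauchy_shift[of x] unfolding \<kappa>_def[abs_def]
    by (simp_all add: power2_commute[of x])
  have \<kappa>u: "integrable lborel (\<lambda>s. \<kappa> x s * \<bar>u s\<bar> powr p)" for x
  proof (rule Bochner_Integration.integrable_bound[OF up])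
    show "AE s in lborel. norm (\<kappa> x s * \<bar>u s\<bar> powr p) \<le> norm (\<bar>u s\<bar> powr p)"
      using \<kappa>_nonneg \<kappa>_le by (intro AE_I2 norm_mono_nonneg) (auto intro: mult_left_le_one_le)
  qed measurable
  have \<kappa>u1: "integrable lborel (\<lambda>s. \<kappa> x s * \<bar>u s\<bar>)" for x
  proof (rule Bochner_Integration.integrable_bound)
    show "integrable lborel (\<lambda>s. \<kappa> x s + \<kappa> x s * \<bar>u s\<bar> powr p)" using \<kappa>i \<kappa>u by simp
    have "\<kappa> x s * \<bar>u s\<bar> \<le> \<kappa> x s + \<kappa> x s * \<bar>u s\<bar> powr p" for s
      using mult_left_mono[OF abs_le_add_powr[OF p zero_less_one, of "u s"] \<kappa>_nonneg[of x s]] by (simp add: distrib_left)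
    then show "AE s in lborel. norm (\<kappa> x s * \<bar>u s\<bar>) \<le> norm (\<kappa> x s + \<kappa> x s * \<bar>u s\<bar> powr p)"
      using \<kappa>_nonneg by (intro AE_I2 norm_mono_nonneg) auto
  qed measurable
  have jen: "(LINT s|lborel. \<kappa> x s * \<bar>u s\<bar>) powr p \<le> (LINT s|lborel. \<kappa> x s * \<bar>u s\<bar> powr p)" for x
  proof -
    define Q where "Q = density lborel (\<lambda>s. ennreal (\<kappa> x s))"
    interpret Q: prob_space Q
    proof (rule prob_spaceI)
      have "emeasure Q (space Q) = (\<integral>\<^sup>+s. ennreal (\<kappa> x s) \<partial>lborel)" by (simp add: Q_def emeasure_density)
      also have "\<dots> = 1" using \<kappa>i \<kappa>_nonneg by (simp add: nn_integral_eq_integral)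
      finally show "emeasure Q (space Q) = 1" .
    qed
    have iQ: "integrable Q (\<lambda>s. \<bar>u s\<bar>)" "integrable Q (\<lambda>s. \<bar>u s\<bar> powr p)"
      unfolding Q_def using \<kappa>u1 \<kappa>u \<kappa>_nonneg by (simp_all add: integrable_density)
    have "(LINT s|Q. \<bar>u s\<bar>) powr p \<le> (LINT s|Q. \<bar>u s\<bar> powr p)"
      by (rule Q.jensen_powr[OF p iQ(1) _ iQ(2)]) auto
    then show ?thesis unfolding Q_def using \<kappa>_nonneg by (simp add: integral_density)
  qed
  have gle: "\<bar>g x\<bar> powr p \<le> (E * pi) powr p * (LINT s|lborel. \<kappa> x s * \<bar>u s\<bar> powr p)" for x
  proof -
    have "E * (LINT s|lborel. inverse (1 + (x - s)\<^sup>2) * \<bar>u s\<bar>) = (E * pi) * (LINT s|lborel. \<kappa> x s * \<bar>u s\<bar>)"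
    proof -
      have "(LINT s|lborel. inverse (1 + (x - s)\<^sup>2) * \<bar>u s\<bar>) = (LINT s|lborel. pi * (\<kappa> x s * \<bar>u s\<bar>))"
        by (simp add: \<kappa>_def)
      then show ?thesis by simp
    qed
    then have "\<bar>g x\<bar> powr p \<le> ((E * pi) * (LINT s|lborel. \<kappa> x s * \<bar>u s\<bar>)) powr p"
      using le[of x] p by (intro powr_mono2) auto
    also have "\<dots> = (E * pi) powr p * (LINT s|lborel. \<kappa> x s * \<bar>u s\<bar>) powr p" by (rule powr_mult)
    also have "\<dots> \<le> (E * pi) powr p * (LINT s|lborel. \<kappa> x s * \<bar>u s\<bar> powr p)" by (intro mult_left_mono jen) auto
    finally show ?thesis .
  qed
  have "(\<integral>\<^sup>+x. ennreal (\<bar>g x\<bar> powr p) \<partial>lborel) \<le> 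
    (\<integral>\<^sup>+x. ennreal ((E * pi) powr p) * (\<integral>\<^sup>+s. ennreal (\<kappa> x s * \<bar>u s\<bar> powr p) \<partial>lborel) \<partial>lborel)"
    using gle \<kappa>u \<kappa>_nonneg by (intro nn_integral_mono) (simp add: nn_integral_eq_integral flip: ennreal_mult)
  also have "\<dots> = ennreal ((E * pi) powr p) * (\<integral>\<^sup>+x. (\<integral>\<^sup>+s. ennreal (\<kappa> x s * \<bar>u s\<bar> powr p) \<partial>lborel) \<partial>lborel)"
    by (intro nn_integral_cmult) measurable
  also have "(\<integral>\<^sup>+x. (\<integral>\<^sup>+s. ennreal (\<kappa> x s * \<bar>u s\<bar> powr p) \<partial>lborel) \<partial>lborel) = 
     (\<integral>\<^sup>+s. (\<integral>\<^sup>+x. ennreal (\<kappa> x s * \<bar>u s\<bar> powr p) \<partial>lborel) \<partial>lborel)"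
    by (rule lborel_pair.Fubini'[symmetric]) measurable
  also have "\<dots> = (\<integral>\<^sup>+s. ennreal (\<bar>u s\<bar> powr p) \<partial>lborel)"
  proof (rule nn_integral_cong)
    fix s
    have e: "\<kappa> x s = \<kappa> s x" for x by (simp add: \<kappa>_def power2_commute)
    have "(\<integral>\<^sup>+x. ennreal (\<kappa> x s * \<bar>u s\<bar> powr p) \<partial>lborel) = (\<integral>\<^sup>+x. ennreal (\<kappa> s x) * ennreal (\<bar>u s\<bar> powr p) \<partial>lborel)"
      using \<kappa>_nonneg by (intro nn_integral_cong) (simp add: e ennreal_mult)
    also have "\<dots> = (\<integral>\<^sup>+x. ennreal (\<kappa> s x) \<partial>lborel) * ennreal (\<bar>u s\<bar> powr p)" by (intro nn_integral_multc) measurable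
    also have "(\<integral>\<^sup>+x. ennreal (\<kappa> s x) \<partial>lborel) = 1" using \<kappa>i \<kappa>_nonneg by (simp add: nn_integral_eq_integral)
    finally show "(\<integral>\<^sup>+x. ennreal (\<kappa> x s * \<bar>u s\<bar> powr p) \<partial>lborel) = ennreal (\<bar>u s\<bar> powr p)" by simp
  qed
  also have "\<dots> = ennreal (LINT s|lborel. \<bar>u s\<bar> powr p)" using up by (intro nn_integral_eq_integral) auto
  finally have nn: "(\<integral>\<^sup>+x. ennreal (\<bar>g x\<bar> powr p) \<partial>lborel) \<le> ennreal ((E * pi) powr p * (LINT s|lborel. \<bar>u s\<bar> powr p))"
    by (simp add: ennreal_mult)
  then have gi: "integrable lborel (\<lambda>x. \<bar>g x\<bar> powr p)"
    by (intro integrableI_bounded) (auto intro: le_less_trans)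
  then show gL: "g \<in> Lp p" by (simp add: Lp_def)
  have "(LINT x|lborel. \<bar>g x\<bar> powr p) \<le> (E * pi) powr p * (LINT s|lborel. \<bar>u s\<bar> powr p)"
    using nn nn_integral_eq_integral[OF gi] by (simp add: ennreal_le_iff)
  also have "\<dots> = (E * pi * Lq_norm p u) powr p" using p by (simp add: powr_mult Lq_norm_powr)
  finally show "Lq_norm p g \<le> E * pi * Lq_norm p u" using p E by (intro Lq_norm_le) auto
qed

text \<open>The bias is the convolution of \<open>u\<close> with the error \<open>R\<close> that the
  window makes on the kernel \<open>G_ker\<close>. Since \<open>R\<close> is below a Cauchy profile
  times \<open>exp (- \<gamma> * N)\<close>, only the L_p norm of \<open>u\<close> enters.\<close>

theorem bias_bound:
  assumes \<gamma>: "\<gamma> > 0" and p: "1 \<le> p" and u: "u \<in> Lp p" and N: "0 \<le> N" "N + 1 \<le> N'"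
    and f: "\<And>x. f x = (LINT s|lborel. G_ker \<gamma> (x - s) * u s)" and fm [measurable]: "f \<in> borel_measurable borel"
  shows "(\<lambda>x. (LINT y|lborel. vp N N' (x - y) * f y) - f x) \<in> Lp p"
    and "Lq_norm p (\<lambda>x. (LINT y|lborel. vp N N' (x - y) * f y) - f x) \<le> biasC \<gamma> * exp (- \<gamma> * N) * pi * Lq_norm p u"
proof -
  note [measurable] = Lp_meas[OF u]
  define C where "C = 1 + 1 powr (1 - p) * (Lq_norm p u powr p) / (2 * \<gamma>)"
  define R where "R z = (LINT y|lborel. vp N N' (z - y) * G_ker \<gamma> y) - G_ker \<gamma> z" for z
  have R: "\<bar>R z\<bar> \<le> biasC \<gamma> * exp (- \<gamma> * N) * inverse (1 + z\<^sup>2)" for z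
    unfolding R_def by (rule vp_conv_G[OF \<gamma> N])
  have Rm [measurable]: "R \<in> borel_measurable borel" unfolding R_def by measurable
  have eq: "(LINT y|lborel. vp N N' (x - y) * f y) - f x = (LINT s|lborel. R (x - s) * u s)" 
    and ig: "integrable lborel (\<lambda>s. R (x - s) * u s)" for x
  proof -
    define F where "F y s = vp N N' (x - y) * (G_ker \<gamma> (y - s) * u s)" for y s
    have Fm: "(\<lambda>(y, s). F y s) \<in> borel_measurable (borel \<Otimes>\<^sub>M borel)" unfolding F_def by measurable
    have vi: "integrable lborel (\<lambda>y. vp N N' (x - y))"
      using lborel_integrable_real_affine[OF vp_integrable[of N N'], of "-1" x] by simp
    have "(LINT y|lborel. vp N N' (x - y) * f y) = (LINT y|lborel. LINT s|lborel. F y s)"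
      by (simp add: F_def f)
    also have "\<dots> = (LINT s|lborel. LINT y|lborel. F y s)"
    proof (rule fubini_lborel[OF Fm, where a = "\<lambda>y. \<bar>vp N N' (x - y)\<bar> * C"])
      show "integrable lborel (F y)" for y unfolding F_def[abs_def] using G_conv(1)[OF \<gamma> p u zero_less_one, of y] by simp
      show "(LINT s|lborel. \<bar>F y s\<bar>) \<le> \<bar>vp N N' (x - y)\<bar> * C" for y
        unfolding F_def abs_mult[of "vp N N' (x - y)"] C_def using G_conv(2)[OF \<gamma> p u zero_less_one, of y]
        by (simp add: mult_left_mono)
      show "integrable lborel (\<lambda>y. \<bar>vp N N' (x - y)\<bar> * C)" using vi by auto
    qed
    also have "\<dots> = (LINT s|lborel. (R (x - s) + G_ker \<gamma> (x - s)) * u s)"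
    proof (rule Bochner_Integration.integral_cong[OF refl])
      fix s
      have "(LINT y|lborel. F y s) = (LINT y|lborel. vp N N' (x - y) * G_ker \<gamma> (y - s)) * u s"
        by (simp add: F_def flip: mult.assoc)
      also have "(LINT y|lborel. vp N N' (x - y) * G_ker \<gamma> (y - s)) = (LINT y|lborel. vp N N' ((x - s) - y) * G_ker \<gamma> y)"
        by (subst lborel_integral_real_affine[of 1 _ s]) (auto simp: algebra_simps)
      finally show "(LINT y|lborel. F y s) = (R (x - s) + G_ker \<gamma> (x - s)) * u s" by (simp add: R_def)
    qed
    also have "\<dots> = (LINT s|lborel. R (x - s) * u s + G_ker \<gamma> (x - s) * u s)" by (simp add: distrib_right)
    finally have 1: "(LINT y|lborel. vp N N' (x - y) * f y) = (LINT s|lborel. R (x - s) * u s + G_ker \<gamma> (x - s) * u s)" .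
    show ig: "integrable lborel (\<lambda>s. R (x - s) * u s)"
    proof (rule Bochner_Integration.integrable_bound)
      define E where "E = biasC \<gamma> * exp (- \<gamma> * N)"
      have E: "E \<ge> 0" using biasC_pos[OF \<gamma>] by (simp add: E_def)
      show "integrable lborel (\<lambda>s. E * (inverse (1 + (s - x)\<^sup>2) + \<bar>u s\<bar> powr p))"
        using integrable_cauchy_shift[of x] Lp_int[OF u] by simp
      have "\<bar>R (x - s) * u s\<bar> \<le> E * (inverse (1 + (s - x)\<^sup>2) + \<bar>u s\<bar> powr p)" for s
      proof -
        define q where "q = inverse (1 + (s - x)\<^sup>2)"
        have q: "0 \<le> q" "q \<le> 1" by (auto simp: q_def inverse_le_1_iff)
        have "\<bar>R (x - s) * u s\<bar> \<le> (E * q) * (1 + \<bar>u s\<bar> powr p)"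
          unfolding abs_mult using R[of "x - s"] abs_le_add_powr[OF p zero_less_one, of "u s"] E q
          by (intro mult_mono) (auto simp: E_def q_def power2_commute[of x])
        also have "\<dots> = E * (q + q * \<bar>u s\<bar> powr p)" by (simp add: algebra_simps)
        also have "\<dots> \<le> E * (q + 1 * \<bar>u s\<bar> powr p)" using E q by (intro mult_left_mono add_left_mono mult_right_mono) auto
        finally show ?thesis by (simp add: q_def)
      qed
      then show "AE s in lborel. norm (R (x - s) * u s) \<le> norm (E * (inverse (1 + (s - x)\<^sup>2) + \<bar>u s\<bar> powr p))"
        by (auto intro!: AE_I2 order_trans[OF _ abs_ge_self])
    qed measurable
    show "(LINT y|lborel. vp N N' (x - y) * f y) - f x = (LINT s|lborel. R (x - s) * u s)"
      unfolding 1 f[of x] by (subst Bochner_Integration.integral_add[OF ig G_conv(1)[OF \<gamma> p u zero_less_one]]) simp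
  qed
  have gm: "(\<lambda>x. (LINT y|lborel. vp N N' (x - y) * f y) - f x) \<in> borel_measurable borel" by measurable
  have E: "0 \<le> biasC \<gamma> * exp (- \<gamma> * N)" using biasC_pos[OF \<gamma>] by simp
  have le: "\<bar>(LINT y|lborel. vp N N' (x - y) * f y) - f x\<bar> \<le> biasC \<gamma> * exp (- \<gamma> * N) * (LINT s|lborel. inverse (1 + (x - s)\<^sup>2) * \<bar>u s\<bar>)" for x
  proof -
    have qi: "integrable lborel (\<lambda>s. inverse (1 + (x - s)\<^sup>2) * \<bar>u s\<bar>)"
    proof (rule Bochner_Integration.integrable_bound)
      show "integrable lborel (\<lambda>s. inverse (1 + (s - x)\<^sup>2) + \<bar>u s\<bar> powr p)"
        using integrable_cauchy_shift[of x] Lp_int[OF u] by simp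
      have "inverse (1 + (x - s)\<^sup>2) * \<bar>u s\<bar> \<le> inverse (1 + (s - x)\<^sup>2) + \<bar>u s\<bar> powr p" for s
      proof -
        define q where "q = inverse (1 + (s - x)\<^sup>2)"
        have q: "0 \<le> q" "q \<le> 1" by (auto simp: q_def inverse_le_1_iff)
        have "q * \<bar>u s\<bar> \<le> q * (1 + \<bar>u s\<bar> powr p)" 
          using q abs_le_add_powr[OF p zero_less_one, of "u s"] by (intro mult_left_mono) auto
        also have "\<dots> \<le> q + 1 * \<bar>u s\<bar> powr p" unfolding distrib_left using q by (intro add_mono mult_right_mono) auto
        finally show ?thesis by (simp add: q_def power2_commute[of x])
      qed
      then show "AE s in lborel. norm (inverse (1 + (x - s)\<^sup>2) * \<bar>u s\<bar>) \<le> norm (inverse (1 + (s - x)\<^sup>2) + \<bar>u s\<bar> powr p)"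
        by (intro AE_I2 norm_mono_nonneg mult_nonneg_nonneg) auto
    qed measurable
    have "\<bar>LINT s|lborel. R (x - s) * u s\<bar> \<le> (LINT s|lborel. \<bar>R (x - s) * u s\<bar>)" by (rule integral_abs_bound)
    also have "\<dots> \<le> (LINT s|lborel. biasC \<gamma> * exp (- \<gamma> * N) * (inverse (1 + (x - s)\<^sup>2) * \<bar>u s\<bar>))"
    proof (intro integral_mono integrable_abs ig)
      show "\<bar>R (x - s) * u s\<bar> \<le> biasC \<gamma> * exp (- \<gamma> * N) * (inverse (1 + (x - s)\<^sup>2) * \<bar>u s\<bar>)" for s
        unfolding abs_mult mult.assoc[symmetric] by (intro mult_right_mono R) auto
    qed (use qi in simp)
    finally show ?thesis unfolding eq by simp
  qed
  show "(\<lambda>x. (LINT y|lborel. vp N N' (x - y) * f y) - f x) \<in> Lp p"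
    "Lq_norm p (\<lambda>x. (LINT y|lborel. vp N N' (x - y) * f y) - f x) \<le> biasC \<gamma> * exp (- \<gamma> * N) * pi * Lq_norm p u"
    by (rule young_cauchy[OF p u E gm le])+
qed

subsection \<open>Size of the kernel\<close>

text \<open>The unscaled kernel as a function of its shape parameter alone. At 0, division by zero
  gives the value 0 in place of the limit \<open>(1 + \<theta>) / (2 * pi)\<close>.\<close>

definition dk :: "real \<Rightarrow> real \<Rightarrow> real" where
  "dk \<theta> x = (cos (\<theta> * x) - cos x) / (pi * (1 - \<theta>) * x\<^sup>2)"

lemma dk_meas [measurable]: "dk \<theta> \<in> borel_measurable borel"
  unfolding dk_def[abs_def] by measurable

lemma dk_zero [simp]: "dk \<theta> 0 = 0" by (simp add: dk_def)

text \<open>The difference of cosines is twice a product of two sines. Bounding both sines by their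
  arguments, only the one with the small factor \<open>1 - \<theta>\<close>, or neither, gives the
  three estimates.\<close>

lemma dk_bounds:
  assumes \<theta>: "0 \<le> \<theta>" "\<theta> < 1"
  shows "\<bar>dk \<theta> x\<bar> \<le> 1" "\<bar>dk \<theta> x\<bar> * \<bar>x\<bar> \<le> 1" "\<bar>dk \<theta> x\<bar> * x\<^sup>2 \<le> 1 / (1 - \<theta>)"
proof -
  define d where "d = \<bar>cos (\<theta> * x) - cos x\<bar>"
  have c: "cos (\<theta> * x) - cos x = 2 * sin ((1 + \<theta>) * x / 2) * sin ((1 - \<theta>) * x / 2)"
    using cos_diff_cos[of "\<theta> * x" x] by (simp add: algebra_simps)
  have s1: "\<bar>sin ((1 - \<theta>) * x / 2)\<bar> \<le> (1 - \<theta>) * \<bar>x\<bar> / 2"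
    using abs_sin_x_le_abs_x[of "(1 - \<theta>) * x / 2"] \<theta> by (simp add: abs_mult)
  have s2: "\<bar>sin ((1 + \<theta>) * x / 2)\<bar> \<le> \<bar>x\<bar>"
  proof -
    have "\<bar>sin ((1 + \<theta>) * x / 2)\<bar> \<le> (1 + \<theta>) / 2 * \<bar>x\<bar>"
      using abs_sin_x_le_abs_x[of "(1 + \<theta>) * x / 2"] \<theta> by (simp add: abs_mult)
    also have "\<dots> \<le> 1 * \<bar>x\<bar>" using \<theta> by (intro mult_right_mono) auto
    finally show ?thesis by simp
  qed
  have d_eq: "d = 2 * \<bar>sin ((1 + \<theta>) * x / 2)\<bar> * \<bar>sin ((1 - \<theta>) * x / 2)\<bar>"
    by (simp add: d_def c abs_mult)
  have d1: "d \<le> (1 - \<theta>) * x\<^sup>2"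
  proof -
    have "d \<le> 2 * \<bar>x\<bar> * ((1 - \<theta>) * \<bar>x\<bar> / 2)"
      unfolding d_eq using s1 s2 by (intro mult_mono) auto
    also have "\<dots> = (1 - \<theta>) * x\<^sup>2" by (simp add: power2_eq_square)
    finally show ?thesis .
  qed
  have d2: "d \<le> (1 - \<theta>) * \<bar>x\<bar>"
  proof -
    have "d \<le> 2 * 1 * ((1 - \<theta>) * \<bar>x\<bar> / 2)"
      unfolding d_eq using s1 by (intro mult_mono) auto
    then show ?thesis by simp
  qed
  have d3: "d \<le> 2" unfolding d_def using cos_le_one[of "\<theta> * x"] cos_ge_minus_one[of "\<theta> * x"] cos_le_one[of x] cos_ge_minus_one[of x] by linarith
  have pi1: "1 \<le> pi" "2 \<le> pi" using pi_gt3 by auto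
  have eq: "\<bar>dk \<theta> x\<bar> = d / (pi * (1 - \<theta>) * x\<^sup>2)" using \<theta> by (simp add: dk_def d_def abs_mult)
  have "\<bar>dk \<theta> x\<bar> \<le> 1 \<and> \<bar>dk \<theta> x\<bar> * \<bar>x\<bar> \<le> 1 \<and> \<bar>dk \<theta> x\<bar> * x\<^sup>2 \<le> 1 / (1 - \<theta>)" 
  proof (cases "x = 0")
    case True then show ?thesis using \<theta> by simp
  next
    case False
    have pos: "0 < pi * (1 - \<theta>) * x\<^sup>2" "0 < (1 - \<theta>) * x\<^sup>2" "0 < (1 - \<theta>) * \<bar>x\<bar>" using \<theta> False by auto
    have a: "d \<le> pi * (1 - \<theta>) * x\<^sup>2"
      using mult_right_mono[OF pi1(1), of "(1 - \<theta>) * x\<^sup>2"] pos d1 by (simp add: mult.assoc)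
    have b: "d \<le> pi * (1 - \<theta>) * \<bar>x\<bar>"
      using mult_right_mono[OF pi1(1), of "(1 - \<theta>) * \<bar>x\<bar>"] pos d2 by (simp add: mult.assoc)
    have e2: "\<bar>dk \<theta> x\<bar> * \<bar>x\<bar> = d / (pi * (1 - \<theta>) * \<bar>x\<bar>)"
    proof -
      have "d / (c * (b * b)) * b = d / (c * b)" if "b \<noteq> 0" for b c using that by simp
      from this[of "\<bar>x\<bar>" "pi * (1 - \<theta>)"] show ?thesis unfolding eq using False by (simp add: power2_eq_square)
    qed
    have e3: "\<bar>dk \<theta> x\<bar> * x\<^sup>2 = d / pi / (1 - \<theta>)" unfolding eq using False by simp
    have "d / pi \<le> 1" using d3 pi1 by simp
    then have "d / pi / (1 - \<theta>) \<le> 1 / (1 - \<theta>)" using \<theta> by (intro divide_right_mono) auto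
    then show ?thesis using a b pos \<theta> False unfolding e2 e3 unfolding eq by (simp add: divide_le_eq_1)
  qed
  then show "\<bar>dk \<theta> x\<bar> \<le> 1" "\<bar>dk \<theta> x\<bar> * \<bar>x\<bar> \<le> 1" "\<bar>dk \<theta> x\<bar> * x\<^sup>2 \<le> 1 / (1 - \<theta>)" by auto
qed

lemma dk_square_le:
  assumes \<theta>: "0 \<le> \<theta>" "\<theta> < 1" shows "(dk \<theta> x)\<^sup>2 \<le> 2 * inverse (1 + x\<^sup>2)"
proof -
  have p: "0 < 1 + x\<^sup>2" by (simp add: add_pos_nonneg)
  have "(dk \<theta> x)\<^sup>2 \<le> 1" using dk_bounds(1)[OF \<theta>] by (simp add: abs_square_le_1)
  moreover have "(dk \<theta> x * x)\<^sup>2 \<le> 1" using dk_bounds(2)[OF \<theta>, of x] by (simp add: abs_square_le_1 abs_mult)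
  ultimately have "(dk \<theta> x)\<^sup>2 * (1 + x\<^sup>2) \<le> 2" by (simp add: distrib_left power_mult_distrib)
  then show ?thesis unfolding divide_inverse[symmetric] pos_le_divide_eq[OF p] .
qed

text \<open>An envelope that is integrable for \<open>r > 1\<close>. Because
  \<open>0 powr (- r) = 0\<close>, its value at 0 is 0; this is compatible with
  \<open>dk_zero\<close>.\<close>

definition mp :: "real \<Rightarrow> real \<Rightarrow> real" where "mp r x = min 1 (\<bar>x\<bar> powr (- r))"

lemma mp_meas [measurable]: "mp r \<in> borel_measurable borel"
  unfolding mp_def[abs_def] by measurable

lemma mp_nonneg: "0 \<le> mp r x" by (simp add: mp_def)

lemma mp_integrable:
  assumes r: "1 < r" shows "integrable lborel (mp r)"
proof -
  define f where "f x = x powr (- r)" for x :: real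
  have [measurable]: "f \<in> borel_measurable borel" unfolding f_def by measurable
  have "(\<integral>\<^sup>+x. ennreal (f x) * indicator {1..} x \<partial>lborel) = 0 - (- (1 powr (1 - r) / (r - 1)))"
  proof (rule nn_integral_FTC_atLeast[where F = "\<lambda>x. - (x powr (1 - r) / (r - 1))"])
    show "((\<lambda>x. - (x powr (1 - r) / (r - 1))) has_real_derivative f x) (at x)" if "1 \<le> x" for x
    proof -
      have "((\<lambda>x. - (x powr (1 - r) / (r - 1))) has_real_derivative - ((1 - r) * x powr (1 - r - 1) / (r - 1))) (at x)"
        using that r by (intro DERIV_minus DERIV_cdivide has_real_derivative_powr) auto
      moreover have "(1 - r) * y / (r - 1) = - y" for y
        using r by (simp add: divide_eq_eq algebra_simps)
      ultimately show ?thesis by (simp add: f_def)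
    qed
    show "((\<lambda>x. - (x powr (1 - r) / (r - 1))) \<longlongrightarrow> 0) at_top"
    proof -
      have "((\<lambda>x::real. x powr (1 - r)) \<longlongrightarrow> 0) at_top"
        using r by (intro tendsto_neg_powr filterlim_ident) auto
      from tendsto_minus[OF tendsto_divide[OF this tendsto_const[of "r - 1"]]] r show ?thesis by simp
    qed
  qed (auto simp: f_def)
  then have fin: "(\<integral>\<^sup>+x. ennreal (f x) * indicator {1..} x \<partial>lborel) < \<infinity>" by simp
  have i1: "integrable lborel (\<lambda>x. f x * indicator {1..} x)"
  proof (rule integrableI_bounded)
    have "(\<integral>\<^sup>+x. ennreal (norm (f x * indicator {1..} x)) \<partial>lborel) = (\<integral>\<^sup>+x. ennreal (f x) * indicator {1..} x \<partial>lborel)"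
      by (intro nn_integral_cong) (auto simp: indicator_def f_def)
    then show "(\<integral>\<^sup>+x. ennreal (norm (f x * indicator {1..} x)) \<partial>lborel) < \<infinity>" using fin by simp
  qed measurable
  have i2: "integrable lborel (\<lambda>x. f (- x) * indicator {1..} (- x))"
    using lborel_integrable_real_affine[OF i1, of "-1" 0] by simp
  have i3: "integrable lborel (indicator {-1..1} :: real \<Rightarrow> real)"
    by (rule integrable_real_indicator) (auto simp: emeasure_lborel_Icc)
  show ?thesis
  proof (rule Bochner_Integration.integrable_bound)
    show "integrable lborel (\<lambda>x. indicator {-1..1} x + f x * indicator {1..} x + f (- x) * indicator {1..} (- x))"
      using i1 i2 i3 by simp
    have "mp r x \<le> indicator {-1..1} x + f x * indicator {1..} x + f (- x) * indicator {1..} (- x)" for x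
      by (auto simp: mp_def f_def indicator_def abs_if min_def)
    then show "AE x in lborel. norm (mp r x) \<le> norm (indicator {-1..1} x + f x * indicator {1..} x + f (- x) * indicator {1..} (- x))"
      by (intro AE_I2 norm_mono_nonneg mp_nonneg) auto
  qed measurable
qed

lemma dk_powr_le:
  assumes \<theta>: "0 \<le> \<theta>" "\<theta> < 1" and p: "1 \<le> p" shows "\<bar>dk \<theta> x\<bar> powr p \<le> mp p x"
proof (cases "x = 0")
  case False
  have "\<bar>dk \<theta> x\<bar> powr p \<le> 1" using dk_bounds(1)[OF \<theta>] p by (intro powr_le1) auto
  moreover have "\<bar>dk \<theta> x\<bar> \<le> \<bar>x\<bar> powr (-1)" using dk_bounds(2)[OF \<theta>, of x] False by (simp add: powr_minus field_simps)
  then have "\<bar>dk \<theta> x\<bar> powr p \<le> (\<bar>x\<bar> powr (-1)) powr p" using p by (intro powr_mono2) auto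
  moreover have "(\<bar>x\<bar> powr (-1)) powr p = \<bar>x\<bar> powr (- p)" unfolding powr_powr by simp
  ultimately show ?thesis unfolding mp_def by (metis min.boundedI)
qed (use mp_nonneg[of p 0] in simp)

text \<open>The bounds \<open>1 / |x|\<close> and \<open>1 / ((1 - \<theta>) * x\<^sup>2)\<close>
  are interpolated with weights 3/4 and 1/4. This gives integrable decay of order 5/4 at the price
  of a factor \<open>N powr (1/4)\<close>, whose square is still small against \<open>1 / h\<close>,
  which is of order \<open>N\<close>.\<close>

lemma dk_le_mp:
  assumes \<theta>: "0 \<le> \<theta>" "\<theta> < 1" shows "\<bar>dk \<theta> x\<bar> \<le> (1 / (1 - \<theta>)) powr (1/4) * mp (5/4) x"
proof (cases "x = 0")
  case x: False
  have A: "1 \<le> 1 / (1 - \<theta>)" using \<theta> by simp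
  then have A4: "1 \<le> (1 / (1 - \<theta>)) powr (1/4)" by (intro ge_one_powr_ge_zero) auto
  have b1: "\<bar>dk \<theta> x\<bar> \<le> (1 / (1 - \<theta>)) powr (1/4) * 1" using dk_bounds(1)[OF \<theta>, of x] A4 by simp
  have b2: "\<bar>dk \<theta> x\<bar> \<le> (1 / (1 - \<theta>)) powr (1/4) * \<bar>x\<bar> powr (- (5/4))"
  proof (cases "dk \<theta> x = 0")
    case False
    have "\<bar>dk \<theta> x\<bar> = \<bar>dk \<theta> x\<bar> powr (3/4) * \<bar>dk \<theta> x\<bar> powr (1/4)" using False by (simp flip: powr_add)
    also have "\<dots> \<le> (\<bar>x\<bar> powr (-1)) powr (3/4) * (1 / (1 - \<theta>) * \<bar>x\<bar> powr (-2)) powr (1/4)"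
    proof (intro mult_mono powr_mono2)
      show "\<bar>dk \<theta> x\<bar> \<le> \<bar>x\<bar> powr (-1)" using dk_bounds(2)[OF \<theta>, of x] x by (simp add: powr_minus field_simps)
      show "\<bar>dk \<theta> x\<bar> \<le> 1 / (1 - \<theta>) * \<bar>x\<bar> powr (-2)"
        using dk_bounds(3)[OF \<theta>, of x] x \<theta> by (simp add: powr_minus powr_numeral field_simps)
    qed auto
    also have "\<dots> = (1 / (1 - \<theta>)) powr (1/4) * (\<bar>x\<bar> powr (- (3/4)) * \<bar>x\<bar> powr (- (1/2)))"
      unfolding powr_mult powr_powr by simp
    also have "\<bar>x\<bar> powr (- (3/4)) * \<bar>x\<bar> powr (- (1/2)) = \<bar>x\<bar> powr (- (5/4))" unfolding powr_add[symmetric] by simp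
    finally show ?thesis .
  qed (use \<theta> in auto)
  from b1 b2 show ?thesis unfolding mp_def by (simp add: min_def)
qed (use mp_nonneg[of "5/4" 0] in simp)

lemma dk_integrable:
  assumes \<theta>: "0 \<le> \<theta>" "\<theta> < 1"
  shows "integrable lborel (dk \<theta>)"
    "(LINT x|lborel. \<bar>dk \<theta> x\<bar>) \<le> (1 / (1 - \<theta>)) powr (1/4) * (LINT x|lborel. mp (5/4) x)"
proof -
  have m: "integrable lborel (\<lambda>x. (1 / (1 - \<theta>)) powr (1/4) * mp (5/4) x)" using mp_integrable[of "5/4"] by simp
  show i: "integrable lborel (dk \<theta>)"
    by (rule Bochner_Integration.integrable_bound[OF m]) (auto intro!: AE_I2 order_trans[OF dk_le_mp[OF \<theta>] abs_ge_self])
  have "(LINT x|lborel. \<bar>dk \<theta> x\<bar>) \<le> (LINT x|lborel. (1 / (1 - \<theta>)) powr (1/4) * mp (5/4) x)"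
    by (intro integral_mono integrable_abs i m dk_le_mp \<theta>)
  then show "(LINT x|lborel. \<bar>dk \<theta> x\<bar>) \<le> (1 / (1 - \<theta>)) powr (1/4) * (LINT x|lborel. mp (5/4) x)" by simp
qed

lemma dk_powr_integral:
  assumes \<theta>: "0 \<le> \<theta>" "\<theta> < 1" and p: "1 < p"
  shows "(LINT x|lborel. \<bar>dk \<theta> x\<bar> powr p) \<le> (LINT x|lborel. mp p x)"
proof -
  have i: "integrable lborel (\<lambda>x. \<bar>dk \<theta> x\<bar> powr p)"
    by (rule Bochner_Integration.integrable_bound[OF mp_integrable[OF p]])
       (use p in \<open>auto intro!: AE_I2 order_trans[OF dk_powr_le[OF \<theta>] abs_ge_self]\<close>)
  show ?thesis using p by (intro integral_mono i mp_integrable dk_powr_le \<theta>) auto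
qed

lemma dk_square_integrable:
  assumes \<theta>: "0 \<le> \<theta>" "\<theta> < 1" shows "integrable lborel (\<lambda>x. (dk \<theta> x)\<^sup>2)"
  by (rule LINT_cauchy_bound(1)[where c = 0 and K = 2]) (use dk_square_le[OF \<theta>] in auto)

text \<open>The integrand lies below a Cauchy profile of width \<open>1 / (1 - \<theta>)\<close>.
  This width is \<open>N\<close>, of order \<open>1 / h\<close>, so after rescaling the second
  moment is of order \<open>h\<close>, and the squared kernel concentrates at the origin.\<close>

lemma dk_second_moment:
  assumes \<theta>: "0 \<le> \<theta>" "\<theta> < 1"
  shows "integrable lborel (\<lambda>x. (dk \<theta> x)\<^sup>2 * x\<^sup>2)" "(LINT x|lborel. (dk \<theta> x)\<^sup>2 * x\<^sup>2) \<le> 2 * pi / (1 - \<theta>)"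
proof -
  define A where "A = 1 / (1 - \<theta>)"
  have A: "A > 0" using \<theta> by (simp add: A_def)
  define q where "q x = 2 * inverse (1 + (0 + 1 / A * x)\<^sup>2)" for x
  have qi: "integrable lborel q" unfolding q_def
    using lborel_integrable_real_affine[OF integrable_cauchy, of "1 / A" 0] A by simp
  have "(LINT x|lborel. inverse (1 + x\<^sup>2)) = 1 / A * (LINT x|lborel. inverse (1 + (0 + 1 / A * x)\<^sup>2))"
    using A by (subst lborel_integral_real_affine[of "1 / A" _ 0]) auto
  moreover have "pi = 1 / A * I \<Longrightarrow> I = pi * A" for I using A by (simp add: field_simps)
  ultimately have "(LINT x|lborel. inverse (1 + (0 + 1 / A * x)\<^sup>2)) = pi * A"
    unfolding integral_cauchy by blast
  then have qI: "(LINT x|lborel. q x) = 2 * pi * A" unfolding q_def by simp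
  have le: "(dk \<theta> x)\<^sup>2 * x\<^sup>2 \<le> q x" for x
  proof -
    have p: "0 < 1 + (1 / A * x)\<^sup>2" by (simp add: add_pos_nonneg)
    have 1: "(\<bar>dk \<theta> x\<bar> * \<bar>x\<bar>)\<^sup>2 \<le> 1" using dk_bounds(2)[OF \<theta>, of x] by (intro power_le_one) auto
    have "(\<bar>dk \<theta> x\<bar> * x\<^sup>2)\<^sup>2 \<le> A\<^sup>2" using dk_bounds(3)[OF \<theta>, of x] by (intro power_mono) (auto simp: A_def)
    then have 2: "(\<bar>dk \<theta> x\<bar> * x\<^sup>2)\<^sup>2 / A\<^sup>2 \<le> 1" using A by simp
    have "(dk \<theta> x)\<^sup>2 * x\<^sup>2 * (1 + (1 / A * x)\<^sup>2) = (\<bar>dk \<theta> x\<bar> * \<bar>x\<bar>)\<^sup>2 + (\<bar>dk \<theta> x\<bar> * x\<^sup>2)\<^sup>2 / A\<^sup>2"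
      by (simp add: power_mult_distrib power_divide distrib_left power2_eq_square[of "x\<^sup>2"])
    also have "\<dots> \<le> 2" using 1 2 by simp
    finally have "(dk \<theta> x)\<^sup>2 * x\<^sup>2 \<le> 2 / (1 + (1 / A * x)\<^sup>2)" by (simp only: pos_le_divide_eq[OF p])
    then show ?thesis by (simp add: q_def divide_inverse)
  qed
  show i: "integrable lborel (\<lambda>x. (dk \<theta> x)\<^sup>2 * x\<^sup>2)"
    by (rule Bochner_Integration.integrable_bound[OF qi]) (use le in \<open>auto intro!: AE_I2 norm_mono_nonneg simp del: real_norm_def\<close>)
  have "(LINT x|lborel. (dk \<theta> x)\<^sup>2 * x\<^sup>2) \<le> (LINT x|lborel. q x)" by (intro integral_mono i qi le)
  then show "(LINT x|lborel. (dk \<theta> x)\<^sup>2 * x\<^sup>2) \<le> 2 * pi / (1 - \<theta>)" by (simp add: qI A_def)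
qed

section \<open>The limit of the squared kernel norm, and the link with the estimator's
  kernel\<close>

lemma sinc_square_le: "(sin x / x)\<^sup>2 \<le> 2 * inverse (1 + x\<^sup>2)" for x :: real
proof -
  have p: "0 < 1 + x\<^sup>2" by (simp add: add_pos_nonneg)
  have "\<bar>sin x / x\<bar> \<le> 1" using abs_sin_x_le_abs_x[of x] by (cases "x = 0") auto
  then have "(sin x / x)\<^sup>2 \<le> 1" by (simp add: abs_square_le_1)
  moreover have "(sin x / x)\<^sup>2 * x\<^sup>2 \<le> 1" by (cases "x = 0") (auto simp: power_divide abs_square_le_1)
  ultimately have "(sin x / x)\<^sup>2 * (1 + x\<^sup>2) \<le> 2" by (simp add: distrib_left)
  then show ?thesis unfolding divide_inverse[symmetric] pos_le_divide_eq[OF p] .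
qed

text \<open>\<open>Si (2 * x) - (sin x)\<^sup>2 / x\<close> is an antiderivative; it vanishes at 0
  and tends to \<open>pi / 2\<close>.\<close>

lemma sinc_square_integral: "(LINT x|lborel. (sin x / x)\<^sup>2) = (pi::real)"
proof -
  define F where "F x = Si (2 * x) - (sin x)\<^sup>2 / x" for x :: real
  have i: "integrable lborel (\<lambda>x::real. (sin x / x)\<^sup>2)"
    by (rule LINT_cauchy_bound(1)[where c = 0 and K = 2]) (use sinc_square_le in auto)
  have "(LBINT x=0..\<infinity>. (sin x / x)\<^sup>2) = pi / 2 - 0"
  proof (rule interval_integral_FTC_nonneg(2)[where F = F])
    show "(F has_real_derivative (sin x / x)\<^sup>2) (at x)" if "0 < ereal x" "ereal x < \<infinity>" for x
    proof -
      have x: "x > 0" using that by simp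
      have "((\<lambda>x. Si (2 * x)) has_real_derivative sinc (2 * x) * 2) (at x)"
        by (rule DERIV_chain2[OF DERIV_Si]) (auto intro!: derivative_eq_intros)
      moreover have "sin (x * 2) = 2 * sin x * cos x" using sin_double[of x] by (simp add: mult.commute)
      ultimately show ?thesis unfolding F_def
        using x by (auto intro!: derivative_eq_intros simp: sin_double power2_eq_square field_simps)
    qed
    show "isCont (\<lambda>x. (sin x / x)\<^sup>2) x" if "0 < ereal x" "ereal x < \<infinity>" for x
      using that by (auto intro!: continuous_intros)
    show "((F \<circ> real_of_ereal) \<longlongrightarrow> 0) (at_right 0)"
    proof -
      have "((\<lambda>x::real. sin x * (sin x / x)) \<longlongrightarrow> sin 0 * 1) (at 0)"
        by (intro tendsto_mult sinc_at_0 tendsto_intros) 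
      then have "((\<lambda>x::real. (sin x)\<^sup>2 / x) \<longlongrightarrow> 0) (at 0)" by (simp add: power2_eq_square)
      moreover have "((\<lambda>x. Si (2 * x)) \<longlongrightarrow> Si (2 * 0)) (at 0)"
        by (intro isCont_tendsto_compose[OF isCont_Si] tendsto_intros)
      ultimately have "(F \<longlongrightarrow> Si (2 * 0) - 0) (at 0)" unfolding F_def by (intro tendsto_diff)
      moreover have "Si 0 = 0" by (simp add: Si_def flip: zero_ereal_def)
      ultimately have "(F \<longlongrightarrow> 0) (at_right 0)" by (simp add: filterlim_at_split)
      then show ?thesis by (simp add: zero_ereal_def ereal_tendsto_simps)
    qed
    show "((F \<circ> real_of_ereal) \<longlongrightarrow> pi / 2) (at_left \<infinity>)"
    proof -
      have "filterlim (\<lambda>x::real. 2 * x) at_top at_top" by (intro filterlim_tendsto_pos_mult_at_top[OF tendsto_const]) (auto intro: filterlim_ident)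
      then have a: "((\<lambda>x. Si (2 * x)) \<longlongrightarrow> pi / 2) at_top" by (rule filterlim_compose[OF Si_at_top])
      have b: "((\<lambda>x::real. (sin x)\<^sup>2 / x) \<longlongrightarrow> 0) at_top"
      proof (rule Lim_null_comparison)
        show "\<forall>\<^sub>F x in at_top. norm ((sin x)\<^sup>2 / x) \<le> inverse x"
          using eventually_gt_at_top[of "0::real"] by eventually_elim (simp add: abs_square_le_1 divide_simps)
      qed (rule tendsto_inverse_0_at_top[OF filterlim_ident])
      have "(F \<longlongrightarrow> pi / 2 - 0) at_top" unfolding F_def by (intro tendsto_diff a b)
      then show ?thesis unfolding ereal_tendsto_simps by simp
    qed
  qed auto
  moreover have "(LBINT x=0..\<infinity>. (sin x / x)\<^sup>2) = (LINT t|lborel. (sin t / t)\<^sup>2 * indicator {0..} t)"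
    unfolding interval_lebesgue_integral_def set_lebesgue_integral_def
    using AE_lborel_singleton[of "0::real"]
    by (auto intro!: integral_cong_AE elim!: eventually_mono simp: einterval_iff indicator_def zero_ereal_def)
  moreover have "(LINT t|lborel. (sin t / t)\<^sup>2 * indicator {0..} t) = (LINT t|lborel. (sin t / t)\<^sup>2) / (2::real)"
    by (rule integral_even_half[OF i]) simp
  ultimately show ?thesis by simp
qed

text \<open>\<open>dk\<close> is a difference quotient at 1 of \<open>cos (s * x)\<close> in
  \<open>s\<close>, so it tends to \<open>sin x / (pi * x)\<close>. The limit \<open>1 / pi\<close>
  is the origin of the factor \<open>1 / sqrt pi\<close> in \<open>beta_const\<close>.\<close>

lemma dk_square_lim:
  assumes \<theta>: "\<And>j. 0 \<le> \<theta> j" "\<And>j. \<theta> j < 1" and lim: "\<theta> \<longlonglongrightarrow> 1"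
  shows "(\<lambda>j. LINT x|lborel. (dk (\<theta> j) x)\<^sup>2) \<longlonglongrightarrow> 1 / pi"
proof -
  have "(\<lambda>j. LINT x|lborel. (dk (\<theta> j) x)\<^sup>2) \<longlonglongrightarrow> (LINT x|lborel. (sin x / x)\<^sup>2 / pi\<^sup>2)"
  proof (rule integral_dominated_convergence[where w = "\<lambda>x. 2 * inverse (1 + x\<^sup>2)"])
    show "integrable lborel (\<lambda>x::real. 2 * inverse (1 + x\<^sup>2))" using integrable_cauchy by simp
    show "AE x in lborel. norm ((dk (\<theta> j) x)\<^sup>2) \<le> 2 * inverse (1 + x\<^sup>2)" for j
      using dk_square_le[OF \<theta>] by auto
    have at: "filterlim \<theta> (at 1) sequentially"
      unfolding filterlim_at using lim \<theta>(2) by (auto simp: less_imp_neq)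
    show "AE x in lborel. (\<lambda>j. (dk (\<theta> j) x)\<^sup>2) \<longlonglongrightarrow> (sin x / x)\<^sup>2 / pi\<^sup>2"
      using AE_lborel_singleton[of "0::real"]
    proof eventually_elim
      case (elim x)
      have "((\<lambda>s. cos (s * x)) has_real_derivative - (sin (1 * x)) * x) (at 1)"
        by (auto intro!: derivative_eq_intros)
      then have "((\<lambda>s. (cos (s * x) - cos (1 * x)) / (s - 1)) \<longlongrightarrow> - sin x * x) (at 1)"
        by (simp add: has_field_derivative_iff)
      from filterlim_compose[OF this at]
      have "(\<lambda>j. (cos (\<theta> j * x) - cos x) / (\<theta> j - 1)) \<longlonglongrightarrow> - sin x * x" by simp
      from tendsto_mult[OF this tendsto_const[of "- 1 / (pi * x\<^sup>2)"]]
      have "(\<lambda>j. (cos (\<theta> j * x) - cos x) / (\<theta> j - 1) * (- 1 / (pi * x\<^sup>2))) \<longlonglongrightarrow> - sin x * x * (- 1 / (pi * x\<^sup>2))" .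
      moreover have "(cos (\<theta> j * x) - cos x) / (\<theta> j - 1) * (- 1 / (pi * x\<^sup>2)) = dk (\<theta> j) x" for j
      proof -
        have "c / (- b) * (- 1 / (pi * x\<^sup>2)) = c / (pi * b * x\<^sup>2)" for b c
          by (simp add: divide_inverse ac_simps)
        from this[of "cos (\<theta> j * x) - cos x" "1 - \<theta> j"] show ?thesis unfolding dk_def by simp
      qed
      moreover have "- sin x * x * (- 1 / (pi * x\<^sup>2)) = sin x / x / pi" using elim by (simp add: power2_eq_square)
      ultimately have "(\<lambda>j. dk (\<theta> j) x) \<longlonglongrightarrow> sin x / x / pi" by simp
      then show ?case using tendsto_power[of "\<lambda>j. dk (\<theta> j) x" "sin x / x / pi" sequentially 2] by (simp add: power_divide power_mult_distrib)
    qed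
  qed measurable
  also have "(LINT x|lborel. (sin x / x)\<^sup>2 / pi\<^sup>2) = 1 / pi"
    unfolding integral_divide_zero sinc_square_integral by (simp add: power2_eq_square)
  finally show ?thesis .
qed

lemma LINT_scale: "h > 0 \<Longrightarrow> (LINT x|lborel. g (x / h)) = h * (LINT x|lborel. g x)" for g :: "real \<Rightarrow> real"
  by (subst lborel_integral_real_affine[of h _ 0]) auto

lemma integrable_scale: "h > 0 \<Longrightarrow> integrable lborel g \<Longrightarrow> integrable lborel (\<lambda>x. g (x / h))" for g :: "real \<Rightarrow> real"
  using lborel_integrable_real_affine[of g "1 / h" 0] by simp

lemma kh_ker_eq_dk: "kh_ker \<gamma> n x = dk (theta_par \<gamma> n) (x / h_par \<gamma> n) / h_par \<gamma> n"
  by (simp add: kh_ker_def k_ker_def dk_def)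

text \<open>Since \<open>h = \<theta> / N\<close>, the frequencies \<open>\<theta> / h\<close> and
  \<open>1 / h\<close> are \<open>N\<close> and \<open>N / \<theta>\<close>, and
  \<open>1 - \<theta> = 1 / N\<close> makes their difference \<open>1 / \<theta>\<close>.\<close>

lemma kh_ker_eq_vp:
  assumes N: "N_par \<gamma> n > 1"
  shows "kh_ker \<gamma> n x = vp (N_par \<gamma> n) (N_par \<gamma> n / theta_par \<gamma> n) x"
proof -
  define N where "N = N_par \<gamma> n"
  define \<theta> where "\<theta> = theta_par \<gamma> n"
  have \<theta>: "\<theta> = 1 - 1 / N" "\<theta> > 0" "\<theta> < 1" and N1: "N > 1" using N by (auto simp: \<theta>_def theta_par_def N_def)
  have h: "h_par \<gamma> n = \<theta> / N" by (simp add: h_par_def \<theta>_def N_def)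
  have a1: "\<theta> * (x / (\<theta> / N)) = N * x" "x / (\<theta> / N) = N / \<theta> * x" using \<theta> N1 by (auto simp: field_simps)
  have d: "N / \<theta> - N = 1 / \<theta>"
  proof -
    have "N * (1 - \<theta>) = 1" using \<theta> N1 by simp
    then show ?thesis using \<theta>(2) by (simp add: field_simps)
  qed
  have "kh_ker \<gamma> n x = (cos (N * x) - cos (N / \<theta> * x)) / (pi * (1 / N) * (N / \<theta> * x)\<^sup>2) / (\<theta> / N)"
    unfolding kh_ker_eq_dk dk_def \<theta>_def[symmetric] h a1 using \<theta> by simp
  also have "\<dots> = (cos (N * x) - cos (N / \<theta> * x)) * \<theta> / (pi * x\<^sup>2)"
  proof -
    have "c / (pi * (1 / N) * (N / \<theta> * x)\<^sup>2) / (\<theta> / N) = c * \<theta> / (pi * x\<^sup>2)" for c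
      using \<theta>(2) N1 by (cases "x = 0"; simp add: power2_eq_square field_simps)
    then show ?thesis .
  qed
  also have "\<dots> = vp N (N / \<theta>) x"
    unfolding vp_def fejer_def d by (simp add: diff_divide_distrib algebra_simps)
  finally show ?thesis by (simp add: N_def \<theta>_def)
qed

subsection \<open>Sequences of densities\<close>

lemma param_limits:
  assumes \<gamma>: "\<gamma> > 0"
  shows "filterlim (N_par \<gamma>) at_top at_top" "(h_par \<gamma> \<longlongrightarrow> 0) at_top" "(theta_par \<gamma> \<longlongrightarrow> 1) at_top"
    "filterlim (\<lambda>n. real n * h_par \<gamma> n) at_top at_top"
    "((\<lambda>n. h_par \<gamma> n * (N_par \<gamma> n powr (1/4))\<^sup>2) \<longlongrightarrow> 0) at_top"
  unfolding h_par_def theta_par_def N_par_def using \<gamma> by real_asymp+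

lemma param_facts:
  assumes \<gamma>: "\<gamma> > 0" and N: "N_par \<gamma> n \<ge> 2"
  shows "1/2 \<le> theta_par \<gamma> n" "theta_par \<gamma> n < 1" "0 \<le> theta_par \<gamma> n" "1 - theta_par \<gamma> n = 1 / N_par \<gamma> n" "0 < h_par \<gamma> n" "0 < n"
    "1 / (1 - theta_par \<gamma> n) = N_par \<gamma> n" "N_par \<gamma> n + 1 \<le> N_par \<gamma> n / theta_par \<gamma> n" "h_par \<gamma> n \<le> 1"
    "exp (- \<gamma> * N_par \<gamma> n) = 1 / sqrt (real n)"
proof -
  define N where "N = N_par \<gamma> n"
  have N2: "N \<ge> 2" using N by (simp add: N_def)
  have \<theta>: "theta_par \<gamma> n = 1 - 1 / N" by (simp add: theta_par_def N_def)
  have iN: "0 < 1 / N" "1 / N \<le> 1 / 2" using N2 by auto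
  show t: "1/2 \<le> theta_par \<gamma> n" "theta_par \<gamma> n < 1" "0 \<le> theta_par \<gamma> n" "1 - theta_par \<gamma> n = 1 / N_par \<gamma> n"
    using \<theta> iN N2 by (auto simp: N_def[symmetric])
  show "1 / (1 - theta_par \<gamma> n) = N_par \<gamma> n" using t(4) by simp
  have h: "h_par \<gamma> n = theta_par \<gamma> n / N" by (simp add: h_par_def N_def)
  show "0 < h_par \<gamma> n" "h_par \<gamma> n \<le> 1" unfolding h using t N2 by auto
  \<comment> \<open>\<open>ln 0 = 0\<close>, so the sample size 0 would give
    \<open>N = 0\<close>.\<close>
  show n: "0 < n"
  proof (rule ccontr)
    assume "\<not> 0 < n"
    then have "N = 0" by (simp add: N_def N_par_def)
    then show False using N2 by simp
  qed
  have d: "N / theta_par \<gamma> n - N = 1 / theta_par \<gamma> n"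
  proof -
    have "N * (1 - theta_par \<gamma> n) = 1" using t(4) N2 by (simp add: N_def)
    then show ?thesis using t(1) by (simp add: field_simps)
  qed
  have "1 \<le> 1 / theta_par \<gamma> n" using t by simp
  then show "N_par \<gamma> n + 1 \<le> N_par \<gamma> n / theta_par \<gamma> n" using d by (simp add: N_def)
  have "- \<gamma> * N = - (ln (real n) / 2)" using \<gamma> by (simp add: N_def N_par_def)
  also have "\<dots> = - ln (sqrt (real n))" using n by (simp add: ln_sqrt)
  also have "exp \<dots> = 1 / sqrt (real n)" using n by (simp add: exp_minus divide_inverse)
  finally show "exp (- \<gamma> * N_par \<gamma> n) = 1 / sqrt (real n)" by (simp add: N_def)
qed

lemma kh_facts:
  assumes \<gamma>: "\<gamma> > 0" and N: "N_par \<gamma> n \<ge> 2"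
  shows "kh_ker \<gamma> n \<in> borel_measurable borel" "\<bar>kh_ker \<gamma> n z\<bar> \<le> 1 / h_par \<gamma> n" "integrable lborel (kh_ker \<gamma> n)"
    "h_par \<gamma> n * (LINT z|lborel. (kh_ker \<gamma> n z)\<^sup>2) = (LINT x|lborel. (dk (theta_par \<gamma> n) x)\<^sup>2)"
    "integrable lborel (\<lambda>z. (kh_ker \<gamma> n z)\<^sup>2)"
    "integrable lborel (\<lambda>z. (kh_ker \<gamma> n z)\<^sup>2 * z\<^sup>2)"
    "h_par \<gamma> n * (LINT z|lborel. (kh_ker \<gamma> n z)\<^sup>2 * z\<^sup>2) \<le> 2 * pi * h_par \<gamma> n"
    "(LINT z|lborel. \<bar>kh_ker \<gamma> n z\<bar>) \<le> N_par \<gamma> n powr (1/4) * (LINT x|lborel. mp (5/4) x)"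
    "1 < p \<Longrightarrow> h_par \<gamma> n * (Lq_norm p (kh_ker \<gamma> n))\<^sup>2 \<le> h_par \<gamma> n powr (2 / p - 1) * (LINT x|lborel. mp p x) powr (2 / p)"
proof -
  note pf = param_facts[OF \<gamma> N]
  define \<theta> where "\<theta> = theta_par \<gamma> n"
  define h where "h = h_par \<gamma> n"
  have \<theta>: "0 \<le> \<theta>" "\<theta> < 1" and h: "h > 0" using pf by (auto simp: \<theta>_def h_def)
  have k: "kh_ker \<gamma> n = (\<lambda>z. dk \<theta> (z / h) / h)" by (simp add: kh_ker_eq_dk[abs_def] \<theta>_def h_def)
  show "kh_ker \<gamma> n \<in> borel_measurable borel" unfolding k by measurable
  show "\<bar>kh_ker \<gamma> n z\<bar> \<le> 1 / h_par \<gamma> n" unfolding k h_def[symmetric] using dk_bounds(1)[OF \<theta>, of "z / h"] h by (simp add: divide_right_mono)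
  show "integrable lborel (kh_ker \<gamma> n)" unfolding k using integrable_scale[OF h dk_integrable(1)[OF \<theta>]] by simp
  have "(LINT z|lborel. (kh_ker \<gamma> n z)\<^sup>2) = (LINT z|lborel. (dk \<theta> (z / h))\<^sup>2) / h\<^sup>2" unfolding k by (simp add: power_divide)
  then show "h_par \<gamma> n * (LINT z|lborel. (kh_ker \<gamma> n z)\<^sup>2) = (LINT x|lborel. (dk (theta_par \<gamma> n) x)\<^sup>2)"
    unfolding h_def[symmetric] \<theta>_def[symmetric] using h LINT_scale[OF h, of "\<lambda>x. (dk \<theta> x)\<^sup>2"] by (simp add: power2_eq_square)
  show "integrable lborel (\<lambda>z. (kh_ker \<gamma> n z)\<^sup>2)" unfolding k
    using integrable_scale[OF h dk_square_integrable[OF \<theta>]] by (simp add: power_divide)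
  have e: "(kh_ker \<gamma> n z)\<^sup>2 * z\<^sup>2 = (dk \<theta> (z / h))\<^sup>2 * (z / h)\<^sup>2" for z unfolding k using h by (simp add: power_divide)
  show "integrable lborel (\<lambda>z. (kh_ker \<gamma> n z)\<^sup>2 * z\<^sup>2)" unfolding e
    by (rule integrable_scale[OF h dk_second_moment(1)[OF \<theta>]])
  have "h * (LINT z|lborel. (kh_ker \<gamma> n z)\<^sup>2 * z\<^sup>2) = h * (h * (LINT x|lborel. (dk \<theta> x)\<^sup>2 * x\<^sup>2))"
    unfolding e using LINT_scale[OF h, of "\<lambda>x. (dk \<theta> x)\<^sup>2 * x\<^sup>2"] by simp
  also have "\<dots> \<le> h * (h * (2 * pi / (1 - \<theta>)))" using h by (intro mult_left_mono dk_second_moment(2) \<theta>) auto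
  also have "2 * pi / (1 - \<theta>) = 2 * pi * N_par \<gamma> n" using pf(7) unfolding \<theta>_def by (metis mult.right_neutral times_divide_eq_right)
  also have "h * (2 * pi * N_par \<gamma> n) = 2 * pi * \<theta>" using N by (simp add: h_def h_par_def \<theta>_def)
  also have "h * (2 * pi * \<theta>) \<le> h * (2 * pi * 1)" using h \<theta> by (intro mult_left_mono) auto
  finally show "h_par \<gamma> n * (LINT z|lborel. (kh_ker \<gamma> n z)\<^sup>2 * z\<^sup>2) \<le> 2 * pi * h_par \<gamma> n" by (simp add: h_def ac_simps)
  have "(LINT z|lborel. \<bar>kh_ker \<gamma> n z\<bar>) = (LINT z|lborel. \<bar>dk \<theta> (z / h)\<bar>) / h" unfolding k using h by simp
  also have "\<dots> = (LINT x|lborel. \<bar>dk \<theta> x\<bar>)" using h LINT_scale[OF h, of "\<lambda>x. \<bar>dk \<theta> x\<bar>"] by simp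
  also have "\<dots> \<le> (1 / (1 - \<theta>)) powr (1/4) * (LINT x|lborel. mp (5/4) x)" by (rule dk_integrable(2)[OF \<theta>])
  also have "1 / (1 - \<theta>) = N_par \<gamma> n" using pf(7) by (simp add: \<theta>_def)
  finally show "(LINT z|lborel. \<bar>kh_ker \<gamma> n z\<bar>) \<le> N_par \<gamma> n powr (1/4) * (LINT x|lborel. mp (5/4) x)" .
  assume p: "1 < p"
  define I where "I = (LINT x|lborel. \<bar>dk \<theta> x\<bar> powr p)"
  have I: "0 \<le> I" "I \<le> (LINT x|lborel. mp p x)" using dk_powr_integral[OF \<theta> p] by (auto simp: I_def)
  have "(LINT z|lborel. \<bar>kh_ker \<gamma> n z\<bar> powr p) = (LINT z|lborel. \<bar>dk \<theta> (z / h)\<bar> powr p) / h powr p"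
    unfolding k using h by (simp add: powr_divide)
  also have "\<dots> = h powr (1 - p) * I"
    using h LINT_scale[OF h, of "\<lambda>x. \<bar>dk \<theta> x\<bar> powr p"] by (simp add: I_def powr_diff)
  finally have "Lq_norm p (kh_ker \<gamma> n) = (h powr (1 - p) * I) powr (1 / p)" by (simp add: Lq_norm_def)
  then have "(Lq_norm p (kh_ker \<gamma> n))\<^sup>2 = (h powr (1 - p) * I) powr (2 / p)" by (simp add: power2_eq_square flip: powr_add)
  also have "\<dots> = h powr ((1 - p) * (2 / p)) * I powr (2 / p)" by (simp add: powr_mult powr_powr)
  also have "(1 - p) * (2 / p) = 2 / p - 2" using p by (simp add: field_simps)
  finally have "h * (Lq_norm p (kh_ker \<gamma> n))\<^sup>2 = h powr (1 + (2 / p - 2)) * I powr (2 / p)"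
    using h by (simp add: mult.assoc[symmetric] powr_mult_base)
  also have "1 + (2 / p - 2) = 2 / p - 1" by simp
  also have "h powr (2 / p - 1) * I powr (2 / p) \<le> h powr (2 / p - 1) * (LINT x|lborel. mp p x) powr (2 / p)"
    using I p by (intro mult_left_mono powr_mono2) auto
  finally show "h_par \<gamma> n * (Lq_norm p (kh_ker \<gamma> n))\<^sup>2 \<le> h_par \<gamma> n powr (2 / p - 1) * (LINT x|lborel. mp p x) powr (2 / p)"
    by (simp add: h_def)
qed

text \<open>Young's inequality with exponents \<open>2 / p\<close> and \<open>2 / (2 - p)\<close>,
  constants discarded: if the first summand is smaller than the left side, then
  \<open>a powr (p / 2 - 1)\<close> exceeds \<open>e * w\<close>, which is the second bound. The
  parameter \<open>e\<close> can make the part linear in \<open>a\<close> as small as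
  desired.\<close>

lemma young_weight:
  fixes a w e p :: real
  assumes p: "0 < p" "p < 2" and a: "0 \<le> a" and w: "0 < w" and e: "0 < e"
  shows "a powr (p / 2) \<le> e * a * w + e powr (- (p / (2 - p))) * w powr (- (p / (2 - p)))"
proof (cases "e * a * w \<le> a powr (p / 2)")
  case False then show ?thesis by (simp add: add_increasing2)
next
  case True
  show ?thesis
  proof (cases "a = 0")
    case False
    with a have a: "a > 0" by simp
    have "a powr (p / 2) = a powr (p / 2 - 1) * a" using a by (simp add: powr_diff)
    with True have "(e * w) * a \<le> a powr (p / 2 - 1) * a" by (simp add: ac_simps)
    then have "e * w \<le> a powr (p / 2 - 1)" using a by simp
    then have "(a powr (p / 2 - 1)) powr (- (p / (2 - p))) \<le> (e * w) powr (- (p / (2 - p)))"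
      using p e w by (intro powr_mono2') auto
    also have "(a powr (p / 2 - 1)) powr (- (p / (2 - p))) = a powr (p / 2)"
    proof -
      have "(p / 2 - 1) * (- (p / (2 - p))) = p / 2" using p by (simp add: field_simps)
      then show ?thesis by (simp only: powr_powr)
    qed
    also have "(e * w) powr (- (p / (2 - p))) = e powr (- (p / (2 - p))) * w powr (- (p / (2 - p)))" by (rule powr_mult)
    finally show ?thesis using a w e by (simp add: add_increasing)
  qed (use p in simp)
qed

text \<open>The weight decays with exponent \<open>lam * p / (2 - p)\<close>, which exceeds 1
  exactly when \<open>lam > (2 - p) / p\<close>.\<close>

lemma weight_integrable:
  fixes p lam :: real
  assumes p: "1 \<le> p" "p < 2" and lam: "(2 - p) / p < lam"
  shows "integrable lborel (\<lambda>x. (1 + \<bar>x\<bar> powr lam) powr (- (p / (2 - p))))"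
proof (rule Bochner_Integration.integrable_bound)
  define q where "q = p / (2 - p)"
  have q: "q > 0" using p by (simp add: q_def)
  have "1 < lam * q" using lam p by (simp add: q_def field_simps)
  then show "integrable lborel (mp (lam * q))" by (rule mp_integrable)
  have "(1 + \<bar>x\<bar> powr lam) powr (- q) \<le> mp (lam * q) x" if "x \<noteq> 0" for x
  proof -
    have "(1 + \<bar>x\<bar> powr lam) powr (- q) \<le> 1 powr (- q)" using q by (intro powr_mono2') auto
    moreover have "(1 + \<bar>x\<bar> powr lam) powr (- q) \<le> (\<bar>x\<bar> powr lam) powr (- q)" using q that by (intro powr_mono2') auto
    ultimately show ?thesis by (simp add: mp_def powr_powr)
  qed
  then show "AE x in lborel. norm ((1 + \<bar>x\<bar> powr lam) powr (- (p / (2 - p)))) \<le> norm (mp (lam * q) x)"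
    using AE_lborel_singleton[of "0::real"] by (auto elim!: eventually_mono simp: q_def mp_nonneg)
qed measurable

text \<open>The sequence that the argument by contradiction produces. The condition on
  \<open>N_par\<close> for every \<open>j\<close> is obtained by dropping finitely many terms; it
  keeps \<open>theta_par\<close> at least 1/2.\<close>

locale density_seq =
  fixes \<gamma> M p lam :: real and f0 :: "real \<Rightarrow> real" and fs :: "nat \<Rightarrow> real \<Rightarrow> real" and ns :: "nat \<Rightarrow> nat"
  assumes \<gamma>: "\<gamma> > 0" and M: "M > 0" and p: "1 \<le> p" and lam: "p < 2 \<Longrightarrow> (2 - p) / p < lam \<and> lam \<le> 2"
    and f0: "f0 \<in> bbF \<gamma> p M lam" and fs: "\<And>j. fs j \<in> bbF \<gamma> p M lam"
    and rho_lim: "(\<lambda>j. rho \<gamma> p M lam f0 (fs j)) \<longlonglongrightarrow> 0"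
    and ns_lim: "filterlim ns at_top sequentially" and N2: "\<And>j. N_par \<gamma> (ns j) \<ge> 2"
begin

lemma u_of_props:
  assumes "f \<in> bbF \<gamma> p M lam"
  shows "u_of \<gamma> p M f \<in> Lp p" "Lq_norm p (u_of \<gamma> p M f) \<le> M" "f x = (LINT s|lborel. G_ker \<gamma> (x - s) * u_of \<gamma> p M f s)"
proof -
  from assms have "\<exists>u. represents \<gamma> p M f u" by (simp add: bbF_def calF_def)
  then have "represents \<gamma> p M f (u_of \<gamma> p M f)" unfolding u_of_def by (rule someI_ex)
  then show "u_of \<gamma> p M f \<in> Lp p" "Lq_norm p (u_of \<gamma> p M f) \<le> M" "f x = (LINT s|lborel. G_ker \<gamma> (x - s) * u_of \<gamma> p M f s)"
    by (auto simp: represents_def Lp_def)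
qed

lemma bbF_density:
  assumes "f \<in> bbF \<gamma> p M lam"
  shows "is_prob_density f" "f \<in> borel_measurable borel" "0 \<le> f x" "integrable lborel f" "(LINT x|lborel. f x) = 1"
  using assms by (auto simp: bbF_def is_prob_density_def)

text \<open>The bound of \<open>G_conv\<close> at height 1 for functions \<open>u\<close> of norm at
  most \<open>M\<close>: a common supremum bound for the class.\<close>

definition Cf where "Cf = 1 + M powr p / (2 * \<gamma>)"

lemma Cf_pos: "Cf > 0" unfolding Cf_def using \<gamma> by (simp add: add_pos_nonneg)

lemma conv_abs_bound:
  assumes f: "f \<in> bbF \<gamma> p M lam"
  shows "(LINT s|lborel. \<bar>G_ker \<gamma> (x - s) * u_of \<gamma> p M f s\<bar>) \<le> Cf"
proof -
  have "(LINT s|lborel. \<bar>G_ker \<gamma> (x - s) * u_of \<gamma> p M f s\<bar>) \<le> 1 + 1 powr (1 - p) * (Lq_norm p (u_of \<gamma> p M f) powr p) / (2 * \<gamma>)"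
    by (rule G_conv(2)[OF \<gamma> p u_of_props(1)[OF f] zero_less_one])
  also have "\<dots> \<le> Cf" unfolding Cf_def using u_of_props(2)[OF f] p \<gamma>
    by (auto intro!: divide_right_mono powr_mono2)
  finally show ?thesis .
qed

lemma bbF_le:
  assumes f: "f \<in> bbF \<gamma> p M lam" shows "f x \<le> Cf"
proof -
  have "\<bar>f x\<bar> \<le> (LINT s|lborel. \<bar>G_ker \<gamma> (x - s) * u_of \<gamma> p M f s\<bar>)"
    unfolding u_of_props(3)[OF f, of x] by (rule integral_abs_bound)
  then show ?thesis using conv_abs_bound[OF f, of x] by linarith
qed

text \<open>Convergence of the \<open>u\<close> in L_p passes through the convolution: in
  \<open>G_conv\<close>, height \<open>\<epsilon> / 2\<close> leaves a multiple of a power of the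
  L_p distance, which tends to zero.\<close>

lemma fs_uniform: "\<epsilon> > 0 \<Longrightarrow> \<forall>\<^sub>F j in sequentially. \<forall>x. \<bar>fs j x - f0 x\<bar> \<le> \<epsilon>"
proof -
  assume e: "\<epsilon> > 0"
  define w where "w j s = u_of \<gamma> p M f0 s - u_of \<gamma> p M (fs j) s" for j s
  have wL: "w j \<in> Lp p" for j unfolding w_def[abs_def] by (intro Lp_diff p u_of_props(1) f0 fs)
  have wl: "(\<lambda>j. Lq_norm p (w j)) \<longlonglongrightarrow> 0"
  proof (rule tendsto_sandwich[OF _ _ tendsto_const rho_lim])
    show "\<forall>\<^sub>F j in sequentially. Lq_norm p (w j) \<le> rho \<gamma> p M lam f0 (fs j)"
      by (rule always_eventually) (auto simp: rho_def w_def[abs_def])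
  qed simp
  define c where "c = (\<epsilon> / 2) powr (1 - p) / (2 * \<gamma>)"
  have "(\<lambda>j. c * Lq_norm p (w j) powr p) \<longlonglongrightarrow> c * 0 powr p"
    by (intro tendsto_mult tendsto_const tendsto_powr2 wl) (use p in auto)
  then have "(\<lambda>j. c * Lq_norm p (w j) powr p) \<longlonglongrightarrow> 0" by simp
  then have "\<forall>\<^sub>F j in sequentially. c * Lq_norm p (w j) powr p < \<epsilon> / 2" using e by (intro order_tendstoD(2)) auto
  then show ?thesis
  proof eventually_elim
    case (elim j)
    show ?case
    proof
      fix x
      have "f0 x - fs j x = (LINT s|lborel. G_ker \<gamma> (x - s) * w j s)"
        unfolding u_of_props(3)[OF f0, of x] u_of_props(3)[OF fs, of j x]
        by (subst Bochner_Integration.integral_diff[symmetric])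
           (auto intro!: G_conv(1)[OF \<gamma> p _ zero_less_one] u_of_props(1) f0 fs simp: w_def right_diff_distrib)
      then have "\<bar>fs j x - f0 x\<bar> = \<bar>LINT s|lborel. G_ker \<gamma> (x - s) * w j s\<bar>" by (simp add: abs_minus_commute)
      also have "\<dots> \<le> (LINT s|lborel. \<bar>G_ker \<gamma> (x - s) * w j s\<bar>)" by (rule integral_abs_bound)
      also have "\<dots> \<le> \<epsilon> / 2 + (\<epsilon> / 2) powr (1 - p) * (Lq_norm p (w j) powr p) / (2 * \<gamma>)"
        using e by (intro G_conv(2) \<gamma> p wL) auto
      also have "\<dots> \<le> \<epsilon>" using elim by (simp add: c_def)
      finally show "\<bar>fs j x - f0 x\<bar> \<le> \<epsilon>" .
    qed
  qed
qed

lemma fs_lim: "(\<lambda>j. fs j x) \<longlonglongrightarrow> f0 x"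
proof (rule LIMSEQ_I)
  fix r :: real assume r: "r > 0"
  then have "\<forall>\<^sub>F j in sequentially. \<forall>x. \<bar>fs j x - f0 x\<bar> \<le> r / 2" by (intro fs_uniform) auto
  then have "\<forall>\<^sub>F j in sequentially. norm (fs j x - f0 x) < r" 
  proof eventually_elim
    case (elim j)
    then have "\<bar>fs j x - f0 x\<bar> \<le> r / 2" by blast
    then show ?case using r by simp
  qed
  then show "\<exists>no. \<forall>n\<ge>no. norm (fs n x - f0 x) < r" by (simp add: eventually_sequentially)
qed

text \<open>A modulus for the limit density; for the densities of the sequence it is combined with
  uniform convergence.\<close>

lemma f0_continuous:
  assumes e: "\<epsilon> > 0"
  obtains \<delta> where "\<delta> > 0" "\<And>z. \<bar>z\<bar> \<le> \<delta> \<Longrightarrow> \<bar>f0 (x - z) - f0 x\<bar> \<le> \<epsilon>"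
proof -
  define c where "c = pi / (2 * \<gamma>)"
  have c: "c > 0" using \<gamma> by (simp add: c_def)
  have "((\<lambda>d. (exp (c * d) - 1) * Cf) \<longlongrightarrow> (exp (c * 0) - 1) * Cf) (at_right 0)" by (intro tendsto_intros)
  then have "((\<lambda>d. (exp (c * d) - 1) * Cf) \<longlongrightarrow> 0) (at_right 0)" by simp
  then have "\<forall>\<^sub>F d in at_right 0. (exp (c * d) - 1) * Cf < \<epsilon>" using e by (rule order_tendstoD(2))
  then obtain b where b: "b > 0" "\<And>d. 0 < d \<Longrightarrow> d < b \<Longrightarrow> (exp (c * d) - 1) * Cf < \<epsilon>"
    unfolding eventually_at_right_field by auto
  show ?thesis
  proof (rule that[of "b / 2"])
    fix z assume z: "\<bar>z\<bar> \<le> b / 2"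
    have "\<bar>f0 x - f0 (x - z)\<bar> \<le> (exp (pi / (2 * \<gamma>) * \<bar>x - (x - z)\<bar>) - 1) * (LINT s|lborel. \<bar>G_ker \<gamma> (x - s) * u_of \<gamma> p M f0 s\<bar>)"
      unfolding u_of_props(3)[OF f0, of x] u_of_props(3)[OF f0, of "x - z"]
      by (rule G_conv_lip[OF \<gamma> p u_of_props(1)[OF f0]])
    also have "\<dots> \<le> (exp (c * (b / 2)) - 1) * Cf"
    proof (intro mult_mono conv_abs_bound f0)
      have "c * \<bar>z\<bar> \<le> c * (b / 2)" using z c by (intro mult_left_mono) auto
      then show "exp (pi / (2 * \<gamma>) * \<bar>x - (x - z)\<bar>) - 1 \<le> exp (c * (b / 2)) - 1" by (simp add: c_def)
      have "0 \<le> c * (b / 2)" using c b(1) by simp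
      then show "0 \<le> exp (c * (b / 2)) - 1" by simp
    qed simp
    also have "\<dots> < \<epsilon>" using b(1) by (intro b(2)) auto
    finally show "\<bar>f0 (x - z) - f0 x\<bar> \<le> \<epsilon>" by (simp add: abs_minus_commute)
  qed (use b in simp)
qed

abbreviation "kk j \<equiv> kh_ker \<gamma> (ns j)"
abbreviation "hh j \<equiv> h_par \<gamma> (ns j)"
abbreviation "th j \<equiv> theta_par \<gamma> (ns j)"
abbreviation "NN j \<equiv> N_par \<gamma> (ns j)"

lemma seq_limits:
  "filterlim NN at_top sequentially" "hh \<longlonglongrightarrow> 0" "th \<longlonglongrightarrow> 1"
  "filterlim (\<lambda>j. real (ns j) * hh j) at_top sequentially"
  "(\<lambda>j. hh j * (NN j powr (1/4))\<^sup>2) \<longlonglongrightarrow> 0"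
  using filterlim_compose[OF param_limits(1)[OF \<gamma>] ns_lim] filterlim_compose[OF param_limits(2)[OF \<gamma>] ns_lim]
    filterlim_compose[OF param_limits(3)[OF \<gamma>] ns_lim] filterlim_compose[OF param_limits(4)[OF \<gamma>] ns_lim]
    filterlim_compose[OF param_limits(5)[OF \<gamma>] ns_lim] by auto

lemmas pf = param_facts[OF \<gamma> N2]
lemmas kf = kh_facts[OF \<gamma> N2]

lemma kde: "kde (fs j) (kk j) (hh j) (ns j)"
  by unfold_locales (rule bbF_density(1)[OF fs] kf(1-3) pf(5,6))+

sublocale K: kde_seq fs kk hh ns
  by (rule kde_seq.intro[OF kde filterlim_compose[OF filterlim_real_sequentially ns_lim] seq_limits(4)])

definition SS where "SS j = (LINT x|lborel. (dk (th j) x)\<^sup>2)"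

lemma SS_lim: "SS \<longlonglongrightarrow> 1 / pi"
  unfolding SS_def by (rule dk_square_lim) (use pf seq_limits in auto)

lemma S2_eq: "kde.S2 (kk j) (hh j) = SS j"
  unfolding kde.S2_def[OF kde] SS_def by (rule kf)

lemma ss_eq: "K.ss j x = (LINT z|lborel. hh j * (kk j z)\<^sup>2 * fs j (x - z))"
  and ss_int: "integrable lborel (\<lambda>z. hh j * (kk j z)\<^sup>2 * fs j (x - z))"
proof -
  note [measurable] = kf(1)[of j] bbF_density(2)[OF fs[of j]]
  show "integrable lborel (\<lambda>z. hh j * (kk j z)\<^sup>2 * fs j (x - z))"
  proof (rule Bochner_Integration.integrable_bound)
    show "integrable lborel (\<lambda>z. hh j * (kk j z)\<^sup>2 * Cf)" using kf(5)[of j] by simp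
    show "AE z in lborel. norm (hh j * (kk j z)\<^sup>2 * fs j (x - z)) \<le> norm (hh j * (kk j z)\<^sup>2 * Cf)"
      using pf(5)[of j] bbF_density(3)[OF fs[of j]] bbF_le[OF fs[of j]]
      by (intro AE_I2 norm_mono_nonneg mult_nonneg_nonneg mult_left_mono) auto
  qed measurable
  have "K.ss j x = hh j * (LINT y|lborel. fs j y * (kk j (x - y))\<^sup>2)"
    unfolding kde.s2_def[OF kde] by (subst kde.integral_D[OF kde]) auto
  also have "(LINT y|lborel. fs j y * (kk j (x - y))\<^sup>2) = (LINT z|lborel. fs j (x - z) * (kk j z)\<^sup>2)"
    by (subst lborel_integral_real_affine[of "-1" _ x]) auto
  also have "hh j * \<dots> = (LINT z|lborel. hh j * (kk j z)\<^sup>2 * fs j (x - z))"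
    by (subst integral_mult_right_zero[symmetric]) (simp add: algebra_simps)
  finally show "K.ss j x = (LINT z|lborel. hh j * (kk j z)\<^sup>2 * fs j (x - z))" .
qed

lemma ss_le: "K.ss j x \<le> Cf * SS j"
proof -
  have "K.ss j x \<le> (LINT z|lborel. hh j * (kk j z)\<^sup>2 * Cf)"
    unfolding ss_eq using ss_int kf(5)[of j] pf(5)[of j] bbF_le[OF fs[of j]]
    by (intro integral_mono mult_left_mono) auto
  also have "\<dots> = Cf * SS j" using kf(4)[of j] by (simp add: SS_def)
  finally show ?thesis .
qed

text \<open>\<open>h\<close> times the squared kernel is an approximate identity of mass
  \<open>SS j\<close>, tending to \<open>1 / pi\<close>. It concentrates by Chebyshev's argument,
  its second moment being at most \<open>2 * pi * h\<close>.\<close>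

lemma ss_lim: "(\<lambda>j. K.ss j x) \<longlonglongrightarrow> f0 x / pi"
proof (rule LIMSEQ_I)
  fix r :: real assume r: "r > 0"
  define e where "e = r / 8"
  have e: "e > 0" using r by (simp add: e_def)
  obtain \<delta> where \<delta>: "\<delta> > 0" "\<And>z. \<bar>z\<bar> \<le> \<delta> \<Longrightarrow> \<bar>f0 (x - z) - f0 x\<bar> \<le> e" using f0_continuous[OF e, of x] by blast
  have f0b: "\<bar>f0 y\<bar> \<le> Cf" for y using bbF_le[OF f0, of y] bbF_density(3)[OF f0, of y] by simp
  \<comment> \<open>Continuity near 0 and boundedness away from 0 in a single estimate, quadratic in
    \<open>z\<close> so that it matches the second moment of the kernel.\<close>
  have pt: "\<bar>f0 (x - z) - f0 x\<bar> \<le> e + 2 * Cf / \<delta>\<^sup>2 * z\<^sup>2" for z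
  proof (cases "\<bar>z\<bar> \<le> \<delta>")
    case True
    then show ?thesis using \<delta>(2)[OF True] Cf_pos by (auto intro: add_increasing2)
  next
    case False
    then have "\<delta>\<^sup>2 \<le> z\<^sup>2" using \<delta>(1) by (simp add: abs_le_square_iff[symmetric])
    then have "2 * Cf * \<delta>\<^sup>2 \<le> 2 * Cf * z\<^sup>2" using Cf_pos by (intro mult_left_mono) auto
    then have "2 * Cf \<le> 2 * Cf / \<delta>\<^sup>2 * z\<^sup>2" using \<delta>(1) by (simp add: field_simps)
    moreover have "\<bar>f0 (x - z) - f0 x\<bar> \<le> 2 * Cf" using f0b[of "x - z"] f0b[of x] by linarith
    ultimately show ?thesis using e by linarith
  qed
  have bound: "\<bar>K.ss j x - f0 x / pi\<bar> \<le> 2 * e * SS j + 2 * Cf / \<delta>\<^sup>2 * (2 * pi * hh j) + Cf * \<bar>SS j - 1 / pi\<bar>"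
    if j: "\<forall>x. \<bar>fs j x - f0 x\<bar> \<le> e" for j
  proof -
    note hp = pf(5)[of j] and k2 = kf(5)[of j] and k2z = kf(6)[of j]
    define \<kappa> where "\<kappa> z = hh j * (kk j z)\<^sup>2" for z
    have \<kappa>0: "\<kappa> z \<ge> 0" for z using hp by (simp add: \<kappa>_def)
    have \<kappa>i: "integrable lborel \<kappa>" unfolding \<kappa>_def[abs_def] using k2 by simp
    have \<kappa>I: "(LINT z|lborel. \<kappa> z) = SS j" unfolding \<kappa>_def using kf(4)[of j] by (simp add: SS_def)
    have \<kappa>z: "integrable lborel (\<lambda>z. \<kappa> z * z\<^sup>2)" unfolding \<kappa>_def using k2z by (simp add: mult.assoc)
    have \<kappa>zI: "(LINT z|lborel. \<kappa> z * z\<^sup>2) \<le> 2 * pi * hh j" unfolding \<kappa>_def using kf(7)[of j] by (simp add: mult.assoc)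
    have si: "integrable lborel (\<lambda>z. \<kappa> z * fs j (x - z))" using ss_int[of j x] by (simp add: \<kappa>_def)
    have "K.ss j x - f0 x * SS j = (LINT z|lborel. \<kappa> z * fs j (x - z) - f0 x * \<kappa> z)"
      using si \<kappa>i by (simp add: ss_eq \<kappa>_def[symmetric] \<kappa>I)
    also have "\<bar>\<dots>\<bar> \<le> (LINT z|lborel. \<bar>\<kappa> z * fs j (x - z) - f0 x * \<kappa> z\<bar>)" by (rule integral_abs_bound)
    also have "\<dots> \<le> (LINT z|lborel. 2 * e * \<kappa> z + 2 * Cf / \<delta>\<^sup>2 * (\<kappa> z * z\<^sup>2))"
    proof (intro integral_mono)
      show "integrable lborel (\<lambda>z. \<bar>\<kappa> z * fs j (x - z) - f0 x * \<kappa> z\<bar>)" using si \<kappa>i by auto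
      show "integrable lborel (\<lambda>z. 2 * e * \<kappa> z + 2 * Cf / \<delta>\<^sup>2 * (\<kappa> z * z\<^sup>2))" using \<kappa>i \<kappa>z by auto
      fix z
      have "\<kappa> z * fs j (x - z) - f0 x * \<kappa> z = \<kappa> z * (fs j (x - z) - f0 x)" by (simp add: algebra_simps)
      then have "\<bar>\<kappa> z * fs j (x - z) - f0 x * \<kappa> z\<bar> = \<kappa> z * \<bar>fs j (x - z) - f0 x\<bar>" using \<kappa>0 by (simp add: abs_mult)
      also have "\<dots> \<le> \<kappa> z * (2 * e + 2 * Cf / \<delta>\<^sup>2 * z\<^sup>2)"
      proof (rule mult_left_mono[OF _ \<kappa>0])
        show "\<bar>fs j (x - z) - f0 x\<bar> \<le> 2 * e + 2 * Cf / \<delta>\<^sup>2 * z\<^sup>2"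
          using spec[OF j, of "x - z"] pt[of z] by linarith
      qed
      finally show "\<bar>\<kappa> z * fs j (x - z) - f0 x * \<kappa> z\<bar> \<le> 2 * e * \<kappa> z + 2 * Cf / \<delta>\<^sup>2 * (\<kappa> z * z\<^sup>2)"
        by (simp add: algebra_simps)
    qed
    also have "\<dots> = 2 * e * SS j + 2 * Cf / \<delta>\<^sup>2 * (LINT z|lborel. \<kappa> z * z\<^sup>2)" using \<kappa>i \<kappa>z \<kappa>I by simp
    also have "\<dots> \<le> 2 * e * SS j + 2 * Cf / \<delta>\<^sup>2 * (2 * pi * hh j)"
      using \<kappa>zI Cf_pos by (intro add_left_mono mult_left_mono) auto
    finally have 1: "\<bar>K.ss j x - f0 x * SS j\<bar> \<le> 2 * e * SS j + 2 * Cf / \<delta>\<^sup>2 * (2 * pi * hh j)" .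
    have "f0 x * SS j - f0 x / pi = f0 x * (SS j - 1 / pi)" by (simp add: right_diff_distrib)
    then have "\<bar>f0 x * SS j - f0 x / pi\<bar> \<le> Cf * \<bar>SS j - 1 / pi\<bar>" using f0b[of x] by (simp add: abs_mult mult_right_mono)
    with 1 show ?thesis by linarith
  qed
  have "(\<lambda>j. 2 * e * SS j + 2 * Cf / \<delta>\<^sup>2 * (2 * pi * hh j) + Cf * \<bar>SS j - 1 / pi\<bar>) \<longlonglongrightarrow>
    2 * e * (1 / pi) + 2 * Cf / \<delta>\<^sup>2 * (2 * pi * 0) + Cf * \<bar>1 / pi - 1 / pi\<bar>"
    by (intro tendsto_intros SS_lim seq_limits)
  moreover have "2 * e * (1 / pi) + 2 * Cf / \<delta>\<^sup>2 * (2 * pi * 0) + Cf * \<bar>1 / pi - 1 / pi\<bar> < r"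
  proof -
    have "2 * e * (1 / pi) \<le> 2 * e * 1" using e pi_gt3 by (intro mult_left_mono) auto
    then show ?thesis using r by (simp add: e_def)
  qed
  ultimately have "\<forall>\<^sub>F j in sequentially. 2 * e * SS j + 2 * Cf / \<delta>\<^sup>2 * (2 * pi * hh j) + Cf * \<bar>SS j - 1 / pi\<bar> < r"
    by (rule order_tendstoD(2))
  then have "\<forall>\<^sub>F j in sequentially. norm (K.ss j x - f0 x / pi) < r"
    using fs_uniform[OF e] by eventually_elim (use bound in \<open>auto intro: le_less_trans\<close>)
  then show "\<exists>no. \<forall>n\<ge>no. norm (K.ss n x - f0 x / pi) < r" by (simp add: eventually_sequentially)
qed

lemma mm_eq: "K.mm j x = (LINT y|lborel. kk j (x - y) * fs j y)"
proof -
  note [measurable] = kf(1)[of j]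
  show ?thesis unfolding kde.m_def[OF kde] by (subst kde.integral_D[OF kde]) (auto simp: mult.commute)
qed

text \<open>The mean is at most the supremum of the density times the L_1 norm of the kernel, hence
  \<open>O(N powr (1/4))\<close>. So the squared mean, by which \<open>s2\<close> differs from the
  variance, disappears in the limit.\<close>

lemma mm_lim: "(\<lambda>j. hh j * (K.mm j x)\<^sup>2) \<longlonglongrightarrow> 0"
proof -
  define c where "c = (LINT x|lborel. mp (5/4) x)"
  have c: "c \<ge> 0" unfolding c_def by (rule Bochner_Integration.integral_nonneg) (rule mp_nonneg)
  have mb: "\<bar>K.mm j x\<bar> \<le> Cf * (NN j powr (1/4) * c)" for j
  proof -
    have ki: "integrable lborel (\<lambda>y. kk j (x - y))" using lborel_integrable_real_affine[OF kf(3)[of j], of "-1" x] by simp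
    note [measurable] = kf(1)[of j] bbF_density(2)[OF fs[of j]]
    have b: "\<bar>kk j (x - y) * fs j y\<bar> \<le> Cf * \<bar>kk j (x - y)\<bar>" for y
      using bbF_le[OF fs[of j], of y] bbF_density(3)[OF fs[of j], of y] by (simp add: abs_mult mult.commute mult_right_mono)
    have i: "integrable lborel (\<lambda>y. kk j (x - y) * fs j y)"
      by (rule Bochner_Integration.integrable_bound[of _ "\<lambda>y. Cf * \<bar>kk j (x - y)\<bar>"])
         (use ki in \<open>auto intro!: AE_I2 order_trans[OF b abs_ge_self]\<close>)
    have "\<bar>K.mm j x\<bar> \<le> (LINT y|lborel. \<bar>kk j (x - y) * fs j y\<bar>)" unfolding mm_eq by (rule integral_abs_bound)
    also have "\<dots> \<le> (LINT y|lborel. Cf * \<bar>kk j (x - y)\<bar>)" using i ki b by (intro integral_mono) auto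
    also have "\<dots> = Cf * (LINT y|lborel. \<bar>kk j (x - y)\<bar>)" by simp
    also have "(LINT y|lborel. \<bar>kk j (x - y)\<bar>) = (LINT z|lborel. \<bar>kk j z\<bar>)"
      by (subst (2) lborel_integral_real_affine[of "-1" _ x]) auto
    also have "Cf * \<dots> \<le> Cf * (NN j powr (1/4) * c)" unfolding c_def using Cf_pos by (intro mult_left_mono kf) auto
    finally show ?thesis .
  qed
  show ?thesis
  proof (rule Lim_null_comparison)
    show "\<forall>\<^sub>F j in sequentially. norm (hh j * (K.mm j x)\<^sup>2) \<le> (Cf * c)\<^sup>2 * (hh j * (NN j powr (1/4))\<^sup>2)"
    proof (intro always_eventually allI)
      fix j
      have "(K.mm j x)\<^sup>2 \<le> (Cf * (NN j powr (1/4) * c))\<^sup>2"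
        using power_mono[OF mb[of j] abs_ge_zero, of 2] by simp
      then have "hh j * (K.mm j x)\<^sup>2 \<le> hh j * (Cf * (NN j powr (1/4) * c))\<^sup>2"
        using pf(5)[of j] by (intro mult_left_mono) auto
      then show "norm (hh j * (K.mm j x)\<^sup>2) \<le> (Cf * c)\<^sup>2 * (hh j * (NN j powr (1/4))\<^sup>2)"
        using pf(5)[of j] by (simp add: power_mult_distrib algebra_simps)
    qed
    show "(\<lambda>j. (Cf * c)\<^sup>2 * (hh j * (NN j powr (1/4))\<^sup>2)) \<longlonglongrightarrow> 0"
      using tendsto_mult_right_zero[OF seq_limits(5)] by blast
  qed
qed

text \<open>The bias is \<open>O(1 / sqrt n)\<close>, so multiplication by
  \<open>sqrt (n * h)\<close> leaves \<open>O(sqrt h)\<close>.\<close>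

lemma bias_lim:
  "(\<lambda>x. K.mm j x - fs j x) \<in> Lp p"
  "(\<lambda>j. sqrt (real (ns j) * hh j) * Lq_norm p (\<lambda>x. K.mm j x - fs j x)) \<longlonglongrightarrow> 0"
proof -
  have m: "K.mm j x = (LINT y|lborel. vp (NN j) (NN j / th j) (x - y) * fs j y)" for j x
    unfolding mm_eq using N2[of j] by (simp add: kh_ker_eq_vp)
  have N0: "0 \<le> NN j" for j using N2[of j] by simp
  note B = bias_bound[OF \<gamma> p u_of_props(1)[OF fs] N0 pf(8) u_of_props(3)[OF fs] bbF_density(2)[OF fs]]
  show "(\<lambda>x. K.mm j x - fs j x) \<in> Lp p" unfolding m by (rule B)
  have le: "Lq_norm p (\<lambda>x. K.mm j x - fs j x) \<le> biasC \<gamma> * (1 / sqrt (real (ns j))) * pi * M" for j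
  proof -
    have "Lq_norm p (\<lambda>x. K.mm j x - fs j x) \<le> biasC \<gamma> * exp (- \<gamma> * NN j) * pi * Lq_norm p (u_of \<gamma> p M (fs j))"
      unfolding m by (rule B)
    also have "\<dots> \<le> biasC \<gamma> * exp (- \<gamma> * NN j) * pi * M"
      using biasC_pos[OF \<gamma>] by (intro mult_left_mono u_of_props(2) fs) auto
    finally show ?thesis by (simp only: pf(10))
  qed
  show "(\<lambda>j. sqrt (real (ns j) * hh j) * Lq_norm p (\<lambda>x. K.mm j x - fs j x)) \<longlonglongrightarrow> 0"
  proof (rule Lim_null_comparison)
    show "\<forall>\<^sub>F j in sequentially. norm (sqrt (real (ns j) * hh j) * Lq_norm p (\<lambda>x. K.mm j x - fs j x)) \<le> biasC \<gamma> * pi * M * sqrt (hh j)"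
    proof (intro always_eventually allI)
      fix j
      have "sqrt (real (ns j) * hh j) * Lq_norm p (\<lambda>x. K.mm j x - fs j x) \<le> sqrt (real (ns j) * hh j) * (biasC \<gamma> * (1 / sqrt (real (ns j))) * pi * M)"
        using pf(5)[of j] by (intro mult_left_mono le) auto
      also have "\<dots> = biasC \<gamma> * pi * M * sqrt (hh j)" using pf(6)[of j] by (simp add: real_sqrt_mult)
      finally show "norm (sqrt (real (ns j) * hh j) * Lq_norm p (\<lambda>x. K.mm j x - fs j x)) \<le> biasC \<gamma> * pi * M * sqrt (hh j)"
        using pf(5)[of j] by simp
    qed
    have "(\<lambda>j. biasC \<gamma> * pi * M * sqrt (hh j)) \<longlonglongrightarrow> biasC \<gamma> * pi * M * sqrt 0" by (intro tendsto_intros seq_limits)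
    then show "(\<lambda>j. biasC \<gamma> * pi * M * sqrt (hh j)) \<longlonglongrightarrow> 0" by simp
  qed
qed

text \<open>For \<open>p \<ge> 2\<close> this is part of the class; for \<open>p < 2\<close> it
  follows from the moment of order \<open>lam\<close> through \<open>young_weight\<close>.\<close>

lemma bbF_powr_int:
  assumes f: "f \<in> bbF \<gamma> p M lam" shows "integrable lborel (\<lambda>x. f x powr (p / 2))"
proof (cases "2 \<le> p")
  case True then show ?thesis using f by (simp add: bbF_def)
next
  case False
  then have p2: "p < 2" by simp
  have fl: "integrable lborel (\<lambda>x. \<bar>x\<bar> powr lam * f x)" using f p2 by (simp add: bbF_def)
  note [measurable] = bbF_density(2)[OF f]
  define w where "w x = 1 + \<bar>x\<bar> powr lam" for x
  have w: "w x > 0" for x by (simp add: w_def add_pos_nonneg)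
  show ?thesis
  proof (rule Bochner_Integration.integrable_bound)
    have "integrable lborel (\<lambda>x. f x + \<bar>x\<bar> powr lam * f x)" using bbF_density(4)[OF f] fl by simp
    then have "integrable lborel (\<lambda>x. 1 * f x * w x)" by (simp add: w_def algebra_simps)
    moreover have "integrable lborel (\<lambda>x. 1 powr (- (p / (2 - p))) * w x powr (- (p / (2 - p))))"
      using weight_integrable[OF p p2] lam[OF p2] by (simp add: w_def)
    ultimately show "integrable lborel (\<lambda>x. 1 * f x * w x + 1 powr (- (p / (2 - p))) * w x powr (- (p / (2 - p))))" by (rule Bochner_Integration.integrable_add)
    show "AE x in lborel. norm (f x powr (p / 2)) \<le> norm (1 * f x * w x + 1 powr (- (p / (2 - p))) * w x powr (- (p / (2 - p))))"
      using p p2 bbF_density(3)[OF f] w by (intro AE_I2 norm_mono_nonneg young_weight) auto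
  qed measurable
qed

definition I0 where "I0 = (LINT x|lborel. f0 x powr (p / 2))"

lemma I0_pos: "I0 > 0"
proof (rule ccontr)
  assume "\<not> I0 > 0"
  moreover have "I0 \<ge> 0" by (simp add: I0_def)
  ultimately have "I0 = 0" by simp
  then have "AE x in lborel. f0 x powr (p / 2) = 0"
    unfolding I0_def using integral_nonneg_eq_0_iff_AE[OF bbF_powr_int[OF f0]] by simp
  then have "AE x in lborel. f0 x = 0" by simp
  then have "(LINT x|lborel. f0 x) = 0" using integral_eq_zero_AE by blast
  then show False using bbF_density(5)[OF f0] by simp
qed

text \<open>Pointwise convergence and Fatou's lemma. A lower bound is the direction wanted, since
  the integral ends up in a denominator.\<close>

lemma powr_integral_liminf:
  assumes c: "0 \<le> c" "c < I0"
  shows "\<forall>\<^sub>F j in sequentially. c < (LINT x|lborel. fs j x powr (p / 2))"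
proof -
  note [measurable] = bbF_density(2)[OF f0] bbF_density(2)[OF fs]
  have "ennreal c < ennreal I0" using c by (simp add: ennreal_less_iff)
  also have "ennreal I0 = (\<integral>\<^sup>+x. ennreal (f0 x powr (p / 2)) \<partial>lborel)"
    unfolding I0_def by (rule nn_integral_eq_integral[symmetric]) (use bbF_powr_int[OF f0] in auto)
  also have "\<dots> = (\<integral>\<^sup>+x. liminf (\<lambda>j. ennreal (fs j x powr (p / 2))) \<partial>lborel)"
  proof (rule nn_integral_cong)
    fix x
    have "(\<lambda>j. ennreal (fs j x powr (p / 2))) \<longlonglongrightarrow> ennreal (f0 x powr (p / 2))"
      using p bbF_density(3)[OF fs] by (intro tendsto_ennrealI tendsto_powr2 fs_lim tendsto_const) auto
    then show "ennreal (f0 x powr (p / 2)) = liminf (\<lambda>j. ennreal (fs j x powr (p / 2)))"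
      using lim_imp_Liminf[OF sequentially_bot] by metis
  qed
  also have "\<dots> \<le> liminf (\<lambda>j. \<integral>\<^sup>+x. ennreal (fs j x powr (p / 2)) \<partial>lborel)"
    by (rule nn_integral_liminf) measurable
  finally have "\<forall>\<^sub>F j in sequentially. ennreal c < (\<integral>\<^sup>+x. ennreal (fs j x powr (p / 2)) \<partial>lborel)"
    by (rule less_LiminfD)
  then show ?thesis
  proof eventually_elim
    case (elim j)
    have "(\<integral>\<^sup>+x. ennreal (fs j x powr (p / 2)) \<partial>lborel) = ennreal (LINT x|lborel. fs j x powr (p / 2))"
      by (rule nn_integral_eq_integral) (use bbF_powr_int[OF fs[of j]] in auto)
    then show ?case using elim c by (simp add: ennreal_less_iff)
  qed
qed

lemma beta_eq:
  assumes f: "f \<in> bbF \<gamma> p M lam"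
  shows "beta_const p f = 1 / sqrt pi * M_const p * (LINT x|lborel. f x powr (p / 2)) powr (1 / p)"
proof -
  have "Lq_norm (p / 2) f = (LINT x|lborel. f x powr (p / 2)) powr (2 / p)"
    using bbF_density(3)[OF f] by (simp add: Lq_norm_def)
  then have "sqrt (Lq_norm (p / 2) f) = (LINT x|lborel. f x powr (p / 2)) powr (1 / p)"
    by (simp add: powr_half_sqrt[symmetric] powr_powr)
  then show ?thesis by (simp add: beta_const_def)
qed

end

subsection \<open>Convergence of the clipped functional\<close>

text \<open>Fatou's lemma for \<open>G j - F j\<close>: dominated convergence, from above, with
  majorants that vary but whose integrals converge.\<close>

lemma reverse_fatou:
  fixes F G :: "nat \<Rightarrow> real \<Rightarrow> real"
  assumes [measurable]: "\<And>j. F j \<in> borel_measurable lborel" "Fl \<in> borel_measurable lborel"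
    and G: "\<And>j. integrable lborel (G j)" "integrable lborel G0"
    and F: "\<And>j x. 0 \<le> F j x" "\<And>j x. F j x \<le> G j x"
    and lim: "\<And>x. (\<lambda>j. F j x) \<longlonglongrightarrow> Fl x" "\<And>x. (\<lambda>j. G j x) \<longlonglongrightarrow> G0 x"
    and GI: "(\<lambda>j. LINT x|lborel. G j x) \<longlonglongrightarrow> (LINT x|lborel. G0 x)" and \<eta>: "\<eta> > 0"
  shows "\<forall>\<^sub>F j in sequentially. (LINT x|lborel. F j x) \<le> (LINT x|lborel. Fl x) + \<eta>"
proof -
  note [measurable] = borel_measurable_integrable[OF G(1)] borel_measurable_integrable[OF G(2)]
  have Fl: "0 \<le> Fl x" "Fl x \<le> G0 x" for x
    by (rule LIMSEQ_le_const[OF lim(1)], use F in blast) (rule LIMSEQ_le[OF lim], use F in blast)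
  have Fi: "integrable lborel (F j)" for j
    by (rule Bochner_Integration.integrable_bound[OF G(1)[of j]]) (use F in \<open>auto intro!: AE_I2 order_trans[OF F(2) abs_ge_self]\<close>)
  have Fli: "integrable lborel Fl"
    by (rule Bochner_Integration.integrable_bound[OF G(2)]) (use Fl in \<open>auto intro!: AE_I2 order_trans[OF Fl(2) abs_ge_self]\<close>)
  define c where "c = (LINT x|lborel. G0 x - Fl x) - \<eta> / 2"
  have ev: "\<forall>\<^sub>F j in sequentially. (LINT x|lborel. G j x) < (LINT x|lborel. G0 x) + \<eta> / 2"
    using \<eta> by (intro order_tendstoD(2)[OF GI]) auto
  have cG: "c = (LINT x|lborel. G0 x) - (LINT x|lborel. Fl x) - \<eta> / 2"
    unfolding c_def by (subst Bochner_Integration.integral_diff[OF G(2) Fli]) simp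
  show ?thesis
  proof (cases "c < 0")
    \<comment> \<open>A negative \<open>c\<close> would be truncated to 0 in \<open>ennreal\<close>;
      here the majorant alone already gives the bound.\<close>
    case True
    from ev show ?thesis
    proof eventually_elim
      case (elim j)
      have "(LINT x|lborel. F j x) \<le> (LINT x|lborel. G j x)" by (intro integral_mono Fi G F)
      with elim True cG show ?case by simp
    qed
  next
    case False
    have "ennreal c < ennreal (LINT x|lborel. G0 x - Fl x)" using False \<eta> by (simp add: c_def ennreal_less_iff)
    also have "\<dots> = (\<integral>\<^sup>+x. ennreal (G0 x - Fl x) \<partial>lborel)"
      by (rule nn_integral_eq_integral[symmetric]) (use G(2) Fli Fl in auto)
    also have "\<dots> = (\<integral>\<^sup>+x. liminf (\<lambda>j. ennreal (G j x - F j x)) \<partial>lborel)"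
    proof (rule nn_integral_cong)
      fix x
      have "(\<lambda>j. ennreal (G j x - F j x)) \<longlonglongrightarrow> ennreal (G0 x - Fl x)"
        by (intro tendsto_ennrealI tendsto_diff lim)
      then show "ennreal (G0 x - Fl x) = liminf (\<lambda>j. ennreal (G j x - F j x))"
        using lim_imp_Liminf[OF sequentially_bot] by metis
    qed
    also have "\<dots> \<le> liminf (\<lambda>j. \<integral>\<^sup>+x. ennreal (G j x - F j x) \<partial>lborel)"
      by (rule nn_integral_liminf) measurable
    finally have "\<forall>\<^sub>F j in sequentially. ennreal c < (\<integral>\<^sup>+x. ennreal (G j x - F j x) \<partial>lborel)"
      by (rule less_LiminfD)
    with ev show ?thesis
    proof eventually_elim
      case (elim j)
      have "(\<integral>\<^sup>+x. ennreal (G j x - F j x) \<partial>lborel) = ennreal (LINT x|lborel. G j x - F j x)"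
        by (rule nn_integral_eq_integral) (use G(1)[of j] Fi[of j] F in auto)
      then have "c < (LINT x|lborel. G j x - F j x)" using elim(2) False by (simp add: ennreal_less_iff)
      also have "\<dots> = (LINT x|lborel. G j x) - (LINT x|lborel. F j x)"
        by (rule Bochner_Integration.integral_diff[OF G(1) Fi])
      finally show ?case using elim(1) cG by simp
    qed
  qed
qed

lemma (in kde) clip_int_meas:
  "(\<lambda>x. LINT X|P. min \<bar>Y X x\<bar> K powr p) \<in> borel_measurable borel"
proof -
  have [measurable]: "(\<lambda>(x, X). Y X x) \<in> borel_measurable (borel \<Otimes>\<^sub>M P)"
    using measurable_pair_swap[OF Y_meas] by simp
  show ?thesis by measurable
qed

section \<open>Absolute moments of the normal law and the Gaussian limit of clipped moments\<close>

lemma std_normal_abs_moment_integrable: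
  assumes "0 \<le> p" shows "integrable lborel (\<lambda>z. std_normal_density z * \<bar>z\<bar> powr p)"
proof -
  define k where "k = 2 * nat \<lceil>p\<rceil>"
  have k: "p \<le> real k" "even k" using assms by (auto simp: k_def) linarith
  show ?thesis
  proof (rule Bochner_Integration.integrable_bound)
    show "integrable lborel (\<lambda>z. std_normal_density z * z ^ 0 + std_normal_density z * z ^ k)"
      by (intro Bochner_Integration.integrable_add integrable_std_normal_moment)
    have "\<bar>z\<bar> powr p \<le> 1 + z ^ k" for z :: real
    proof (cases "\<bar>z\<bar> \<le> 1")
      case True
      then have "\<bar>z\<bar> powr p \<le> 1" using assms by (intro powr_le1) auto
      then show ?thesis using k(2) by (simp add: zero_le_even_power add_increasing2)
    next
      case False
      then have "\<bar>z\<bar> powr p \<le> \<bar>z\<bar> powr real k" using k by (intro powr_mono) auto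
      also have "\<dots> = z ^ k" using False k(2) by (subst powr_realpow) (auto simp: power_even_abs)
      finally show ?thesis by simp
    qed
    then have "std_normal_density z * \<bar>z\<bar> powr p \<le> std_normal_density z * z ^ 0 + std_normal_density z * z ^ k" for z
      using mult_left_mono[of "\<bar>z\<bar> powr p" "1 + z ^ k" "std_normal_density z"] by (simp add: distrib_left)
    then show "AE z in lborel. norm (std_normal_density z * \<bar>z\<bar> powr p) \<le> norm (std_normal_density z * z ^ 0 + std_normal_density z * z ^ k)"
      by (intro AE_I2 norm_mono_nonneg) auto
  qed measurable
qed

lemma M_const_powr:
  assumes "p > 0" shows "M_const p powr p = (LINT z|lborel. std_normal_density z * \<bar>z\<bar> powr p)" "M_const p > 0"
proof -
  show 1: "M_const p powr p = (LINT z|lborel. std_normal_density z * \<bar>z\<bar> powr p)"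
    using assms by (simp add: M_const_def powr_powr mult.commute)
  have "(LINT z|lborel. std_normal_density z * \<bar>z\<bar> powr p) \<noteq> 0"
  proof
    assume "(LINT z|lborel. std_normal_density z * \<bar>z\<bar> powr p) = 0"
    then have "AE z in lborel. std_normal_density z * \<bar>z\<bar> powr p = 0"
      using integral_nonneg_eq_0_iff_AE[OF std_normal_abs_moment_integrable[of p]] assms by simp
    moreover have "AE z in lborel. z \<noteq> (0::real)" by (rule AE_lborel_singleton)
    ultimately have "AE z in (lborel :: real measure). False"
    proof eventually_elim
      case (elim z)
      have "std_normal_density z > 0" by (rule normal_density_pos) simp
      then show ?case using elim by simp
    qed
    then show False by (simp add: eventually_False ae_filter_eq_bot_iff emeasure_lborel_UNIV)
  qed
  then have "M_const p powr p \<noteq> 0" unfolding 1 .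
  then show "M_const p > 0" by (auto simp: M_const_def)
qed

lemma dk_square_integral_le:
  assumes \<theta>: "0 \<le> \<theta>" "\<theta> < 1" shows "(LINT x|lborel. (dk \<theta> x)\<^sup>2) \<le> 2 * pi"
  using LINT_cauchy_bound(2)[of "\<lambda>x. (dk \<theta> x)\<^sup>2" 2 0] dk_square_le[OF \<theta>] by simp

context density_seq
begin

definition Fc where "Fc K j x = (LINT X|K.PP j. min \<bar>K.YY j X x\<bar> K powr p)"
definition Fl where "Fl K x = (LINT z|std_normal_distribution. min \<bar>sqrt (f0 x / pi) * z\<bar> K powr p)"

text \<open>For fixed \<open>K\<close> the clipped power is bounded and continuous, as weak
  convergence requires.\<close>

lemma Fc_lim:
  assumes K: "K > 0" shows "(\<lambda>j. Fc K j x) \<longlonglongrightarrow> Fl K x"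
  unfolding Fc_def Fl_def
proof (rule K.clt[OF _ mm_lim, where B = "K powr p"])
  show "(\<lambda>j. K.ss j x) \<longlonglongrightarrow> (sqrt (f0 x / pi))\<^sup>2" using ss_lim[of x] bbF_density(3)[OF f0, of x] by simp
  show "isCont (\<lambda>y. min \<bar>y\<bar> K powr p) y" for y
    unfolding isCont_def using p K by (intro tendsto_powr2 tendsto_min tendsto_rabs tendsto_ident_at tendsto_const) auto
  show "\<bar>min \<bar>y\<bar> K powr p\<bar> \<le> K powr p" for y using p K by (auto intro!: powr_mono2 min.boundedI)
qed

lemma Fl_meas [measurable]: "Fl K \<in> borel_measurable borel"
proof -
  interpret N: prob_space std_normal_distribution by (rule real_distribution.axioms(1)[OF real_dist_normal_dist])
  note [measurable] = bbF_density(2)[OF f0]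
  show ?thesis unfolding Fl_def by measurable
qed

text \<open>Dropping the clip leaves the p-th absolute moment of a centred normal variable with
  variance \<open>f0 x / pi\<close>. Integrated over \<open>x\<close>, this is exactly
  \<open>beta0 powr p\<close>.\<close>

lemma Fl_le:
  assumes K: "K > 0"
  shows "0 \<le> Fl K x" "Fl K x \<le> (1 / sqrt pi) powr p * M_const p powr p * f0 x powr (p / 2)"
proof -
  define \<sigma> where "\<sigma> = sqrt (f0 x / pi)"
  have \<sigma>: "\<sigma> \<ge> 0" "\<sigma> = sqrt (f0 x) * (1 / sqrt pi)" using bbF_density(3)[OF f0, of x] by (auto simp: \<sigma>_def real_sqrt_divide)
  show "0 \<le> Fl K x" by (simp add: Fl_def)
  have "Fl K x = (LINT z|lborel. std_normal_density z * min \<bar>\<sigma> * z\<bar> K powr p)"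
    unfolding Fl_def \<sigma>_def by (subst integral_density) auto
  also have "\<dots> \<le> (LINT z|lborel. \<sigma> powr p * (std_normal_density z * \<bar>z\<bar> powr p))"
  proof (rule integral_mono)
    have i: "integrable lborel (\<lambda>z. \<sigma> powr p * (std_normal_density z * \<bar>z\<bar> powr p))"
      using std_normal_abs_moment_integrable[of p] p by simp
    have le: "std_normal_density z * min \<bar>\<sigma> * z\<bar> K powr p \<le> \<sigma> powr p * (std_normal_density z * \<bar>z\<bar> powr p)" for z
    proof -
      have "min \<bar>\<sigma> * z\<bar> K powr p \<le> \<bar>\<sigma> * z\<bar> powr p" using p K by (intro powr_mono2) (auto intro: min.boundedI)
      also have "\<dots> = \<sigma> powr p * \<bar>z\<bar> powr p" using \<sigma>(1) by (simp add: abs_mult powr_mult)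
      finally have "std_normal_density z * min \<bar>\<sigma> * z\<bar> K powr p \<le> std_normal_density z * (\<sigma> powr p * \<bar>z\<bar> powr p)" by (intro mult_left_mono) auto
      then show ?thesis by (simp add: algebra_simps)
    qed
    show "integrable lborel (\<lambda>z. \<sigma> powr p * (std_normal_density z * \<bar>z\<bar> powr p))" by (rule i)
    show "integrable lborel (\<lambda>z. std_normal_density z * min \<bar>\<sigma> * z\<bar> K powr p)"
      by (rule Bochner_Integration.integrable_bound[OF i])
         (auto intro!: AE_I2 norm_mono_nonneg le simp del: real_norm_def)
    show "std_normal_density z * min \<bar>\<sigma> * z\<bar> K powr p \<le> \<sigma> powr p * (std_normal_density z * \<bar>z\<bar> powr p)" for z by (rule le)
  qed
  also have "\<dots> = \<sigma> powr p * M_const p powr p" using p by (simp add: M_const_powr)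
  also have "\<sigma> powr p = f0 x powr (p / 2) * (1 / sqrt pi) powr p"
    unfolding \<sigma>(2) powr_mult using bbF_density(3)[OF f0, of x] by (simp add: powr_half_sqrt[symmetric] powr_powr)
  finally show "Fl K x \<le> (1 / sqrt pi) powr p * M_const p powr p * f0 x powr (p / 2)" by (simp add: algebra_simps)
qed

definition beta0 where "beta0 = beta_const p f0"

lemma beta0_pos: "beta0 > 0"
  unfolding beta0_def beta_eq[OF f0] using M_const_powr(2)[of p] p I0_pos by (auto simp: I0_def)

lemma beta0_powr: "beta0 powr p = (1 / sqrt pi) powr p * M_const p powr p * I0"
  unfolding beta0_def beta_eq[OF f0] powr_mult using p I0_pos by (simp add: powr_powr I0_def)

lemma Fl_int:
  assumes K: "K > 0"
  shows "integrable lborel (Fl K)" "(LINT x|lborel. Fl K x) \<le> beta0 powr p"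
proof -
  have i: "integrable lborel (\<lambda>x. (1 / sqrt pi) powr p * M_const p powr p * f0 x powr (p / 2))" using bbF_powr_int[OF f0] by simp
  show i': "integrable lborel (Fl K)"
    by (rule Bochner_Integration.integrable_bound[OF i]) (use Fl_le[OF K] in \<open>auto intro!: AE_I2 norm_mono_nonneg simp del: real_norm_def\<close>)
  have "(LINT x|lborel. Fl K x) \<le> (LINT x|lborel. (1 / sqrt pi) powr p * M_const p powr p * f0 x powr (p / 2))"
    by (intro integral_mono i i' Fl_le K)
  then show "(LINT x|lborel. Fl K x) \<le> beta0 powr p" by (simp add: beta0_powr I0_def)
qed

lemma SS_le: "SS j \<le> 2 * pi"
  unfolding SS_def by (rule dk_square_integral_le[OF pf(3) pf(2)])

lemma SS_nonneg: "0 \<le> SS j" by (simp add: SS_def)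

definition C0 where "C0 = Cf * (2 * pi)"

lemma ss_le_C0: "K.ss j x \<le> C0"
  using order_trans[OF ss_le[of j x] mult_left_mono[OF SS_le[of j] less_imp_le[OF Cf_pos]]] by (simp add: C0_def)

section \<open>Weighted variance bounds for \<open>p < 2\<close> and convergence of the clipped
  integral\<close>

definition wt where "wt x = 1 + \<bar>x\<bar> powr lam"

lemma wt_pos: "wt x > 0" by (simp add: wt_def add_pos_nonneg)

lemma wt_meas [measurable]: "wt \<in> borel_measurable borel" unfolding wt_def by measurable

text \<open>The second summand of \<open>rho\<close> controls the change of the moment, and a
  convergent sequence of distances is bounded.\<close>

lemma moment_bounded:
  assumes p2: "p < 2"
  obtains L where "L \<ge> 0" "\<And>j. (LINT x|lborel. \<bar>x\<bar> powr lam * fs j x) \<le> L"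
proof -
  have i0: "integrable lborel (\<lambda>x. \<bar>x\<bar> powr lam * f0 x)" using f0 p2 by (simp add: bbF_def)
  have ij: "integrable lborel (\<lambda>x. \<bar>x\<bar> powr lam * fs j x)" for j using fs[of j] p2 by (simp add: bbF_def)
  obtain B where B: "\<And>j. \<bar>rho \<gamma> p M lam f0 (fs j)\<bar> \<le> B"
    using convergent_imp_Bseq[OF convergentI[OF rho_lim]] by (auto simp: Bseq_def)
  have "(LINT x|lborel. \<bar>x\<bar> powr lam * fs j x) \<le> (LINT x|lborel. \<bar>x\<bar> powr lam * f0 x) + B" for j
  proof -
    have id: "integrable lborel (\<lambda>x. \<bar>x\<bar> powr lam * \<bar>f0 x - fs j x\<bar>)"
    proof -
      have "integrable lborel (\<lambda>x. \<bar>\<bar>x\<bar> powr lam * f0 x - \<bar>x\<bar> powr lam * fs j x\<bar>)" using i0 ij[of j] by auto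
      then show ?thesis by (simp add: abs_mult flip: right_diff_distrib)
    qed
    have "(LINT x|lborel. \<bar>x\<bar> powr lam * fs j x) \<le> (LINT x|lborel. \<bar>x\<bar> powr lam * f0 x + \<bar>x\<bar> powr lam * \<bar>f0 x - fs j x\<bar>)"
    proof (rule integral_mono)
      show "\<bar>x\<bar> powr lam * fs j x \<le> \<bar>x\<bar> powr lam * f0 x + \<bar>x\<bar> powr lam * \<bar>f0 x - fs j x\<bar>" for x
        unfolding distrib_left[symmetric] by (intro mult_left_mono) auto
    qed (use i0 ij[of j] id in auto)
    also have "\<dots> = (LINT x|lborel. \<bar>x\<bar> powr lam * f0 x) + (LINT x|lborel. \<bar>x\<bar> powr lam * \<bar>f0 x - fs j x\<bar>)"
      using i0 id by simp
    also have "(LINT x|lborel. \<bar>x\<bar> powr lam * \<bar>f0 x - fs j x\<bar>) \<le> rho \<gamma> p M lam f0 (fs j)" using p2 by (simp add: rho_def)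
    also have "\<dots> \<le> B" using B[of j] by linarith
    finally show ?thesis by simp
  qed
  moreover have "0 \<le> (LINT x|lborel. \<bar>x\<bar> powr lam * f0 x) + B"
    using order_trans[OF abs_ge_zero B] bbF_density(3)[OF f0] by (intro add_nonneg_nonneg Bochner_Integration.integral_nonneg) auto
  ultimately show ?thesis using that by blast
qed

text \<open>Separates the weight of a sum into a moment of the density and a quadratic term for the
  kernel. The bound \<open>lam \<le> 2\<close> gives both \<open>2 powr lam \<le> 4\<close> and
  \<open>|z| powr lam \<le> 1 + z\<^sup>2\<close>.\<close>

lemma wt_shift_le:
  assumes "0 < lam" "lam \<le> 2"
  shows "wt (y + z) \<le> 5 + 4 * \<bar>y\<bar> powr lam + 4 * z\<^sup>2"
proof -
  have t: "(2::real) powr lam \<le> 4" using powr_mono[of lam 2 2] assms by (simp add: powr_numeral)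
  have "\<bar>y + z\<bar> powr lam \<le> (2 * max \<bar>y\<bar> \<bar>z\<bar>) powr lam" using assms by (intro powr_mono2) (auto simp: max_def)
  also have "\<dots> = 2 powr lam * max \<bar>y\<bar> \<bar>z\<bar> powr lam" by (rule powr_mult)
  also have "\<dots> \<le> 4 * max \<bar>y\<bar> \<bar>z\<bar> powr lam" using t by (intro mult_right_mono) auto
  also have "\<dots> \<le> 4 * (\<bar>y\<bar> powr lam + \<bar>z\<bar> powr lam)" by (intro mult_left_mono) (auto simp: max_def)
  also have "\<bar>z\<bar> powr lam \<le> 1 + z\<^sup>2"
  proof (cases "\<bar>z\<bar> \<le> 1")
    case True
    then have "\<bar>z\<bar> powr lam \<le> 1" using assms by (intro powr_le1) auto
    then show ?thesis by (simp add: add_increasing2)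
  next
    case False
    then have "\<bar>z\<bar> powr lam \<le> \<bar>z\<bar> powr 2" using assms by (intro powr_mono) auto
    then show ?thesis using False by (simp add: powr_numeral)
  qed
  finally show ?thesis by (simp add: wt_def)
qed

text \<open>\<open>s2\<close> is the convolution of the density with \<open>h\<close> times the
  squared kernel, so its weighted integral splits into the moment of order \<open>lam\<close> of the
  density and the second moment of the kernel, both bounded in \<open>j\<close>.\<close>

lemma weighted_ss:
  assumes p2: "p < 2"
  obtains L where "L \<ge> 0" "\<And>j. integrable lborel (\<lambda>x. K.ss j x * wt x)" "\<And>j. (LINT x|lborel. K.ss j x * wt x) \<le> L"
proof -
  have lam': "0 < lam" "lam \<le> 2"
  proof -
    have "0 < (2 - p) / p" using p p2 by simp
    then show "0 < lam" using lam[OF p2] by linarith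
  qed (use lam[OF p2] in simp)
  obtain Lf where Lf: "Lf \<ge> 0" "\<And>j. (LINT x|lborel. \<bar>x\<bar> powr lam * fs j x) \<le> Lf" using moment_bounded[OF p2] by blast
  define L where "L = (5 + 4 * Lf) * (2 * pi) + 4 * (2 * pi)"
  have L0: "L \<ge> 0" using Lf by (simp add: L_def)
  have bound: "(\<integral>\<^sup>+x. ennreal (K.ss j x * wt x) \<partial>lborel) \<le> ennreal L" for j
  proof -
    note [measurable] = kf(1)[of j] bbF_density(2)[OF fs[of j]]
    define \<kappa> where "\<kappa> z = hh j * (kk j z)\<^sup>2" for z
    have [measurable]: "\<kappa> \<in> borel_measurable borel" unfolding \<kappa>_def by measurable
    have \<kappa>0: "\<kappa> z \<ge> 0" for z using pf(5)[of j] by (simp add: \<kappa>_def)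
    have f0': "0 \<le> fs j y" for y by (rule bbF_density(3)[OF fs])
    have w0: "0 \<le> wt x" for x using wt_pos[of x] by simp
    have fi: "integrable lborel (fs j)" "integrable lborel (\<lambda>x. \<bar>x\<bar> powr lam * fs j x)"
      using bbF_density(4)[OF fs] fs[of j] p2 by (auto simp: bbF_def)
    have \<kappa>i: "integrable lborel \<kappa>" "(LINT z|lborel. \<kappa> z) = SS j" "integrable lborel (\<lambda>z. \<kappa> z * z\<^sup>2)" "(LINT z|lborel. \<kappa> z * z\<^sup>2) \<le> 2 * pi * hh j"
      unfolding \<kappa>_def[abs_def] using kf(4)[of j] kf(5)[of j] kf(6)[of j] kf(7)[of j] by (auto simp: SS_def mult.assoc)
    have "(\<integral>\<^sup>+x. ennreal (K.ss j x * wt x) \<partial>lborel) = (\<integral>\<^sup>+x. (\<integral>\<^sup>+z. ennreal (\<kappa> z * fs j (x - z) * wt x) \<partial>lborel) \<partial>lborel)"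
    proof (rule nn_integral_cong)
      fix x
      have "K.ss j x * wt x = (LINT z|lborel. \<kappa> z * fs j (x - z) * wt x)" by (simp add: ss_eq \<kappa>_def)
      also have "ennreal \<dots> = (\<integral>\<^sup>+z. ennreal (\<kappa> z * fs j (x - z) * wt x) \<partial>lborel)"
        using ss_int[of j x] \<kappa>0 f0' w0 by (intro nn_integral_eq_integral[symmetric]) (auto simp: \<kappa>_def)
      finally show "ennreal (K.ss j x * wt x) = (\<integral>\<^sup>+z. ennreal (\<kappa> z * fs j (x - z) * wt x) \<partial>lborel)" .
    qed
    also have "\<dots> = (\<integral>\<^sup>+z. (\<integral>\<^sup>+x. ennreal (\<kappa> z * fs j (x - z) * wt x) \<partial>lborel) \<partial>lborel)"
      by (rule lborel_pair.Fubini'[symmetric]) measurable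
    also have "\<dots> \<le> (\<integral>\<^sup>+z. ennreal ((5 + 4 * Lf) * \<kappa> z + 4 * (\<kappa> z * z\<^sup>2)) \<partial>lborel)"
    proof (rule nn_integral_mono)
      fix z
      have "(\<integral>\<^sup>+x. ennreal (\<kappa> z * fs j (x - z) * wt x) \<partial>lborel) = (\<integral>\<^sup>+y. ennreal (\<kappa> z * fs j y * wt (y + z)) \<partial>lborel)"
        by (subst nn_integral_real_affine[of _ 1 z]) (auto simp: add.commute)
      also have "\<dots> \<le> (\<integral>\<^sup>+y. ennreal (\<kappa> z * ((5 + 4 * z\<^sup>2) * fs j y + 4 * (\<bar>y\<bar> powr lam * fs j y))) \<partial>lborel)"
      proof (intro nn_integral_mono ennreal_leI)
        fix y
        have "\<kappa> z * fs j y * wt (y + z) \<le> \<kappa> z * fs j y * (5 + 4 * \<bar>y\<bar> powr lam + 4 * z\<^sup>2)"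
          using \<kappa>0 f0' lam' by (intro mult_left_mono wt_shift_le) auto
        then show "\<kappa> z * fs j y * wt (y + z) \<le> \<kappa> z * ((5 + 4 * z\<^sup>2) * fs j y + 4 * (\<bar>y\<bar> powr lam * fs j y))"
          by (simp add: algebra_simps)
      qed
      also have "\<dots> = ennreal (LINT y|lborel. \<kappa> z * ((5 + 4 * z\<^sup>2) * fs j y + 4 * (\<bar>y\<bar> powr lam * fs j y)))"
        using fi \<kappa>0 f0' by (intro nn_integral_eq_integral) (auto intro!: mult_nonneg_nonneg add_nonneg_nonneg)
      also have "(LINT y|lborel. \<kappa> z * ((5 + 4 * z\<^sup>2) * fs j y + 4 * (\<bar>y\<bar> powr lam * fs j y))) =
          \<kappa> z * ((5 + 4 * z\<^sup>2) * 1 + 4 * (LINT y|lborel. \<bar>y\<bar> powr lam * fs j y))"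
        using fi bbF_density(5)[OF fs[of j]] by simp
      also have "\<dots> \<le> \<kappa> z * ((5 + 4 * z\<^sup>2) * 1 + 4 * Lf)" using Lf(2)[of j] \<kappa>0 by (intro mult_left_mono) auto
      also have "\<dots> = (5 + 4 * Lf) * \<kappa> z + 4 * (\<kappa> z * z\<^sup>2)" by (simp add: algebra_simps)
      finally show "(\<integral>\<^sup>+x. ennreal (\<kappa> z * fs j (x - z) * wt x) \<partial>lborel) \<le> ennreal ((5 + 4 * Lf) * \<kappa> z + 4 * (\<kappa> z * z\<^sup>2))"
        by (simp add: ennreal_leI)
    qed
    also have "\<dots> = ennreal (LINT z|lborel. (5 + 4 * Lf) * \<kappa> z + 4 * (\<kappa> z * z\<^sup>2))"
      using \<kappa>i \<kappa>0 Lf by (intro nn_integral_eq_integral) (auto intro!: add_nonneg_nonneg mult_nonneg_nonneg)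
    also have "(LINT z|lborel. (5 + 4 * Lf) * \<kappa> z + 4 * (\<kappa> z * z\<^sup>2)) = (5 + 4 * Lf) * SS j + 4 * (LINT z|lborel. \<kappa> z * z\<^sup>2)"
      using \<kappa>i by simp
    also have "\<dots> \<le> (5 + 4 * Lf) * (2 * pi) + 4 * (2 * pi * 1)"
    proof (intro add_mono mult_left_mono SS_le)
      have "2 * pi * hh j \<le> 2 * pi * 1" using pf(9)[of j] by (intro mult_left_mono) auto
      then show "(LINT z|lborel. \<kappa> z * z\<^sup>2) \<le> 2 * pi * 1" using \<kappa>i(4) by linarith
    qed (use Lf in auto)
    finally show ?thesis by (simp add: L_def ennreal_leI)
  qed
  have nn: "0 \<le> K.ss j x * wt x" for j x using kde.s2_nonneg[OF kde] wt_pos[of x] by simp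
  have i: "integrable lborel (\<lambda>x. K.ss j x * wt x)" for j
  proof (rule integrableI_bounded)
    show "(\<lambda>x. K.ss j x * wt x) \<in> borel_measurable lborel" using kde.s2_meas[OF kde[of j]] by measurable
    show "(\<integral>\<^sup>+x. ennreal (norm (K.ss j x * wt x)) \<partial>lborel) < \<infinity>"
      using nn le_less_trans[OF bound[of j]] by simp
  qed
  have "(LINT x|lborel. K.ss j x * wt x) \<le> L" for j
    using bound[of j] nn_integral_eq_integral[OF i[of j]] nn L0 by (simp add: ennreal_le_iff)
  with that L0 i show ?thesis by blast
qed

lemma Fc_meas [measurable]: "Fc K j \<in> borel_measurable borel"
  unfolding Fc_def[abs_def] by (rule kde.clip_int_meas[OF kde])

lemma Fc_nonneg: "0 \<le> Fc K j x" by (simp add: Fc_def)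

text \<open>For \<open>p \<ge> 2\<close> the clipped moments lie below multiples of
  \<open>s2\<close>, whose integrals converge, and \<open>reverse_fatou\<close> applies. For
  \<open>p < 2\<close>, \<open>young_weight\<close> splits them into a weighted variance with small
  factor \<open>e\<close> and a fixed integrable function \<open>D\<close>; the minimum with
  \<open>D\<close> converges by domination.\<close>

lemma clip_integral:
  assumes K: "K > 0" and \<eta>: "\<eta> > 0"
  shows "\<forall>\<^sub>F j in sequentially. (\<integral>\<^sup>+x. ennreal (Fc K j x) \<partial>lborel) \<le> ennreal (beta0 powr p + \<eta>)"
proof (cases "2 \<le> p")
  case True
  define c where "c = 4 * K powr (p - 2)"
  have le: "Fc K j x \<le> c * K.ss j x" for j x
    unfolding Fc_def c_def by (rule kde.clip_moment_ge2[OF kde True K])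
  have G: "integrable lborel (\<lambda>x. c * K.ss j x)" for j using kde.int_s2[OF kde[of j]] by simp
  have Gl: "(\<lambda>j. LINT x|lborel. c * K.ss j x) \<longlonglongrightarrow> (LINT x|lborel. c * (f0 x / pi))"
  proof -
    have "(\<lambda>j. c * SS j) \<longlonglongrightarrow> c * (1 / pi)" by (intro tendsto_intros SS_lim)
    moreover have "(\<lambda>j. LINT x|lborel. c * K.ss j x) = (\<lambda>j. c * SS j)"
      by (simp add: kde.LINT_s2[OF kde] S2_eq)
    moreover have "(LINT x|lborel. c * (f0 x / pi)) = c * (1 / pi)" by (simp add: bbF_density(5)[OF f0])
    ultimately show ?thesis by (simp only:)
  qed
  have "\<forall>\<^sub>F j in sequentially. (LINT x|lborel. Fc K j x) \<le> (LINT x|lborel. Fl K x) + \<eta>"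
  proof (rule reverse_fatou[OF _ _ G _ Fc_nonneg le Fc_lim[OF K] _ Gl \<eta>])
    show "integrable lborel (\<lambda>x. c * (f0 x / pi))" using bbF_density(4)[OF f0] by simp
    show "(\<lambda>j. c * K.ss j x) \<longlonglongrightarrow> c * (f0 x / pi)" for x by (intro tendsto_intros ss_lim)
  qed auto
  then show ?thesis
  proof eventually_elim
    case (elim j)
    have i: "integrable lborel (Fc K j)"
      by (rule Bochner_Integration.integrable_bound[OF G[of j]]) (use le Fc_nonneg in \<open>auto intro!: AE_I2 norm_mono_nonneg simp del: real_norm_def\<close>)
    have "(\<integral>\<^sup>+x. ennreal (Fc K j x) \<partial>lborel) = ennreal (LINT x|lborel. Fc K j x)"
      using i Fc_nonneg by (intro nn_integral_eq_integral) auto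
    also have "\<dots> \<le> ennreal (beta0 powr p + \<eta>)" using elim Fl_int(2)[OF K] by (intro ennreal_leI) linarith
    finally show ?case .
  qed
next
  case False
  then have p2: "p < 2" by simp
  obtain L where L: "L \<ge> 0" "\<And>j. integrable lborel (\<lambda>x. K.ss j x * wt x)" "\<And>j. (LINT x|lborel. K.ss j x * wt x) \<le> L"
    using weighted_ss[OF p2] by blast
  \<comment> \<open>Chosen so that \<open>4 * e * (L + 1) = \<eta> / 2\<close>; the added 1 avoids
    division by zero.\<close>
  define e where "e = \<eta> / (8 * (L + 1))"
  have e: "e > 0" using \<eta> L(1) by (simp add: e_def)
  define D where "D x = e powr (- (p / (2 - p))) * wt x powr (- (p / (2 - p)))" for x
  have Di: "integrable lborel D" unfolding D_def[abs_def] using weight_integrable[OF p p2] lam[OF p2] by (simp add: wt_def)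
  have D0: "0 \<le> D x" for x by (simp add: D_def)
  have le: "Fc K j x \<le> e * (4 * K.ss j x) * wt x + min (Fc K j x) (D x)" for j x
  proof -
    have s0: "0 \<le> K.ss j x" by (rule kde.s2_nonneg[OF kde])
    have "Fc K j x \<le> (4 * K.ss j x) powr (p / 2)"
      unfolding Fc_def using kde.clip_moment_le2[OF kde p _ K] p2 by auto
    also have "\<dots> \<le> e * (4 * K.ss j x) * wt x + D x"
      unfolding D_def using p p2 s0 wt_pos[of x] e by (intro young_weight) auto
    finally show ?thesis using s0 e wt_pos[of x] by (auto simp: min_def)
  qed
  have "(\<lambda>j. LINT x|lborel. min (Fc K j x) (D x)) \<longlonglongrightarrow> (LINT x|lborel. min (Fl K x) (D x))"
  proof (rule integral_dominated_convergence[OF _ _ Di])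
    show "AE x in lborel. (\<lambda>j. min (Fc K j x) (D x)) \<longlonglongrightarrow> min (Fl K x) (D x)"
      by (intro AE_I2 tendsto_min Fc_lim K tendsto_const)
    show "AE x in lborel. norm (min (Fc K j x) (D x)) \<le> D x" for j using Fc_nonneg D0 by auto
  qed (use borel_measurable_integrable[OF Di] in auto)
  then have "\<forall>\<^sub>F j in sequentially. (LINT x|lborel. min (Fc K j x) (D x)) < (LINT x|lborel. min (Fl K x) (D x)) + \<eta> / 2"
    using \<eta> by (intro order_tendstoD(2)) auto
  then show ?thesis
  proof eventually_elim
    case (elim j)
    have mi: "integrable lborel (\<lambda>x. min (Fc K j x) (D x))"
      by (rule Bochner_Integration.integrable_bound[OF Di])
         (use Fc_nonneg D0 borel_measurable_integrable[OF Di] in \<open>auto intro!: AE_I2 norm_mono_nonneg min.boundedI simp del: real_norm_def\<close>)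
    have gi: "integrable lborel (\<lambda>x. e * (4 * K.ss j x) * wt x + min (Fc K j x) (D x))"
    proof -
      have "integrable lborel (\<lambda>x. (4 * e) * (K.ss j x * wt x) + min (Fc K j x) (D x))" using L(2)[of j] mi by simp
      then show ?thesis by (simp add: algebra_simps)
    qed
    have "(\<integral>\<^sup>+x. ennreal (Fc K j x) \<partial>lborel) \<le> (\<integral>\<^sup>+x. ennreal (e * (4 * K.ss j x) * wt x + min (Fc K j x) (D x)) \<partial>lborel)"
      by (intro nn_integral_mono ennreal_leI le)
    also have "\<dots> = ennreal (LINT x|lborel. e * (4 * K.ss j x) * wt x + min (Fc K j x) (D x))"
      by (intro nn_integral_eq_integral gi AE_I2) (rule order_trans[OF Fc_nonneg le])
    also have "(LINT x|lborel. e * (4 * K.ss j x) * wt x + min (Fc K j x) (D x)) = (LINT x|lborel. (4 * e) * (K.ss j x * wt x) + min (Fc K j x) (D x))"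
      by (simp add: algebra_simps)
    also have "\<dots> = 4 * e * (LINT x|lborel. K.ss j x * wt x) + (LINT x|lborel. min (Fc K j x) (D x))"
      using L(2)[of j] mi by simp
    also have "\<dots> \<le> \<eta> / 2 + (beta0 powr p + \<eta> / 2)"
    proof (rule add_mono)
      have "4 * e * (LINT x|lborel. K.ss j x * wt x) \<le> 4 * e * (L + 1)"
        using L(3)[of j] e by (intro mult_left_mono) auto
      also have "4 * e * (L + 1) = \<eta> / 2"
      proof -
        have *: "4 * (\<eta> / (8 * b)) * b = \<eta> / 2" if "b \<noteq> 0" for b using that by simp
        have "L + 1 \<noteq> 0" using L(1) by linarith
        then show ?thesis unfolding e_def by (rule *)
      qed
      finally show "4 * e * (LINT x|lborel. K.ss j x * wt x) \<le> \<eta> / 2" .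
      have "(LINT x|lborel. min (Fl K x) (D x)) \<le> (LINT x|lborel. Fl K x)"
      proof (intro integral_mono Fl_int(1) K)
        show "integrable lborel (\<lambda>x. min (Fl K x) (D x))"
          by (rule Bochner_Integration.integrable_bound[OF Di])
             (use Fl_le(1)[OF K] D0 borel_measurable_integrable[OF Di] in \<open>auto intro!: AE_I2 norm_mono_nonneg min.boundedI simp del: real_norm_def\<close>)
      qed auto
      then show "(LINT x|lborel. min (Fc K j x) (D x)) \<le> beta0 powr p + \<eta> / 2"
        using elim Fl_int(2)[OF K] by linarith
    qed
    finally show ?case by (simp add: ennreal_leI add.commute)
  qed
qed

end

subsection \<open>Tail and exponential moments\<close>

text \<open>\<open>h\<close> is of order \<open>1 / ln n\<close>, so with \<open>r < 1\<close> the
  exponential grows more slowly than every power of \<open>n\<close>. The application has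
  \<open>q = p - 2\<close> and \<open>r = 1 - 2 / p\<close>.\<close>

lemma polynomial_beats_exponent:
  fixes q r c \<gamma> :: real
  assumes "\<gamma> > 0" "q > 0" "r > 0" "r < 1" "c > 0"
  shows "((\<lambda>n. (2 / sqrt (real n * h_par \<gamma> n)) powr q * exp (c * h_par \<gamma> n powr (- r))) \<longlongrightarrow> 0) at_top"
  unfolding h_par_def theta_par_def N_par_def using assms by real_asymp

context density_seq
begin

abbreviation "TT j S X \<equiv> kde.T (fs j) (kk j) (hh j) (ns j) p S X"

lemma hL1_lim: "(\<lambda>j. hh j * (Lq_norm 1 (kk j))\<^sup>2) \<longlonglongrightarrow> 0"
proof (rule Lim_null_comparison)
  define c where "c = (LINT x|lborel. mp (5/4) x)"
  show "\<forall>\<^sub>F j in sequentially. norm (hh j * (Lq_norm 1 (kk j))\<^sup>2) \<le> c\<^sup>2 * (hh j * (NN j powr (1/4))\<^sup>2)"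
  proof (intro always_eventually allI)
    fix j
    have "Lq_norm 1 (kk j) = (LINT z|lborel. \<bar>kk j z\<bar>)" by (simp add: Lq_norm_def)
    then have "Lq_norm 1 (kk j) \<le> NN j powr (1/4) * c" using kf(8)[of j] by (simp add: c_def)
    then have "(Lq_norm 1 (kk j))\<^sup>2 \<le> (NN j powr (1/4) * c)\<^sup>2" by (intro power_mono) auto
    then have "hh j * (Lq_norm 1 (kk j))\<^sup>2 \<le> hh j * (NN j powr (1/4) * c)\<^sup>2"
      using pf(5)[of j] by (intro mult_left_mono) auto
    then show "norm (hh j * (Lq_norm 1 (kk j))\<^sup>2) \<le> c\<^sup>2 * (hh j * (NN j powr (1/4))\<^sup>2)"
      using pf(5)[of j] by (simp add: power_mult_distrib ac_simps)
  qed
  show "(\<lambda>j. c\<^sup>2 * (hh j * (NN j powr (1/4))\<^sup>2)) \<longlonglongrightarrow> 0"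
    using tendsto_mult_right_zero[OF seq_limits(5)] by blast
qed

lemma aa_le_1: "\<forall>\<^sub>F j in sequentially. K.aa j \<le> 1"
  using order_tendstoD(2)[OF K.aa_lim zero_less_one] by eventually_elim simp

lemma moment_bound:
  assumes r: "2 \<le> r"
  obtains w where "w \<ge> 0"
    "\<And>j. K.aa j \<le> 1 \<Longrightarrow> (\<integral>\<^sup>+X. ennreal (kde.T (fs j) (kk j) (hh j) (ns j) r UNIV X powr r) \<partial>K.PP j) \<le> ennreal w"
proof -
  obtain C where C: "C > 0" "\<And>y. \<bar>y\<bar> powr r \<le> C * (cosh y - 1)" using powr_le_cosh[OF r] by blast
  define w where "w = C * exp C0 * (2 * pi)"
  have "(\<integral>\<^sup>+X. ennreal (kde.T (fs j) (kk j) (hh j) (ns j) r UNIV X powr r) \<partial>K.PP j) \<le> ennreal w" if a: "K.aa j \<le> 1" for j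
  proof -
    have "(\<integral>\<^sup>+X. ennreal (kde.T (fs j) (kk j) (hh j) (ns j) r UNIV X powr r) \<partial>K.PP j) \<le> ennreal (C * exp C0 * kde.S2 (kk j) (hh j))"
      by (rule kde.T_powr_le[OF kde]) (use r C kde.Y_moment_s2[OF kde C(2) C(1) _ a ss_le_C0] in auto)
    also have "\<dots> \<le> ennreal w"
      unfolding w_def S2_eq using C(1) SS_le[of j] by (intro ennreal_leI mult_left_mono) auto
    finally show ?thesis .
  qed
  then show ?thesis using that[of w] C(1) by (auto simp: w_def)
qed

text \<open>The order of choices matters: the clipping level \<open>K\<close> makes Markov's part at
  most \<open>\<delta> / 2\<close>, then \<open>t\<close> does so for Chernoff's part, and only then
  does \<open>j\<close> grow.\<close>

lemma tail:
  assumes \<eta>: "\<eta> > 0" and \<delta>: "\<delta> > 0"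
  shows "\<forall>\<^sub>F j in sequentially. emeasure (K.PP j) {X \<in> space (K.PP j). beta0 powr p + 3 * \<eta> \<le> TT j UNIV X powr p} \<le> ennreal \<delta>"
proof -
  obtain w where w: "w \<ge> 0"
    "\<And>j. K.aa j \<le> 1 \<Longrightarrow> (\<integral>\<^sup>+X. ennreal (kde.T (fs j) (kk j) (hh j) (ns j) (p + 2) UNIV X powr (p + 2)) \<partial>K.PP j) \<le> ennreal w"
    using moment_bound[of "p + 2"] p by auto
  \<comment> \<open>Gives \<open>K\<^sup>2 * \<eta> = 2 * (w + 1) / \<delta>\<close>, hence
    \<open>w / (K\<^sup>2 * \<eta>) \<le> \<delta> / 2\<close>.\<close>
  define K where "K = sqrt (2 * (w + 1) / (\<delta> * \<eta>))"
  have K: "K > 0" using w \<eta> \<delta> by (simp add: K_def)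
  have K2: "w / (K\<^sup>2 * \<eta>) \<le> \<delta> / 2"
  proof -
    have "K\<^sup>2 * \<eta> = 2 * (w + 1) / \<delta>" using w \<eta> \<delta> by (simp add: K_def)
    then have "w / (K\<^sup>2 * \<eta>) = \<delta> / 2 * (w / (w + 1))" by simp
    also have "\<dots> \<le> \<delta> / 2 * 1" using w \<delta> by (intro mult_left_mono) auto
    finally show ?thesis by simp
  qed
  \<comment> \<open>Solves \<open>exp (- t * \<eta> + 1) \<le> \<delta> / 2\<close>; the 1 leaves
    room for the quadratic term of the bounded difference inequality, which is eventually below
    1.\<close>
  define t where "t = max 1 ((1 - ln (\<delta> / 2)) / \<eta>)"
  have t: "t > 0" by (simp add: t_def)
  have "(1 - ln (\<delta> / 2)) / \<eta> \<le> t" by (simp add: t_def)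
  then have "1 - ln (\<delta> / 2) \<le> t * \<eta>" using \<eta> by (simp add: pos_divide_le_eq)
  then have "- t * \<eta> + 1 \<le> ln (\<delta> / 2)" by simp
  then have et: "exp (- t * \<eta> + 1) \<le> \<delta> / 2" using \<delta> by (metis exp_le_cancel_iff exp_ln half_gt_zero)
  define c where "c = 2 * t\<^sup>2 * (p * K powr (p - 1))\<^sup>2"
  have "(\<lambda>j. c * (hh j * (Lq_norm 1 (kk j))\<^sup>2)) \<longlonglongrightarrow> c * 0" by (intro tendsto_intros hL1_lim)
  then have "\<forall>\<^sub>F j in sequentially. c * (hh j * (Lq_norm 1 (kk j))\<^sup>2) < 1" by (intro order_tendstoD(2)) auto
  then show ?thesis using clip_integral[OF K \<eta>] aa_le_1
  proof eventually_elim
    case (elim j)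
    have V: "(\<integral>\<^sup>+X. ennreal (kde.VK (fs j) (kk j) (hh j) (ns j) p K X) \<partial>K.PP j) \<le> ennreal (beta0 powr p + \<eta>)"
      using elim(2) unfolding kde.nn_VK[OF kde p K] Fc_def .
    have eq: "beta0 powr p + 3 * \<eta> = (beta0 powr p + \<eta>) + 2 * \<eta>" by simp
    have "emeasure (K.PP j) {X \<in> space (K.PP j). beta0 powr p + 3 * \<eta> \<le> TT j UNIV X powr p} \<le> ennreal (exp (- t * \<eta> + 2 * t\<^sup>2 * (p * K powr (p - 1))\<^sup>2 * (hh j * (Lq_norm 1 (kk j))\<^sup>2)) + w / (K\<^sup>2 * \<eta>))"
      unfolding eq by (rule kde.T_tail[OF kde p K \<eta> t w(1) _ V w(2)[OF elim(3)]]) (use \<eta> in auto)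
    also have "\<dots> \<le> ennreal (exp (- t * \<eta> + 1) + \<delta> / 2)"
      using elim(1) K2 unfolding c_def by (intro ennreal_leI add_mono) auto
    also have "\<dots> \<le> ennreal \<delta>" using et by (intro ennreal_leI) simp
    finally show ?case .
  qed
qed

text \<open>For \<open>p \<ge> 2\<close> the moments are linear in \<open>s2\<close>; for
  \<open>p < 2\<close>, \<open>young_weight\<close> with \<open>e = 1\<close> yields the weighted
  variance and a fixed integrable function.\<close>

lemma T_powr_bounded:
  obtains v where "v \<ge> 0" "\<forall>\<^sub>F j in sequentially. (\<integral>\<^sup>+X. ennreal (TT j UNIV X powr p) \<partial>K.PP j) \<le> ennreal v"
proof (cases "2 \<le> p")
  case True
  obtain w where w: "w \<ge> 0" "\<And>j. K.aa j \<le> 1 \<Longrightarrow> (\<integral>\<^sup>+X. ennreal (TT j UNIV X powr p) \<partial>K.PP j) \<le> ennreal w"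
    using moment_bound[OF True] by blast
  have "\<forall>\<^sub>F j in sequentially. (\<integral>\<^sup>+X. ennreal (TT j UNIV X powr p) \<partial>K.PP j) \<le> ennreal w"
    using aa_le_1 by eventually_elim (rule w)
  then show ?thesis using that w(1) by blast
next
  case False
  then have p2: "p < 2" by simp
  obtain L where L: "L \<ge> 0" "\<And>j. integrable lborel (\<lambda>x. K.ss j x * wt x)" "\<And>j. (LINT x|lborel. K.ss j x * wt x) \<le> L"
    using weighted_ss[OF p2] by blast
  define D where "D x = 1 powr (- (p / (2 - p))) * wt x powr (- (p / (2 - p)))" for x
  have Di: "integrable lborel D" unfolding D_def[abs_def] using weight_integrable[OF p p2] lam[OF p2] by (simp add: wt_def)
  have D0: "0 \<le> D x" for x by (simp add: D_def)
  define v where "v = 4 * L + (LINT x|lborel. D x)"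
  have "(\<integral>\<^sup>+X. ennreal (TT j UNIV X powr p) \<partial>K.PP j) \<le> ennreal v" for j
  proof -
    have s0: "0 \<le> K.ss j x" for x by (rule kde.s2_nonneg[OF kde])
    have w0: "0 \<le> wt x" for x using wt_pos[of x] by simp
    have "(\<integral>\<^sup>+X. ennreal (TT j UNIV X powr p) \<partial>K.PP j) = (\<integral>\<^sup>+x. ennreal (LINT X|K.PP j. \<bar>K.YY j X x\<bar> powr p) * indicator UNIV x \<partial>lborel)"
      by (rule kde.nn_T_powr[OF kde p]) simp
    also have "\<dots> \<le> (\<integral>\<^sup>+x. ennreal (4 * (K.ss j x * wt x) + D x) \<partial>lborel)"
    proof (rule nn_integral_mono)
      fix x
      have "(LINT X|K.PP j. \<bar>K.YY j X x\<bar> powr p) \<le> (4 * K.ss j x) powr (p / 2)"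
        using kde.Y_moment_le2[OF kde p] p2 by auto
      also have "\<dots> \<le> 1 * (4 * K.ss j x) * wt x + D x"
        unfolding D_def using p p2 s0 wt_pos[of x] by (intro young_weight) auto
      finally show "ennreal (LINT X|K.PP j. \<bar>K.YY j X x\<bar> powr p) * indicator UNIV x \<le> ennreal (4 * (K.ss j x * wt x) + D x)"
        by (simp add: ennreal_leI mult.assoc)
    qed
    also have "\<dots> = ennreal (LINT x|lborel. 4 * (K.ss j x * wt x) + D x)"
      using L(2)[of j] Di s0 w0 D0 by (intro nn_integral_eq_integral) (auto intro!: add_nonneg_nonneg mult_nonneg_nonneg)
    also have "(LINT x|lborel. 4 * (K.ss j x * wt x) + D x) = 4 * (LINT x|lborel. K.ss j x * wt x) + (LINT x|lborel. D x)"
      using L(2)[of j] Di by simp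
    also have "\<dots> \<le> v" using L(3)[of j] by (simp add: v_def)
    finally show ?thesis by (simp add: ennreal_leI)
  qed
  moreover have "v \<ge> 0" using L(1) D0 by (simp add: v_def)
  ultimately show ?thesis using that[of v] by auto
qed

lemma hLp_le:
  assumes "p > 1" shows "hh j * (Lq_norm p (kk j))\<^sup>2 \<le> hh j powr (2 / p - 1) * (LINT x|lborel. mp p x) powr (2 / p)"
  using kf(9)[OF assms] .

text \<open>For \<open>1 < p \<le> 2\<close> the factor \<open>h powr (2 / p - 1)\<close> is at most
  1. The case \<open>p = 1\<close> stands apart because the envelope \<open>mp 1\<close> is not
  integrable; there \<open>hL1_lim\<close> takes its place.\<close>

lemma exp_moment_le2:
  assumes p2: "p \<le> 2" and B: "B > 0"
  shows "\<exists>C. \<forall>\<^sub>F j in sequentially. (\<integral>\<^sup>+X. ennreal (exp (B * TT j UNIV X)) \<partial>K.PP j) \<le> ennreal C"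
proof -
  obtain v where v: "v \<ge> 0" "\<forall>\<^sub>F j in sequentially. (\<integral>\<^sup>+X. ennreal (TT j UNIV X powr p) \<partial>K.PP j) \<le> ennreal v"
    using T_powr_bounded by blast
  have "\<exists>H. \<forall>\<^sub>F j in sequentially. hh j * (Lq_norm p (kk j))\<^sup>2 \<le> H"
  proof (cases "p = 1")
    case True
    have "\<forall>\<^sub>F j in sequentially. hh j * (Lq_norm 1 (kk j))\<^sup>2 < 1" by (rule order_tendstoD(2)[OF hL1_lim]) simp
    then have "\<forall>\<^sub>F j in sequentially. hh j * (Lq_norm p (kk j))\<^sup>2 \<le> 1" unfolding True by eventually_elim simp
    then show ?thesis by blast
  next
    case False
    then have p1: "p > 1" using p by simp
    have "hh j * (Lq_norm p (kk j))\<^sup>2 \<le> 1 * (LINT x|lborel. mp p x) powr (2 / p)" for j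
    proof -
      have "hh j powr (2 / p - 1) \<le> 1" using pf(5)[of j] pf(9)[of j] p p2 by (intro powr_le1) auto
      then have "hh j powr (2 / p - 1) * (LINT x|lborel. mp p x) powr (2 / p) \<le> 1 * (LINT x|lborel. mp p x) powr (2 / p)"
        by (intro mult_right_mono) auto
      with hLp_le[OF p1, of j] show ?thesis by linarith
    qed
    then show ?thesis by (intro exI always_eventually allI)
  qed
  then obtain H where H: "\<forall>\<^sub>F j in sequentially. hh j * (Lq_norm p (kk j))\<^sup>2 \<le> H" by blast
  have "\<forall>\<^sub>F j in sequentially. (\<integral>\<^sup>+X. ennreal (exp (B * TT j UNIV X)) \<partial>K.PP j) \<le> ennreal (exp (B * (1 + v) + 2 * B\<^sup>2 * H))"
    using v(2) H
  proof eventually_elim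
    case (elim j)
    have "(\<integral>\<^sup>+X. ennreal (exp (B * TT j UNIV X)) \<partial>K.PP j) \<le> ennreal (exp (B * (1 + v) + 2 * B\<^sup>2 * (hh j * (Lq_norm p (kk j))\<^sup>2)))"
      by (rule kde.T_exp[OF kde p _ v(1) B elim(1)]) simp
    also have "\<dots> \<le> ennreal (exp (B * (1 + v) + 2 * B\<^sup>2 * H))"
      using elim(2) by (auto intro!: ennreal_leI mult_left_mono)
    finally show ?case .
  qed
  then show ?thesis by blast
qed

text \<open>On the complement of \<open>G\<close> the p-th moment \<open>v j\<close> is so small
  that it outweighs the growing bound \<open>exp (E j)\<close> which bounded differences give for
  the exponential moment.\<close>

lemma exp_moment_gt2:
  assumes p2: "p > 2" and B: "B > 0"
  shows "\<exists>C. \<forall>\<^sub>F j in sequentially. (\<integral>\<^sup>+X. ennreal (exp (B * TT j UNIV X)) \<partial>K.PP j) \<le> ennreal C"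
proof -
  \<comment> \<open>The norm over the line is at most the sum of the norms over the two sets, hence
    at most twice the larger one, so the exponent doubles.\<close>
  define b where "b = 2 * B"
  have b: "b > 0" using B by (simp add: b_def)
  have pp: "2 \<le> p" using p2 by simp
  obtain C where C: "C > 0" "\<And>y. \<bar>y\<bar> powr p \<le> C * (cosh y - 1)" using powr_le_cosh[OF pp] by blast
  define G where "G j = kde.G (fs j) (kk j) (hh j) (ns j) p b" for j
  have Gm: "G j \<in> sets borel" for j unfolding G_def by (rule kde.G_meas[OF kde])
  define I where "I = (LINT x|lborel. mp p x) powr (2 / p)"
  have I0: "I \<ge> 0" by (simp add: I_def)
  define v where "v j = 3 * C * K.aa j powr (p - 2) * SS j" for j
  \<comment> \<open>The logarithm of the bound that bounded differences give on the complement at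
    the doubled exponent \<open>2 * b\<close>.\<close>
  define E where "E j = 2 * b * (1 + v j) + 2 * (2 * b)\<^sup>2 * (hh j powr (2 / p - 1) * I)" for j
  have v0: "v j \<ge> 0" for j using C(1) SS_nonneg[of j] by (simp add: v_def)
  have a_pow: "(\<lambda>j. K.aa j powr (p - 2)) \<longlonglongrightarrow> 0"
  proof -
    have "(\<lambda>j. K.aa j powr (p - 2)) \<longlonglongrightarrow> 0 powr (p - 2)"
      using p2 kde.a_pos[OF kde] by (intro tendsto_powr2 K.aa_lim tendsto_const) (auto intro!: always_eventually less_imp_le)
    then show ?thesis by simp
  qed
  have small: "\<forall>\<^sub>F j in sequentially. SS j * b powr p * K.aa j powr (p - 2) < 1"
  proof -
    have "(\<lambda>j. SS j * b powr p * K.aa j powr (p - 2)) \<longlonglongrightarrow> (1 / pi) * b powr p * 0"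
      by (intro tendsto_intros SS_lim a_pow)
    then show ?thesis by (intro order_tendstoD(2)) auto
  qed
  have v_lim: "\<forall>\<^sub>F j in sequentially. v j < 1"
  proof -
    have "v \<longlonglongrightarrow> 3 * C * 0 * (1 / pi)" unfolding v_def by (intro tendsto_intros SS_lim a_pow)
    then show ?thesis by (intro order_tendstoD(2)) auto
  qed
  have SSpos: "\<forall>\<^sub>F j in sequentially. SS j > 0" by (rule order_tendstoD(1)[OF SS_lim]) simp
  define c where "c = 2 * (2 * b)\<^sup>2 * (I + 1)"
  have c: "c > 0" using b I0 by (simp add: c_def)
  have "(\<lambda>j. K.aa j powr (p - 2) * exp (c * hh j powr (2 / p - 1))) \<longlonglongrightarrow> 0"
  proof -
    have "2 / p < 1" using p2 by simp
    have "((\<lambda>n. (2 / sqrt (real n * h_par \<gamma> n)) powr (p - 2) * exp (c * h_par \<gamma> n powr (- (1 - 2 / p)))) \<longlongrightarrow> 0) at_top"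
      using p2 c \<gamma> by (intro polynomial_beats_exponent) auto
    from filterlim_compose[OF this ns_lim] show ?thesis by (simp add: kde.a_def[OF kde])
  qed
  then have "\<forall>\<^sub>F j in sequentially. K.aa j powr (p - 2) * exp (c * hh j powr (2 / p - 1)) < 1" by (intro order_tendstoD(2)) auto
  then have vE: "\<forall>\<^sub>F j in sequentially. v j * exp (E j) \<le> 3 * C * (2 * pi) * exp (4 * b)"
    using v_lim
  proof eventually_elim
    case (elim j)
    have "E j \<le> 2 * b * 2 + c * hh j powr (2 / p - 1)"
      unfolding E_def
    proof (rule add_mono)
      show "2 * b * (1 + v j) \<le> 2 * b * 2" using elim b by (intro mult_left_mono) auto
      have "2 * (2 * b)\<^sup>2 * (hh j powr (2 / p - 1) * I) \<le> 2 * (2 * b)\<^sup>2 * (hh j powr (2 / p - 1) * (I + 1))"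
        by (intro mult_left_mono) auto
      then show "2 * (2 * b)\<^sup>2 * (hh j powr (2 / p - 1) * I) \<le> c * hh j powr (2 / p - 1)"
        by (simp add: c_def ac_simps)
    qed
    then have "exp (E j) \<le> exp (4 * b) * exp (c * hh j powr (2 / p - 1))" by (simp flip: exp_add)
    then have "v j * exp (E j) \<le> v j * (exp (4 * b) * exp (c * hh j powr (2 / p - 1)))" using v0 by (intro mult_left_mono)
    also have "\<dots> = (3 * C * exp (4 * b) * SS j) * (K.aa j powr (p - 2) * exp (c * hh j powr (2 / p - 1)))"
      by (simp add: v_def)
    also have "\<dots> \<le> (3 * C * exp (4 * b) * (2 * pi)) * 1"
      using C(1) SS_le[of j] SS_nonneg[of j] elim(1) by (intro mult_mono) auto
    finally show ?case by (simp add: ac_simps)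
  qed
  define Cg where "Cg = exp p + 2 * exp (b\<^sup>2 * (2 * pi) powr (2 / p) * C0 powr (1 - 2 / p))"
  define Cb where "Cb = exp b + 1 + 3 * C * (2 * pi) * exp (4 * b)"
  have Cb0: "0 \<le> 1 + 3 * C * (2 * pi) * exp (4 * b)" using C(1) by simp
  have "\<forall>\<^sub>F j in sequentially. (\<integral>\<^sup>+X. ennreal (exp (B * TT j UNIV X)) \<partial>K.PP j) \<le> ennreal (Cg + Cb)"
    using small v_lim SSpos vE
  proof eventually_elim
    case (elim j)
    have mG [measurable]: "TT j (G j) \<in> borel_measurable (K.PP j)" by (rule kde.T_meas[OF kde Gm])
    have mB [measurable]: "TT j (- G j) \<in> borel_measurable (K.PP j)" by (rule kde.T_meas[OF kde]) (use Gm in auto)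
    have good: "(\<integral>\<^sup>+X. ennreal (exp (b * TT j (G j) X)) \<partial>K.PP j) \<le> ennreal Cg"
    proof -
      have "(\<integral>\<^sup>+X. ennreal (exp (b * TT j (G j) X)) \<partial>K.PP j) \<le> ennreal (exp p + 2 * exp (b\<^sup>2 * SS j powr (2 / p) * C0 powr (1 - 2 / p)))"
        unfolding G_def using kde.T_exp_good[OF kde pp b _ ss_le_C0, of j] elim(3) by (simp add: S2_eq)
      also have "\<dots> \<le> ennreal Cg" unfolding Cg_def using SS_le[of j] SS_nonneg[of j] p2
        by (intro ennreal_leI add_left_mono mult_left_mono exp_le_cancel_iff[THEN iffD2] mult_right_mono powr_mono2) auto
      finally show ?thesis .
    qed
    have Vb: "(\<integral>\<^sup>+X. ennreal (TT j (- G j) X powr p) \<partial>K.PP j) \<le> ennreal (v j)"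
    proof -
      have "(\<integral>\<^sup>+X. ennreal (TT j (- G j) X powr p) \<partial>K.PP j) \<le> ennreal (3 * C * K.aa j powr (p - 2) * kde.S2 (kk j) (hh j))"
      proof (rule kde.T_powr_le[OF kde p])
        show "- G j \<in> sets borel" using Gm by auto
        show "0 \<le> 3 * C * K.aa j powr (p - 2)" using C(1) by simp
        show "(LINT X|K.PP j. \<bar>K.YY j X x\<bar> powr p) \<le> 3 * C * K.aa j powr (p - 2) * K.ss j x" if "x \<in> - G j" for x
          using kde.Y_moment_bad[OF kde pp b C(2) C(1) _ that[unfolded G_def]] elim(1) by (simp add: S2_eq)
      qed
      then show ?thesis by (simp add: S2_eq v_def)
    qed
    have bad2: "(\<integral>\<^sup>+X. ennreal (exp (2 * b * TT j (- G j) X)) \<partial>K.PP j) \<le> ennreal (exp (E j))"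
    proof -
      have "(\<integral>\<^sup>+X. ennreal (exp (2 * b * TT j (- G j) X)) \<partial>K.PP j) \<le> ennreal (exp (2 * b * (1 + v j) + 2 * (2 * b)\<^sup>2 * (hh j * (Lq_norm p (kk j))\<^sup>2)))"
        by (rule kde.T_exp[OF kde p _ v0 _ Vb]) (use Gm b in auto)
      also have "\<dots> \<le> ennreal (exp (E j))" unfolding E_def I_def
        using hLp_le[of j] p2 by (intro ennreal_leI exp_le_cancel_iff[THEN iffD2] add_left_mono mult_left_mono) auto
      finally show ?thesis .
    qed
    \<comment> \<open>Three regimes: \<open>t \<le> 1\<close>; \<open>b * t \<le> E j\<close>, where
      \<open>t powr p \<ge> 1\<close> bears the factor \<open>exp (E j)\<close>; and larger
      \<open>t\<close>, where doubling the exponent gains \<open>exp (- E j)\<close>. After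
      integration the middle term is at most 1 and the last at most
      \<open>v j * exp (E j)\<close>.\<close>
    have pt: "exp (b * t) \<le> exp b + exp (- E j) * exp (2 * b * t) + exp (E j) * t powr p" if t: "0 \<le> t" for t
    proof (cases "t \<le> 1")
      case True
      then have "exp (b * t) \<le> exp b" using b by simp
      then show ?thesis by (simp add: add_increasing2)
    next
      case False
      then have t1: "1 \<le> t powr p" using p by (intro ge_one_powr_ge_zero) auto
      have "exp (b * t) \<le> exp (- E j) * exp (2 * b * t) + exp (E j)"
      proof (cases "b * t \<le> E j")
        case True then show ?thesis by (simp add: add_increasing)
      next
        case False
        then have "exp (b * t) \<le> exp (- E j) * exp (2 * b * t)" by (simp flip: exp_add)
        then show ?thesis using exp_gt_zero[of "E j"] by linarith
      qed
      also have "\<dots> \<le> exp (- E j) * exp (2 * b * t) + exp (E j) * t powr p"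
        using t1 by (intro add_left_mono) simp
      finally show ?thesis by (simp add: add.assoc add_increasing)
    qed
    have bad: "(\<integral>\<^sup>+X. ennreal (exp (b * TT j (- G j) X)) \<partial>K.PP j) \<le> ennreal Cb"
    proof -
      interpret PJ: prob_space "K.PP j" by (rule kde.prob_space_P[OF kde])
      have "(\<integral>\<^sup>+X. ennreal (exp (b * TT j (- G j) X)) \<partial>K.PP j) \<le> 
        (\<integral>\<^sup>+X. ennreal (exp b) + ennreal (exp (- E j)) * ennreal (exp (2 * b * TT j (- G j) X)) + ennreal (exp (E j)) * ennreal (TT j (- G j) X powr p) \<partial>K.PP j)"
        using pt[OF kde.T_nonneg[OF kde]] by (intro nn_integral_mono) (simp add: ennreal_leI flip: ennreal_mult ennreal_plus)
      also have "\<dots> = ennreal (exp b) + ennreal (exp (- E j)) * (\<integral>\<^sup>+X. ennreal (exp (2 * b * TT j (- G j) X)) \<partial>K.PP j) + ennreal (exp (E j)) * (\<integral>\<^sup>+X. ennreal (TT j (- G j) X powr p) \<partial>K.PP j)"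
        by (simp add: nn_integral_add nn_integral_cmult PJ.emeasure_space_1)
      also have "\<dots> \<le> ennreal (exp b) + ennreal (exp (- E j)) * ennreal (exp (E j)) + ennreal (exp (E j)) * ennreal (v j)"
        by (intro add_mono mult_left_mono bad2 Vb) auto
      also have "\<dots> = ennreal (exp b + 1 + v j * exp (E j))"
      proof -
        have e1: "ennreal (exp (- E j)) * ennreal (exp (E j)) = ennreal 1" by (simp flip: ennreal_mult exp_add)
        have e2: "ennreal (exp (E j)) * ennreal (v j) = ennreal (v j * exp (E j))"
          using v0[of j] by (simp add: mult.commute flip: ennreal_mult)
        show ?thesis unfolding e1 e2 using v0[of j] by (simp del: ennreal_1 flip: ennreal_plus)
      qed
      also have "\<dots> \<le> ennreal Cb" unfolding Cb_def using elim(4) by (intro ennreal_leI) simp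
      finally show ?thesis .
    qed
    have "exp (B * TT j UNIV X) \<le> exp (b * TT j (G j) X) + exp (b * TT j (- G j) X)" for X
    proof -
      have "TT j UNIV X \<le> TT j (G j) X + TT j (- G j) X"
      proof -
        have "(\<lambda>x. indicator UNIV x * K.YY j X x) = (\<lambda>x. indicator (G j) x * K.YY j X x + indicator (- G j) x * K.YY j X x)"
          by (auto simp: indicator_def fun_eq_iff)
        then show ?thesis unfolding kde.T_def[OF kde] using Gm
          by (simp only:) (intro minkowski p kde.Y_ind_Lp[OF kde p]; auto)
      qed
      then have "B * TT j UNIV X \<le> B * (2 * max (TT j (G j) X) (TT j (- G j) X))"
        using B by (intro mult_left_mono) (auto simp: max_def)
      then have "exp (B * TT j UNIV X) \<le> exp (b * max (TT j (G j) X) (TT j (- G j) X))" by (simp add: b_def ac_simps)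
      also have "\<dots> \<le> exp (b * TT j (G j) X) + exp (b * TT j (- G j) X)" by (auto simp: max_def add_increasing add_increasing2)
      finally show ?thesis .
    qed
    then have "(\<integral>\<^sup>+X. ennreal (exp (B * TT j UNIV X)) \<partial>K.PP j) \<le> (\<integral>\<^sup>+X. ennreal (exp (b * TT j (G j) X)) + ennreal (exp (b * TT j (- G j) X)) \<partial>K.PP j)"
      by (intro nn_integral_mono) (simp add: ennreal_leI flip: ennreal_plus)
    also have "\<dots> = (\<integral>\<^sup>+X. ennreal (exp (b * TT j (G j) X)) \<partial>K.PP j) + (\<integral>\<^sup>+X. ennreal (exp (b * TT j (- G j) X)) \<partial>K.PP j)"
      by (intro nn_integral_add) measurable
    also have "\<dots> \<le> ennreal Cg + ennreal Cb" by (intro add_mono good bad)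
    also have "\<dots> = ennreal (Cg + Cb)" 
    proof (rule ennreal_plus[symmetric])
      show "0 \<le> Cg" by (simp add: Cg_def add_nonneg_nonneg)
      show "0 \<le> Cb" using Cb0 exp_gt_zero[of b] unfolding Cb_def by linarith
    qed
    finally show ?case .
  qed
  then show ?thesis by blast
qed

lemma exp_moment:
  assumes B: "B > 0"
  obtains C where "C \<ge> 0" "\<forall>\<^sub>F j in sequentially. (\<integral>\<^sup>+X. ennreal (exp (B * TT j UNIV X)) \<partial>K.PP j) \<le> ennreal C"
proof -
  obtain C where "\<forall>\<^sub>F j in sequentially. (\<integral>\<^sup>+X. ennreal (exp (B * TT j UNIV X)) \<partial>K.PP j) \<le> ennreal C"
    using exp_moment_le2[OF _ B] exp_moment_gt2[OF _ B] by (cases "p \<le> 2") auto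
  then have "\<forall>\<^sub>F j in sequentially. (\<integral>\<^sup>+X. ennreal (exp (B * TT j UNIV X)) \<partial>K.PP j) \<le> ennreal (max 0 C)"
    by eventually_elim (auto intro: order_trans ennreal_leI)
  then show ?thesis using that[of "max 0 C"] by auto
qed

end

subsection \<open>The risk\<close>

context density_seq
begin

abbreviation "beta j \<equiv> beta_const p (fs j)"

text \<open>The lower bound from Fatou's lemma at level \<open>(1 - e) powr p * I0\<close>, followed
  by a p-th root.\<close>

lemma beta_liminf:
  assumes e: "0 < e" "e < 1"
  shows "\<forall>\<^sub>F j in sequentially. (1 - e) * beta0 \<le> beta j"
proof -
  have "(1 - e) powr p < 1 powr p" using e p by (intro powr_less_mono2) auto
  then have "(1 - e) powr p * I0 < 1 * I0" using I0_pos by (intro mult_strict_right_mono) auto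
  then have "\<forall>\<^sub>F j in sequentially. (1 - e) powr p * I0 < (LINT x|lborel. fs j x powr (p / 2))"
    using I0_pos by (intro powr_integral_liminf) auto
  then show ?thesis
  proof eventually_elim
    case (elim j)
    have "((1 - e) powr p * I0) powr (1 / p) \<le> (LINT x|lborel. fs j x powr (p / 2)) powr (1 / p)"
      using elim p I0_pos by (intro powr_mono2) auto
    then have "(1 - e) * I0 powr (1 / p) \<le> (LINT x|lborel. fs j x powr (p / 2)) powr (1 / p)"
      using e p by (simp add: powr_mult powr_powr)
    then have "1 / sqrt pi * M_const p * ((1 - e) * I0 powr (1 / p)) \<le> 1 / sqrt pi * M_const p * (LINT x|lborel. fs j x powr (p / 2)) powr (1 / p)"
      using M_const_powr(2)[of p] p by (intro mult_left_mono) auto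
    then show ?case unfolding beta0_def beta_eq[OF f0] beta_eq[OF fs] I0_def[symmetric] by (simp add: ac_simps)
  qed
qed

definition bb where "bb j = sqrt (real (ns j) * hh j) * Lq_norm p (\<lambda>x. K.mm j x - fs j x)"

text \<open>Minkowski's inequality for deviation and bias; the normalisations fit because
  \<open>sqrt (h / n) / sqrt (n * h) = 1 / n\<close>.\<close>

lemma estimator_norm_le:
  assumes b: "beta j > 0"
  shows "Lq_norm p (\<lambda>x. estimator \<gamma> (ns j) X x - fs j x) / psi_rate \<gamma> p (fs j) (ns j) \<le> (TT j UNIV X + bb j) / beta j"
proof -
  define r where "r = sqrt (real (ns j) * hh j)"
  have r: "r > 0" using pf(5)[of j] pf(6)[of j] by (simp add: r_def)
  have n: "real (ns j) > 0" using pf(6)[of j] by simp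
  have rn: "1 / r * sqrt (hh j / real (ns j)) = 1 / real (ns j)"
  proof -
    have "1 / r * sqrt (hh j / real (ns j)) = sqrt (hh j) / sqrt (hh j) / (sqrt (real (ns j)) * sqrt (real (ns j)))"
      by (simp add: r_def real_sqrt_mult real_sqrt_divide)
    also have "\<dots> = 1 / real (ns j)" using pf(5)[of j] n by simp
    finally show ?thesis .
  qed
  have eq: "estimator \<gamma> (ns j) X x - fs j x = 1 / r * K.YY j X x + (K.mm j x - fs j x)" for x
  proof -
    have "K.YY j X x = sqrt (hh j / real (ns j)) * ((\<Sum>i<ns j. kk j (x - X i)) - real (ns j) * K.mm j x)"
      unfolding kde.Y_def[OF kde] kde.\<xi>_def[OF kde] by (simp add: sum_subtractf flip: sum_distrib_left)
    then have "1 / r * K.YY j X x = (1 / r * sqrt (hh j / real (ns j))) * ((\<Sum>i<ns j. kk j (x - X i)) - real (ns j) * K.mm j x)"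
      by simp
    also have "\<dots> = estimator \<gamma> (ns j) X x - K.mm j x" unfolding rn using n by (simp add: estimator_def diff_divide_distrib)
    finally show ?thesis by simp
  qed
  have "Lq_norm p (\<lambda>x. estimator \<gamma> (ns j) X x - fs j x) \<le> Lq_norm p (\<lambda>x. 1 / r * K.YY j X x) + Lq_norm p (\<lambda>x. K.mm j x - fs j x)"
    unfolding eq by (intro minkowski p Lp_cmult kde.Y_Lp[OF kde p] bias_lim(1))
  also have "Lq_norm p (\<lambda>x. 1 / r * K.YY j X x) = 1 / r * TT j UNIV X"
    using p r by (subst Lq_norm_cmult) (auto simp: kde.T_def[OF kde])
  also have "1 / r * TT j UNIV X + Lq_norm p (\<lambda>x. K.mm j x - fs j x) = (TT j UNIV X + bb j) / r"
    using r by (simp add: bb_def r_def[symmetric] add_divide_distrib)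
  finally have "Lq_norm p (\<lambda>x. estimator \<gamma> (ns j) X x - fs j x) \<le> (TT j UNIV X + bb j) / r" .
  then have "Lq_norm p (\<lambda>x. estimator \<gamma> (ns j) X x - fs j x) / (beta j / r) \<le> (TT j UNIV X + bb j) / r / (beta j / r)"
    using b r by (intro divide_right_mono) auto
  also have "\<dots> = (TT j UNIV X + bb j) / beta j" using b r by simp
  finally show ?thesis by (simp add: psi_rate_def r_def)
qed

text \<open>Off a bad event the normalised loss argument is at most \<open>1 + d\<close>, and
  continuity of \<open>l\<close> at 1 gives \<open>l 1 + \<epsilon> / 2\<close>. On the bad event,
  of probability at most \<open>\<delta>\<close>, the exponential growth of \<open>l\<close> meets a
  bounded exponential moment of twice the order; each of the two resulting terms costs
  \<open>\<epsilon> / 4\<close>.\<close>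

lemma risk_eventually_le:
  assumes l: "l \<in> loss_class A B" and A: "A > 0" and B: "B > 0" and \<epsilon>: "\<epsilon> > 0"
  shows "\<forall>\<^sub>F j in sequentially. risk \<gamma> p l (fs j) (ns j) \<le> ennreal (l 1 + \<epsilon>)"
proof -
  have mono: "l x \<le> l y" if "0 \<le> x" "x \<le> y" for x y using l that by (auto simp: loss_class_def mono_on_def)
  have lA: "l x \<le> A * exp (B * x)" if "0 \<le> x" for x using l that by (auto simp: loss_class_def)
  have l1: "0 \<le> l 1" using mono[of 0 1] l by (simp add: loss_class_def)
  obtain d0 where d0: "d0 > 0" "\<And>x. \<bar>x - 1\<bar> < d0 \<Longrightarrow> \<bar>l x - l 1\<bar> < \<epsilon> / 2"
  proof -
    have "isCont l 1" using l by (simp add: loss_class_def)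
    then have "\<exists>d>0. \<forall>x. \<bar>x - 1\<bar> < d \<longrightarrow> \<bar>l x - l 1\<bar> < \<epsilon> / 2"
      using \<epsilon> unfolding continuous_at_eps_delta dist_real_def by (metis half_gt_zero)
    then show ?thesis using that by blast
  qed
  define d where "d = min 1 (d0 / 2)"
  have d: "d > 0" "d \<le> 1" "d < d0" using d0(1) by (auto simp: d_def min_def)
  have "\<bar>l (1 + d) - l 1\<bar> < \<epsilon> / 2" using d by (intro d0(2)) auto
  then have ld: "l (1 + d) \<le> l 1 + \<epsilon> / 2" by linarith
  \<comment> \<open>Makes \<open>beta0 powr p + 3 * \<eta>\<close> the p-th power of
    \<open>beta0 * (1 + d / 4)\<close>, the threshold of \<open>tail\<close>.\<close>
  define \<eta> where "\<eta> = beta0 powr p * ((1 + d / 4) powr p - 1) / 3"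
  have "1 powr p < (1 + d / 4) powr p" using d p by (intro powr_less_mono2) auto
  then have \<eta>: "\<eta> > 0" using beta0_pos by (simp add: \<eta>_def)
  have thr: "beta0 powr p + 3 * \<eta> = (beta0 * (1 + d / 4)) powr p" 
    unfolding \<eta>_def powr_mult by (simp add: right_diff_distrib diff_divide_distrib)
  \<comment> \<open>Eventually \<open>beta j\<close> is at least \<open>beta0 / 2\<close>, so
    \<open>B / beta j \<le> c\<close>. The bias term, eventually below 1, adds at most
    \<open>c\<close> to the exponent, whence the factor \<open>exp c\<close> in
    \<open>A'\<close>.\<close>
  define c where "c = 2 * B / beta0"
  have c: "c > 0" using B beta0_pos by (simp add: c_def)
  obtain Ce where Ce: "Ce \<ge> 0" "\<forall>\<^sub>F j in sequentially. (\<integral>\<^sup>+X. ennreal (exp (2 * c * TT j UNIV X)) \<partial>K.PP j) \<le> ennreal Ce"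
    using exp_moment[of "2 * c"] c by auto
  define A' where "A' = A * exp c"
  have A': "A' > 0" using A by (simp add: A'_def)
  \<comment> \<open>Weight of the exponential moment in \<open>amgm\<close>, small enough that
    \<open>A' * \<theta> * Ce \<le> \<epsilon> / 4\<close>.\<close>
  define \<theta> where "\<theta> = \<epsilon> / (4 * A' * (Ce + 1))"
  have \<theta>: "\<theta> > 0" unfolding \<theta>_def using \<epsilon> A' Ce(1) by (intro divide_pos_pos mult_pos_pos add_nonneg_pos) auto
  have \<theta>1: "A' * \<theta> * Ce \<le> \<epsilon> / 4"
  proof -
    have "A' * \<theta> * Ce \<le> A' * \<theta> * (Ce + 1)" using A' \<theta> by (intro mult_left_mono) auto
    also have "\<dots> = \<epsilon> / 4"
    proof -
      have *: "a * (\<epsilon> / (4 * a * b)) * b = \<epsilon> / 4" if "a \<noteq> 0" "b \<noteq> 0" for a b using that by simp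
      show ?thesis unfolding \<theta>_def using A' Ce(1) by (intro *) auto
    qed
    finally show ?thesis .
  qed
  \<comment> \<open>Chosen after \<open>\<theta>\<close>, so that the indicator of the bad event
    contributes \<open>A' * \<delta> / \<theta> = \<epsilon> / 4\<close>.\<close>
  define \<delta> where "\<delta> = \<epsilon> * \<theta> / (4 * A')"
  have \<delta>: "\<delta> > 0" using \<epsilon> \<theta> A' by (simp add: \<delta>_def)
  have \<delta>1: "A' * (\<delta> / \<theta>) = \<epsilon> / 4" using \<theta> A' by (simp add: \<delta>_def)
  have bb_lim: "bb \<longlonglongrightarrow> 0" unfolding bb_def by (rule bias_lim(2))
  have bb_ev: "\<forall>\<^sub>F j in sequentially. bb j < min 1 (beta0 * d / 8)"
    using d beta0_pos by (intro order_tendstoD(2)[OF bb_lim]) auto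
  have be: "\<forall>\<^sub>F j in sequentially. (1 - d / 4) * beta0 \<le> beta j" using d by (intro beta_liminf) auto
  from Ce(2) tail[OF \<eta> \<delta>] bb_ev be show ?thesis
  proof eventually_elim
    case (elim j)
    interpret PJ: prob_space "K.PP j" by (rule kde.prob_space_P[OF kde])
    have [measurable]: "TT j UNIV \<in> borel_measurable (K.PP j)" by (rule kde.T_meas[OF kde]) simp
    define bad where "bad = {X \<in> space (K.PP j). beta0 powr p + 3 * \<eta> \<le> TT j UNIV X powr p}"
    have [measurable]: "bad \<in> sets (K.PP j)" unfolding bad_def by measurable
    have b4: "beta0 * (3 / 4) \<le> beta j"
    proof -
      have "(3 / 4) * beta0 \<le> (1 - d / 4) * beta0" using d beta0_pos by (intro mult_right_mono) auto
      then show ?thesis using elim(4) by simp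
    qed
    have bpos: "beta j > 0" using b4 beta0_pos by linarith
    have T0: "0 \<le> TT j UNIV X" for X by (rule kde.T_nonneg[OF kde])
    have bb0: "0 \<le> bb j" using pf(5)[of j] by (simp add: bb_def)
    define R where "R X = Lq_norm p (\<lambda>x. estimator \<gamma> (ns j) X x - fs j x) / psi_rate \<gamma> p (fs j) (ns j)" for X
    have R: "0 \<le> R X" "R X \<le> (TT j UNIV X + bb j) / beta j" for X
    proof -
      have "0 \<le> psi_rate \<gamma> p (fs j) (ns j)" unfolding psi_rate_def using bpos pf(5)[of j] by simp
      then show "0 \<le> R X" unfolding R_def by simp
      show "R X \<le> (TT j UNIV X + bb j) / beta j" unfolding R_def by (rule estimator_norm_le[OF bpos])
    qed
    have good_le: "l (R X) \<le> l 1 + \<epsilon> / 2" if "X \<in> space (K.PP j)" "X \<notin> bad" for X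
    proof -
      have "TT j UNIV X powr p < (beta0 * (1 + d / 4)) powr p" using that by (auto simp: bad_def thr)
      moreover have "(beta0 * (1 + d / 4)) powr p \<le> TT j UNIV X powr p" if "beta0 * (1 + d / 4) \<le> TT j UNIV X"
        using that p beta0_pos d by (intro powr_mono2) auto
      ultimately have "TT j UNIV X < beta0 * (1 + d / 4)" by (meson not_less)
      then have "TT j UNIV X + bb j \<le> beta0 * (1 + d / 4) + beta0 * d / 8" using elim(3) by linarith
      also have "\<dots> = beta0 * (1 + 3 * d / 8)" by (simp add: algebra_simps)
      \<comment> \<open>The numerator loses \<open>d / 4\<close> to the tail threshold and
        \<open>d / 8\<close> to the bias, the denominator loses \<open>d / 4\<close>; for
        \<open>d \<le> 1\<close> all this fits below \<open>1 + d\<close>.\<close>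
      also have "\<dots> \<le> beta0 * ((1 + d) * (1 - d / 4))"
      proof (rule mult_left_mono)
        have "d * d \<le> d * 1" using d by (intro mult_left_mono) auto
        moreover have "(1 + d) * (1 - d / 4) = 1 + 3 * d / 4 - d * d / 4" by (simp add: field_simps)
        ultimately show "1 + 3 * d / 8 \<le> (1 + d) * (1 - d / 4)" using d by linarith
      qed (use beta0_pos in simp)
      also have "\<dots> = (1 + d) * ((1 - d / 4) * beta0)" by (simp add: ac_simps)
      also have "\<dots> \<le> (1 + d) * beta j" using elim(4) d by (intro mult_left_mono) auto
      finally have "(TT j UNIV X + bb j) / beta j \<le> 1 + d" using bpos by (simp add: pos_divide_le_eq)
      then have "l (R X) \<le> l (1 + d)" using R[of X] by (intro mono) auto
      then show ?thesis using ld by linarith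
    qed
    have bad_le: "l (R X) \<le> A' * exp (c * TT j UNIV X)" for X
    proof -
      have "(TT j UNIV X + bb j) / beta j \<le> (TT j UNIV X + 1) / (beta0 / 2)"
        using elim(3) b4 beta0_pos T0[of X] bb0 bpos by (intro frac_le) auto
      then have "R X \<le> (TT j UNIV X + 1) * (2 / beta0)" using R[of X] by simp
      then have "B * R X \<le> B * ((TT j UNIV X + 1) * (2 / beta0))" using B by (intro mult_left_mono) auto
      also have "\<dots> = c * TT j UNIV X + c" by (simp add: c_def algebra_simps add_divide_distrib)
      finally have "A * exp (B * R X) \<le> A * exp (c * TT j UNIV X + c)" using A by simp
      with lA[OF R(1)[of X]] show ?thesis by (simp add: A'_def exp_add ac_simps)
    qed
    \<comment> \<open>Replaces a product of the exponential with the indicator of the bad event by a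
      sum, at the cost of doubling the exponent.\<close>
    have amgm: "exp (c * t) \<le> \<theta> * exp (2 * c * t) + 1 / \<theta>" for t
    proof (cases "1 \<le> \<theta> * exp (c * t)")
      case True
      then have "exp (c * t) * 1 \<le> exp (c * t) * (\<theta> * exp (c * t))" by (intro mult_left_mono) auto
      also have "\<dots> = \<theta> * exp (2 * c * t)" by (simp flip: exp_add)
      finally show ?thesis using \<theta> by (simp add: add_increasing2)
    next
      case False
      then have "exp (c * t) \<le> 1 / \<theta>" using \<theta> by (simp add: field_simps)
      then show ?thesis using \<theta> by (simp add: add_increasing)
    qed
    have pt: "ennreal (l (R X)) \<le> ennreal (l 1 + \<epsilon> / 2) + ennreal (A' * \<theta>) * ennreal (exp (2 * c * TT j UNIV X)) + ennreal (A' / \<theta>) * indicator bad X"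
      if X: "X \<in> space (K.PP j)" for X
    proof (cases "X \<in> bad")
      case True
      have "l (R X) \<le> A' * (\<theta> * exp (2 * c * TT j UNIV X) + 1 / \<theta>)"
        using bad_le[of X] amgm[of "TT j UNIV X"] A' by (meson mult_left_mono less_imp_le order_trans)
      then have "ennreal (l (R X)) \<le> ennreal (A' * \<theta> * exp (2 * c * TT j UNIV X) + A' / \<theta>)" by (intro ennreal_leI) (simp add: algebra_simps)
      also have "\<dots> = ennreal (A' * \<theta>) * ennreal (exp (2 * c * TT j UNIV X)) + ennreal (A' / \<theta>)"
        using A' \<theta> by (simp add: ennreal_mult)
      also have "\<dots> \<le> ennreal (l 1 + \<epsilon> / 2) + ennreal (A' * \<theta>) * ennreal (exp (2 * c * TT j UNIV X)) + ennreal (A' / \<theta>)"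
        by (intro add_right_mono) (simp add: add_increasing)
      finally show ?thesis using True by simp
    next
      case False
      have "ennreal (l (R X)) \<le> ennreal (l 1 + \<epsilon> / 2)" by (intro ennreal_leI good_le X False)
      then show ?thesis by (simp add: add_increasing2 False)
    qed
    have "risk \<gamma> p l (fs j) (ns j) = (\<integral>\<^sup>+X. ennreal (l (R X)) \<partial>K.PP j)"
      unfolding risk_def R_def kde.P_def[OF kde] kde.D_def[OF kde] ..
    also have "\<dots> \<le> (\<integral>\<^sup>+X. ennreal (l 1 + \<epsilon> / 2) + ennreal (A' * \<theta>) * ennreal (exp (2 * c * TT j UNIV X)) + ennreal (A' / \<theta>) * indicator bad X \<partial>K.PP j)"
      by (intro nn_integral_mono pt)
    also have "\<dots> = ennreal (l 1 + \<epsilon> / 2) + ennreal (A' * \<theta>) * (\<integral>\<^sup>+X. ennreal (exp (2 * c * TT j UNIV X)) \<partial>K.PP j) + ennreal (A' / \<theta>) * emeasure (K.PP j) bad"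
      by (simp add: nn_integral_add nn_integral_cmult PJ.emeasure_space_1)
    also have "\<dots> \<le> ennreal (l 1 + \<epsilon> / 2) + ennreal (A' * \<theta>) * ennreal Ce + ennreal (A' / \<theta>) * ennreal \<delta>"
      using elim(1,2) unfolding bad_def by (intro add_mono mult_left_mono) auto
    also have "\<dots> = ennreal (l 1 + \<epsilon> / 2 + A' * \<theta> * Ce + A' / \<theta> * \<delta>)"
    proof -
      have nn: "0 \<le> l 1 + \<epsilon> / 2" "0 \<le> A' * \<theta>" "0 \<le> A' / \<theta>" "0 \<le> A' * \<theta> * Ce" "0 \<le> A' / \<theta> * \<delta>"
        using l1 \<epsilon> A' \<theta> Ce(1) \<delta> by auto
      then show ?thesis using Ce(1) \<delta> by (simp add: ennreal_mult[symmetric] ennreal_plus[symmetric] del: ennreal_plus)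
    qed
    also have "\<dots> \<le> ennreal (l 1 + \<epsilon>)" using \<theta>1 \<delta>1 by (intro ennreal_leI) simp
    finally show ?case .
  qed
qed

end

lemma density_seq_shift:
  assumes "\<gamma> > 0" "M > 0" "1 \<le> p" "p < 2 \<Longrightarrow> (2 - p) / p < lam \<and> lam \<le> 2" "f0 \<in> bbF \<gamma> p M lam"
    and fs: "\<And>j. fs j \<in> bbF \<gamma> p M lam" and r: "(\<lambda>j. rho \<gamma> p M lam f0 (fs j)) \<longlonglongrightarrow> 0"
    and ns: "filterlim ns at_top sequentially"
  obtains k where "density_seq \<gamma> M p lam f0 (\<lambda>j. fs (j + k)) (\<lambda>j. ns (j + k))"
proof -
  have "\<forall>\<^sub>F j in sequentially. N_par \<gamma> (ns j) \<ge> 2"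
    using filterlim_compose[OF param_limits(1)[OF assms(1)] ns] by (simp add: filterlim_at_top)
  then obtain k where k: "\<And>j. j \<ge> k \<Longrightarrow> N_par \<gamma> (ns j) \<ge> 2" by (auto simp: eventually_sequentially)
  have "density_seq \<gamma> M p lam f0 (\<lambda>j. fs (j + k)) (\<lambda>j. ns (j + k))"
  proof
    show "(\<lambda>j. rho \<gamma> p M lam f0 (fs (j + k))) \<longlonglongrightarrow> 0" by (rule LIMSEQ_ignore_initial_segment[OF r])
    show "filterlim (\<lambda>j. ns (j + k)) at_top sequentially"
      by (rule filterlim_compose[OF ns]) (rule filterlim_add_const_nat_at_top)
  qed (use assms k in auto)
  then show ?thesis by (rule that)
qed

theorem theorem1:
  fixes \<gamma> M p lam A B :: real and f0 l :: "real \<Rightarrow> real"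
  assumes "\<gamma> > 0" and "M > 0" and "1 \<le> p"
    and "p < 2 \<Longrightarrow> (2 - p) / p < lam \<and> lam \<le> 2"
    and "A > 0" and "B > 0"
    and "f0 \<in> bbF \<gamma> p M lam"
    and "l \<in> loss_class A B"
  shows "\<forall>\<epsilon>>0. \<exists>\<delta>>0.
           limsup (\<lambda>n. SUP f\<in>{f \<in> bbF \<gamma> p M lam. rho \<gamma> p M lam f0 f < \<delta>}. risk \<gamma> p l f n)
             \<le> ennreal (l 1 + \<epsilon>)"
proof (rule ccontr)
  assume "\<not> ?thesis"
  then obtain \<epsilon> where \<epsilon>: "\<epsilon> > 0" and neg: "\<And>\<delta>. \<delta> > 0 \<Longrightarrow> \<not> limsup (\<lambda>n. SUP f\<in>{f \<in> bbF \<gamma> p M lam. rho \<gamma> p M lam f0 f < \<delta>}. risk \<gamma> p l f n)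
             \<le> ennreal (l 1 + \<epsilon>)" by auto
  \<comment> \<open>If the bound held for all \<open>n \<ge> j\<close> on the ball of radius
    \<open>1 / Suc j\<close>, the limsup over that ball would satisfy it too. The violating pairs
    have sample sizes tending to infinity and densities converging to \<open>f0\<close>.\<close>
  have "\<exists>n f. j \<le> n \<and> f \<in> bbF \<gamma> p M lam \<and> rho \<gamma> p M lam f0 f < 1 / real (Suc j) \<and> ennreal (l 1 + \<epsilon>) < risk \<gamma> p l f n" for j
  proof (rule ccontr)
    assume none: "\<not> ?thesis"
    have "\<forall>n\<ge>j. (SUP f\<in>{f \<in> bbF \<gamma> p M lam. rho \<gamma> p M lam f0 f < 1 / real (Suc j)}. risk \<gamma> p l f n) \<le> ennreal (l 1 + \<epsilon>)"
    proof (intro allI impI SUP_least)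
      fix n f assume "j \<le> n" "f \<in> {f \<in> bbF \<gamma> p M lam. rho \<gamma> p M lam f0 f < 1 / real (Suc j)}"
      then show "risk \<gamma> p l f n \<le> ennreal (l 1 + \<epsilon>)" using none unfolding not_less[symmetric] by blast
    qed
    then have "limsup (\<lambda>n. SUP f\<in>{f \<in> bbF \<gamma> p M lam. rho \<gamma> p M lam f0 f < 1 / real (Suc j)}. risk \<gamma> p l f n) \<le> ennreal (l 1 + \<epsilon>)"
      by (intro Limsup_bounded) (auto simp: eventually_sequentially)
    then show False using neg[of "1 / real (Suc j)"] by simp
  qed
  then obtain ns fs where s: "\<And>j. j \<le> ns j" "\<And>j. fs j \<in> bbF \<gamma> p M lam"
    "\<And>j. rho \<gamma> p M lam f0 (fs j) < 1 / real (Suc j)" "\<And>j. ennreal (l 1 + \<epsilon>) < risk \<gamma> p l (fs j) (ns j)"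
    by metis
  have rho0: "0 \<le> rho \<gamma> p M lam f0 g" for g by (simp add: rho_def)
  have r: "(\<lambda>j. rho \<gamma> p M lam f0 (fs j)) \<longlonglongrightarrow> 0"
  proof (rule tendsto_sandwich[OF _ _ tendsto_const LIMSEQ_inverse_real_of_nat])
    show "\<forall>\<^sub>F j in sequentially. rho \<gamma> p M lam f0 (fs j) \<le> inverse (real (Suc j))"
      using s(3) by (auto intro!: always_eventually less_imp_le simp: inverse_eq_divide)
  qed (use rho0 in auto)
  have ns: "filterlim ns at_top sequentially"
    by (rule filterlim_at_top_mono[OF filterlim_ident]) (use s(1) in auto)
  obtain k where "density_seq \<gamma> M p lam f0 (\<lambda>j. fs (j + k)) (\<lambda>j. ns (j + k))"
    by (rule density_seq_shift[OF assms(1,2,3,4,7) s(2) r ns])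
  from density_seq.risk_eventually_le[OF this assms(8,5,6) \<epsilon>]
  obtain j where "risk \<gamma> p l (fs (j + k)) (ns (j + k)) \<le> ennreal (l 1 + \<epsilon>)"
    by (auto simp: eventually_sequentially)
  then show False using s(4)[of "j + k"] by simp
qed

end
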